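(* Let $N\ge 2$ and $k\in\mathbb{N}$, $k\ge 1$. For any $c>0$ the minimum $$\min\{\lambda_k(\Omega):\ \Omega\subset\mathbb{R}^N,\ \Omega \text{ quasi-open set},\ m_N(\Omega)\le c\}$$ is achieved; that is, there exists a quasi-open set $\hat\Omega\subset\mathbb{R}^N$ with $m_N(\hat\Omega)\le c$ such that $\lambda_k(\hat\Omega)\le\lambda_k(\Omega)$ for every quasi-open set $\Omega\subset\mathbb{R}^N$ with $m_N(\Omega)\le c$.
   Context: The measure $m_N$ on $\mathbb{R}^N$ is $dm_N=e^{|x|^2/2}\,dx$. $H^1(\mathbb{R}^N;m_N)$ is the weighted Sobolev space of functions $u\in L^2(\mathbb{R}^N;m_N)$ with weak gradient in $L^2(\mathbb{R}^N;m_N)$, with norm $\left(\|u\|^2_{L^2(\mathbb{R}^N;m_N)}+\|\nabla u\|^2_{L^2(\mathbb{R}^N;m_N)}\right)^{1/2}$. Capacity: for $E\subset\mathbb{R}^N$, $\mathrm{cap}(E)=\inf\{\|u\|_{H^1(\mathbb{R}^N)}^2:\ u\in H^1(\mathbb{R}^N),\ u\ge 1 \text{ a.e. in a neighbourhood of } E\}$ (unweighted). A property holds quasi-everywhere (q.e.) if it holds outside a set of zero capacity. A set $\Omega\subset\mathbb{R}^N$ is quasi-open if for every $\varepsilon>0$ there is an open set $\omega_\varepsilon$ with $\mathrm{cap}(\omega_\varepsilon)<\varepsilon$ such that $\Omega\cup\omega_\varepsilon$ is open. For $\Omega$ open, $H_0^1(\Omega;m_N)$ is the closure of $C_0^\infty(\Omega)$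 in the norm $\left(\|u\|^2_{L^2(\Omega;m_N)}+\|\nabla u\|^2_{L^2(\Omega;m_N)}\right)^{1/2}$; for $\Omega$ quasi-open, $H_0^1(\Omega;m_N)$ is the space of $u\in H^1(\mathbb{R}^N;m_N)$ whose quasi-continuous representative vanishes q.e. on $\mathbb{R}^N\setminus\Omega$ (the two definitions agree for open sets). $0<\lambda_1(\Omega)\le\lambda_2(\Omega)\le\dots$ are the eigenvalues, repeated according to multiplicity, of $-\Delta u-x\cdot\nabla u=\lambda u$ in $\Omega$, $u=0$ on $\partial\Omega$, understood weakly: $u\in H_0^1(\Omega;m_N)\setminus\{0\}$ and $\int_\Omega\nabla u\cdot\nabla\varphi\,dm_N=\lambda\int_\Omega u\varphi\,dm_N$ for all $\varphi\in H_0^1(\Omega;m_N)$. Equivalently, $$\lambda_k(\Omega)=\min_{V}\max_{v\in V\setminus\{0\}}\frac{\int_\Omega|\nabla v|^2dm_N}{\int_\Omega v^2dm_N},$$ the minimum being over $k$-dimensional subspaces $V$ of $H_0^1(\Omega;m_N)$ (with $\lambda_k(\Omega)=+\infty$ if there is no such subspace). *)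

theory Defs
  imports "HOL-Analysis.Analysis"
begin

subsection \<open>Smooth test functions and weak gradients\<close>

primrec times_continuously_differentiable ::
    "nat \<Rightarrow> ('a::euclidean_space \<Rightarrow> real) \<Rightarrow> bool" where
  "times_continuously_differentiable 0 f \<longleftrightarrow> continuous_on UNIV f"
| "times_continuously_differentiable (Suc n) f \<longleftrightarrow>
     (\<forall>x. f differentiable (at x)) \<and>
     (\<forall>v. times_continuously_differentiable n (\<lambda>x. frechet_derivative f (at x) v))"

definition test_functions :: "('a::euclidean_space \<Rightarrow> real) set" where
  "test_functions = {\<phi>. (\<forall>n. times_continuously_differentiable n \<phi>) \<and>
                         compact (closure {x. \<phi> x \<noteq> 0})}"

definition locally_integrable :: "('a::euclidean_space \<Rightarrow> 'b::euclidean_space) \<Rightarrow> bool" where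
  "locally_integrable f \<longleftrightarrow> (\<forall>K. compact K \<longrightarrow> set_integrable lebesgue K f)"

text \<open>Elements of the function spaces below are genuine functions; identification up to null
  sets is made explicit where it matters. The weak gradient is unique only almost everywhere,
  so \<open>weak_gradient\<close> is an arbitrary choice and is used only under integrals.\<close>

definition has_weak_gradient ::
    "('a::euclidean_space \<Rightarrow> real) \<Rightarrow> ('a \<Rightarrow> 'a) \<Rightarrow> bool" where
  "has_weak_gradient u G \<longleftrightarrow> locally_integrable u \<and> locally_integrable G \<and>
     (\<forall>\<phi>\<in>test_functions. \<forall>b\<in>Basis.
        (LINT x|lebesgue. u x * frechet_derivative \<phi> (at x) b) =
        - (LINT x|lebesgue. (G x \<bullet> b) * \<phi> x))"

definition weak_gradient :: "('a::euclidean_space \<Rightarrow> real) \<Rightarrow> 'a \<Rightarrow> 'a" where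
  "weak_gradient u = (SOME G. has_weak_gradient u G)"

subsection \<open>Weighted Sobolev spaces\<close>

text \<open>Everything is based on the Lebesgue (completed) \<open>\<sigma>\<close>-algebra, since quasi-open sets are
  Lebesgue measurable but need not be Borel.\<close>

definition mN :: "'a::euclidean_space measure" where
  "mN = density lebesgue (\<lambda>x. ennreal (exp ((norm x)\<^sup>2 / 2)))"

definition L2 :: "'a measure \<Rightarrow> ('a \<Rightarrow> 'b::euclidean_space) set" where
  "L2 M = {f \<in> borel_measurable M. integrable M (\<lambda>x. (norm (f x))\<^sup>2)}"

text \<open>\<open>H1 lebesgue\<close> is the unweighted and \<open>H1 mN\<close> the weighted space. The weak gradient is in
  both cases the distributional one, taken with respect to Lebesgue measure.\<close>

definition H1 :: "'a::euclidean_space measure \<Rightarrow> ('a \<Rightarrow> real) set" where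
  "H1 M = {u \<in> L2 M. \<exists>G. has_weak_gradient u G \<and> G \<in> L2 M}"

definition H1_norm :: "'a::euclidean_space measure \<Rightarrow> ('a \<Rightarrow> real) \<Rightarrow> real" where
  "H1_norm M u = sqrt ((LINT x|M. (u x)\<^sup>2) + (LINT x|M. (norm (weak_gradient u x))\<^sup>2))"

subsection \<open>Capacity and quasi-open sets\<close>

definition cap :: "'a::euclidean_space set \<Rightarrow> ennreal" where
  "cap E = Inf {ennreal ((H1_norm lebesgue u)\<^sup>2) | u.
     u \<in> H1 lebesgue \<and> (\<exists>U. open U \<and> E \<subseteq> U \<and> (AE x in lebesgue. x \<in> U \<longrightarrow> u x \<ge> 1))}"

definition quasi_everywhere :: "('a::euclidean_space \<Rightarrow> bool) \<Rightarrow> bool" where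
  "quasi_everywhere P \<longleftrightarrow> cap {x. \<not> P x} = 0"

definition quasi_open :: "'a::euclidean_space set \<Rightarrow> bool" where
  "quasi_open \<Omega> \<longleftrightarrow>
     (\<forall>\<epsilon>>0. \<exists>\<omega>. open \<omega> \<and> cap \<omega> < ennreal \<epsilon> \<and> open (\<Omega> \<union> \<omega>))"

definition quasi_continuous :: "('a::euclidean_space \<Rightarrow> real) \<Rightarrow> bool" where
  "quasi_continuous f \<longleftrightarrow>
     (\<forall>\<epsilon>>0. \<exists>\<omega>. open \<omega> \<and> cap \<omega> < ennreal \<epsilon> \<and> continuous_on (- \<omega>) f)"

text \<open>A quasi-continuous representative is unique up to a set of zero capacity, so the
  existential quantifier over representatives is unambiguous.\<close>

definition H10 :: "'a::euclidean_space set \<Rightarrow> ('a \<Rightarrow> real) set" where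
  "H10 \<Omega> = {u \<in> H1 mN. \<exists>v. quasi_continuous v \<and> (AE x in lebesgue. v x = u x) \<and>
                            quasi_everywhere (\<lambda>x. x \<notin> \<Omega> \<longrightarrow> v x = 0)}"

subsection \<open>Eigenvalues\<close>

definition eigenspace :: "'a::euclidean_space set \<Rightarrow> real \<Rightarrow> ('a \<Rightarrow> real) set" where
  "eigenspace \<Omega> \<mu> = {u \<in> H10 \<Omega>. \<forall>\<phi>\<in>H10 \<Omega>.
     (LINT x:\<Omega>|mN. weak_gradient u x \<bullet> weak_gradient \<phi> x) = \<mu> * (LINT x:\<Omega>|mN. u x * \<phi> x)}"

definition independent_modulo_null ::
    "nat \<Rightarrow> (nat \<Rightarrow> 'a::euclidean_space \<Rightarrow> real) \<Rightarrow> bool" where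
  "independent_modulo_null n u \<longleftrightarrow>
     (\<forall>a::nat \<Rightarrow> real. (AE x in lebesgue. (\<Sum>i<n. a i * u i x) = 0) \<longrightarrow> (\<forall>i<n. a i = 0))"

text \<open>The dimension of the eigenspace modulo null functions; it is \<open>0\<close> precisely when \<open>\<mu>\<close> is
  not an eigenvalue.\<close>

definition multiplicity :: "'a::euclidean_space set \<Rightarrow> real \<Rightarrow> enat" where
  "multiplicity \<Omega> \<mu> =
     Sup {enat n | n. \<exists>u. (\<forall>i<n. u i \<in> eigenspace \<Omega> \<mu>) \<and> independent_modulo_null n u}"

text \<open>The number of eigenvalues in \<open>{..t}\<close>, repeated according to multiplicity; all but the
  eigenvalues contribute \<open>0\<close> to the sum.\<close>

definition eigenvalue_count :: "'a::euclidean_space set \<Rightarrow> real \<Rightarrow> enat" where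
  "eigenvalue_count \<Omega> t = (\<Sum>\<^sub>\<infinity>\<mu>\<in>{..t}. multiplicity \<Omega> \<mu>)"

text \<open>The \<open>k\<close>-th entry (\<open>k \<ge> 1\<close>) of the nondecreasing list of eigenvalues repeated according to
  multiplicity. It is \<open>\<infinity>\<close>, the infimum of the empty set, if there are fewer than \<open>k\<close> of them.\<close>

definition eigenvalue :: "nat \<Rightarrow> 'a::euclidean_space set \<Rightarrow> ereal" where
  "eigenvalue k \<Omega> = Inf {ereal t | t. enat k \<le> eigenvalue_count \<Omega> t}"

end

theory Submission
  imports Defs "HOL-Complex_Analysis.Great_Picard"
begin

text \<open>\<^bold>\<open>Why a minimiser exists.\<close> Let \<open>L\<close> be the infimum and let \<open>\<Omega> n\<close> be a minimising sequence of domains. Each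
  \<open>\<Omega> n\<close> carries \<open>k\<close> orthonormal eigenfunctions \<open>e n i\<close> whose eigenvalues are at most \<open>t n\<close>, where
  \<open>t n\<close> tends to \<open>L\<close>. They are bounded in the weighted Sobolev space, and the weight grows so fast that
  this space embeds compactly into the weighted \<open>L2\<close> space, on the whole of space and with no bound on the
  domains (\<open>compact_embedding\<close>). So a subsequence converges in \<open>L2\<close> to functions \<open>f i\<close>. Linear combinations
  of the \<open>f i\<close> keep their norms, and the energy is lower semicontinuous, so all Rayleigh quotients on their
  span are at most \<open>L\<close>. The optimal domain is the set \<open>\<Omega>'\<close> on which one of the quasi-continuous
  representatives of the \<open>f i\<close> is nonzero. It is quasi-open, the \<open>f i\<close> lie in \<open>H10 \<Omega>'\<close> by construction, and
  Fatou's lemma bounds its measure: where \<open>f i \<noteq> 0\<close>, almost every point belongs to \<open>\<Omega> n\<close> for all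
  large \<open>n\<close> of a suitable subsequence (\<open>measure_nonzero_limit_le\<close>). These steps are put together
  in \<open>limit_domain\<close>.

  \<^bold>\<open>From Rayleigh quotients to eigenvalues.\<close> The \<open>k\<close>-th eigenvalue is defined by counting eigenvectors,
  so the upper bound for the quotients has to produce \<open>k\<close> eigenvectors in \<open>H10 \<Omega>'\<close>. This is the min-max
  principle for a pair of quadratic forms with a compact embedding (\<open>eigensystem_of_small_energy\<close>), proved in
  the locale \<open>energy_forms\<close>. It applies because \<open>H10 \<Omega>'\<close> is closed in the Sobolev norm (\<open>H10_limit\<close>): a fast
  convergent sequence of quasi-continuous functions converges outside a set of zero capacity.

  \<^bold>\<open>Why the embedding is compact.\<close> Test the weak derivative of \<open>u\<^sup>2\<close> against the vector field
  \<open>x\<close> times the weight. The divergence of this field contains \<open>norm x ^ 2\<close> times the weight, so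
  \<open>norm x * u\<close> is bounded in the weighted \<open>L2\<close> norm (\<open>second_moment_bound\<close>) and no mass escapes to infinity.
  On bounded sets the averages of \<open>u\<close> over small balls are equi-Lipschitz and uniformly close to \<open>u\<close>,
  by the bound of translations through the gradient (\<open>translation_difference_le\<close>).

  \<^bold>\<open>How weak derivatives are handled.\<close> Averages over balls serve as mollifiers: the average of a Sobolev
  function is a Lipschitz Sobolev function, which is what quasi-continuity asks for. The chain rule is proved with
  difference quotients for outer functions with a quadratic Taylor remainder, so truncations are
  replaced by rational functions such as \<open>2 * s\<^sup>2 / (1 + s\<^sup>2)\<close>. Weak compactness is replaced by the
  parallelogram law: nearly minimal elements of a decreasing sequence of convex sets form a
  Cauchy sequence (\<open>l2_minimizing_Cauchy\<close>).\<close>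

section \<open>Square integrable functions\<close>

definition l2_inner :: "'a measure \<Rightarrow> ('a \<Rightarrow> 'b::euclidean_space) \<Rightarrow> ('a \<Rightarrow> 'b) \<Rightarrow> real" where
  "l2_inner M f g = (LINT x|M. f x \<bullet> g x)"

definition l2_norm :: "'a measure \<Rightarrow> ('a \<Rightarrow> 'b::euclidean_space) \<Rightarrow> real" where
  "l2_norm M f = sqrt (LINT x|M. (norm (f x))\<^sup>2)"

lemma L2I: "f \<in> borel_measurable M \<Longrightarrow> integrable M (\<lambda>x. (norm (f x))\<^sup>2) \<Longrightarrow> f \<in> L2 M"
  by (simp add: L2_def)

lemma L2_measurable [measurable_dest]: "f \<in> L2 M \<Longrightarrow> f \<in> borel_measurable M"
  by (simp add: L2_def)

lemma L2_integrable: "f \<in> L2 M \<Longrightarrow> integrable M (\<lambda>x. (norm (f x))\<^sup>2)"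
  by (simp add: L2_def)

text \<open>Domination is stated for the squares, because every membership below comes from an integrable majorant
  of the square.\<close>

lemma L2_bound:
  assumes "g \<in> borel_measurable M" "integrable M h" "AE x in M. (norm (g x))\<^sup>2 \<le> h x"
  shows "g \<in> L2 M"
proof (rule L2I[OF assms(1)])
  show "integrable M (\<lambda>x. (norm (g x))\<^sup>2)"
    by (rule Bochner_Integration.integrable_bound[OF assms(2)]) (use assms in auto)
qed

lemma norm_mult_le_squares: "norm a * norm b \<le> (norm a)\<^sup>2 + (norm b)\<^sup>2"
proof -
  have "0 \<le> (norm a - norm b)\<^sup>2" by simp
  hence "2 * (norm a * norm b) \<le> (norm a)\<^sup>2 + (norm b)\<^sup>2"
    by (simp add: power2_diff)
  moreover have "0 \<le> norm a * norm b" by simp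
  ultimately show ?thesis by linarith
qed

lemma norm_add_square_le: 
  fixes a b :: "'b::real_inner"
  shows "(norm (a + b))\<^sup>2 \<le> 2 * (norm a)\<^sup>2 + 2 * (norm b)\<^sup>2"
proof -
  have "(norm (a + b))\<^sup>2 + (norm (a - b))\<^sup>2 = 2 * (norm a)\<^sup>2 + 2 * (norm b)\<^sup>2"
    by (simp add: power2_norm_eq_inner inner_add_left inner_add_right inner_diff_left inner_diff_right inner_commute)
  thus ?thesis by (smt (verit) zero_le_power2)
qed

lemma L2_integrable_norm_mult:
  assumes "f \<in> L2 M" "g \<in> L2 M"
  shows "integrable M (\<lambda>x. norm (f x) * norm (g x))"
proof (rule Bochner_Integration.integrable_bound)
  show "integrable M (\<lambda>x. (norm (f x))\<^sup>2 + (norm (g x))\<^sup>2)"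
    using assms by (intro Bochner_Integration.integrable_add L2_integrable)
  show "(\<lambda>x. norm (f x) * norm (g x)) \<in> borel_measurable M"
    using L2_measurable[OF assms(1)] L2_measurable[OF assms(2)] by measurable
  show "AE x in M. norm (norm (f x) * norm (g x)) \<le> norm ((norm (f x))\<^sup>2 + (norm (g x))\<^sup>2)"
    using norm_mult_le_squares by (auto simp: abs_mult)
qed

lemma L2_integrable_inner:
  assumes "f \<in> L2 M" "g \<in> L2 M"
  shows "integrable M (\<lambda>x. f x \<bullet> g x)"
proof (rule Bochner_Integration.integrable_bound)
  show "integrable M (\<lambda>x. norm (f x) * norm (g x))"
    using assms by (rule L2_integrable_norm_mult)
  show "(\<lambda>x. f x \<bullet> g x) \<in> borel_measurable M"
    using L2_measurable[OF assms(1)] L2_measurable[OF assms(2)] by measurable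
  show "AE x in M. norm (f x \<bullet> g x) \<le> norm (norm (f x) * norm (g x))"
    by (auto simp: abs_mult Cauchy_Schwarz_ineq2)
qed

lemma L2_integrable_mult:
  fixes f g :: "'a \<Rightarrow> real"
  assumes "f \<in> L2 M" "g \<in> L2 M"
  shows "integrable M (\<lambda>x. f x * g x)"
  using L2_integrable_inner[OF assms] by simp

lemma L2_zero [simp]: "(\<lambda>x. 0) \<in> L2 M"
  by (auto simp: L2_def)

lemma L2_add:
  assumes "f \<in> L2 M" "g \<in> L2 M" shows "(\<lambda>x. f x + g x) \<in> L2 M"
proof (rule L2_bound)
  show "(\<lambda>x. f x + g x) \<in> borel_measurable M"
    using L2_measurable[OF assms(1)] L2_measurable[OF assms(2)] by measurable
  show "integrable M (\<lambda>x. 2 * (norm (f x))\<^sup>2 + 2 * (norm (g x))\<^sup>2)"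
    using assms by (intro Bochner_Integration.integrable_add integrable_mult_right L2_integrable)
  show "AE x in M. (norm (f x + g x))\<^sup>2 \<le> 2 * (norm (f x))\<^sup>2 + 2 * (norm (g x))\<^sup>2"
    using norm_add_square_le by auto
qed

lemma L2_scaleR: "f \<in> L2 M \<Longrightarrow> (\<lambda>x. c *\<^sub>R f x) \<in> L2 M"
  by (auto simp: L2_def power_mult_distrib)

lemma L2_cmult: fixes f :: "'a \<Rightarrow> real" shows "f \<in> L2 M \<Longrightarrow> (\<lambda>x. c * f x) \<in> L2 M"
  using L2_scaleR[of f M c] by simp

lemma L2_minus: "f \<in> L2 M \<Longrightarrow> (\<lambda>x. - f x) \<in> L2 M"
  using L2_scaleR[of f M "-1"] by simp

lemma L2_diff: "f \<in> L2 M \<Longrightarrow> g \<in> L2 M \<Longrightarrow> (\<lambda>x. f x - g x) \<in> L2 M"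
  using L2_add[of f M "\<lambda>x. - g x"] L2_minus[of g M] by simp

lemma L2_sum: "(\<And>i. i \<in> I \<Longrightarrow> f i \<in> L2 M) \<Longrightarrow> (\<lambda>x. \<Sum>i\<in>I. f i x) \<in> L2 M"
  by (induction I rule: infinite_finite_induct) (auto intro: L2_add)

lemma L2_norm_fun: "f \<in> L2 M \<Longrightarrow> (\<lambda>x. norm (f x)) \<in> L2 M"
  by (auto simp: L2_def)

lemma L2_inner_const: "f \<in> L2 M \<Longrightarrow> (\<lambda>x. f x \<bullet> b) \<in> L2 M"
proof (rule L2_bound)
  assume f: "f \<in> L2 M"
  show "(\<lambda>x. f x \<bullet> b) \<in> borel_measurable M"
    using L2_measurable[OF f] by measurable
  show "integrable M (\<lambda>x. (norm b)\<^sup>2 * (norm (f x))\<^sup>2)"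
    using f by (intro integrable_mult_right L2_integrable)
  show "AE x in M. (norm (f x \<bullet> b))\<^sup>2 \<le> (norm b)\<^sup>2 * (norm (f x))\<^sup>2"
    using Cauchy_Schwarz_ineq2[of "f _" b] by (auto simp: power_mult_distrib[symmetric] mult.commute intro!: abs_le_square_iff[THEN iffD1])
qed

lemma l2_norm_nonneg [simp]: "0 \<le> l2_norm M f"
  by (simp add: l2_norm_def)

lemma l2_norm_zero [simp]: "l2_norm M (\<lambda>x. 0) = 0"
  by (simp add: l2_norm_def)

lemma l2_norm_sq: "(l2_norm M f)\<^sup>2 = (LINT x|M. (norm (f x))\<^sup>2)"
  by (simp add: l2_norm_def)

lemma l2_norm_sq_inner: "(l2_norm M f)\<^sup>2 = l2_inner M f f"
  by (simp add: l2_norm_sq l2_inner_def power2_norm_eq_inner)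

lemma l2_norm_sq_real: fixes f :: "'a \<Rightarrow> real" shows "(l2_norm M f)\<^sup>2 = (LINT x|M. (f x)\<^sup>2)"
  by (simp add: l2_norm_sq)

lemma l2_norm_scaleR: "l2_norm M (\<lambda>x. c *\<^sub>R f x) = \<bar>c\<bar> * l2_norm M f"
  by (simp add: l2_norm_def power_mult_distrib real_sqrt_mult)

lemma l2_norm_cmult: fixes f :: "'a \<Rightarrow> real" shows "l2_norm M (\<lambda>x. c * f x) = \<bar>c\<bar> * l2_norm M f"
  using l2_norm_scaleR[of M c f] by simp

lemma l2_norm_minus: "l2_norm M (\<lambda>x. - f x) = l2_norm M f"
  by (simp add: l2_norm_def)

lemma l2_norm_minus_commute: "l2_norm M (\<lambda>x. f x - g x) = l2_norm M (\<lambda>x. g x - f x)"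
  by (simp add: l2_norm_def norm_minus_commute)

lemma l2_norm_norm: "l2_norm M (\<lambda>x. norm (f x)) = l2_norm M f"
  by (simp add: l2_norm_def)

lemma l2_norm_mono_AE:
  assumes "g \<in> L2 M" "AE x in M. norm (f x) \<le> norm (g x)" 
  shows "l2_norm M f \<le> l2_norm M g"
  unfolding l2_norm_def
  by (rule real_sqrt_le_mono, rule integral_mono_AE') (use assms in \<open>auto simp: L2_def power_mono intro: power_mono\<close>)

lemma l2_norm_cong_AE:
  assumes "f \<in> borel_measurable M" "g \<in> borel_measurable M" "AE x in M. f x = g x"
  shows "l2_norm M f = l2_norm M g"
  unfolding l2_norm_def using assms by (intro arg_cong[of _ _ sqrt] integral_cong_AE) auto

lemma l2_inner_cong_AE:
  assumes "f \<in> borel_measurable M" "g \<in> borel_measurable M" "AE x in M. f x = g x"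
    "f' \<in> borel_measurable M" "g' \<in> borel_measurable M" "AE x in M. f' x = g' x"
  shows "l2_inner M f f' = l2_inner M g g'"
  unfolding l2_inner_def using assms by (intro integral_cong_AE) auto

lemma L2_cong_AE:
  assumes "f \<in> L2 M" "g \<in> borel_measurable M" "AE x in M. f x = g x"
  shows "g \<in> L2 M"
  using assms by (intro L2_bound[OF assms(2) L2_integrable[OF assms(1)]]) auto

lemma l2_inner_commute: "l2_inner M f g = l2_inner M g f"
  by (simp add: l2_inner_def inner_commute)

lemma l2_inner_add_left:
  "f \<in> L2 M \<Longrightarrow> g \<in> L2 M \<Longrightarrow> h \<in> L2 M \<Longrightarrow>
    l2_inner M (\<lambda>x. f x + g x) h = l2_inner M f h + l2_inner M g h"
  unfolding l2_inner_def inner_add_left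
  by (rule Bochner_Integration.integral_add) (auto intro: L2_integrable_inner)

lemma l2_inner_scaleR_left: "l2_inner M (\<lambda>x. c *\<^sub>R f x) h = c * l2_inner M f h"
  unfolding l2_inner_def by simp

lemma l2_inner_diff_left:
  "f \<in> L2 M \<Longrightarrow> g \<in> L2 M \<Longrightarrow> h \<in> L2 M \<Longrightarrow>
    l2_inner M (\<lambda>x. f x - g x) h = l2_inner M f h - l2_inner M g h"
  unfolding l2_inner_def inner_diff_left
  by (rule Bochner_Integration.integral_diff) (auto intro: L2_integrable_inner)

lemma l2_inner_add_right:
  "f \<in> L2 M \<Longrightarrow> g \<in> L2 M \<Longrightarrow> h \<in> L2 M \<Longrightarrow>
    l2_inner M h (\<lambda>x. f x + g x) = l2_inner M h f + l2_inner M h g"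
  unfolding l2_inner_commute[of M h] by (rule l2_inner_add_left)

lemma l2_inner_diff_right:
  "f \<in> L2 M \<Longrightarrow> g \<in> L2 M \<Longrightarrow> h \<in> L2 M \<Longrightarrow>
    l2_inner M h (\<lambda>x. f x - g x) = l2_inner M h f - l2_inner M h g"
  unfolding l2_inner_commute[of M h] by (rule l2_inner_diff_left)

lemma l2_inner_scaleR_right: "l2_inner M h (\<lambda>x. c *\<^sub>R f x) = c * l2_inner M h f"
  unfolding l2_inner_def by simp

lemma l2_norm_add_sq:
  assumes "f \<in> L2 M" "g \<in> L2 M"
  shows "(l2_norm M (\<lambda>x. f x + g x))\<^sup>2 = (l2_norm M f)\<^sup>2 + 2 * l2_inner M f g + (l2_norm M g)\<^sup>2"
proof -
  note fg = L2_add[OF assms]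
  show ?thesis unfolding l2_norm_sq_inner
    unfolding l2_inner_add_left[OF assms fg] l2_inner_add_right[OF assms assms(1)]
      l2_inner_add_right[OF assms assms(2)]
    using l2_inner_commute[of M g f] by linarith
qed

lemma l2_norm_diff_sq:
  assumes "f \<in> L2 M" "g \<in> L2 M"
  shows "(l2_norm M (\<lambda>x. f x - g x))\<^sup>2 = (l2_norm M f)\<^sup>2 - 2 * l2_inner M f g + (l2_norm M g)\<^sup>2"
proof -
  note fg = L2_diff[OF assms]
  show ?thesis unfolding l2_norm_sq_inner
    unfolding l2_inner_diff_left[OF assms fg] l2_inner_diff_right[OF assms assms(1)]
      l2_inner_diff_right[OF assms assms(2)]
    using l2_inner_commute[of M g f] by linarith
qed

text \<open>The optimal choice is \<open>t = B / C\<close>. For \<open>C = 0\<close> a linear function that is bounded below is constant.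
  Used with \<open>A = 0\<close>, this says that a first variation vanishes at a minimum.\<close>

lemma quadratic_nonneg_discriminant:
  fixes A B C :: real
  assumes "A \<ge> 0" "C \<ge> 0" "\<And>t. A - 2 * t * B + t\<^sup>2 * C \<ge> 0"
  shows "B\<^sup>2 \<le> A * C"
proof (cases "C = 0")
  case True
  have "B = 0"
  proof (rule ccontr)
    assume "B \<noteq> 0"
    thus False using assms(3)[of "(A+1)/(2*B)"] True by (simp add: field_simps)
  qed
  thus ?thesis using True by simp
next
  case False
  hence "C > 0" using assms by simp
  thus ?thesis using assms(3)[of "B/C"]
    by (simp add: field_simps power2_eq_square)
qed

lemma l2_Cauchy_Schwarz:
  assumes "f \<in> L2 M" "g \<in> L2 M"
  shows "\<bar>l2_inner M f g\<bar> \<le> l2_norm M f * l2_norm M g"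
proof -
  have "(l2_inner M f g)\<^sup>2 \<le> (l2_norm M f)\<^sup>2 * (l2_norm M g)\<^sup>2"
  proof (rule quadratic_nonneg_discriminant)
    fix t
    have "0 \<le> (l2_norm M (\<lambda>x. f x - t *\<^sub>R g x))\<^sup>2" by simp
    also have "\<dots> = (l2_norm M f)\<^sup>2 - 2 * t * l2_inner M f g + t\<^sup>2 * (l2_norm M g)\<^sup>2"
      using assms by (simp add: l2_norm_diff_sq L2_scaleR l2_inner_scaleR_right l2_norm_scaleR power_mult_distrib)
    finally show "0 \<le> (l2_norm M f)\<^sup>2 - 2 * t * l2_inner M f g + t\<^sup>2 * (l2_norm M g)\<^sup>2" .
  qed auto
  hence "\<bar>l2_inner M f g\<bar>\<^sup>2 \<le> (l2_norm M f * l2_norm M g)\<^sup>2" by (simp add: power_mult_distrib)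
  thus ?thesis by (rule power2_le_imp_le) simp
qed

lemma l2_norm_triangle:
  assumes "f \<in> L2 M" "g \<in> L2 M"
  shows "l2_norm M (\<lambda>x. f x + g x) \<le> l2_norm M f + l2_norm M g"
proof (rule power2_le_imp_le)
  show "(l2_norm M (\<lambda>x. f x + g x))\<^sup>2 \<le> (l2_norm M f + l2_norm M g)\<^sup>2"
    using l2_norm_add_sq[OF assms] l2_Cauchy_Schwarz[OF assms] by (simp add: power2_sum)
qed auto

lemma l2_norm_triangle_diff:
  assumes "f \<in> L2 M" "g \<in> L2 M" "h \<in> L2 M"
  shows "l2_norm M (\<lambda>x. f x - h x) \<le> l2_norm M (\<lambda>x. f x - g x) + l2_norm M (\<lambda>x. g x - h x)"
  using l2_norm_triangle[of "\<lambda>x. f x - g x" M "\<lambda>x. g x - h x"] assms by (auto intro: L2_diff)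

lemma l2_norm_triangle_sub:
  assumes "f \<in> L2 M" "g \<in> L2 M"
  shows "l2_norm M f \<le> l2_norm M g + l2_norm M (\<lambda>x. f x - g x)"
  using l2_norm_triangle[of g M "\<lambda>x. f x - g x"] assms by (auto intro: L2_diff)

lemma l2_norm_sum_le:
  "(\<And>i. i \<in> I \<Longrightarrow> f i \<in> L2 M) \<Longrightarrow> l2_norm M (\<lambda>x. \<Sum>i\<in>I. f i x) \<le> (\<Sum>i\<in>I. l2_norm M (f i))"
proof (induction I rule: infinite_finite_induct)
  case (insert i I)
  have "l2_norm M (\<lambda>x. f i x + (\<Sum>i\<in>I. f i x)) \<le> l2_norm M (f i) + l2_norm M (\<lambda>x. \<Sum>i\<in>I. f i x)"
    using insert by (intro l2_norm_triangle L2_sum) auto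
  thus ?case using insert by fastforce
qed auto

lemma l2_parallelogram:
  assumes "f \<in> L2 M" "g \<in> L2 M"
  shows "(l2_norm M (\<lambda>x. f x - g x))\<^sup>2 = 2 * (l2_norm M f)\<^sup>2 + 2 * (l2_norm M g)\<^sup>2
     - 4 * (l2_norm M (\<lambda>x. (1/2) *\<^sub>R (f x + g x)))\<^sup>2"
  unfolding l2_norm_scaleR power_mult_distrib l2_norm_add_sq[OF assms] l2_norm_diff_sq[OF assms]
  by (simp add: field_simps)

text \<open>Norm bounds pass to almost everywhere limits by Fatou's lemma for the squares.\<close>

lemma l2_Fatou:
  assumes h: "\<And>k. h k \<in> L2 M" and C: "\<And>k. l2_norm M (h k) \<le> C"
    and lim: "AE x in M. (\<lambda>k. h k x) \<longlonglongrightarrow> g x" and g: "g \<in> borel_measurable M"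
  shows "g \<in> L2 M" "l2_norm M g \<le> C"
proof -
  have C0: "0 \<le> C" using C[of 0] l2_norm_nonneg[of M "h 0"] by linarith
  have [measurable]: "h k \<in> borel_measurable M" for k using h L2_measurable by blast
  note g[measurable]
  have eq: "(\<integral>\<^sup>+x. ennreal ((norm (h k x))\<^sup>2) \<partial>M) = ennreal ((l2_norm M (h k))\<^sup>2)" for k
    unfolding l2_norm_sq by (rule nn_integral_eq_integral) (use h L2_integrable in auto)
  have "(\<integral>\<^sup>+x. ennreal ((norm (g x))\<^sup>2) \<partial>M) = (\<integral>\<^sup>+x. liminf (\<lambda>k. ennreal ((norm (h k x))\<^sup>2)) \<partial>M)"
  proof (rule nn_integral_cong_AE)
    show "AE x in M. ennreal ((norm (g x))\<^sup>2) = liminf (\<lambda>k. ennreal ((norm (h k x))\<^sup>2))"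
      using lim
    proof eventually_elim
      case (elim x)
      have "(\<lambda>k. ennreal ((norm (h k x))\<^sup>2)) \<longlonglongrightarrow> ennreal ((norm (g x))\<^sup>2)"
        by (intro tendsto_intros elim)
      thus ?case by (intro lim_imp_Liminf[symmetric]) auto
    qed
  qed
  also have "\<dots> \<le> liminf (\<lambda>k. \<integral>\<^sup>+x. ennreal ((norm (h k x))\<^sup>2) \<partial>M)"
    by (rule nn_integral_liminf) simp
  also have "\<dots> \<le> liminf (\<lambda>k. ennreal (C\<^sup>2))"
    unfolding eq by (intro Liminf_mono always_eventually allI ennreal_leI power_mono C) auto
  also have "\<dots> = ennreal (C\<^sup>2)" by (simp add: Liminf_const)
  finally have le: "(\<integral>\<^sup>+x. ennreal ((norm (g x))\<^sup>2) \<partial>M) \<le> ennreal (C\<^sup>2)" .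
  have int: "integrable M (\<lambda>x. (norm (g x))\<^sup>2)"
    by (rule integrableI_bounded) (use le in \<open>auto simp: le_less_trans\<close>)
  thus "g \<in> L2 M" using g by (auto intro: L2I)
  have "ennreal ((l2_norm M g)\<^sup>2) \<le> ennreal (C\<^sup>2)"
    using le int by (simp add: l2_norm_sq nn_integral_eq_integral)
  hence "(l2_norm M g)\<^sup>2 \<le> C\<^sup>2" by simp
  thus "l2_norm M g \<le> C" using C0 by (rule power2_le_imp_le)
qed

lemma l2_AE_subseq:
  assumes "\<And>n. f n \<in> L2 M" "(\<lambda>n. l2_norm M (f n)) \<longlonglongrightarrow> 0"
  shows "\<exists>r::nat\<Rightarrow>nat. strict_mono r \<and> (AE x in M. (\<lambda>n. f (r n) x) \<longlonglongrightarrow> 0)"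
proof -
  have "(\<lambda>n. (l2_norm M (f n))\<^sup>2) \<longlonglongrightarrow> 0\<^sup>2" by (intro tendsto_intros assms)
  hence "(\<lambda>n. (\<integral>x. norm ((norm (f n x))\<^sup>2) \<partial>M)) \<longlonglongrightarrow> 0" by (simp add: l2_norm_sq)
  from tendsto_L1_AE_subseq[OF _ this] obtain r :: "nat\<Rightarrow>nat" where
    r: "strict_mono r" "AE x in M. (\<lambda>n. (norm (f (r n) x))\<^sup>2) \<longlonglongrightarrow> 0"
    using assms(1) L2_integrable by blast
  from r(2) have "AE x in M. (\<lambda>n. f (r n) x) \<longlonglongrightarrow> 0"
  proof eventually_elim
    case (elim x)
    hence "(\<lambda>n. sqrt ((norm (f (r n) x))\<^sup>2)) \<longlonglongrightarrow> sqrt 0" by (intro tendsto_intros)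
    thus ?case by (simp add: tendsto_norm_zero_iff)
  qed
  thus ?thesis using r by blast
qed

definition l2_Cauchy :: "'a measure \<Rightarrow> (nat \<Rightarrow> 'a \<Rightarrow> 'b::euclidean_space) \<Rightarrow> bool" where
  "l2_Cauchy M f \<longleftrightarrow> (\<forall>e>0. \<exists>N. \<forall>m\<ge>N. \<forall>n\<ge>N. l2_norm M (\<lambda>x. f m x - f n x) < e)"

text \<open>Each term is at most \<open>2 ^ -k\<close> times the square root of the weighted sum.\<close>

lemma summable_of_weighted_squares:
  fixes d :: "nat \<Rightarrow> 'b::banach"
  assumes "summable (\<lambda>k. 4^k * (norm (d k))\<^sup>2)"
  shows "summable d"
proof -
  let ?S = "\<Sum>k. 4^k * (norm (d k))\<^sup>2"
  have "norm (d k) \<le> sqrt ?S * (1/2)^k" for k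
  proof -
    have "4^k * (norm (d k))\<^sup>2 \<le> ?S"
      using sum_le_suminf[OF assms, of "{k}"] by simp
    hence "sqrt (4^k * (norm (d k))\<^sup>2) \<le> sqrt ?S" by (rule real_sqrt_le_mono)
    moreover have "sqrt (4^k * (norm (d k))\<^sup>2) = 2^k * norm (d k)"
      by (simp add: real_sqrt_mult real_sqrt_power)
    ultimately show ?thesis by (simp add: field_simps)
  qed
  moreover have "summable (\<lambda>k. sqrt ?S * (1/2)^k)"
    by (intro summable_mult summable_geometric) simp
  ultimately show ?thesis by (rule summable_comparison_test'[rotated])
qed

text \<open>With increments of norm at most \<open>4 ^ -k\<close>, the squares weighted by \<open>4 ^ k\<close> still have integrals of sum at
  most \<open>\<Sum> 4 ^ -k\<close>, so the weighted series of squares converges almost everywhere and the increments are summable there.\<close>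

lemma l2_fast_convergence_AE:
  assumes f: "\<And>n. f n \<in> L2 M" and fast: "\<And>k. l2_norm M (\<lambda>x. f (Suc k) x - f k x) \<le> (1/4)^k"
  shows "AE x in M. convergent (\<lambda>k. f k x)"
proof -
  let ?d = "\<lambda>k x. f (Suc k) x - f k x"
  have d: "?d k \<in> L2 M" for k by (intro L2_diff f)
  have [measurable]: "f k \<in> borel_measurable M" for k using f L2_measurable by blast
  have le: "(\<integral>\<^sup>+x. ennreal (4^k * (norm (?d k x))\<^sup>2) \<partial>M) \<le> ennreal ((1/4)^k)" for k
  proof -
    have "(\<integral>\<^sup>+x. ennreal (4^k * (norm (?d k x))\<^sup>2) \<partial>M) = ennreal (4^k * (l2_norm M (?d k))\<^sup>2)"
      unfolding l2_norm_sq using L2_integrable[OF d[of k]]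
      by (subst nn_integral_eq_integral) auto
    also have "\<dots> \<le> ennreal ((4^k) * ((1/4)^k)\<^sup>2)"
      by (intro ennreal_leI mult_left_mono power_mono fast) auto
    also have "(4^k) * ((1/4)^k)\<^sup>2 = ((1/4)^k :: real)"
      by (simp add: power2_eq_square power_mult_distrib[symmetric] mult.assoc[symmetric])
    finally show ?thesis .
  qed
  have "(\<integral>\<^sup>+x. (\<Sum>k. ennreal (4^k * (norm (?d k x))\<^sup>2)) \<partial>M) = (\<Sum>k. \<integral>\<^sup>+x. ennreal (4^k * (norm (?d k x))\<^sup>2) \<partial>M)"
    by (rule nn_integral_suminf) simp
  also have "\<dots> \<le> (\<Sum>k. ennreal ((1/4)^k))" by (intro suminf_le le) auto
  also have "\<dots> = ennreal (\<Sum>k. (1/4)^k)" by (rule suminf_ennreal2) auto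
  finally have "(\<integral>\<^sup>+x. (\<Sum>k. ennreal (4^k * (norm (?d k x))\<^sup>2)) \<partial>M) \<noteq> \<infinity>"
    using ennreal_less_top by (metis infinity_ennreal_def neq_top_trans ennreal_neq_top)
  hence "AE x in M. (\<Sum>k. ennreal (4^k * (norm (?d k x))\<^sup>2)) \<noteq> \<infinity>"
    by (intro nn_integral_PInf_AE) auto
  thus ?thesis
  proof eventually_elim
    case (elim x)
    hence "summable (\<lambda>k. 4^k * (norm (?d k x))\<^sup>2)"
      by (intro summable_suminf_not_top) (auto simp: top.not_eq_extremum)
    hence "summable (\<lambda>k. ?d k x)" by (rule summable_of_weighted_squares)
    hence "convergent (\<lambda>n. \<Sum>k<n. ?d k x)" by (simp add: summable_iff_convergent)
    hence "convergent (\<lambda>n. f n x - f 0 x)" by (subst (asm) sum_lessThan_telescope[of "\<lambda>k. f k x"])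
    hence "convergent (\<lambda>n. (f n x - f 0 x) + f 0 x)" by (intro convergent_add convergent_const)
    thus ?case by simp
  qed
qed

lemma l2_Cauchy_fast_subseq:
  assumes "l2_Cauchy M f"
  obtains r :: "nat \<Rightarrow> nat" where "strict_mono r" 
    "\<And>k n. n \<ge> r k \<Longrightarrow> l2_norm M (\<lambda>x. f n x - f (r k) x) \<le> (1/4)^k"
proof -
  have "\<forall>k. \<exists>N. \<forall>m\<ge>N. \<forall>n\<ge>N. l2_norm M (\<lambda>x. f m x - f n x) < (1/4)^k"
    using assms by (auto simp: l2_Cauchy_def)
  then obtain N where N: "\<And>k m n. m \<ge> N k \<Longrightarrow> n \<ge> N k \<Longrightarrow> l2_norm M (\<lambda>x. f m x - f n x) < (1/4)^k"
    by metis
  \<comment> \<open>The sum of all earlier thresholds dominates \<open>N k\<close>, and the summand \<open>k\<close> makes \<open>r\<close> strictly monotone.\<close>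
  define r where "r k = k + (\<Sum>j\<le>k. N j)" for k
  have "strict_mono r" unfolding strict_mono_Suc_iff r_def by simp
  moreover have "r k \<ge> N k" for k unfolding r_def
    using member_le_sum[of k "{..k}" N] by simp
  moreover have "l2_norm M (\<lambda>x. f n x - f (r k) x) \<le> (1/4)^k" if "n \<ge> r k" for k n
    using N[of k n "r k"] that \<open>\<And>k. r k \<ge> N k\<close>[of k] by simp
  ultimately show ?thesis using that by blast
qed

text \<open>The Riesz-Fischer theorem: a fast subsequence converges almost everywhere, and Fatou's lemma transfers the
  Cauchy estimate to the limit.\<close>

lemma l2_complete:
  assumes f: "\<And>n. f n \<in> L2 M" and cau: "l2_Cauchy M f"
  obtains g where "g \<in> L2 M" "(\<lambda>n. l2_norm M (\<lambda>x. f n x - g x)) \<longlonglongrightarrow> 0"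
proof -
  obtain r :: "nat \<Rightarrow> nat" where r: "strict_mono r"
    and rf: "\<And>k n. n \<ge> r k \<Longrightarrow> l2_norm M (\<lambda>x. f n x - f (r k) x) \<le> (1/4)^k"
    using l2_Cauchy_fast_subseq[OF cau] by blast
  have [measurable]: "f k \<in> borel_measurable M" for k using f L2_measurable by blast
  have conv: "AE x in M. convergent (\<lambda>k. f (r k) x)"
    using f by (intro l2_fast_convergence_AE rf strict_mono_less_eq[OF r, THEN iffD2]) auto
  define g where "g x = lim (\<lambda>k. f (r k) x)" for x
  have g[measurable]: "g \<in> borel_measurable M" unfolding g_def by measurable
  have lim: "AE x in M. (\<lambda>k. f (r k) x) \<longlonglongrightarrow> g x"
    using conv by eventually_elim (simp add: g_def convergent_LIMSEQ_iff)
  have key: "(\<lambda>x. f n x - g x) \<in> L2 M \<and> l2_norm M (\<lambda>x. f n x - g x) \<le> e"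
    if N: "\<forall>m\<ge>N. \<forall>n\<ge>N. l2_norm M (\<lambda>x. f m x - f n x) < e" and n: "n \<ge> N" for n N e
  proof -
    let ?h = "\<lambda>k x. f n x - f (r (k + N)) x"
    have h: "?h k \<in> L2 M" for k by (intro L2_diff f)
    have b: "l2_norm M (?h k) \<le> e" for k
      using N n seq_suble[OF r, of "k+N"] by (intro less_imp_le) auto
    have l: "AE x in M. (\<lambda>k. ?h k x) \<longlonglongrightarrow> f n x - g x"
      using lim by eventually_elim (intro tendsto_intros LIMSEQ_ignore_initial_segment)
    show ?thesis using l2_Fatou[OF h b l] by simp
  qed
  obtain N1 where N1: "\<forall>m\<ge>N1. \<forall>n\<ge>N1. l2_norm M (\<lambda>x. f m x - f n x) < 1"
    using cau unfolding l2_Cauchy_def by (meson zero_less_one)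
  have "(\<lambda>x. f N1 x - (f N1 x - g x)) \<in> L2 M"
    by (rule L2_diff[OF f conjunct1[OF key[OF N1 order_refl]]])
  hence gL: "g \<in> L2 M" by simp
  have "(\<lambda>n. l2_norm M (\<lambda>x. f n x - g x)) \<longlonglongrightarrow> 0"
  proof (rule LIMSEQ_I)
    fix e :: real assume "e > 0"
    then obtain N where N: "\<forall>m\<ge>N. \<forall>n\<ge>N. l2_norm M (\<lambda>x. f m x - f n x) < e/2"
      using cau unfolding l2_Cauchy_def by (meson half_gt_zero)
    have "\<forall>n\<ge>N. norm (l2_norm M (\<lambda>x. f n x - g x) - 0) < e" 
      using key[OF N] \<open>e > 0\<close> by fastforce
    thus "\<exists>no. \<forall>n\<ge>no. norm (l2_norm M (\<lambda>x. f n x - g x) - 0) < e" by blast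
  qed
  thus ?thesis using gL that by blast
qed

lemma l2_Cauchy_of_converges:
  assumes "\<And>n. f n \<in> L2 M" "g \<in> L2 M" "(\<lambda>n. l2_norm M (\<lambda>x. f n x - g x)) \<longlonglongrightarrow> 0"
  shows "l2_Cauchy M f"
  unfolding l2_Cauchy_def
proof (intro allI impI)
  fix e :: real assume "e > 0"
  then obtain N where N: "\<forall>n\<ge>N. norm (l2_norm M (\<lambda>x. f n x - g x) - 0) < e/2"
    using LIMSEQ_D[OF assms(3)] by (meson half_gt_zero)
  show "\<exists>N. \<forall>m\<ge>N. \<forall>n\<ge>N. l2_norm M (\<lambda>x. f m x - f n x) < e"
  proof (intro exI allI impI)
    fix m n assume "m \<ge> N" "n \<ge> N"
    have "l2_norm M (\<lambda>x. f m x - f n x) \<le> l2_norm M (\<lambda>x. f m x - g x) + l2_norm M (\<lambda>x. f n x - g x)"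
      using l2_norm_triangle_diff[of "f m" M g "f n"] assms l2_norm_minus_commute[of M g "f n"] by simp
    also have "\<dots> < e" using N[rule_format, OF \<open>m \<ge> N\<close>] N[rule_format, OF \<open>n \<ge> N\<close>] by simp
    finally show "l2_norm M (\<lambda>x. f m x - f n x) < e" .
  qed
qed

lemma l2_norm_tendsto:
  assumes "\<And>n. f n \<in> L2 M" "g \<in> L2 M" "(\<lambda>n. l2_norm M (\<lambda>x. f n x - g x)) \<longlonglongrightarrow> 0"
  shows "(\<lambda>n. l2_norm M (f n)) \<longlonglongrightarrow> l2_norm M g"
proof (rule LIM_zero_cancel, rule Lim_null_comparison[OF _ assms(3)], rule always_eventually, rule allI)
  fix n show "norm (l2_norm M (f n) - l2_norm M g) \<le> l2_norm M (\<lambda>x. f n x - g x)"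
    using l2_norm_triangle_sub[of "f n" M g] l2_norm_triangle_sub[of g M "f n"] assms 
      l2_norm_minus_commute[of M g "f n"] by auto
qed

lemma l2_inner_tendsto_left:
  assumes "\<And>n. f n \<in> L2 M" "g \<in> L2 M" "(\<lambda>n. l2_norm M (\<lambda>x. f n x - g x)) \<longlonglongrightarrow> 0" "h \<in> L2 M"
  shows "(\<lambda>n. l2_inner M (f n) h) \<longlonglongrightarrow> l2_inner M g h"
proof (rule LIM_zero_cancel, rule Lim_null_comparison, rule always_eventually, rule allI)
  fix n show "norm (l2_inner M (f n) h - l2_inner M g h) \<le> l2_norm M (\<lambda>x. f n x - g x) * l2_norm M h"
    using l2_Cauchy_Schwarz[of "\<lambda>x. f n x - g x" M h] assms by (simp add: l2_inner_diff_left L2_diff)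
next
  show "(\<lambda>n. l2_norm M (\<lambda>x. f n x - g x) * l2_norm M h) \<longlonglongrightarrow> 0"
    using tendsto_mult_left_zero[OF assms(3)] by simp
qed

text \<open>The parallelogram law turns near minimality into the Cauchy property: \<open>g n\<close> minimises the norm up to the
  error \<open>e n\<close> over a class with infimum \<open>d n\<close>, and the midpoint with a later \<open>g m\<close> still belongs to the \<open>n\<close>-th class. The classes
  may shrink with \<open>n\<close>. This is used as a substitute for weak compactness.\<close>

lemma l2_minimizing_Cauchy:
  assumes g: "\<And>n. g n \<in> L2 M" and d: "\<And>n. (l2_norm M (g n))\<^sup>2 \<le> d n + e n" 
    and mid: "\<And>m n. n \<le> m \<Longrightarrow> d n \<le> (l2_norm M (\<lambda>x. (1/2) *\<^sub>R (g n x + g m x)))\<^sup>2"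
    and dl: "d \<longlonglongrightarrow> D" and el: "e \<longlonglongrightarrow> 0"
  shows "l2_Cauchy M g"
  unfolding l2_Cauchy_def
proof (intro allI impI)
  fix \<epsilon> :: real assume e: "\<epsilon> > 0"
  define \<delta> where "\<delta> = \<epsilon>\<^sup>2 / 8"
  have \<delta>: "\<delta> > 0" using e by (simp add: \<delta>_def)
  have "eventually (\<lambda>n. \<bar>d n - D\<bar> < \<delta> \<and> \<bar>e n\<bar> < \<delta>) sequentially"
    using tendstoD[OF dl \<delta>] tendstoD[OF el \<delta>] by eventually_elim (auto simp: dist_real_def)
  then obtain N where N: "\<And>n. n \<ge> N \<Longrightarrow> \<bar>d n - D\<bar> < \<delta> \<and> \<bar>e n\<bar> < \<delta>"
    by (auto simp: eventually_sequentially)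
  have main: "l2_norm M (\<lambda>x. g n x - g m x) < \<epsilon>" if "n \<le> m" "N \<le> n" for m n
  proof (rule power2_less_imp_less)
    have "(l2_norm M (\<lambda>x. g n x - g m x))\<^sup>2 \<le> 2 * (d n + e n) + 2 * (d m + e m) - 4 * d n"
      using l2_parallelogram[OF g g, of n m] d[of n] d[of m] mid[OF that(1)]
      by (smt (verit, best))
    also have "\<dots> < 8 * \<delta>" using N[of n] N[of m] that by (simp add: abs_less_iff)
    finally show "(l2_norm M (\<lambda>x. g n x - g m x))\<^sup>2 < \<epsilon>\<^sup>2" by (simp add: \<delta>_def)
  qed (use e in auto)
  show "\<exists>N. \<forall>m\<ge>N. \<forall>n\<ge>N. l2_norm M (\<lambda>x. g m x - g n x) < \<epsilon>"
  proof (intro exI[of _ N] allI impI)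
    fix m n assume "N \<le> m" "N \<le> n"
    thus "l2_norm M (\<lambda>x. g m x - g n x) < \<epsilon>"
      using main[of n m] main[of m n] l2_norm_minus_commute[of M "g n" "g m"] by (cases "n \<le> m") auto
  qed
qed

section \<open>The min-max principle for a pair of quadratic forms\<close>

text \<open>Gaussian elimination: the last equation expresses the unknown at a pivot \<open>p\<close> by the others.\<close>

lemma homogeneous_system_nontrivial:
  fixes A :: "nat \<Rightarrow> 'i \<Rightarrow> real"
  assumes "finite I" "m < card I"
  shows "\<exists>c. (\<exists>i\<in>I. c i \<noteq> 0) \<and> (\<forall>j<m. (\<Sum>i\<in>I. c i * A j i) = 0)"
  using assms
proof (induction m arbitrary: I A)
  case 0
  then obtain i where "i \<in> I" by (metis card.empty ex_in_conv not_less_zero)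
  thus ?case by (intro exI[of _ "\<lambda>_. 1"]) auto
next
  case (Suc m)
  show ?case
  proof (cases "\<forall>i\<in>I. A m i = 0")
    case True
    obtain c where "\<exists>i\<in>I. c i \<noteq> 0" "\<forall>j<m. (\<Sum>i\<in>I. c i * A j i) = 0"
      using Suc.IH[of I A] Suc.prems by auto
    thus ?thesis using True by (intro exI[of _ c]) (auto simp: less_Suc_eq)
  next
    case False
    then obtain p where p: "p \<in> I" "A m p \<noteq> 0" by blast
    let ?J = "I - {p}"
    have J: "finite ?J" "m < card ?J" using Suc.prems p by auto
    obtain c where c: "\<exists>i\<in>?J. c i \<noteq> 0"
      "\<forall>j<m. (\<Sum>i\<in>?J. c i * (A j i - A j p * A m i / A m p)) = 0"
      using Suc.IH[OF J, of "\<lambda>j i. A j i - A j p * A m i / A m p"] by auto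
    define s where "s = (\<Sum>i\<in>?J. c i * A m i)"
    define c' where "c' = c(p := - s / A m p)"
    have split: "(\<Sum>i\<in>I. c' i * A j i) = - s / A m p * A j p + (\<Sum>i\<in>?J. c i * A j i)" for j
    proof -
      have "(\<Sum>i\<in>I. c' i * A j i) = c' p * A j p + (\<Sum>i\<in>?J. c' i * A j i)"
        using Suc.prems p by (simp add: sum.remove)
      also have "(\<Sum>i\<in>?J. c' i * A j i) = (\<Sum>i\<in>?J. c i * A j i)"
        by (intro sum.cong) (auto simp: c'_def)
      finally show ?thesis by (simp add: c'_def)
    qed
    have "(\<Sum>i\<in>I. c' i * A j i) = 0" if "j < Suc m" for j
    proof (cases "j = m")
      case True
      thus ?thesis using split[of j] p by (simp add: s_def)
    next
      case False
      hence "0 = (\<Sum>i\<in>?J. c i * (A j i - A j p * A m i / A m p))" using c(2) that by simp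
      also have "\<dots> = (\<Sum>i\<in>?J. c i * A j i) - (\<Sum>i\<in>?J. (A j p / A m p) * (c i * A m i))"
        by (simp add: sum_subtractf[symmetric] algebra_simps)
      also have "\<dots> = (\<Sum>i\<in>?J. c i * A j i) - (A j p / A m p) * s"
        by (simp add: s_def sum_distrib_left)
      finally show ?thesis using split[of j] by simp
    qed
    moreover have "\<exists>i\<in>I. c' i \<noteq> 0" using c(1) by (auto simp: c'_def)
    ultimately show ?thesis by blast
  qed
qed

text \<open>A supremum of extended naturals that reaches a finite \<open>k\<close> is reached by a member, because below \<open>k\<close> there is
  a largest number \<open>k - 1\<close>.\<close>

lemma enat_le_SupD:
  assumes "enat k \<le> Sup A" "k \<noteq> 0"
  shows "\<exists>y\<in>A. enat k \<le> y"
proof (rule ccontr)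
  assume "\<not> (\<exists>y\<in>A. enat k \<le> y)"
  hence "\<forall>y\<in>A. y \<le> enat (k - 1)" using assms(2)
    by (metis One_nat_def Suc_pred enat_ord_simps(1) iless_eSuc0 ileI1 linorder_not_le neq0_conv eSuc_enat leD Suc_ile_eq not_le)
  hence "Sup A \<le> enat (k - 1)" by (intro Sup_least) auto
  hence "enat k \<le> enat (k - 1)" using assms(1) by (rule order_trans[rotated])
  thus False using assms(2) by simp
qed

lemma enat_le_add_split:
  assumes "enat k \<le> x + y"
  obtains p q where "k = p + q" "enat p \<le> x" "enat q \<le> y"
proof (cases "enat k \<le> x")
  case True
  thus ?thesis using that[of k 0] by (simp add: zero_enat_def[symmetric])
next
  case False
  then obtain p where p: "x = enat p" "p \<le> k" by (cases x) auto
  hence "enat (k - p) \<le> y" using assms by (cases y) auto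
  thus ?thesis using that[of p "k - p"] p by simp
qed

definition lincomb :: "nat \<Rightarrow> (nat \<Rightarrow> real) \<Rightarrow> (nat \<Rightarrow> 'x \<Rightarrow> real) \<Rightarrow> 'x \<Rightarrow> real" where
  "lincomb n c u = (\<lambda>x. \<Sum>i<n. c i * u i x)"

text \<open>The form \<open>a\<close> is the energy and \<open>b\<close> the \<open>L2\<close> inner product. Both are only semidefinite, since the elements are
  functions and not classes modulo null functions; limits and independence are therefore stated through \<open>b\<close>.
  The assumption \<open>compact\<close> is the compact embedding together with closedness of \<open>S\<close>; with
  \<open>lower_semicontinuous\<close> it yields minimisers of the energy under constraints.\<close>

locale energy_forms =
  fixes S :: "('x \<Rightarrow> real) set" and a b :: "('x \<Rightarrow> real) \<Rightarrow> ('x \<Rightarrow> real) \<Rightarrow> real"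
  assumes zero: "(\<lambda>x. 0) \<in> S"
    and add: "u \<in> S \<Longrightarrow> v \<in> S \<Longrightarrow> (\<lambda>x. u x + v x) \<in> S"
    and scale: "u \<in> S \<Longrightarrow> (\<lambda>x. c * u x) \<in> S"
    and a_add: "u \<in> S \<Longrightarrow> v \<in> S \<Longrightarrow> w \<in> S \<Longrightarrow> a (\<lambda>x. u x + v x) w = a u w + a v w"
    and a_scale: "u \<in> S \<Longrightarrow> w \<in> S \<Longrightarrow> a (\<lambda>x. c * u x) w = c * a u w"
    and a_commute: "u \<in> S \<Longrightarrow> v \<in> S \<Longrightarrow> a u v = a v u"
    and a_nonneg: "u \<in> S \<Longrightarrow> 0 \<le> a u u"
    and b_add: "u \<in> S \<Longrightarrow> v \<in> S \<Longrightarrow> w \<in> S \<Longrightarrow> b (\<lambda>x. u x + v x) w = b u w + b v w"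
    and b_scale: "u \<in> S \<Longrightarrow> w \<in> S \<Longrightarrow> b (\<lambda>x. c * u x) w = c * b u w"
    and b_commute: "u \<in> S \<Longrightarrow> v \<in> S \<Longrightarrow> b u v = b v u"
    and b_nonneg: "u \<in> S \<Longrightarrow> 0 \<le> b u u"
    and compact: "(\<And>n. vs n \<in> S) \<Longrightarrow> (\<And>n. b (vs n) (vs n) \<le> 1) \<Longrightarrow> (\<And>n. a (vs n) (vs n) \<le> C) \<Longrightarrow>
       \<exists>r w. strict_mono (r :: nat \<Rightarrow> nat) \<and> w \<in> S \<and> 
         (\<lambda>n. b (\<lambda>x. vs (r n) x - w x) (\<lambda>x. vs (r n) x - w x)) \<longlonglongrightarrow> 0"
    and lower_semicontinuous: "(\<And>n. vs n \<in> S) \<Longrightarrow> w \<in> S \<Longrightarrow> (\<And>n. a (vs n) (vs n) \<le> C) \<Longrightarrow> 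
         (\<lambda>n. b (\<lambda>x. vs n x - w x) (\<lambda>x. vs n x - w x)) \<longlonglongrightarrow> 0 \<Longrightarrow> a w w \<le> C"
begin

definition eigenvector :: "real \<Rightarrow> ('x \<Rightarrow> real) \<Rightarrow> bool" where
  "eigenvector \<mu> u \<longleftrightarrow> u \<in> S \<and> (\<forall>\<phi>\<in>S. a u \<phi> = \<mu> * b u \<phi>)"

definition orthonormal :: "nat \<Rightarrow> (nat \<Rightarrow> 'x \<Rightarrow> real) \<Rightarrow> bool" where
  "orthonormal n e \<longleftrightarrow> (\<forall>i<n. \<forall>j<n. b (e i) (e j) = (if i = j then 1 else 0))"

definition eigensystem :: "nat \<Rightarrow> (nat \<Rightarrow> 'x \<Rightarrow> real) \<Rightarrow> (nat \<Rightarrow> real) \<Rightarrow> bool" where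
  "eigensystem n e \<mu> \<longleftrightarrow> orthonormal n e \<and> (\<forall>i<n. eigenvector (\<mu> i) (e i))"

definition independent :: "nat \<Rightarrow> (nat \<Rightarrow> 'x \<Rightarrow> real) \<Rightarrow> bool" where
  "independent n u \<longleftrightarrow> (\<forall>c. b (lincomb n c u) (lincomb n c u) = 0 \<longrightarrow> (\<forall>i<n. c i = 0))"

lemma diff: "u \<in> S \<Longrightarrow> v \<in> S \<Longrightarrow> (\<lambda>x. u x - v x) \<in> S"
  using add[of u "\<lambda>x. -1 * v x"] scale[of v "-1"] by simp

lemma lincomb_mem: "(\<And>i. i < n \<Longrightarrow> u i \<in> S) \<Longrightarrow> lincomb n c u \<in> S"
proof (induction n)
  case (Suc n)
  hence "(\<lambda>x. lincomb n c u x + c n * u n x) \<in> S" by (intro add scale) auto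
  thus ?case by (simp add: lincomb_def)
qed (simp add: lincomb_def zero)

lemma a_zero: "w \<in> S \<Longrightarrow> a (\<lambda>x. 0) w = 0"
  using a_scale[OF zero, of w 0] by simp

lemma b_zero: "w \<in> S \<Longrightarrow> b (\<lambda>x. 0) w = 0"
  using b_scale[OF zero, of w 0] by simp

lemma a_lincomb:
  assumes "\<And>i. i < n \<Longrightarrow> u i \<in> S" "w \<in> S"
  shows "a (lincomb n c u) w = (\<Sum>i<n. c i * a (u i) w)"
  using assms(1)
proof (induction n)
  case 0 thus ?case using a_zero assms by (simp add: lincomb_def)
next
  case (Suc n)
  have "a (lincomb (Suc n) c u) w = a (\<lambda>x. lincomb n c u x + c n * u n x) w"
    by (simp add: lincomb_def)
  also have "\<dots> = a (lincomb n c u) w + a (\<lambda>x. c n * u n x) w"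
    using Suc assms by (intro a_add lincomb_mem scale) auto
  finally show ?case using Suc assms(2) by (simp add: a_scale)
qed

lemma b_lincomb:
  assumes "\<And>i. i < n \<Longrightarrow> u i \<in> S" "w \<in> S"
  shows "b (lincomb n c u) w = (\<Sum>i<n. c i * b (u i) w)"
  using assms(1)
proof (induction n)
  case 0 thus ?case using b_zero assms by (simp add: lincomb_def)
next
  case (Suc n)
  have "b (lincomb (Suc n) c u) w = b (\<lambda>x. lincomb n c u x + c n * u n x) w"
    by (simp add: lincomb_def)
  also have "\<dots> = b (lincomb n c u) w + b (\<lambda>x. c n * u n x) w"
    using Suc assms by (intro b_add lincomb_mem scale) auto
  finally show ?case using Suc assms(2) by (simp add: b_scale)
qed

lemma b_diff: "u \<in> S \<Longrightarrow> v \<in> S \<Longrightarrow> w \<in> S \<Longrightarrow> b (\<lambda>x. u x - v x) w = b u w - b v w"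
  using b_add[of u "\<lambda>x. -1 * v x" w] b_scale[of v w "-1"] scale[of v "-1"] by simp

lemma a_diff: "u \<in> S \<Longrightarrow> v \<in> S \<Longrightarrow> w \<in> S \<Longrightarrow> a (\<lambda>x. u x - v x) w = a u w - a v w"
  using a_add[of u "\<lambda>x. -1 * v x" w] a_scale[of v w "-1"] scale[of v "-1"] by simp

lemma a_quadratic:
  assumes "u \<in> S" "v \<in> S"
  shows "a (\<lambda>x. u x + t * v x) (\<lambda>x. u x + t * v x) = a u u + 2 * t * a u v + t\<^sup>2 * a v v"
proof -
  have tv: "(\<lambda>x. t * v x) \<in> S" and uv: "(\<lambda>x. u x + t * v x) \<in> S" using assms by (auto intro: add scale)
  have 1: "a u (\<lambda>x. u x + t * v x) = a u u + t * a u v"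
    using a_commute[OF assms(1) uv] a_add[OF assms(1) tv assms(1)] a_scale[OF assms(2,1), of t] 
      a_commute[OF assms] by simp
  have 2: "a v (\<lambda>x. u x + t * v x) = a u v + t * a v v"
    using a_commute[OF assms(2) uv] a_add[OF assms(1) tv assms(2)] a_scale[OF assms(2,2), of t] by simp
  show ?thesis using a_add[OF assms(1) tv uv] a_scale[OF assms(2) uv, of t] 1 2 
    by (simp add: algebra_simps power2_eq_square)
qed

lemma b_quadratic:
  assumes "u \<in> S" "v \<in> S"
  shows "b (\<lambda>x. u x + t * v x) (\<lambda>x. u x + t * v x) = b u u + 2 * t * b u v + t\<^sup>2 * b v v"
proof -
  have tv: "(\<lambda>x. t * v x) \<in> S" and uv: "(\<lambda>x. u x + t * v x) \<in> S" using assms by (auto intro: add scale)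
  have 1: "b u (\<lambda>x. u x + t * v x) = b u u + t * b u v"
    using b_commute[OF assms(1) uv] b_add[OF assms(1) tv assms(1)] b_scale[OF assms(2,1), of t] 
      b_commute[OF assms] by simp
  have 2: "b v (\<lambda>x. u x + t * v x) = b u v + t * b v v"
    using b_commute[OF assms(2) uv] b_add[OF assms(1) tv assms(2)] b_scale[OF assms(2,2), of t] by simp
  show ?thesis using b_add[OF assms(1) tv uv] b_scale[OF assms(2) uv, of t] 1 2 
    by (simp add: algebra_simps power2_eq_square)
qed

lemma b_Cauchy_Schwarz:
  assumes "u \<in> S" "v \<in> S" shows "(b u v)\<^sup>2 \<le> b u u * b v v"
proof (rule quadratic_nonneg_discriminant)
  fix t
  have "0 \<le> b (\<lambda>x. u x + (-t) * v x) (\<lambda>x. u x + (-t) * v x)"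
    using assms by (intro b_nonneg add scale)
  thus "0 \<le> b u u - 2 * t * b u v + t\<^sup>2 * b v v"
    unfolding b_quadratic[OF assms] by simp
qed (use assms b_nonneg in auto)

lemma scale_diag:
  assumes "u \<in> S"
  shows "a (\<lambda>x. c * u x) (\<lambda>x. c * u x) = c\<^sup>2 * a u u" "b (\<lambda>x. c * u x) (\<lambda>x. c * u x) = c\<^sup>2 * b u u"
  using a_quadratic[OF zero assms, of c] b_quadratic[OF zero assms, of c] a_zero[OF assms] a_zero[OF zero]
    b_zero[OF assms] b_zero[OF zero] by auto

lemma orthonormal_lincomb:
  assumes "orthonormal n e" "\<And>i. i < n \<Longrightarrow> e i \<in> S"
  shows "j < n \<Longrightarrow> b (lincomb n c e) (e j) = c j"
    and "b (lincomb n c e) (lincomb n c e) = (\<Sum>i<n. (c i)\<^sup>2)"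
proof -
  have *: "b (lincomb n c e) (e j) = c j" if "j < n" for j
  proof -
    have "b (lincomb n c e) (e j) = (\<Sum>i<n. c i * b (e i) (e j))" using that assms by (intro b_lincomb) auto
    also have "\<dots> = (\<Sum>i<n. if i = j then c i else 0)"
      using assms(1) that by (intro sum.cong) (auto simp: orthonormal_def)
    finally show ?thesis using that by (simp add: sum.delta)
  qed
  thus "j < n \<Longrightarrow> b (lincomb n c e) (e j) = c j" .
  have "b (lincomb n c e) (lincomb n c e) = (\<Sum>i<n. c i * b (e i) (lincomb n c e))"
    using assms by (intro b_lincomb lincomb_mem) auto
  also have "\<dots> = (\<Sum>i<n. (c i)\<^sup>2)"
    using * assms lincomb_mem[of n e c] by (intro sum.cong) (auto simp: power2_eq_square b_commute[of "e _" "lincomb n c e"])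
  finally show "b (lincomb n c e) (lincomb n c e) = (\<Sum>i<n. (c i)\<^sup>2)" .
qed

lemma orthonormal_independent:
  assumes "orthonormal n e" "\<And>i. i < n \<Longrightarrow> e i \<in> S"
  shows "independent n e"
  unfolding independent_def
proof (intro allI impI)
  fix c i assume "b (lincomb n c e) (lincomb n c e) = 0" "i < n"
  hence "(\<Sum>i<n. (c i)\<^sup>2) = 0" using orthonormal_lincomb(2)[of n e c] assms by simp
  thus "c i = 0" using \<open>i < n\<close> by (simp add: sum_nonneg_eq_0_iff)
qed

text \<open>Orthogonality to \<open>m\<close> vectors is a system of \<open>m\<close> linear equations for more than \<open>m\<close> coefficients.\<close>

lemma orthogonal_unit_lincomb:
  assumes u: "\<And>i. i < n \<Longrightarrow> u i \<in> S" and ind: "independent n u" 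
    and e: "\<And>j. j < m \<Longrightarrow> e j \<in> S" and mn: "m < n"
  shows "\<exists>c. b (lincomb n c u) (lincomb n c u) = 1 \<and> (\<forall>j<m. b (lincomb n c u) (e j) = 0)"
proof -
  obtain c where c: "\<exists>i\<in>{..<n}. c i \<noteq> 0" "\<forall>j<m. (\<Sum>i<n. c i * b (u i) (e j)) = 0"
    using homogeneous_system_nontrivial[of "{..<n}" m "\<lambda>j i. b (u i) (e j)"] mn by auto
  let ?w = "lincomb n c u"
  have w: "?w \<in> S" by (rule lincomb_mem[OF u])
  have "b ?w ?w \<noteq> 0" using ind c(1) unfolding independent_def by blast
  hence pos: "b ?w ?w > 0" using b_nonneg[OF w] by simp
  define s where "s = 1 / sqrt (b ?w ?w)"
  have eq: "lincomb n (\<lambda>i. s * c i) u = (\<lambda>x. s * ?w x)"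
    by (simp add: lincomb_def sum_distrib_left mult.assoc)
  have "b (\<lambda>x. s * ?w x) (\<lambda>x. s * ?w x) = 1"
    using pos unfolding scale_diag(2)[OF w] by (simp add: s_def power_divide)
  moreover have "b (\<lambda>x. s * ?w x) (e j) = 0" if "j < m" for j
    using b_scale[OF w e[OF that]] b_lincomb[OF u e[OF that]] c(2) that by simp
  ultimately show ?thesis unfolding eq[symmetric] by blast
qed

lemma eigenvector_lincomb:
  assumes "\<And>i. i < n \<Longrightarrow> eigenvector \<mu> (u i)"
  shows "eigenvector \<mu> (lincomb n c u)"
  using assms unfolding eigenvector_def
  by (auto intro!: lincomb_mem simp: a_lincomb b_lincomb sum_distrib_left algebra_simps intro!: sum.cong)

lemma orthonormal_Suc:
  assumes e: "orthonormal m e" and eS: "\<And>i. i < m \<Longrightarrow> e i \<in> S" and w: "w \<in> S" "b w w = 1" "\<forall>j<m. b w (e j) = 0"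
  shows "orthonormal (Suc m) (e(m := w))"
  using assms b_commute[OF w(1) eS] by (auto simp: orthonormal_def less_Suc_eq)

text \<open>Gram-Schmidt inside one eigenspace, with the next vector obtained by the dimension count.\<close>

lemma orthonormalize_eigenvectors:
  assumes u: "\<And>i. i < n \<Longrightarrow> eigenvector \<mu> (u i)" and ind: "independent n u"
  shows "\<exists>e. eigensystem n e (\<lambda>_. \<mu>)"
proof -
  have "m \<le> n \<Longrightarrow> \<exists>e. eigensystem m e (\<lambda>_. \<mu>)" for m
  proof (induction m)
    case 0 show ?case by (simp add: eigensystem_def orthonormal_def)
  next
    case (Suc m)
    then obtain e where e: "eigensystem m e (\<lambda>_. \<mu>)" by auto
    have eS: "e j \<in> S" if "j < m" for j using e that by (auto simp: eigensystem_def eigenvector_def)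
    have uS: "u j \<in> S" if "j < n" for j using u that by (auto simp: eigenvector_def)
    obtain c where c: "b (lincomb n c u) (lincomb n c u) = 1" "\<forall>j<m. b (lincomb n c u) (e j) = 0"
      using orthogonal_unit_lincomb[OF uS ind, of m e] eS Suc.prems by auto
    have "eigenvector \<mu> (lincomb n c u)" using u by (rule eigenvector_lincomb)
    moreover have "orthonormal (Suc m) (e(m := lincomb n c u))"
      using orthonormal_Suc[OF _ eS lincomb_mem[OF uS] c] e by (auto simp: eigensystem_def)
    ultimately have "eigensystem (Suc m) (e(m := lincomb n c u)) (\<lambda>_. \<mu>)"
      using e by (auto simp: eigensystem_def less_Suc_eq)
    thus ?case by blast
  qed
  thus ?thesis by blast
qed

lemma eigenvectors_orthogonal:
  assumes "eigenvector \<mu> u" "eigenvector \<nu> v" "\<mu> \<noteq> \<nu>"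
  shows "b u v = 0"
proof -
  have S: "u \<in> S" "v \<in> S" using assms by (auto simp: eigenvector_def)
  have "\<mu> * b u v = a u v" using assms S by (auto simp: eigenvector_def)
  also have "\<dots> = a v u" by (rule a_commute[OF S])
  also have "\<dots> = \<nu> * b u v" using assms S b_commute[OF S] by (auto simp: eigenvector_def)
  finally show ?thesis using assms(3) by simp
qed

lemma eigensystem_energy:
  assumes "eigensystem n e \<mu>" "\<And>i. i < n \<Longrightarrow> \<mu> i \<le> t"
  shows "a (lincomb n c e) (lincomb n c e) \<le> t * (\<Sum>i<n. (c i)\<^sup>2)"
proof -
  have e: "orthonormal n e" and ev: "\<And>i. i < n \<Longrightarrow> eigenvector (\<mu> i) (e i)"
    using assms by (auto simp: eigensystem_def)
  have eS: "e i \<in> S" if "i < n" for i using ev that by (auto simp: eigenvector_def)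
  let ?w = "lincomb n c e"
  have w: "?w \<in> S" by (rule lincomb_mem[OF eS])
  have "a ?w ?w = (\<Sum>i<n. c i * a (e i) ?w)" by (rule a_lincomb[OF eS w])
  also have "\<dots> = (\<Sum>i<n. \<mu> i * (c i)\<^sup>2)"
  proof (rule sum.cong)
    fix i assume i: "i \<in> {..<n}"
    have "a (e i) ?w = \<mu> i * b (e i) ?w" using ev[of i] i w by (auto simp: eigenvector_def)
    also have "b (e i) ?w = c i" using orthonormal_lincomb(1)[OF e eS, of i c] i b_commute[OF eS w] by simp
    finally show "c i * a (e i) ?w = \<mu> i * (c i)\<^sup>2" by (simp add: power2_eq_square)
  qed simp
  also have "\<dots> \<le> (\<Sum>i<n. t * (c i)\<^sup>2)" using assms(2) by (intro sum_mono mult_right_mono) auto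
  finally show ?thesis by (simp add: sum_distrib_left)
qed

text \<open>By the Cauchy-Schwarz inequality for \<open>b\<close>.\<close>

lemma b_limit:
  assumes v: "\<And>n. v n \<in> S" and w: "w \<in> S" and phi: "\<phi> \<in> S"
    and lim: "(\<lambda>n. b (\<lambda>x. v n x - w x) (\<lambda>x. v n x - w x)) \<longlonglongrightarrow> 0"
  shows "(\<lambda>n. b (v n) \<phi>) \<longlonglongrightarrow> b w \<phi>"
proof -
  have "(\<lambda>n. (b (\<lambda>x. v n x - w x) \<phi>)\<^sup>2) \<longlonglongrightarrow> 0"
  proof (rule tendsto_sandwich[OF _ _ tendsto_const])
    show "\<forall>\<^sub>F n in sequentially. (b (\<lambda>x. v n x - w x) \<phi>)\<^sup>2 \<le> b (\<lambda>x. v n x - w x) (\<lambda>x. v n x - w x) * b \<phi> \<phi>"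
      using v w phi by (intro always_eventually allI b_Cauchy_Schwarz diff)
    show "(\<lambda>n. b (\<lambda>x. v n x - w x) (\<lambda>x. v n x - w x) * b \<phi> \<phi>) \<longlonglongrightarrow> 0"
      by (rule tendsto_mult_left_zero[OF lim])
  qed auto
  hence "(\<lambda>n. sqrt ((b (\<lambda>x. v n x - w x) \<phi>)\<^sup>2)) \<longlonglongrightarrow> sqrt 0" by (rule tendsto_real_sqrt)
  hence "(\<lambda>n. b (v n) \<phi> - b w \<phi>) \<longlonglongrightarrow> 0"
    using b_diff[OF v w phi] by (simp add: tendsto_rabs_zero_iff)
  thus ?thesis by (rule LIM_zero_cancel)
qed

text \<open>The first variation of the Rayleigh quotient vanishes in the directions orthogonal to the eigenvectors already
  found. In the direction of these eigenvectors both forms vanish on the minimiser, so the equation holds for all test elements.\<close>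

lemma minimizer_is_eigenvector:
  assumes e: "eigensystem m e \<mu>" and w: "w \<in> S" "b w w = 1" "\<forall>j<m. b w (e j) = 0" 
    and min: "\<And>v. v \<in> S \<Longrightarrow> b v v = 1 \<Longrightarrow> \<forall>j<m. b v (e j) = 0 \<Longrightarrow> a w w \<le> a v v"
  shows "eigenvector (a w w) w"
proof -
  have ev: "\<And>i. i < m \<Longrightarrow> eigenvector (\<mu> i) (e i)" and on: "orthonormal m e"
    using e by (auto simp: eigensystem_def)
  have eS: "e i \<in> S" if "i < m" for i using ev that by (auto simp: eigenvector_def)
  let ?I = "a w w"
  have I0: "?I \<ge> 0" using a_nonneg w by blast
  \<comment> \<open>The bound for unit vectors extends to all vectors by homogeneity; a vector with \<open>b v v = 0\<close> is covered by \<open>a v v \<ge> 0\<close>.\<close>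
  have rayleigh: "?I * b v v \<le> a v v" if v: "v \<in> S" "\<forall>j<m. b v (e j) = 0" for v
  proof (cases "b v v = 0")
    case True thus ?thesis using a_nonneg[OF v(1)] by simp
  next
    case False
    hence pos: "b v v > 0" using b_nonneg[OF v(1)] by simp
    define s where "s = 1 / sqrt (b v v)"
    have s2: "s\<^sup>2 = 1 / b v v" using pos by (simp add: s_def power_divide)
    have "?I \<le> a (\<lambda>x. s * v x) (\<lambda>x. s * v x)"
    proof (rule min)
      show "b (\<lambda>x. s * v x) (\<lambda>x. s * v x) = 1" unfolding scale_diag(2)[OF v(1)] s2 using pos by simp
      show "\<forall>j<m. b (\<lambda>x. s * v x) (e j) = 0" using b_scale[OF v(1) eS] v(2) by simp
    qed (use v scale in auto)
    thus ?thesis unfolding scale_diag(1)[OF v(1)] s2 using pos by (simp add: field_simps)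
  qed
  have orth: "a w \<phi> = ?I * b w \<phi>" if phi: "\<phi> \<in> S" "\<forall>j<m. b \<phi> (e j) = 0" for \<phi>
  proof -
    \<comment> \<open>The quadratic polynomial in \<open>t\<close> of the perturbation \<open>w + t \<phi>\<close> is nonnegative and has constant term \<open>0\<close>.\<close>
    have "(?I * b w \<phi> - a w \<phi>)\<^sup>2 \<le> 0 * (a \<phi> \<phi> - ?I * b \<phi> \<phi>)"
    proof (rule quadratic_nonneg_discriminant)
      show "0 \<le> a \<phi> \<phi> - ?I * b \<phi> \<phi>" using rayleigh[OF phi] by simp
      fix t
      have "?I * b (\<lambda>x. w x + t * \<phi> x) (\<lambda>x. w x + t * \<phi> x) \<le> a (\<lambda>x. w x + t * \<phi> x) (\<lambda>x. w x + t * \<phi> x)"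
      proof (rule rayleigh)
        show "(\<lambda>x. w x + t * \<phi> x) \<in> S" using w phi by (intro add scale)
        show "\<forall>j<m. b (\<lambda>x. w x + t * \<phi> x) (e j) = 0"
          using b_add[OF w(1) scale[OF phi(1)] eS] b_scale[OF phi(1) eS] w(3) phi(2) by simp
      qed
      thus "0 \<le> 0 - 2 * t * (?I * b w \<phi> - a w \<phi>) + t\<^sup>2 * (a \<phi> \<phi> - ?I * b \<phi> \<phi>)"
        unfolding a_quadratic[OF w(1) phi(1)] b_quadratic[OF w(1) phi(1)] using w(2) 
        by (simp add: algebra_simps)
    qed simp
    thus ?thesis by simp
  qed
  have "a w \<phi> = ?I * b w \<phi>" if phi: "\<phi> \<in> S" for \<phi>
  proof -
    \<comment> \<open>The orthogonal projection of \<open>\<phi>\<close> to the span of the given eigenvectors.\<close>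
    define p where "p = lincomb m (\<lambda>j. b \<phi> (e j)) e"
    have p: "p \<in> S" unfolding p_def by (rule lincomb_mem[OF eS])
    have wp: "a p w = 0" "b p w = 0"
    proof -
      have "b (e j) w = 0" if "j < m" for j using w(3) that b_commute[OF w(1) eS[OF that]] by simp
      moreover have "a (e j) w = 0" if "j < m" for j 
        using ev[OF that] w(1) calculation[OF that] by (simp add: eigenvector_def)
      ultimately show "a p w = 0" "b p w = 0"
        unfolding p_def using a_lincomb[OF eS w(1)] b_lincomb[OF eS w(1)] by auto
    qed
    have "\<forall>j<m. b (\<lambda>x. \<phi> x - p x) (e j) = 0"
      using b_diff[OF phi p eS] orthonormal_lincomb(1)[OF on eS] by (simp add: p_def)
    hence "a w (\<lambda>x. \<phi> x - p x) = ?I * b w (\<lambda>x. \<phi> x - p x)" by (intro orth diff phi p)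
    thus ?thesis using a_commute[OF w(1) diff[OF phi p]] b_commute[OF w(1) diff[OF phi p]]
      a_diff[OF phi p w(1)] b_diff[OF phi p w(1)] wp a_commute[OF w(1) phi] b_commute[OF w(1) phi] by simp
  qed
  thus ?thesis using w(1) unfolding eigenvector_def by blast
qed

text \<open>A minimising sequence has bounded energy, so it converges along a subsequence. The constraints pass to the limit
  because they are continuous for \<open>b\<close>, and the energy does not increase.\<close>

lemma constrained_minimizer_exists:
  assumes e: "\<And>j. j < m \<Longrightarrow> e j \<in> S" and v1: "v1 \<in> S" "b v1 v1 = 1" "\<forall>j<m. b v1 (e j) = 0"
  obtains w where "w \<in> S" "b w w = 1" "\<forall>j<m. b w (e j) = 0"
    "\<And>v. v \<in> S \<Longrightarrow> b v v = 1 \<Longrightarrow> \<forall>j<m. b v (e j) = 0 \<Longrightarrow> a w w \<le> a v v"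
proof -
  define X where "X = {v \<in> S. b v v = 1 \<and> (\<forall>j<m. b v (e j) = 0)}"
  define I where "I = (INF v\<in>X. a v v)"
  have v1X: "v1 \<in> X" using v1 by (simp add: X_def)
  have bdd: "bdd_below ((\<lambda>v. a v v) ` X)" by (rule bdd_belowI[of _ 0]) (auto simp: X_def a_nonneg)
  have "\<exists>v\<in>X. a v v < I + 1 / real (Suc n)" for n
    using cINF_less_iff[of X "\<lambda>v. a v v" "I + 1 / real (Suc n)"] bdd v1X by (auto simp: I_def)
  then obtain v where vX: "\<And>n. v n \<in> X" and va: "\<And>n. a (v n) (v n) < I + 1 / real (Suc n)" by metis
  have vS: "v n \<in> S" and vb: "b (v n) (v n) = 1" for n using vX by (auto simp: X_def)
  have "a (v n) (v n) \<le> I + 1" for n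
  proof -
    have "1 / real (Suc n) \<le> 1" by simp
    thus ?thesis using va[of n] by linarith
  qed
  then obtain r w where r: "strict_mono (r :: nat \<Rightarrow> nat)" and w: "w \<in> S" 
    and lim: "(\<lambda>n. b (\<lambda>x. v (r n) x - w x) (\<lambda>x. v (r n) x - w x)) \<longlonglongrightarrow> 0"
    using compact[of v "I + 1"] vS vb by auto
  have blim: "\<phi> \<in> S \<Longrightarrow> (\<lambda>n. b (v (r n)) \<phi>) \<longlonglongrightarrow> b w \<phi>" for \<phi>
    by (rule b_limit[OF vS w _ lim])
  have "b w (e j) = 0" if "j < m" for j
  proof -
    have "(\<lambda>n. b (v (r n)) (e j)) = (\<lambda>n. 0)" using vX that by (auto simp: X_def)
    thus ?thesis using blim[OF e[OF that]] LIMSEQ_unique tendsto_const by metis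
  qed
  moreover have "b w w = 1"
  proof -
    have "b (\<lambda>x. v (r n) x - w x) (\<lambda>x. v (r n) x - w x) = 1 - 2 * b (v (r n)) w + b w w" for n
      using b_quadratic[OF vS w, of "r n" "-1"] vb by simp
    moreover have "(\<lambda>n. 1 - 2 * b (v (r n)) w + b w w) \<longlonglongrightarrow> 1 - 2 * b w w + b w w"
      by (intro tendsto_intros blim w)
    ultimately have "1 - 2 * b w w + b w w = 0" using lim LIMSEQ_unique by force
    thus ?thesis by simp
  qed
  moreover have "a w w \<le> I"
  proof (rule field_le_epsilon)
    fix d :: real assume "d > 0"
    then obtain N where N: "1 / real (Suc N) < d" using nat_approx_posE by blast
    have "a (v (r (n + N))) (v (r (n + N))) \<le> I + d" for n
    proof -
      have "Suc N \<le> Suc (r (n + N))" using seq_suble[OF r, of "n+N"] by simp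
      hence "1 / real (Suc (r (n + N))) \<le> 1 / real (Suc N)" by (intro divide_left_mono) auto
      thus ?thesis using va[of "r (n+N)"] N by linarith
    qed
    thus "a w w \<le> I + d"
      by (rule lower_semicontinuous[OF vS w _ LIMSEQ_ignore_initial_segment[OF lim]])
  qed
  moreover have "I \<le> a u u" if "u \<in> S" "b u u = 1" "\<forall>j<m. b u (e j) = 0" for u
    unfolding I_def using bdd that by (intro cINF_lower) (auto simp: X_def)
  ultimately show ?thesis using that[OF w] by (meson order_trans)
qed

text \<open>The upper bound in the min-max principle. Eigenvectors are produced one after the other as constrained minimisers.
  As long as fewer than \<open>k\<close> have been found, the span of \<open>u\<close> contains a unit vector orthogonal to them, so the next
  minimum is at most \<open>t\<close>.\<close>

theorem eigensystem_of_small_energy: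
  assumes u: "\<And>i. i < k \<Longrightarrow> u i \<in> S" and ind: "independent k u"
    and le: "\<And>c. a (lincomb k c u) (lincomb k c u) \<le> t * b (lincomb k c u) (lincomb k c u)"
  shows "\<exists>e \<mu>. eigensystem k e \<mu> \<and> (\<forall>i<k. \<mu> i \<le> t)"
proof -
  have "m \<le> k \<Longrightarrow> \<exists>e \<mu>. eigensystem m e \<mu> \<and> (\<forall>i<m. \<mu> i \<le> t)" for m
  proof (induction m)
    case 0 show ?case by (simp add: eigensystem_def orthonormal_def)
  next
    case (Suc m)
    then obtain e \<mu> where e: "eigensystem m e \<mu>" and mu: "\<forall>i<m. \<mu> i \<le> t" by auto
    have eS: "e j \<in> S" if "j < m" for j using e that by (auto simp: eigensystem_def eigenvector_def)
    obtain c where c: "b (lincomb k c u) (lincomb k c u) = 1" "\<forall>j<m. b (lincomb k c u) (e j) = 0"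
      using orthogonal_unit_lincomb[OF u ind, of m e] eS Suc.prems by auto
    have cS: "lincomb k c u \<in> S" by (rule lincomb_mem[OF u])
    obtain w where w: "w \<in> S" "b w w = 1" "\<forall>j<m. b w (e j) = 0"
      and min: "\<And>v. v \<in> S \<Longrightarrow> b v v = 1 \<Longrightarrow> \<forall>j<m. b v (e j) = 0 \<Longrightarrow> a w w \<le> a v v"
      using constrained_minimizer_exists[OF eS cS c] by blast
    have "eigenvector (a w w) w" by (rule minimizer_is_eigenvector[OF e w min])
    moreover have "a w w \<le> t" using min[OF cS c] le[of c] c(1) by simp
    moreover have "orthonormal (Suc m) (e(m := w))"
      using orthonormal_Suc[OF _ eS w] e by (auto simp: eigensystem_def)
    ultimately have "eigensystem (Suc m) (e(m := w)) (\<mu>(m := a w w)) \<and> (\<forall>i<Suc m. (\<mu>(m := a w w)) i \<le> t)"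
      using e mu by (auto simp: eigensystem_def less_Suc_eq)
    thus ?case by blast
  qed
  thus ?thesis by blast
qed

definition multiplicity_of :: "real \<Rightarrow> enat" where
  "multiplicity_of \<mu> = Sup {enat n | n. \<exists>u. (\<forall>i<n. eigenvector \<mu> (u i)) \<and> independent n u}"

lemma eigensystem_mono: "eigensystem n e \<mu> \<Longrightarrow> m \<le> n \<Longrightarrow> eigensystem m e \<mu>"
  by (auto simp: eigensystem_def orthonormal_def)

lemma eigensystem_mem: "eigensystem n e \<mu> \<Longrightarrow> i < n \<Longrightarrow> e i \<in> S"
  by (auto simp: eigensystem_def eigenvector_def)

lemma enat_le_multiplicity_iff: "enat n \<le> multiplicity_of \<mu> \<longleftrightarrow> (\<exists>e. eigensystem n e (\<lambda>_. \<mu>))"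
proof
  assume le: "enat n \<le> multiplicity_of \<mu>"
  show "\<exists>e. eigensystem n e (\<lambda>_. \<mu>)"
  proof (cases "n = 0")
    case True thus ?thesis by (simp add: eigensystem_def orthonormal_def)
  next
    case False
    hence "\<exists>y\<in>{enat n | n. \<exists>u. (\<forall>i<n. eigenvector \<mu> (u i)) \<and> independent n u}. enat n \<le> y"
      using le unfolding multiplicity_of_def by (intro enat_le_SupD) auto
    then obtain n' u where "n \<le> n'" "\<forall>i<n'. eigenvector \<mu> (u i)" "independent n' u" by auto
    thus ?thesis using orthonormalize_eigenvectors[of n' \<mu> u] eigensystem_mono by blast
  qed
next
  assume "\<exists>e. eigensystem n e (\<lambda>_. \<mu>)"
  then obtain e where e: "eigensystem n e (\<lambda>_. \<mu>)" by blast
  hence "independent n e" using orthonormal_independent[of n e] eigensystem_mem[OF e] by (auto simp: eigensystem_def)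
  thus "enat n \<le> multiplicity_of \<mu>" unfolding multiplicity_of_def
    using e by (intro Sup_upper) (auto simp: eigensystem_def)
qed

text \<open>Eigenvectors for different eigenvalues are orthogonal by symmetry of both forms.\<close>

lemma eigensystem_append:
  assumes "eigensystem p e (\<lambda>_. \<nu>)" "eigensystem q f \<mu>" "\<forall>i<q. \<mu> i \<noteq> \<nu>"
  shows "eigensystem (p + q) (\<lambda>i. if i < p then e i else f (i - p)) (\<lambda>i. if i < p then \<nu> else \<mu> (i - p))"
proof -
  have E: "eigenvector \<nu> (e i)" if "i < p" for i using assms(1) that by (auto simp: eigensystem_def)
  have F: "eigenvector (\<mu> i) (f i)" if "i < q" for i using assms(2) that by (auto simp: eigensystem_def)
  have 1: "b (e i) (f j) = 0" if "i < p" "j < q" for i j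
    using eigenvectors_orthogonal[OF E[OF that(1)] F[OF that(2)]] assms(3) that by auto
  have 2: "b (f j) (e i) = 0" if "i < p" "j < q" for i j
    using 1[OF that] b_commute[of "e i" "f j"] E[OF that(1)] F[OF that(2)] by (simp add: eigenvector_def)
  have "orthonormal (p + q) (\<lambda>i. if i < p then e i else f (i - p))"
    using assms 1 2 by (auto simp: orthonormal_def eigensystem_def)
  thus ?thesis using E F by (auto simp: eigensystem_def)
qed

lemma eigensystem_of_sum_multiplicity:
  assumes "finite F" "enat k \<le> sum multiplicity_of F"
  shows "\<exists>e \<mu>. eigensystem k e \<mu> \<and> (\<forall>i<k. \<mu> i \<in> F)"
  using assms
proof (induction F arbitrary: k)
  case empty
  hence "k = 0" by (simp add: zero_enat_def)
  thus ?case by (simp add: eigensystem_def orthonormal_def)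
next
  case (insert \<nu> F)
  obtain p q where pq: "k = p + q" "enat p \<le> multiplicity_of \<nu>" "enat q \<le> sum multiplicity_of F"
    using enat_le_add_split[of k "multiplicity_of \<nu>" "sum multiplicity_of F"] insert by auto
  obtain e where e: "eigensystem p e (\<lambda>_. \<nu>)" using pq(2) enat_le_multiplicity_iff by blast
  obtain f \<mu> where f: "eigensystem q f \<mu>" "\<forall>i<q. \<mu> i \<in> F" using insert.IH[OF pq(3)] by blast
  have "\<forall>i<q. \<mu> i \<noteq> \<nu>" using f(2) insert.hyps by auto
  from eigensystem_append[OF e f(1) this] show ?case using f(2) pq(1) by (intro exI conjI) auto
qed

lemma card_level_le_multiplicity:
  assumes "eigensystem k e \<mu>"
  shows "enat (card {i\<in>{..<k}. \<mu> i = \<nu>}) \<le> multiplicity_of \<nu>"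
proof -
  let ?A = "{i\<in>{..<k}. \<mu> i = \<nu>}"
  obtain h where h: "bij_betw h {0..<card ?A} ?A"
    using ex_bij_betw_nat_finite[of ?A] by auto
  have hA: "h i \<in> ?A" if "i < card ?A" for i using h that by (auto simp: bij_betw_def)
  have hi: "h i = h j \<longleftrightarrow> i = j" if "i < card ?A" "j < card ?A" for i j
    using h that by (auto simp: bij_betw_def inj_on_def)
  have "eigensystem (card ?A) (e \<circ> h) (\<lambda>_. \<nu>)"
    using assms hA hi by (fastforce simp: eigensystem_def orthonormal_def)
  thus ?thesis using enat_le_multiplicity_iff by blast
qed

text \<open>Counting eigenvalues with multiplicity amounts to finding orthonormal eigenvectors. An infinite sum of extended
  naturals that reaches \<open>k\<close> does so on a finite set of eigenvalues, and orthonormal bases of finitely many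
  eigenspaces fit together. Conversely, the vectors of an eigensystem are sorted by their eigenvalue.\<close>

theorem enat_le_eigenvalue_count_iff:
  "enat k \<le> (\<Sum>\<^sub>\<infinity>\<mu>\<in>{..t}. multiplicity_of \<mu>) \<longleftrightarrow> (\<exists>e \<mu>. eigensystem k e \<mu> \<and> (\<forall>i<k. \<mu> i \<le> t))"
proof
  assume le: "enat k \<le> (\<Sum>\<^sub>\<infinity>\<mu>\<in>{..t}. multiplicity_of \<mu>)"
  show "\<exists>e \<mu>. eigensystem k e \<mu> \<and> (\<forall>i<k. \<mu> i \<le> t)"
  proof (cases "k = 0")
    case True thus ?thesis by (simp add: eigensystem_def orthonormal_def)
  next
    case False
    have "\<exists>y\<in>sum multiplicity_of ` {F. finite F \<and> F \<subseteq> {..t}}. enat k \<le> y"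
      using le False by (intro enat_le_SupD) (auto simp: nonneg_infsum_complete)
    then obtain F where "finite F" "F \<subseteq> {..t}" "enat k \<le> sum multiplicity_of F" by auto
    thus ?thesis using eigensystem_of_sum_multiplicity[of F k] by fastforce
  qed
next
  assume "\<exists>e \<mu>. eigensystem k e \<mu> \<and> (\<forall>i<k. \<mu> i \<le> t)"
  then obtain e \<mu> where e: "eigensystem k e \<mu>" "\<forall>i<k. \<mu> i \<le> t" by blast
  let ?F = "\<mu> ` {..<k}"
  have "k = (\<Sum>\<nu>\<in>?F. card {i\<in>{..<k}. \<mu> i = \<nu>})"
    using sum.image_gen[of "{..<k}" "\<lambda>_. 1::nat" \<mu>] by simp
  hence "enat k = enat (\<Sum>\<nu>\<in>?F. card {i\<in>{..<k}. \<mu> i = \<nu>})" by (rule arg_cong)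
  also have "\<dots> = (\<Sum>\<nu>\<in>?F. enat (card {i\<in>{..<k}. \<mu> i = \<nu>}))"
    unfolding of_nat_eq_enat[symmetric] by (rule of_nat_sum)
  also have "\<dots> \<le> sum multiplicity_of ?F" by (intro sum_mono card_level_le_multiplicity[OF e(1)])
  also have "\<dots> \<le> (\<Sum>\<^sub>\<infinity>\<mu>\<in>{..t}. multiplicity_of \<mu>)"
    using e(2) by (subst nonneg_infsum_complete) (auto intro!: SUP_upper)
  finally show "enat k \<le> (\<Sum>\<^sub>\<infinity>\<mu>\<in>{..t}. multiplicity_of \<mu>)" .
qed

end

section \<open>Smooth functions\<close>

definition smooth :: "('a::euclidean_space \<Rightarrow> real) \<Rightarrow> bool" where
  "smooth f \<longleftrightarrow> (\<forall>n. times_continuously_differentiable n f)"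

lemma frechet_derivative_eqI:
  "(f has_derivative f') (at x) \<Longrightarrow> frechet_derivative f (at x) v = f' v"
  using frechet_derivative_at[of f f' x] by simp

lemma tcd_Suc_D: "times_continuously_differentiable (Suc n) f \<Longrightarrow> times_continuously_differentiable n f"
proof (induction n arbitrary: f)
  case 0
  thus ?case by (auto simp: continuous_on_eq_continuous_at intro!: differentiable_imp_continuous_within)
next
  case (Suc n)
  have "times_continuously_differentiable n (\<lambda>x. frechet_derivative f (at x) v)" for v
    using Suc.prems by (intro Suc.IH) simp
  thus ?case using Suc.prems by simp
qed

lemma tcd_const: "times_continuously_differentiable n (\<lambda>x. c)"
proof (induction n arbitrary: c)
  case (Suc n)
  have "(\<lambda>x. frechet_derivative (\<lambda>x. c) (at x) v) = (\<lambda>x. 0)" for v :: 'a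
    by (intro ext frechet_derivative_eqI[where f'="\<lambda>_. 0"]) simp
  thus ?case using Suc by simp
qed simp

lemma tcd_add:
  "times_continuously_differentiable n f \<Longrightarrow> times_continuously_differentiable n g \<Longrightarrow>
   times_continuously_differentiable n (\<lambda>x. f x + g x)"
proof (induction n arbitrary: f g)
  case 0 thus ?case by (auto intro: continuous_intros)
next
  case (Suc n)
  have d: "f differentiable at x" "g differentiable at x" for x using Suc.prems by auto
  have "(\<lambda>x. frechet_derivative (\<lambda>x. f x + g x) (at x) v) = 
      (\<lambda>x. frechet_derivative f (at x) v + frechet_derivative g (at x) v)" for v
    by (intro ext frechet_derivative_eqI[where f'="\<lambda>v. frechet_derivative f (at _) v + frechet_derivative g (at _) v"]
      has_derivative_add d[THEN frechet_derivative_works[THEN iffD1]])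
  thus ?case using Suc d by auto
qed

lemma tcd_mult:
  "times_continuously_differentiable n f \<Longrightarrow> times_continuously_differentiable n g \<Longrightarrow>
   times_continuously_differentiable n (\<lambda>x. f x * g x)"
proof (induction n arbitrary: f g)
  case 0 thus ?case by (auto intro: continuous_intros)
next
  case (Suc n)
  have d: "f differentiable at x" "g differentiable at x" for x using Suc.prems by auto
  have "(\<lambda>x. frechet_derivative (\<lambda>x. f x * g x) (at x) v) = 
      (\<lambda>x. f x * frechet_derivative g (at x) v + frechet_derivative f (at x) v * g x)" for v
    by (intro ext frechet_derivative_eqI[where f'="\<lambda>v. f _ * frechet_derivative g (at _) v + frechet_derivative f (at _) v * g _"]
      has_derivative_mult d[THEN frechet_derivative_works[THEN iffD1]])
  moreover have "times_continuously_differentiable n f" "times_continuously_differentiable n g"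
    using Suc.prems tcd_Suc_D by blast+
  ultimately show ?case using Suc d by (auto intro!: tcd_add)
qed

lemma smooth_const: "smooth (\<lambda>x. c)" by (simp add: smooth_def tcd_const)
lemma smooth_add: "smooth f \<Longrightarrow> smooth g \<Longrightarrow> smooth (\<lambda>x. f x + g x)" by (simp add: smooth_def tcd_add)
lemma smooth_mult: "smooth f \<Longrightarrow> smooth g \<Longrightarrow> smooth (\<lambda>x. f x * g x)" by (simp add: smooth_def tcd_mult)
lemma smooth_minus: "smooth f \<Longrightarrow> smooth (\<lambda>x. - f x)"
  using smooth_mult[OF smooth_const[of "-1"], of f] by simp
lemma smooth_diff: "smooth f \<Longrightarrow> smooth g \<Longrightarrow> smooth (\<lambda>x. f x - g x)"
  using smooth_add[OF _ smooth_minus, of f g] by simp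
lemma smooth_sum: "(\<And>i. i \<in> I \<Longrightarrow> smooth (f i)) \<Longrightarrow> smooth (\<lambda>x. \<Sum>i\<in>I. f i x)"
  by (induction I rule: infinite_finite_induct) (auto intro: smooth_const smooth_add)
lemma smooth_prod: "(\<And>i. i \<in> I \<Longrightarrow> smooth (f i)) \<Longrightarrow> smooth (\<lambda>x. \<Prod>i\<in>I. f i x)"
  by (induction I rule: infinite_finite_induct) (auto intro: smooth_const smooth_mult)

lemma smooth_has_derivative: "smooth f \<Longrightarrow> (f has_derivative frechet_derivative f (at x)) (at x)"
proof -
  assume "smooth f"
  hence "times_continuously_differentiable (Suc 0) f" unfolding smooth_def by blast
  thus ?thesis by (auto intro: frechet_derivative_works[THEN iffD1])
qed

lemma smooth_derivative: "smooth f \<Longrightarrow> smooth (\<lambda>x. frechet_derivative f (at x) v)"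
  unfolding smooth_def
proof
  fix n assume "\<forall>n. times_continuously_differentiable n f"
  hence "times_continuously_differentiable (Suc n) f" by blast
  thus "times_continuously_differentiable n (\<lambda>x. frechet_derivative f (at x) v)" by simp
qed

lemma smooth_continuous: "smooth f \<Longrightarrow> continuous_on UNIV f"
  by (metis smooth_def times_continuously_differentiable.simps(1))

lemma smooth_inner: "smooth (\<lambda>x. x \<bullet> b)"
  unfolding smooth_def
proof
  fix n show "times_continuously_differentiable n (\<lambda>x. x \<bullet> b)"
  proof (cases n)
    case 0 thus ?thesis by (auto intro: continuous_intros)
  next
    case (Suc m)
    have d: "((\<lambda>x. x \<bullet> b) has_derivative (\<lambda>v. v \<bullet> b)) (at x)" for x :: 'a
      by (auto intro!: derivative_eq_intros)
    hence "(\<lambda>x::'a. frechet_derivative (\<lambda>x. x \<bullet> b) (at x) v) = (\<lambda>x. v \<bullet> b)" for v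
      by (intro ext frechet_derivative_eqI)
    thus ?thesis using Suc d by (auto simp: tcd_const differentiable_def)
  qed
qed

text \<open>The outer function comes with the sequence of all its derivatives: \<open>H (Suc m)\<close> is the derivative of \<open>H m\<close>.
  The induction then runs over all members of the sequence at once, and iterated chain rules are avoided.\<close>

lemma tcd_compose_derivative_sequence:
  assumes H: "\<And>m t. (H m has_real_derivative H (Suc m) t) (at t)" and p: "smooth p"
  shows "times_continuously_differentiable n (\<lambda>x. H m (p x))"
proof (induction n arbitrary: m)
  case 0
  have "continuous_on UNIV (H m)" using H by (intro DERIV_continuous_on) (auto intro: has_field_derivative_at_within)
  thus ?case using smooth_continuous[OF p] continuous_on_compose2[of UNIV "H m" UNIV p] by simp
next
  case (Suc n)
  have d: "((\<lambda>x. H m (p x)) has_derivative (\<lambda>v. H (Suc m) (p x) * frechet_derivative p (at x) v)) (at x)" for x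
    using has_derivative_compose[OF smooth_has_derivative[OF p] H[unfolded has_field_derivative_def]] by simp
  hence "(\<lambda>x. frechet_derivative (\<lambda>x. H m (p x)) (at x) v) = 
      (\<lambda>x. H (Suc m) (p x) * frechet_derivative p (at x) v)" for v
    by (intro ext frechet_derivative_eqI)
  moreover have "times_continuously_differentiable n (\<lambda>x. H (Suc m) (p x) * frechet_derivative p (at x) v)" for v
    using Suc smooth_derivative[OF p] by (intro tcd_mult) (auto simp: smooth_def)
  ultimately show ?case using d by (auto simp: differentiable_def)
qed

lemma smooth_compose_derivative_sequence:
  assumes "\<And>m t. (H m has_real_derivative H (Suc m) t) (at t)" "smooth p"
  shows "smooth (\<lambda>x. H m (p x))"
  using tcd_compose_derivative_sequence[of H p] assms by (simp add: smooth_def)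

lemma smooth_exp: "smooth p \<Longrightarrow> smooth (\<lambda>x. exp (p x))"
  by (rule smooth_compose_derivative_sequence[where H="\<lambda>_. exp"]) auto

text \<open>The derivatives of \<open>exp (-1/t)\<close> have the form \<open>P (1/t) * exp (-1/t)\<close> with a polynomial \<open>P\<close>; differentiating once
  more replaces \<open>P s\<close> by \<open>s\<^sup>2 * (P s - P' s)\<close>.\<close>

primrec bump_poly :: "nat \<Rightarrow> real poly" where
  "bump_poly 0 = 1"
| "bump_poly (Suc m) = [:0, 0, 1:] * (bump_poly m - pderiv (bump_poly m))"

definition bump_deriv :: "nat \<Rightarrow> real \<Rightarrow> real" where
  "bump_deriv m t = (if t > 0 then poly (bump_poly m) (1 / t) / exp (1 / t) else 0)"

abbreviation bump :: "real \<Rightarrow> real" where "bump \<equiv> bump_deriv 0"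

lemma bump_eq: "bump t = (if t > 0 then exp (- 1 / t) else 0)"
  by (simp add: bump_deriv_def exp_minus divide_inverse)

lemma poly_div_exp_tendsto_0: "((\<lambda>s::real. s ^ k * poly p s / exp s) \<longlongrightarrow> 0) at_top"
proof (induction p arbitrary: k)
  case (pCons a p)
  have "((\<lambda>s::real. a * (s ^ k / exp s) + s ^ (Suc k) * poly p s / exp s) \<longlongrightarrow> a * 0 + 0) at_top"
    by (intro tendsto_intros pCons.IH tendsto_power_div_exp_0)
  thus ?case by (simp add: algebra_simps add_divide_distrib)
qed simp

text \<open>The critical point is \<open>t = 0\<close>: with \<open>s = 1/t\<close>, the right difference quotient is a polynomial in \<open>s\<close> divided
  by \<open>exp s\<close>.\<close>

lemma bump_deriv_has_derivative: "(bump_deriv m has_real_derivative bump_deriv (Suc m) t) (at t)"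
proof -
  consider "t > 0" | "t < 0" | "t = 0" by linarith
  thus ?thesis
  proof cases
    case 1
    have "((\<lambda>t. poly (bump_poly m) (1 / t) / exp (1 / t)) has_real_derivative bump_deriv (Suc m) t) (at t)"
      using 1 by (auto intro!: derivative_eq_intros poly_DERIV[THEN DERIV_chain2] 
        simp: bump_deriv_def field_simps power2_eq_square)
    moreover have "\<forall>\<^sub>F s in nhds t. bump_deriv m s = poly (bump_poly m) (1 / s) / exp (1 / s)"
      using eventually_nhds_in_open[of "{0<..}" t] 1 by (auto simp: bump_deriv_def elim!: eventually_mono)
    ultimately show ?thesis by (subst DERIV_cong_ev) auto
  next
    case 2
    have "\<forall>\<^sub>F s in nhds t. bump_deriv m s = 0"
      using eventually_nhds_in_open[of "{..<0}" t] 2 by (auto simp: bump_deriv_def elim!: eventually_mono)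
    thus ?thesis using 2 by (subst DERIV_cong_ev[where g="\<lambda>_. 0"]) (auto simp: bump_deriv_def)
  next
    case 3
    have "((\<lambda>h. bump_deriv m h / h) \<longlongrightarrow> 0) (at 0)"
    proof (rule filterlim_split_at_real)
      have "\<forall>\<^sub>F h in at_left (0::real). bump_deriv m h / h = 0"
        by (auto simp: eventually_at_filter bump_deriv_def)
      thus "((\<lambda>h. bump_deriv m h / h) \<longlongrightarrow> 0) (at_left 0)" by (rule tendsto_eventually)
      have "((\<lambda>h. (\<lambda>s. s ^ 1 * poly (bump_poly m) s / exp s) (inverse h)) \<longlongrightarrow> 0) (at_right 0)"
        by (rule filterlim_compose[OF poly_div_exp_tendsto_0 filterlim_inverse_at_top_right])
      moreover have "\<forall>\<^sub>F h in at_right (0::real). 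
          (\<lambda>s. s ^ 1 * poly (bump_poly m) s / exp s) (inverse h) = bump_deriv m h / h"
        by (auto simp: eventually_at_filter bump_deriv_def divide_inverse)
      ultimately show "((\<lambda>h. bump_deriv m h / h) \<longlongrightarrow> 0) (at_right 0)"
        by (rule Lim_transform_eventually)
    qed
    thus ?thesis using 3 by (simp add: DERIV_def bump_deriv_def)
  qed
qed

lemma smooth_bump: "smooth p \<Longrightarrow> smooth (\<lambda>x. bump (p x))"
  by (rule smooth_compose_derivative_sequence[where H=bump_deriv and m=0]) (rule bump_deriv_has_derivative)

lemma bump_nonneg: "0 \<le> bump t" and bump_le_1: "bump t \<le> 1"
  by (auto simp: bump_eq)

lemma bump_pos: "t > 0 \<Longrightarrow> 0 < bump t"
  by (auto simp: bump_eq)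

lemma bump_scaled_tendsto: "(\<lambda>n. bump (real (Suc n) * t)) \<longlonglongrightarrow> (if t > 0 then 1 else 0)"
proof (cases "t > 0")
  case True
  have "(\<lambda>n. exp (- (1 / t) * (1 / real (Suc n)))) \<longlonglongrightarrow> exp (- (1 / t) * 0)"
    by (intro tendsto_intros LIMSEQ_Suc lim_1_over_n)
  moreover have "bump (real (Suc n) * t) = exp (- (1 / t) * (1 / real (Suc n)))" for n
    using True by (simp add: bump_eq del: of_nat_Suc)
  ultimately show ?thesis using True by simp
next
  case False
  hence "bump (real (Suc n) * t) = 0" for n 
    by (auto simp: bump_eq zero_less_mult_iff)
  thus ?thesis using False by simp
qed

section \<open>Test functions\<close>

lemma test_functions_iff: "\<phi> \<in> test_functions \<longleftrightarrow> smooth \<phi> \<and> compact (closure {x. \<phi> x \<noteq> 0})"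
  by (simp add: test_functions_def smooth_def)

lemma test_functionI:
  assumes "smooth \<phi>" "compact K" "\<And>x. x \<notin> K \<Longrightarrow> \<phi> x = 0"
  shows "\<phi> \<in> test_functions"
proof -
  have "{x. \<phi> x \<noteq> 0} \<subseteq> K" using assms(3) by blast
  hence "closure {x. \<phi> x \<noteq> 0} \<subseteq> K" using assms(2) by (simp add: closure_minimal compact_imp_closed)
  hence "compact (closure {x. \<phi> x \<noteq> 0})" using assms(2) 
    by (metis closed_closure compact_Int_closed inf.absorb_iff2)
  thus ?thesis using assms(1) by (simp add: test_functions_iff)
qed

lemma test_function_smooth: "\<phi> \<in> test_functions \<Longrightarrow> smooth \<phi>" by (simp add: test_functions_iff)

lemma test_function_support:
  assumes "\<phi> \<in> test_functions"
  obtains R where "R > 0" "\<And>x. norm x > R \<Longrightarrow> \<phi> x = 0"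
proof -
  have "compact (closure {x. \<phi> x \<noteq> 0})" using assms unfolding test_functions_iff by blast
  hence "bounded (closure {x. \<phi> x \<noteq> 0})" by (rule compact_imp_bounded)
  then obtain R where R: "R > 0" "\<forall>x\<in>closure {x. \<phi> x \<noteq> 0}. norm x \<le> R" by (auto simp: bounded_pos)
  have "\<phi> x = 0" if "norm x > R" for x
  proof (rule ccontr)
    assume "\<phi> x \<noteq> 0"
    hence "x \<in> closure {x. \<phi> x \<noteq> 0}" using closure_subset[of "{x. \<phi> x \<noteq> 0}"] by blast
    thus False using R(2) that by force
  qed
  thus ?thesis using R(1) that by blast
qed

lemma test_functionI_ball:
  assumes "smooth \<phi>" "\<And>x. norm x > R \<Longrightarrow> \<phi> x = 0"
  shows "\<phi> \<in> test_functions"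
  by (rule test_functionI[where K="cball 0 R"]) (use assms in \<open>auto simp: dist_norm\<close>)

lemma test_function_add: 
  assumes "\<phi> \<in> test_functions" "\<psi> \<in> test_functions" shows "(\<lambda>x. \<phi> x + \<psi> x) \<in> test_functions"
proof -
  obtain R where R: "\<And>x. norm x > R \<Longrightarrow> \<phi> x = 0" using assms test_function_support by metis
  obtain R' where R': "\<And>x. norm x > R' \<Longrightarrow> \<psi> x = 0" using assms test_function_support by metis
  show ?thesis by (rule test_functionI_ball[where R="max R R'"])
    (use assms R R' in \<open>auto intro: smooth_add test_function_smooth\<close>)
qed

lemma test_function_mult: 
  assumes "\<phi> \<in> test_functions" "smooth \<psi>" shows "(\<lambda>x. \<psi> x * \<phi> x) \<in> test_functions"
proof -
  obtain R where R: "\<And>x. norm x > R \<Longrightarrow> \<phi> x = 0" using assms test_function_support by metis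
  show ?thesis by (rule test_functionI_ball[where R="R"])
    (use assms R in \<open>auto intro: smooth_mult test_function_smooth\<close>)
qed

lemma test_function_scale: "\<phi> \<in> test_functions \<Longrightarrow> (\<lambda>x. c * \<phi> x) \<in> test_functions"
  using test_function_mult[OF _ smooth_const] .

lemma test_function_has_derivative:
  "\<phi> \<in> test_functions \<Longrightarrow> (\<phi> has_derivative frechet_derivative \<phi> (at x)) (at x)"
  by (intro smooth_has_derivative test_function_smooth)

lemma test_function_derivative_zero:
  assumes phi: "\<phi> \<in> test_functions" and R: "\<And>x. norm x > R \<Longrightarrow> \<phi> x = 0" and x: "norm x > R"
  shows "frechet_derivative \<phi> (at x) v = 0"
proof -
  have "open {x::'a. norm x > R}" by (intro open_Collect_less continuous_intros)
  hence "\<forall>\<^sub>F y in nhds x. \<phi> y = 0" using eventually_nhds_in_open[of "{x. norm x > R}" x] x R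
    by (auto elim!: eventually_mono)
  hence "\<forall>\<^sub>F y in at x. 0 = \<phi> y" by (auto simp: eventually_nhds_conv_at)
  hence "(\<phi> has_derivative (\<lambda>_. 0)) (at x)"
    using R[OF x] by (intro has_derivative_transform_eventually[OF has_derivative_const[of 0]]) auto
  thus ?thesis by (rule frechet_derivative_eqI)
qed

lemma test_function_derivative:
  assumes "\<phi> \<in> test_functions" shows "(\<lambda>x. frechet_derivative \<phi> (at x) v) \<in> test_functions"
proof -
  obtain R where R: "\<And>x. norm x > R \<Longrightarrow> \<phi> x = 0" using assms test_function_support by metis
  show ?thesis by (rule test_functionI_ball[where R="R"])
    (auto intro: smooth_derivative test_function_smooth[OF assms] test_function_derivative_zero[OF assms R])
qed

lemma frechet_derivative_translate:
  assumes "smooth \<phi>"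
  shows "((\<lambda>x. \<phi> (x + h)) has_derivative frechet_derivative \<phi> (at (x + h))) (at x)"
    "frechet_derivative (\<lambda>x. \<phi> (x + h)) (at x) v = frechet_derivative \<phi> (at (x + h)) v"
proof -
  have "((\<lambda>x. x + h) has_derivative (\<lambda>v. v)) (at x)" by (auto intro!: derivative_eq_intros)
  from has_derivative_compose[OF this smooth_has_derivative[OF assms]]
  show "((\<lambda>x. \<phi> (x + h)) has_derivative frechet_derivative \<phi> (at (x + h))) (at x)" .
  thus "frechet_derivative (\<lambda>x. \<phi> (x + h)) (at x) v = frechet_derivative \<phi> (at (x + h)) v"
    by (rule frechet_derivative_eqI)
qed

lemma smooth_translate:
  assumes "smooth \<phi>" shows "smooth (\<lambda>x. \<phi> (x + h))"
proof -
  have "smooth \<phi> \<Longrightarrow> times_continuously_differentiable n (\<lambda>x. \<phi> (x + h))" for n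
  proof (induction n arbitrary: \<phi>)
    case 0
    have "continuous_on UNIV (\<lambda>x. x + h)" by (intro continuous_intros)
    thus ?case using continuous_on_compose2[OF smooth_continuous[OF 0], of UNIV "\<lambda>x. x + h"] by simp
  next
    case (Suc n)
    thus ?case using frechet_derivative_translate(1)[OF Suc.prems, of h] Suc.IH[OF smooth_derivative[OF Suc.prems]]
      by (auto simp: differentiable_def frechet_derivative_translate(2))
  qed
  thus ?thesis using assms by (simp add: smooth_def)
qed

lemma test_function_translate:
  assumes "\<phi> \<in> test_functions" shows "(\<lambda>x. \<phi> (x + h)) \<in> test_functions"
proof -
  obtain R where R: "\<And>x. norm x > R \<Longrightarrow> \<phi> x = 0" using assms test_function_support by metis
  have "\<phi> (x + h) = 0" if "norm x > R + norm h" for x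
    using R[of "x + h"] norm_triangle_ineq4[of "x + h" h] that by force
  thus ?thesis by (rule test_functionI_ball[OF smooth_translate[OF test_function_smooth[OF assms]]])
qed

lemma test_function_continuous: "\<phi> \<in> test_functions \<Longrightarrow> continuous_on UNIV \<phi>"
  by (intro smooth_continuous test_function_smooth)

lemma test_function_borel: "\<phi> \<in> test_functions \<Longrightarrow> \<phi> \<in> borel_measurable borel"
  by (intro borel_measurable_continuous_onI test_function_continuous)

lemma test_function_measurable: "\<phi> \<in> test_functions \<Longrightarrow> \<phi> \<in> borel_measurable lebesgue"
  by (intro measurable_completion) (auto intro: test_function_borel)

lemma test_function_bounded:
  assumes "\<phi> \<in> test_functions"
  obtains B where "B > 0" "\<And>x. \<bar>\<phi> x\<bar> \<le> B"
proof -
  let ?K = "closure {x. \<phi> x \<noteq> 0}"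
  have "compact ?K" using assms by (simp add: test_functions_iff)
  hence "compact (\<phi> ` ?K)"
    by (intro compact_continuous_image continuous_on_subset[OF test_function_continuous[OF assms]]) auto
  hence "bounded (\<phi> ` ?K)" by (rule compact_imp_bounded)
  then obtain B where B: "B > 0" "\<forall>y\<in>\<phi> ` ?K. norm y \<le> B" by (auto simp: bounded_pos)
  have "\<bar>\<phi> x\<bar> \<le> B" for x
  proof (cases "\<phi> x = 0")
    case False
    hence "x \<in> ?K" using closure_subset[of "{x. \<phi> x \<noteq> 0}"] by blast
    thus ?thesis using B by auto
  qed (use B in auto)
  thus ?thesis using B(1) that by blast
qed

lemma emeasure_lebesgue_cball_finite: "emeasure lebesgue (cball x r :: 'a::euclidean_space set) < \<infinity>"
  using emeasure_bounded_finite[of "cball x r"] by simp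

lemma test_function_L2: assumes "\<phi> \<in> test_functions" shows "\<phi> \<in> L2 lebesgue"
proof (rule L2I[OF test_function_measurable[OF assms]])
  obtain R where R: "\<And>x. norm x > R \<Longrightarrow> \<phi> x = 0" using assms test_function_support by metis
  obtain B where B: "\<And>x. \<bar>\<phi> x\<bar> \<le> B" using assms test_function_bounded by metis
  show "integrable lebesgue (\<lambda>x. (norm (\<phi> x))\<^sup>2)"
  proof (rule integrableI_bounded_set[where A="cball 0 R" and B="B\<^sup>2"])
    show "(\<lambda>x. (norm (\<phi> x))\<^sup>2) \<in> borel_measurable lebesgue"
      using test_function_measurable[OF assms] by measurable
    show "AE x in lebesgue. x \<in> cball 0 R \<longrightarrow> norm ((norm (\<phi> x))\<^sup>2) \<le> B\<^sup>2"
      using power_mono[OF B abs_ge_zero, of _ 2] by simp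
  qed (use R emeasure_lebesgue_cball_finite in \<open>auto simp: dist_norm\<close>)
qed

lemma frechet_derivative_expand:
  assumes "smooth \<phi>"
  shows "frechet_derivative \<phi> (at x) v = (\<Sum>b\<in>Basis. (v \<bullet> b) * frechet_derivative \<phi> (at x) b)"
proof -
  have lin: "linear (frechet_derivative \<phi> (at x))"
    using smooth_has_derivative[OF assms] by (rule has_derivative_linear)
  have "frechet_derivative \<phi> (at x) v = frechet_derivative \<phi> (at x) (\<Sum>b\<in>Basis. (v \<bullet> b) *\<^sub>R b)"
    by (simp add: euclidean_representation)
  also have "\<dots> = (\<Sum>b\<in>Basis. (v \<bullet> b) * frechet_derivative \<phi> (at x) b)"
    by (simp add: linear_sum[OF lin] linear_cmul[OF lin])
  finally show ?thesis .
qed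

text \<open>All partial derivatives are test functions again, hence bounded.\<close>

lemma test_function_lipschitz:
  assumes "\<phi> \<in> test_functions"
  obtains C where "C > 0" "\<And>x h. \<bar>\<phi> (x + h) - \<phi> x\<bar> \<le> C * norm h"
proof -
  have "\<exists>B. B > 0 \<and> (\<forall>x. \<bar>frechet_derivative \<phi> (at x) b\<bar> \<le> B)" for b
    using test_function_bounded[OF test_function_derivative[OF assms, of b]] by metis
  then obtain B where B: "\<And>b. B b > 0" "\<And>b x. \<bar>frechet_derivative \<phi> (at x) b\<bar> \<le> B b" by metis
  define C where "C = (\<Sum>b\<in>(Basis::'a set). B b)"
  have C: "C > 0" unfolding C_def using B by (intro sum_pos) auto
  have on: "onorm (frechet_derivative \<phi> (at x)) \<le> C" for x
  proof (rule onorm_bound)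
    fix v :: 'a
    have "\<bar>frechet_derivative \<phi> (at x) v\<bar> \<le> (\<Sum>b\<in>Basis. \<bar>(v \<bullet> b) * frechet_derivative \<phi> (at x) b\<bar>)"
      unfolding frechet_derivative_expand[OF test_function_smooth[OF assms], of x v] by (rule sum_abs)
    also have "\<dots> \<le> (\<Sum>b\<in>Basis. norm v * B b)"
      using B Basis_le_norm by (intro sum_mono) (auto simp: abs_mult intro!: mult_mono)
    finally show "norm (frechet_derivative \<phi> (at x) v) \<le> C * norm v"
      by (simp add: C_def sum_distrib_left mult.commute)
  qed (use C in auto)
  have "\<bar>\<phi> (x + h) - \<phi> x\<bar> \<le> C * norm h" for x h
    using differentiable_bound[of UNIV \<phi> "\<lambda>x. frechet_derivative \<phi> (at x)" C "x + h" x] on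
      test_function_has_derivative[OF assms] by auto
  thus ?thesis using C that by blast
qed

section \<open>Local integrability\<close>

lemma locally_integrable_measurable:
  assumes "locally_integrable (f :: 'a::euclidean_space \<Rightarrow> 'b::euclidean_space)"
  shows "f \<in> borel_measurable lebesgue"
proof (rule borel_measurable_LIMSEQ_metric)
  fix n :: nat
  show "(\<lambda>x. indicator (cball 0 (real n)) x *\<^sub>R f x) \<in> borel_measurable lebesgue"
    using assms unfolding locally_integrable_def set_integrable_def by (intro borel_measurable_integrable) auto
next
  fix x :: 'a
  obtain N where N: "norm x \<le> real N" using real_arch_simple by blast
  have "\<forall>\<^sub>F n in sequentially. indicator (cball 0 (real n)) x *\<^sub>R f x = f x"
    using eventually_ge_at_top[of N]
  proof eventually_elim
    case (elim n)
    hence "norm x \<le> real n" using N by linarith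
    thus ?case by simp
  qed
  thus "(\<lambda>n. indicator (cball 0 (real n)) x *\<^sub>R f x) \<longlonglongrightarrow> f x" by (rule tendsto_eventually)
qed

lemma locally_integrable_cball:
  "locally_integrable f \<Longrightarrow> integrable lebesgue (\<lambda>x. indicator (cball 0 R) x *\<^sub>R f x)"
  unfolding locally_integrable_def set_integrable_def by auto

lemma locally_integrableI:
  assumes f: "f \<in> borel_measurable lebesgue"
    and "\<And>R. integrable lebesgue (\<lambda>x. indicator (cball 0 R) x *\<^sub>R norm (f x))"
  shows "locally_integrable f"
  unfolding locally_integrable_def set_integrable_def
proof (intro allI impI)
  fix K :: "'a set" assume "compact K"
  then obtain R where "\<forall>x\<in>K. norm x \<le> R" using compact_imp_bounded by (meson bounded_iff)
  hence R: "K \<subseteq> cball 0 R" by auto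
  have [measurable]: "K \<in> sets lebesgue" using \<open>compact K\<close> by (simp add: compact_imp_closed)
  show "integrable lebesgue (\<lambda>x. indicator K x *\<^sub>R f x)"
  proof (rule Bochner_Integration.integrable_bound[OF assms(2)[of R]])
    show "(\<lambda>x. indicator K x *\<^sub>R f x) \<in> borel_measurable lebesgue" using f by measurable
    show "AE x in lebesgue. norm (indicator K x *\<^sub>R f x) \<le> norm (indicator (cball 0 R) x *\<^sub>R norm (f x))"
      by (rule AE_I2) (use R in \<open>auto simp: indicator_def\<close>)
  qed
qed

lemma indicator_ball_L2: "(indicator (cball 0 R) :: 'a::euclidean_space \<Rightarrow> real) \<in> L2 lebesgue"
proof (rule L2I)
  have "integrable lebesgue (indicator (cball 0 R) :: 'a \<Rightarrow> real)"
    using emeasure_lebesgue_cball_finite[of "0::'a" R] by (intro integrable_real_indicator) auto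
  moreover have "(\<lambda>x::'a. (norm (indicator (cball 0 R) x :: real))\<^sup>2) = indicator (cball 0 R)"
    by (auto simp: indicator_def)
  ultimately show "integrable lebesgue (\<lambda>x::'a. (norm (indicator (cball 0 R) x :: real))\<^sup>2)" by simp
qed (intro borel_measurable_indicator, simp)

lemma L2_locally_integrable:
  fixes f :: "'a::euclidean_space \<Rightarrow> 'b::euclidean_space"
  assumes "f \<in> L2 lebesgue" shows "locally_integrable f"
proof (rule locally_integrableI[OF L2_measurable[OF assms]])
  fix R
  from L2_integrable_mult[OF indicator_ball_L2 L2_norm_fun[OF assms]]
  show "integrable lebesgue (\<lambda>x. indicator (cball 0 R) x *\<^sub>R norm (f x))" by simp
qed

text \<open>The form of local integrability that is used throughout: the product with a bounded function of bounded
  support is integrable.\<close>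

lemma locally_integrable_test:
  fixes f :: "'a::euclidean_space \<Rightarrow> 'b::euclidean_space"
  assumes f: "locally_integrable f" and m: "m \<in> borel_measurable lebesgue" and B: "\<And>x. \<bar>m x\<bar> \<le> B"
    and R: "\<And>x. norm x > R \<Longrightarrow> m x = 0"
  shows "integrable lebesgue (\<lambda>x. m x *\<^sub>R f x)"
proof (rule Bochner_Integration.integrable_bound)
  show "integrable lebesgue (\<lambda>x. B *\<^sub>R (indicator (cball 0 R) x *\<^sub>R f x))"
    using locally_integrable_cball[OF f] by (rule integrable_scaleR_right)
  show "(\<lambda>x. m x *\<^sub>R f x) \<in> borel_measurable lebesgue"
    using m locally_integrable_measurable[OF f] by measurable
  have "\<bar>m x\<bar> * norm (f x) \<le> \<bar>B\<bar> * (indicator (cball 0 R) x * norm (f x))" for x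
  proof (cases "norm x \<le> R")
    case True
    thus ?thesis using B[of x] by (auto intro!: mult_right_mono)
  qed (use R[of x] in auto)
  thus "AE x in lebesgue. norm (m x *\<^sub>R f x) \<le> norm (B *\<^sub>R (indicator (cball 0 R) x *\<^sub>R f x))"
    by (auto simp: abs_mult mult.assoc)
qed

lemma locally_integrable_test_mult:
  fixes u :: "'a::euclidean_space \<Rightarrow> real"
  assumes "locally_integrable u" "\<phi> \<in> test_functions"
  shows "integrable lebesgue (\<lambda>x. u x * \<phi> x)"
proof -
  obtain R where R: "\<And>x. norm x > R \<Longrightarrow> \<phi> x = 0" using assms test_function_support by metis
  obtain B where B: "\<And>x. \<bar>\<phi> x\<bar> \<le> B" using assms test_function_bounded by metis
  show ?thesis using locally_integrable_test[OF assms(1) test_function_measurable[OF assms(2)] B R]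
    by (simp add: mult.commute)
qed

lemma locally_integrable_inner:
  assumes "locally_integrable G" shows "locally_integrable (\<lambda>x. G x \<bullet> b)"
proof (rule locally_integrableI)
  show "(\<lambda>x. G x \<bullet> b) \<in> borel_measurable lebesgue"
    using locally_integrable_measurable[OF assms] by measurable
  fix R
  have "integrable lebesgue (\<lambda>x. norm ((indicator (cball 0 R) x *\<^sub>R G x) \<bullet> b))"
    by (intro integrable_norm integrable_inner_left locally_integrable_cball assms)
  thus "integrable lebesgue (\<lambda>x. indicator (cball 0 R) x *\<^sub>R norm (G x \<bullet> b))"
    by (simp add: abs_mult)
qed

section \<open>The fundamental lemma of the calculus of variations\<close>

text \<open>Smooth approximations from below of the indicator of an open box: along each coordinate, two steps that get
  steeper with \<open>n\<close>.\<close>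

definition box_bump :: "nat \<Rightarrow> 'a::euclidean_space \<Rightarrow> 'a \<Rightarrow> 'a \<Rightarrow> real" where
  "box_bump n l u x = (\<Prod>b\<in>Basis. bump (real (Suc n) * (x \<bullet> b - l \<bullet> b)) * bump (real (Suc n) * (u \<bullet> b - x \<bullet> b)))"

lemma box_bump_zero: "x \<notin> cbox l u \<Longrightarrow> box_bump n l u x = 0"
proof -
  assume "x \<notin> cbox l u"
  then obtain b where b: "b \<in> Basis" "x \<bullet> b < l \<bullet> b \<or> u \<bullet> b < x \<bullet> b" by (auto simp: mem_box not_le)
  hence "bump (real (Suc n) * (x \<bullet> b - l \<bullet> b)) * bump (real (Suc n) * (u \<bullet> b - x \<bullet> b)) = 0"
    by (auto simp: bump_eq zero_less_mult_iff simp del: of_nat_Suc)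
  thus ?thesis unfolding box_bump_def using b(1) by (intro prod_zero) auto
qed

lemma box_bump_test: "box_bump n l u \<in> test_functions"
proof (rule test_functionI[OF _ compact_cbox box_bump_zero])
  show "smooth (box_bump n l u)"
    unfolding box_bump_def[abs_def]
    by (intro smooth_prod smooth_mult smooth_bump smooth_const smooth_diff smooth_inner)
qed

lemma box_bump_bounds: "0 \<le> box_bump n l u x" "box_bump n l u x \<le> 1"
  unfolding box_bump_def using bump_nonneg bump_le_1 
  by (auto intro!: prod_nonneg prod_le_1 mult_le_one mult_nonneg_nonneg)

lemma box_bump_tendsto: "(\<lambda>n. box_bump n l u x) \<longlonglongrightarrow> indicator (box l u) x"
proof -
  have "(\<lambda>n. box_bump n l u x) \<longlonglongrightarrow> (\<Prod>b\<in>Basis. (if x \<bullet> b - l \<bullet> b > 0 then 1 else 0) * (if u \<bullet> b - x \<bullet> b > 0 then 1 else 0))"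
    unfolding box_bump_def by (intro tendsto_prod tendsto_mult bump_scaled_tendsto)
  moreover have "(\<Prod>b\<in>Basis. (if x \<bullet> b - l \<bullet> b > 0 then 1 else 0) * (if u \<bullet> b - x \<bullet> b > 0 then 1 else 0)) = (indicator (box l u) x :: real)"
  proof (cases "x \<in> box l u")
    case True thus ?thesis by (auto simp: mem_box intro!: prod.neutral)
  next
    case False
    then obtain b where "b \<in> Basis" "\<not> (l \<bullet> b < x \<bullet> b) \<or> \<not> (x \<bullet> b < u \<bullet> b)" by (auto simp: mem_box)
    thus ?thesis using False by (auto intro!: prod_zero bexI[of _ b])
  qed
  ultimately show ?thesis by simp
qed

text \<open>The measures with densities \<open>max 0 f\<close> and \<open>max 0 (- f)\<close> agree on all boxes, which generate the Borel sets and
  are stable under intersection. Hence they are equal and so are their densities.\<close>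

lemma AE_zero_of_box_integrals_lborel:
  fixes f :: "'a::euclidean_space \<Rightarrow> real"
  assumes f: "integrable lborel f" and box: "\<And>l u. (LINT x|lborel. indicator (box l u) x * f x) = 0"
  shows "AE x in lborel. f x = 0"
proof -
  have [measurable]: "f \<in> borel_measurable borel" using f by auto
  let ?E = "range (\<lambda>(a, b). box a b::'a set)"
  let ?A = "\<lambda>n::nat. box (- (real n *\<^sub>R One)) (real n *\<^sub>R One) :: 'a set"
  have fin: "integral\<^sup>N lborel (\<lambda>x. ennreal (f x)) \<noteq> \<infinity>" using f by (simp add: real_integrable_def)
  have "density lborel (\<lambda>x. ennreal (f x)) = density lborel (\<lambda>x. ennreal (- f x))"
  proof (rule measure_eqI_generator_eq)
    show "Int_stable ?E" by (auto simp: Int_stable_def box_Int_box)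
    show "?E \<subseteq> Pow UNIV" "sets (density lborel (\<lambda>x. ennreal (f x))) = sigma_sets UNIV ?E" 
      "sets (density lborel (\<lambda>x. ennreal (- f x))) = sigma_sets UNIV ?E"
      by (simp_all add: borel_eq_box)
    show "range ?A \<subseteq> ?E" "(\<Union>i. ?A i) = UNIV" unfolding UN_box_eq_UNIV by auto
    show "emeasure (density lborel (\<lambda>x. ennreal (f x))) (?A i) \<noteq> \<infinity>" for i
    proof -
      have "emeasure (density lborel (\<lambda>x. ennreal (f x))) (?A i) \<le> integral\<^sup>N lborel (\<lambda>x. ennreal (f x))"
        by (subst emeasure_density) (auto intro!: nn_integral_mono simp: indicator_def)
      thus ?thesis using fin by (metis infinity_ennreal_def neq_top_trans)
    qed
    fix X assume "X \<in> ?E"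
    then obtain l u where X: "X = box l u" by auto
    let ?h = "\<lambda>x. indicator X x * f x"
    have hm: "integrable lborel ?h"
      using integrable_mult_indicator[OF _ f, of X] X by simp
    have "enn2real (\<integral>\<^sup>+x. ennreal (?h x) \<partial>lborel) = enn2real (\<integral>\<^sup>+x. ennreal (- ?h x) \<partial>lborel)"
      using real_lebesgue_integral_def[OF hm] box X by simp
    moreover have "(\<integral>\<^sup>+x. ennreal (?h x) \<partial>lborel) < top" "(\<integral>\<^sup>+x. ennreal (- ?h x) \<partial>lborel) < top"
      using hm unfolding real_integrable_def by (auto simp: less_top)
    ultimately have "(\<integral>\<^sup>+x. ennreal (?h x) \<partial>lborel) = (\<integral>\<^sup>+x. ennreal (- ?h x) \<partial>lborel)"
      using ennreal_enn2real by metis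
    moreover have "emeasure (density lborel (\<lambda>x. ennreal (f x))) X = (\<integral>\<^sup>+x. ennreal (?h x) \<partial>lborel)"
      using X by (subst emeasure_density) (auto intro!: nn_integral_cong simp: indicator_def)
    moreover have "emeasure (density lborel (\<lambda>x. ennreal (- f x))) X = (\<integral>\<^sup>+x. ennreal (- ?h x) \<partial>lborel)"
      using X by (subst emeasure_density) (auto intro!: nn_integral_cong simp: indicator_def)
    ultimately show "emeasure (density lborel (\<lambda>x. ennreal (f x))) X = emeasure (density lborel (\<lambda>x. ennreal (- f x))) X"
      by simp
  qed
  hence "AE x in lborel. ennreal (f x) = ennreal (- f x)"
    using fin by (subst (asm) finite_density_unique) auto
  thus ?thesis
  proof eventually_elim
    case (elim x)
    hence "ennreal (f x) = 0 \<and> ennreal (- f x) = 0"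
      by (cases "f x \<ge> 0") (auto simp: ennreal_neg)
    thus ?case by (simp add: ennreal_eq_0_iff)
  qed
qed

lemma borel_representative:
  fixes f :: "'a::euclidean_space \<Rightarrow> 'b::euclidean_space"
  assumes f: "f \<in> borel_measurable lebesgue"
  obtains g where "g \<in> borel_measurable borel" "AE x in lebesgue. f x = g x"
proof -
  have "\<exists>g\<in>borel_measurable lborel. AE x in lborel. f x \<bullet> b = g x" for b
    using borel_measurable_inner[OF f borel_measurable_const[of b]] by (intro completion_ex_borel_measurable_real)
  then obtain g where g: "\<And>b. g b \<in> borel_measurable lborel" "\<And>b. AE x in lborel. f x \<bullet> b = g b x" by metis
  have "(\<lambda>x. \<Sum>b\<in>Basis. g b x *\<^sub>R b) \<in> borel_measurable borel" using g(1) by simp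
  moreover have "AE x in lborel. \<forall>b\<in>Basis. f x \<bullet> b = g b x" using g(2) by (intro AE_finite_allI) auto
  hence "AE x in lborel. f x = (\<Sum>b\<in>Basis. g b x *\<^sub>R b)"
  proof eventually_elim
    case (elim x)
    hence "(\<Sum>b\<in>Basis. g b x *\<^sub>R b) = (\<Sum>b\<in>Basis. (f x \<bullet> b) *\<^sub>R b)" by (intro sum.cong) auto
    thus ?case by (simp add: euclidean_representation)
  qed
  ultimately show ?thesis using that AE_completion by blast
qed

text \<open>The integrals of \<open>g\<close> over boxes are limits of integrals against test functions. The statement on boxes is for
  integrable Borel functions, so \<open>g\<close> is cut off by a box and replaced by a Borel representative.\<close>

theorem fundamental_lemma:
  fixes g :: "'a::euclidean_space \<Rightarrow> real"
  assumes g: "locally_integrable g" and zero: "\<And>\<phi>. \<phi> \<in> test_functions \<Longrightarrow> (LINT x|lebesgue. g x * \<phi> x) = 0"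
  shows "AE x in lebesgue. g x = 0"
proof -
  have gm[measurable]: "g \<in> borel_measurable lebesgue" using g by (rule locally_integrable_measurable)
  have box: "(LINT x|lebesgue. indicator (box l u) x * g x) = 0" for l u
  proof -
    have "(\<lambda>n. LINT x|lebesgue. box_bump n l u x * g x) \<longlonglongrightarrow> (LINT x|lebesgue. indicator (box l u) x * g x)"
    proof (rule integral_dominated_convergence)
      have "set_integrable lebesgue (cbox l u) g" using g by (simp add: locally_integrable_def)
      thus "integrable lebesgue (\<lambda>x. norm (indicator (cbox l u) x *\<^sub>R g x))"
        unfolding set_integrable_def by (rule integrable_norm)
      show "(\<lambda>x. box_bump n l u x * g x) \<in> borel_measurable lebesgue" for n
        using test_function_measurable[OF box_bump_test[of n l u]] by measurable
      have "box l u \<in> sets lebesgue" by simp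
      thus "(\<lambda>x. indicator (box l u) x * g x) \<in> borel_measurable lebesgue" by measurable
      show "AE x in lebesgue. norm (box_bump n l u x * g x) \<le> norm (indicator (cbox l u) x *\<^sub>R g x)" for n
      proof (rule AE_I2)
        fix x
        show "norm (box_bump n l u x * g x) \<le> norm (indicator (cbox l u) x *\<^sub>R g x)"
          using box_bump_bounds[of n l u x] box_bump_zero[of x l u n]
          by (cases "x \<in> cbox l u") (auto simp: abs_mult mult_left_le_one_le)
      qed
      show "AE x in lebesgue. (\<lambda>n. box_bump n l u x * g x) \<longlonglongrightarrow> indicator (box l u) x * g x"
        by (intro AE_I2 tendsto_mult box_bump_tendsto tendsto_const)
    qed
    moreover have "(LINT x|lebesgue. box_bump n l u x * g x) = 0" for n
      using zero[OF box_bump_test[of n l u]] by (simp add: mult.commute)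
    ultimately show ?thesis by (simp add: LIMSEQ_const_iff)
  qed
  have local: "AE x in lebesgue. x \<in> box l u \<longrightarrow> g x = 0" for l u
  proof -
    let ?f = "\<lambda>x. indicator (box l u) x * g x"
    have bs: "box l u \<in> sets lebesgue" by simp
    have "set_integrable lebesgue (cbox l u) g" using g by (simp add: locally_integrable_def)
    hence "set_integrable lebesgue (box l u) g"
      by (rule set_integrable_subset[OF _ bs box_subset_cbox])
    hence f: "integrable lebesgue ?f" by (simp add: set_integrable_def)
    then obtain h where h[measurable]: "h \<in> borel_measurable borel" and fh: "AE x in lebesgue. ?f x = h x"
      using borel_representative by (metis borel_measurable_integrable)
    have hm: "h \<in> borel_measurable lebesgue" by (intro measurable_completion) simp
    have "integrable lebesgue h" using f fh hm by (subst integrable_cong_AE[of h _ ?f]) auto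
    hence "integrable lborel h" by (subst (asm) integrable_completion) auto
    moreover have "(LINT x|lborel. indicator (box l' u') x * h x) = 0" for l' u'
    proof -
      have "(LINT x|lborel. indicator (box l' u') x * h x) = (LINT x|lebesgue. indicator (box l' u') x * h x)"
        by (rule integral_completion[symmetric]) simp
      also have "\<dots> = (LINT x|lebesgue. indicator (box l' u') x * ?f x)"
        using fh by (intro integral_cong_AE) (auto intro!: borel_measurable_times borel_measurable_indicator hm gm)
      also have "\<dots> = 0"
        using box unfolding mult.assoc[symmetric] indicator_inter_arith[symmetric] box_Int_box .
      finally show ?thesis .
    qed
    ultimately have "AE x in lborel. h x = 0" by (rule AE_zero_of_box_integrals_lborel)
    hence "AE x in lebesgue. h x = 0" by (rule AE_completion)
    with fh show ?thesis by eventually_elim (auto simp: indicator_def)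
  qed
  have "AE x in lebesgue. \<forall>n::nat. x \<in> box (- (real n *\<^sub>R One)) (real n *\<^sub>R One) \<longrightarrow> g x = 0"
    unfolding AE_all_countable using local by blast
  thus ?thesis
  proof eventually_elim
    case (elim x)
    have "x \<in> (\<Union>n::nat. box (- (real n *\<^sub>R One)) (real n *\<^sub>R One))" unfolding UN_box_eq_UNIV by simp
    thus ?case using elim by auto
  qed
qed

section \<open>Density of test functions\<close>

text \<open>Projection to the closure of the test functions. The differences of \<open>f\<close> and a minimising sequence converge to a
  function \<open>g\<close> that is orthogonal to all test functions, so \<open>g\<close> vanishes almost everywhere by the fundamental lemma.\<close>

theorem test_functions_dense_L2:
  fixes f :: "'a::euclidean_space \<Rightarrow> real"
  assumes f: "f \<in> L2 lebesgue"
  obtains \<phi> where "\<And>n. \<phi> n \<in> test_functions" "(\<lambda>n::nat. l2_norm lebesgue (\<lambda>x. f x - \<phi> n x)) \<longlonglongrightarrow> 0"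
proof -
  define N where "N \<phi> = (l2_norm lebesgue (\<lambda>x. f x - \<phi> x))\<^sup>2" for \<phi>
  define I where "I = (INF \<phi>\<in>test_functions. N \<phi>)"
  have ne: "(\<lambda>x::'a. 0::real) \<in> test_functions" by (rule test_functionI_ball[where R=0]) (auto intro: smooth_const)
  have bdd: "bdd_below (N ` test_functions)" by (rule bdd_belowI[of _ 0]) (auto simp: N_def)
  have low: "I \<le> N \<phi>" if "\<phi> \<in> test_functions" for \<phi>
    unfolding I_def using bdd that by (rule cINF_lower)
  have "\<exists>\<phi>\<in>test_functions. N \<phi> < I + 1 / real (Suc n)" for n
    using cINF_less_iff[of test_functions N "I + 1 / real (Suc n)"] bdd ne by (auto simp: I_def)
  then obtain \<phi> where t: "\<And>n. \<phi> n \<in> test_functions" and N: "\<And>n. N (\<phi> n) < I + 1 / real (Suc n)" by metis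
  let ?g = "\<lambda>n x. f x - \<phi> n x"
  have gL: "?g n \<in> L2 lebesgue" for n by (rule L2_diff[OF f test_function_L2[OF t]])
  have sl: "(\<lambda>n. 1 / real (Suc n)) \<longlonglongrightarrow> 0" by (intro LIMSEQ_Suc lim_1_over_n)
  have "l2_Cauchy lebesgue ?g"
  proof (rule l2_minimizing_Cauchy[OF gL, where d="\<lambda>_. I" and D=I and e="\<lambda>n. 1 / real (Suc n)"])
    show "(l2_norm lebesgue (?g n))\<^sup>2 \<le> I + 1 / real (Suc n)" for n
      using N[of n] by (simp add: N_def)
    fix m n :: nat
    have "(\<lambda>x. (1/2) * (\<phi> n x + \<phi> m x)) \<in> test_functions" by (intro test_function_scale test_function_add t)
    from low[OF this] show "I \<le> (l2_norm lebesgue (\<lambda>x. (1/2) *\<^sub>R (?g n x + ?g m x)))\<^sup>2"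
      by (simp add: N_def algebra_simps)
  qed (auto intro: sl[simplified])
  then obtain g where g: "g \<in> L2 lebesgue" and lim: "(\<lambda>n. l2_norm lebesgue (\<lambda>x. ?g n x - g x)) \<longlonglongrightarrow> 0"
    using l2_complete[of ?g lebesgue, OF gL] by blast
  have lower: "I \<le> (l2_norm lebesgue (\<lambda>x. g x - \<psi> x))\<^sup>2" if psi: "\<psi> \<in> test_functions" for \<psi>
  proof (rule LIMSEQ_le_const)
    show "(\<lambda>n. (l2_norm lebesgue (\<lambda>x. ?g n x - \<psi> x))\<^sup>2) \<longlonglongrightarrow> (l2_norm lebesgue (\<lambda>x. g x - \<psi> x))\<^sup>2"
      using lim by (intro tendsto_power l2_norm_tendsto[OF L2_diff[OF gL test_function_L2[OF psi]] 
            L2_diff[OF g test_function_L2[OF psi]]]) (simp add: algebra_simps)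
    have "I \<le> (l2_norm lebesgue (\<lambda>x. ?g n x - \<psi> x))\<^sup>2" for n
      using low[OF test_function_add[OF t psi], of n] by (simp add: N_def algebra_simps)
    thus "\<exists>N. \<forall>n\<ge>N. I \<le> (l2_norm lebesgue (\<lambda>x. ?g n x - \<psi> x))\<^sup>2" by blast
  qed
  have upper: "(l2_norm lebesgue g)\<^sup>2 \<le> I"
  proof (rule LIMSEQ_le)
    show "(\<lambda>n. (l2_norm lebesgue (?g n))\<^sup>2) \<longlonglongrightarrow> (l2_norm lebesgue g)\<^sup>2"
      by (intro tendsto_power l2_norm_tendsto gL g lim)
    show "(\<lambda>n. I + 1 / real (Suc n)) \<longlonglongrightarrow> I" using tendsto_add[OF tendsto_const sl, of I] by simp
    show "\<exists>N. \<forall>n\<ge>N. (l2_norm lebesgue (?g n))\<^sup>2 \<le> I + 1 / real (Suc n)"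
      using N by (auto simp: N_def intro: less_imp_le)
  qed
  have orth: "(LINT x|lebesgue. g x * \<psi> x) = 0" if psi: "\<psi> \<in> test_functions" for \<psi>
  proof -
    have "(l2_inner lebesgue g \<psi>)\<^sup>2 \<le> 0 * (l2_norm lebesgue \<psi>)\<^sup>2"
    proof (rule quadratic_nonneg_discriminant)
      fix s :: real
      have "I \<le> (l2_norm lebesgue (\<lambda>x. g x - s *\<^sub>R \<psi> x))\<^sup>2"
        using lower[OF test_function_scale[OF psi], of s] by simp
      also have "\<dots> = (l2_norm lebesgue g)\<^sup>2 - 2 * s * l2_inner lebesgue g \<psi> + s\<^sup>2 * (l2_norm lebesgue \<psi>)\<^sup>2"
        by (subst l2_norm_diff_sq[OF g L2_scaleR[OF test_function_L2[OF psi]]])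
          (simp only: l2_inner_scaleR_right l2_norm_scaleR power_mult_distrib power2_abs mult.assoc)
      finally show "0 \<le> 0 - 2 * s * l2_inner lebesgue g \<psi> + s\<^sup>2 * (l2_norm lebesgue \<psi>)\<^sup>2"
        using upper by simp
    qed auto
    thus ?thesis by (simp add: l2_inner_def)
  qed
  have "AE x in lebesgue. g x = 0"
    using orth by (intro fundamental_lemma L2_locally_integrable g)
  hence "l2_norm lebesgue g = l2_norm lebesgue (\<lambda>x::'a. 0 :: real)"
    using L2_measurable[OF g] by (intro l2_norm_cong_AE) auto
  hence "(\<lambda>n. l2_norm lebesgue (?g n)) \<longlonglongrightarrow> 0"
    using l2_norm_tendsto[OF gL g lim] by simp
  thus ?thesis using t that by blast
qed

text \<open>Choose \<open>\<phi>\<close> close to \<open>f\<close> to get \<open>norm f ^ 2 \<le> K * norm f\<close>. This gives the bound once \<open>K \<ge> 0\<close>.\<close>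

lemma l2_norm_le_of_duality:
  fixes f :: "'a::euclidean_space \<Rightarrow> real"
  assumes f: "f \<in> L2 lebesgue" and K: "\<And>\<phi>. \<phi> \<in> test_functions \<Longrightarrow> l2_inner lebesgue f \<phi> \<le> K * l2_norm lebesgue \<phi>"
  shows "l2_norm lebesgue f \<le> K"
proof -
  obtain \<phi> where t: "\<And>n. \<phi> n \<in> test_functions" and lim: "(\<lambda>n. l2_norm lebesgue (\<lambda>x. f x - \<phi> n x)) \<longlonglongrightarrow> 0"
    using test_functions_dense_L2[OF f] by blast
  have pL: "\<phi> n \<in> L2 lebesgue" for n by (intro test_function_L2 t)
  have lim': "(\<lambda>n. l2_norm lebesgue (\<lambda>x. \<phi> n x - f x)) \<longlonglongrightarrow> 0"
    using lim l2_norm_minus_commute[of lebesgue f "\<phi> _"] by simp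
  have "(l2_norm lebesgue f)\<^sup>2 \<le> K * l2_norm lebesgue f"
  proof (rule LIMSEQ_le)
    show "(\<lambda>n. l2_inner lebesgue f (\<phi> n)) \<longlonglongrightarrow> (l2_norm lebesgue f)\<^sup>2"
      unfolding l2_norm_sq_inner l2_inner_commute[of lebesgue f "\<phi> _"] 
      by (rule l2_inner_tendsto_left[OF pL f lim' f])
    show "(\<lambda>n. K * l2_norm lebesgue (\<phi> n)) \<longlonglongrightarrow> K * l2_norm lebesgue f"
      by (intro tendsto_mult tendsto_const l2_norm_tendsto[OF pL f lim'])
  qed (use K t in auto)
  moreover have "0 \<le> K"
  proof (rule ccontr)
    \<comment> \<open>A negative \<open>K\<close> forces \<open>f = 0\<close>; then the hypothesis makes the norm of every test function vanish, which is
      contradicted by the bump on the unit box.\<close>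
    assume K0: "\<not> 0 \<le> K"
    have "K * l2_norm lebesgue f \<ge> (l2_norm lebesgue f)\<^sup>2" by (rule calculation)
    hence "l2_norm lebesgue f = 0" using K0 
      by (smt (verit) l2_norm_nonneg mult_nonneg_nonpos2 power2_eq_square zero_less_mult_iff mult_neg_pos)
    hence "l2_inner lebesgue f \<phi> = 0" if "\<phi> \<in> test_functions" for \<phi>
      using l2_Cauchy_Schwarz[OF f test_function_L2[OF that]] by simp
    moreover define \<phi>1 where "\<phi>1 = box_bump 0 (0::'a) One"
    ultimately have "0 \<le> K * l2_norm lebesgue \<phi>1" using K[OF box_bump_test, of 0 0 One] box_bump_test by (metis)
    hence n0: "l2_norm lebesgue \<phi>1 = 0" using K0 
      by (smt (verit) l2_norm_nonneg mult_neg_pos)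
    have "(l2_norm lebesgue \<phi>1)\<^sup>2 = 0" using n0 by simp
    hence "AE x in lebesgue. (\<phi>1 x)\<^sup>2 = 0"
      unfolding l2_norm_sq_real
      using integral_nonneg_eq_0_iff_AE[of lebesgue "\<lambda>x. (\<phi>1 x)\<^sup>2"] L2_integrable[OF test_function_L2[OF box_bump_test[of 0 "0::'a" One]]]
      by (simp add: \<phi>1_def)
    hence "AE x in lebesgue. x \<notin> box 0 (One::'a)"
    proof eventually_elim
      case (elim x)
      have "\<phi>1 x > 0" if "x \<in> box 0 One"
        unfolding \<phi>1_def box_bump_def using that 
        by (intro prod_pos) (auto simp: mem_box intro!: mult_pos_pos bump_pos)
      thus ?case using elim by force
    qed
    hence "emeasure lebesgue (box 0 (One::'a)) = 0"
      by (subst (asm) AE_iff_measurable[OF _ refl]) auto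
    thus False by (simp add: emeasure_lborel_box_eq)
  qed
  ultimately show ?thesis
    by (smt (verit) l2_norm_nonneg mult_right_le_imp_le power2_eq_square)
qed

section \<open>Translations\<close>

lemma L2_scaleR_const:
  fixes f :: "'a \<Rightarrow> real"
  assumes "f \<in> L2 M" shows "(\<lambda>x. f x *\<^sub>R b) \<in> L2 M"
proof (rule L2I)
  show "(\<lambda>x. f x *\<^sub>R b) \<in> borel_measurable M" using L2_measurable[OF assms] by measurable
  have "integrable M (\<lambda>x. (norm b)\<^sup>2 * (norm (f x))\<^sup>2)" using assms by (intro integrable_mult_right L2_integrable)
  thus "integrable M (\<lambda>x. (norm (f x *\<^sub>R b))\<^sup>2)" by (simp add: power_mult_distrib mult.commute)
qed

lemma distr_lebesgue_translate: "distr lebesgue lebesgue (\<lambda>x. h + x) = (lebesgue :: 'a::euclidean_space measure)"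
  and measurable_lebesgue_translate: "(\<lambda>x. h + x) \<in> lebesgue \<rightarrow>\<^sub>M (lebesgue :: 'a::euclidean_space measure)"
proof -
  have eq: "(\<lambda>x. h + (\<Sum>j\<in>Basis. (1 * (x \<bullet> j)) *\<^sub>R j)) = (\<lambda>x::'a. h + x)"
    by (simp add: euclidean_representation)
  show "distr lebesgue lebesgue (\<lambda>x. h + x) = (lebesgue :: 'a measure)"
    using lebesgue_affine_euclidean[of "\<lambda>_::'a. 1" h] unfolding eq by (simp add: density_1)
  show "(\<lambda>x. h + x) \<in> lebesgue \<rightarrow>\<^sub>M (lebesgue :: 'a measure)"
    using lebesgue_affine_measurable[of "\<lambda>_::'a. 1" h] unfolding eq by simp
qed

lemma measurable_translate:
  assumes "f \<in> borel_measurable (lebesgue :: 'a::euclidean_space measure)"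
  shows "(\<lambda>x. f (x + h)) \<in> borel_measurable lebesgue"
  using measurable_compose[OF measurable_lebesgue_translate assms, of h] by (simp add: add.commute)

lemma integral_translate:
  fixes f :: "'a::euclidean_space \<Rightarrow> 'b::{banach, second_countable_topology}"
  assumes f: "f \<in> borel_measurable lebesgue"
  shows "(LINT x|lebesgue. f (x + h)) = (LINT x|lebesgue. f x)"
proof -
  have "(LINT x|lebesgue. f x) = (LINT x|distr lebesgue lebesgue (\<lambda>x. h + x). f x)"
    by (simp add: distr_lebesgue_translate)
  also have "\<dots> = (LINT x|lebesgue. f (h + x))"
    by (rule integral_distr[OF measurable_lebesgue_translate f])
  finally show ?thesis by (simp add: add.commute)
qed

lemma integrable_translate:
  fixes f :: "'a::euclidean_space \<Rightarrow> 'b::{banach, second_countable_topology}"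
  assumes f: "integrable lebesgue f"
  shows "integrable lebesgue (\<lambda>x. f (x + h))"
proof -
  have "integrable (distr lebesgue lebesgue (\<lambda>x. h + x)) f" using f by (simp add: distr_lebesgue_translate)
  hence "integrable lebesgue (\<lambda>x. f (h + x))"
    by (subst (asm) integrable_distr_eq[OF measurable_lebesgue_translate]) (use f in auto)
  thus ?thesis by (simp add: add.commute)
qed

lemma L2_translate: "f \<in> L2 lebesgue \<Longrightarrow> (\<lambda>x. f (x + h)) \<in> L2 lebesgue"
  using measurable_translate[of f h] integrable_translate[of "\<lambda>x. (norm (f x))\<^sup>2" h] by (auto simp: L2_def)

lemma l2_norm_translate: "f \<in> borel_measurable lebesgue \<Longrightarrow> l2_norm lebesgue (\<lambda>x. f (x + h)) = l2_norm lebesgue f"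
  unfolding l2_norm_def using integral_translate[of "\<lambda>x. (norm (f x))\<^sup>2" h] by simp

text \<open>A Lipschitz function with support in the ball of radius \<open>R\<close>; for \<open>norm h \<le> 1\<close> the difference lives in the
  ball of radius \<open>R + 1\<close>.\<close>

lemma translation_continuous_test:
  assumes "\<phi> \<in> test_functions"
  obtains C where "\<And>h::'a::euclidean_space. norm h \<le> 1 \<Longrightarrow> l2_norm lebesgue (\<lambda>x. \<phi> (x + h) - \<phi> x) \<le> C * norm h"
proof -
  obtain R where R: "R > 0" "\<And>x. norm x > R \<Longrightarrow> \<phi> x = 0" using assms test_function_support by metis
  obtain C where C: "C > 0" "\<And>x h. \<bar>\<phi> (x + h) - \<phi> x\<bar> \<le> C * norm h" using assms test_function_lipschitz by metis
  let ?I = "indicator (cball 0 (R + 1)) :: 'a \<Rightarrow> real"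
  have "l2_norm lebesgue (\<lambda>x. \<phi> (x + h) - \<phi> x) \<le> (C * l2_norm lebesgue ?I) * norm h" if h: "norm h \<le> 1" for h
  proof -
    have "l2_norm lebesgue (\<lambda>x. \<phi> (x + h) - \<phi> x) \<le> l2_norm lebesgue (\<lambda>x. (C * norm h) * ?I x)"
    proof (rule l2_norm_mono_AE[OF L2_cmult[OF indicator_ball_L2]], rule AE_I2)
      fix x
      show "norm (\<phi> (x + h) - \<phi> x) \<le> norm ((C * norm h) * ?I x)"
      proof (cases "x \<in> cball 0 (R + 1)")
        case True thus ?thesis using C by (auto simp: abs_mult)
      next
        case False
        hence "norm x > R + 1" by simp
        moreover have "norm (x + h) \<ge> norm x - norm h" by (metis norm_diff_ineq)
        ultimately show ?thesis using R(2)[of x] R(2)[of "x + h"] h by simp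
      qed
    qed
    thus ?thesis using C(1) by (simp add: l2_norm_cmult algebra_simps abs_mult)
  qed
  thus ?thesis using that by blast
qed

text \<open>Approximate by a test function; translations preserve the norm of the error.\<close>

lemma translation_continuous_real:
  fixes f :: "'a::euclidean_space \<Rightarrow> real"
  assumes f: "f \<in> L2 lebesgue" and e: "e > 0"
  shows "\<exists>d>0. \<forall>h. norm h \<le> d \<longrightarrow> l2_norm lebesgue (\<lambda>x. f (x + h) - f x) \<le> e"
proof -
  obtain \<phi> where t: "\<And>n. \<phi> n \<in> test_functions" and lim: "(\<lambda>n. l2_norm lebesgue (\<lambda>x. f x - \<phi> n x)) \<longlonglongrightarrow> 0"
    using test_functions_dense_L2[OF f] by blast
  have "e / 3 > 0" using e by simp
  from LIMSEQ_D[OF lim this] obtain n where n: "l2_norm lebesgue (\<lambda>x. f x - \<phi> n x) < e / 3" by auto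
  have pL: "\<phi> n \<in> L2 lebesgue" by (intro test_function_L2 t)
  obtain C where C: "\<And>h::'a. norm h \<le> 1 \<Longrightarrow> l2_norm lebesgue (\<lambda>x. \<phi> n (x + h) - \<phi> n x) \<le> C * norm h"
    using translation_continuous_test[OF t] by metis
  define d where "d = min 1 (e / (3 * (\<bar>C\<bar> + 1)))"
  have d: "d > 0" using e by (auto simp: d_def)
  have "l2_norm lebesgue (\<lambda>x. f (x + h) - f x) \<le> e" if h: "norm h \<le> d" for h
  proof -
    have "l2_norm lebesgue (\<lambda>x. \<phi> n (x + h) - \<phi> n x) \<le> C * norm h" using h by (intro C) (simp add: d_def)
    also have "\<dots> \<le> (\<bar>C\<bar> + 1) * (e / (3 * (\<bar>C\<bar> + 1)))" using h by (intro mult_mono) (auto simp: d_def)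
    also have "\<dots> = e / 3" by (simp add: field_simps)
    finally have 2: "l2_norm lebesgue (\<lambda>x. \<phi> n (x + h) - \<phi> n x) \<le> e / 3" .
    have 1: "l2_norm lebesgue (\<lambda>x. f (x + h) - \<phi> n (x + h)) = l2_norm lebesgue (\<lambda>x. f x - \<phi> n x)"
      using L2_measurable[OF L2_diff[OF f pL]] by (rule l2_norm_translate)
    have "l2_norm lebesgue (\<lambda>x. f (x + h) - f x) \<le> 
        l2_norm lebesgue (\<lambda>x. f (x + h) - \<phi> n (x + h)) + l2_norm lebesgue (\<lambda>x. \<phi> n (x + h) - f x)"
      by (intro l2_norm_triangle_diff L2_translate f pL)
    also have "l2_norm lebesgue (\<lambda>x. \<phi> n (x + h) - f x) \<le> 
        l2_norm lebesgue (\<lambda>x. \<phi> n (x + h) - \<phi> n x) + l2_norm lebesgue (\<lambda>x. \<phi> n x - f x)"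
      by (intro l2_norm_triangle_diff L2_translate f pL)
    finally show ?thesis using 1 2 n l2_norm_minus_commute[of lebesgue f "\<phi> n"] by linarith
  qed
  thus ?thesis using d by blast
qed

theorem translation_continuous:
  fixes f :: "'a::euclidean_space \<Rightarrow> 'b::euclidean_space"
  assumes f: "f \<in> L2 lebesgue" and e: "e > 0"
  shows "\<exists>d>0. \<forall>h. norm h \<le> d \<longrightarrow> l2_norm lebesgue (\<lambda>x. f (x + h) - f x) \<le> e"
proof -
  have "\<forall>b\<in>(Basis::'b set). \<exists>d>0. \<forall>h. norm h \<le> d \<longrightarrow> l2_norm lebesgue (\<lambda>x. f (x + h) \<bullet> b - f x \<bullet> b) \<le> e / DIM('b)"
    using e by (intro ballI translation_continuous_real L2_inner_const f) auto
  then obtain d where d: "\<And>b. b \<in> (Basis::'b set) \<Longrightarrow> d b > 0"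
    "\<And>b h. b \<in> (Basis::'b set) \<Longrightarrow> norm h \<le> d b \<Longrightarrow> l2_norm lebesgue (\<lambda>x. f (x + h) \<bullet> b - f x \<bullet> b) \<le> e / DIM('b)"
    by metis
  have "l2_norm lebesgue (\<lambda>x. f (x + h) - f x) \<le> e" if h: "norm h \<le> Min (d ` Basis)" for h
  proof -
    let ?F = "\<lambda>b x. (f (x + h) \<bullet> b - f x \<bullet> b) *\<^sub>R b"
    have L: "?F b \<in> L2 lebesgue" for b 
      by (intro L2_scaleR_const L2_diff L2_translate[OF L2_inner_const[OF f]] L2_inner_const[OF f])
    have "(\<lambda>x. f (x + h) - f x) = (\<lambda>x. \<Sum>b\<in>Basis. ?F b x)"
      by (simp add: inner_diff_left[symmetric] euclidean_representation)
    hence "l2_norm lebesgue (\<lambda>x. f (x + h) - f x) = l2_norm lebesgue (\<lambda>x. \<Sum>b\<in>Basis. ?F b x)" by simp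
    also have "\<dots> \<le> (\<Sum>b\<in>Basis. l2_norm lebesgue (?F b))" using L by (intro l2_norm_sum_le) auto
    also have "\<dots> \<le> (\<Sum>b\<in>(Basis::'b set). e / DIM('b))"
    proof (rule sum_mono)
      fix b :: 'b assume b: "b \<in> Basis"
      have "norm h \<le> d b" using h b by (meson Min_le finite_Basis finite_imageI imageI order_trans)
      from d(2)[OF b this] show "l2_norm lebesgue (?F b) \<le> e / DIM('b)"
        using b by (simp add: l2_norm_def)
    qed
    finally show ?thesis by simp
  qed
  moreover have "Min (d ` (Basis::'b set)) > 0" using d(1) by (subst Min_gr_iff) auto
  ultimately show ?thesis by blast
qed

section \<open>Weak gradients\<close>

lemma locally_integrable_add:
  "locally_integrable f \<Longrightarrow> locally_integrable g \<Longrightarrow> locally_integrable (\<lambda>x. f x + g x)"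
  unfolding locally_integrable_def by (auto intro: set_integral_add)

lemma locally_integrable_scaleR:
  "locally_integrable f \<Longrightarrow> locally_integrable (\<lambda>x. c *\<^sub>R f x)"
  unfolding locally_integrable_def by auto

lemma locally_integrable_diff:
  "locally_integrable f \<Longrightarrow> locally_integrable g \<Longrightarrow> locally_integrable (\<lambda>x. f x - g x)"
  unfolding locally_integrable_def by (auto intro: set_integral_diff)

lemma locally_integrable_cong_AE:
  assumes f: "locally_integrable f" and g: "g \<in> borel_measurable lebesgue" and ae: "AE x in lebesgue. f x = g x"
  shows "locally_integrable g"
  unfolding locally_integrable_def set_integrable_def
proof (intro allI impI)
  fix K :: "'a set" assume "compact K"
  hence [measurable]: "K \<in> sets lebesgue" by (simp add: compact_imp_closed)
  have "integrable lebesgue (\<lambda>x. indicator K x *\<^sub>R f x)" using f \<open>compact K\<close> 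
    by (simp add: locally_integrable_def set_integrable_def)
  moreover have "(\<lambda>x. indicator K x *\<^sub>R f x) \<in> borel_measurable lebesgue" 
    using locally_integrable_measurable[OF f] by measurable
  moreover have "(\<lambda>x. indicator K x *\<^sub>R g x) \<in> borel_measurable lebesgue" using g by measurable
  ultimately show "integrable lebesgue (\<lambda>x. indicator K x *\<^sub>R g x)"
    using ae by (subst integrable_cong_AE[of _ _ "\<lambda>x. indicator K x *\<^sub>R f x"]) auto
qed

text \<open>The defining identity is linear in the direction, so it extends from basis vectors to all vectors.\<close>

lemma weak_gradient_identity:
  assumes "has_weak_gradient u G" "\<phi> \<in> test_functions"
  shows "(LINT x|lebesgue. u x * frechet_derivative \<phi> (at x) v) = - (LINT x|lebesgue. (G x \<bullet> v) * \<phi> x)"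
proof -
  have u: "locally_integrable u" and G: "locally_integrable G" using assms by (auto simp: has_weak_gradient_def)
  have i1: "integrable lebesgue (\<lambda>x. (v \<bullet> b) * (u x * frechet_derivative \<phi> (at x) b))" for b
    by (intro integrable_mult_right locally_integrable_test_mult u test_function_derivative assms)
  have i2: "integrable lebesgue (\<lambda>x. (v \<bullet> b) * ((G x \<bullet> b) * \<phi> x))" for b
    by (intro integrable_mult_right locally_integrable_test_mult locally_integrable_inner G assms)
  have "(LINT x|lebesgue. u x * frechet_derivative \<phi> (at x) v) = 
      (LINT x|lebesgue. (\<Sum>b\<in>Basis. (v \<bullet> b) * (u x * frechet_derivative \<phi> (at x) b)))"
    unfolding frechet_derivative_expand[OF test_function_smooth[OF assms(2)], of _ v] 
    by (simp add: sum_distrib_left mult.left_commute)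
  also have "\<dots> = (\<Sum>b\<in>Basis. (v \<bullet> b) * (LINT x|lebesgue. u x * frechet_derivative \<phi> (at x) b))"
    by (subst Bochner_Integration.integral_sum) (use i1 in auto)
  also have "\<dots> = - (\<Sum>b\<in>Basis. (v \<bullet> b) * (LINT x|lebesgue. (G x \<bullet> b) * \<phi> x))"
    using assms by (simp add: has_weak_gradient_def sum_negf[symmetric])
  also have "(\<Sum>b\<in>Basis. (v \<bullet> b) * (LINT x|lebesgue. (G x \<bullet> b) * \<phi> x)) = 
      (LINT x|lebesgue. (\<Sum>b\<in>Basis. (v \<bullet> b) * ((G x \<bullet> b) * \<phi> x)))"
    by (subst Bochner_Integration.integral_sum) (use i2 in auto)
  also have "\<dots> = (LINT x|lebesgue. (G x \<bullet> v) * \<phi> x)"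
    by (simp add: euclidean_inner[of "G _" v] sum_distrib_right sum_distrib_left algebra_simps)
  finally show ?thesis .
qed

lemma weak_gradient_unique:
  assumes "has_weak_gradient u G" "has_weak_gradient u' G'" "AE x in lebesgue. u x = u' x"
  shows "AE x in lebesgue. G x = G' x"
proof -
  have li: "locally_integrable u" "locally_integrable G" "locally_integrable u'" "locally_integrable G'" 
    using assms by (auto simp: has_weak_gradient_def)
  have "AE x in lebesgue. (G x \<bullet> b) - (G' x \<bullet> b) = 0" if b: "b \<in> Basis" for b
  proof (rule fundamental_lemma)
    show "locally_integrable (\<lambda>x. (G x \<bullet> b) - (G' x \<bullet> b))"
      by (intro locally_integrable_diff locally_integrable_inner li)
    fix \<phi> :: "'a \<Rightarrow> real" assume phi: "\<phi> \<in> test_functions"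
    have "(LINT x|lebesgue. u x * frechet_derivative \<phi> (at x) b) = (LINT x|lebesgue. u' x * frechet_derivative \<phi> (at x) b)"
      using assms(3) locally_integrable_measurable[OF li(1)] locally_integrable_measurable[OF li(3)]
        test_function_measurable[OF test_function_derivative[OF phi, of b]]
      by (intro integral_cong_AE) auto
    hence "(LINT x|lebesgue. (G x \<bullet> b) * \<phi> x) = (LINT x|lebesgue. (G' x \<bullet> b) * \<phi> x)"
      using weak_gradient_identity[OF assms(1) phi] weak_gradient_identity[OF assms(2) phi] by simp
    thus "(LINT x|lebesgue. ((G x \<bullet> b) - (G' x \<bullet> b)) * \<phi> x) = 0"
      unfolding left_diff_distrib using li phi
      by (subst Bochner_Integration.integral_diff) (auto intro: locally_integrable_test_mult locally_integrable_inner)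
  qed
  hence "AE x in lebesgue. \<forall>b\<in>Basis. (G x \<bullet> b) - (G' x \<bullet> b) = 0" by (intro AE_finite_allI) auto
  thus ?thesis by eventually_elim (auto intro: euclidean_eqI)
qed

lemma has_weak_gradient_cong:
  assumes "has_weak_gradient u G" "AE x in lebesgue. u x = u' x" "AE x in lebesgue. G x = G' x"
    and m: "u' \<in> borel_measurable lebesgue" "G' \<in> borel_measurable lebesgue"
  shows "has_weak_gradient u' G'"
proof -
  have li: "locally_integrable u" "locally_integrable G" using assms by (auto simp: has_weak_gradient_def)
  have "(LINT x|lebesgue. u' x * frechet_derivative \<phi> (at x) b) = - (LINT x|lebesgue. (G' x \<bullet> b) * \<phi> x)"
    if phi: "\<phi> \<in> test_functions" and b: "b \<in> Basis" for \<phi> b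
  proof -
    have "(LINT x|lebesgue. u' x * frechet_derivative \<phi> (at x) b) = (LINT x|lebesgue. u x * frechet_derivative \<phi> (at x) b)"
      using assms(2) locally_integrable_measurable[OF li(1)] m
        test_function_measurable[OF test_function_derivative[OF phi, of b]]
      by (intro integral_cong_AE) auto
    also have "\<dots> = - (LINT x|lebesgue. (G x \<bullet> b) * \<phi> x)" by (rule weak_gradient_identity[OF assms(1) phi])
    also have "(LINT x|lebesgue. (G x \<bullet> b) * \<phi> x) = (LINT x|lebesgue. (G' x \<bullet> b) * \<phi> x)"
      using assms(3) locally_integrable_measurable[OF li(2)] m test_function_measurable[OF phi]
      by (intro integral_cong_AE) (auto intro!: borel_measurable_times borel_measurable_inner)
    finally show ?thesis .
  qed
  thus ?thesis using assms li by (auto simp: has_weak_gradient_def intro: locally_integrable_cong_AE)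
qed

lemma has_weak_gradient_add:
  assumes "has_weak_gradient u G" "has_weak_gradient v H"
  shows "has_weak_gradient (\<lambda>x. u x + v x) (\<lambda>x. G x + H x)"
proof -
  have li: "locally_integrable u" "locally_integrable G" "locally_integrable v" "locally_integrable H"
    using assms by (auto simp: has_weak_gradient_def)
  have "(LINT x|lebesgue. (u x + v x) * frechet_derivative \<phi> (at x) b) = - (LINT x|lebesgue. ((G x + H x) \<bullet> b) * \<phi> x)"
    if phi: "\<phi> \<in> test_functions" for \<phi> b
    unfolding distrib_right inner_add_left
    using weak_gradient_identity[OF assms(1) phi, of b] weak_gradient_identity[OF assms(2) phi, of b]
      locally_integrable_test_mult[OF li(1) test_function_derivative[OF phi, of b]]
      locally_integrable_test_mult[OF li(3) test_function_derivative[OF phi, of b]]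
      locally_integrable_test_mult[OF locally_integrable_inner[OF li(2)] phi]
      locally_integrable_test_mult[OF locally_integrable_inner[OF li(4)] phi]
    by simp
  thus ?thesis using li by (auto simp: has_weak_gradient_def intro: locally_integrable_add)
qed

lemma has_weak_gradient_scale:
  assumes "has_weak_gradient u G"
  shows "has_weak_gradient (\<lambda>x. c * u x) (\<lambda>x. c *\<^sub>R G x)"
  using assms locally_integrable_scaleR[of u c] locally_integrable_scaleR[of G c] 
  by (auto simp: has_weak_gradient_def mult.assoc)

lemma has_weak_gradient_zero: "has_weak_gradient (\<lambda>x. 0) (\<lambda>x. 0)"
  by (auto simp: has_weak_gradient_def locally_integrable_def set_integrable_def)

lemma has_weak_gradient_weak_gradient:
  assumes "has_weak_gradient u G"
  shows "has_weak_gradient u (weak_gradient u)" "AE x in lebesgue. weak_gradient u x = G x"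
proof -
  show *: "has_weak_gradient u (weak_gradient u)" unfolding weak_gradient_def by (rule someI[of _ G]) (rule assms)
  show "AE x in lebesgue. weak_gradient u x = G x" by (rule weak_gradient_unique[OF * assms]) simp
qed

text \<open>Both sides of the defining identity are inner products with fixed square integrable functions.\<close>

lemma has_weak_gradient_L2_limit:
  assumes W: "\<And>n. has_weak_gradient (u n) (G n)"
    and L: "\<And>n. u n \<in> L2 lebesgue" "\<And>n. G n \<in> L2 lebesgue" "v \<in> L2 lebesgue" "H \<in> L2 lebesgue"
    and lim: "(\<lambda>n. l2_norm lebesgue (\<lambda>x. u n x - v x)) \<longlonglongrightarrow> 0" "(\<lambda>n. l2_norm lebesgue (\<lambda>x. G n x - H x)) \<longlonglongrightarrow> 0"
  shows "has_weak_gradient v H"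
proof -
  have "(LINT x|lebesgue. v x * frechet_derivative \<phi> (at x) b) = - (LINT x|lebesgue. (H x \<bullet> b) * \<phi> x)"
    if phi: "\<phi> \<in> test_functions" for \<phi> b
  proof -
    let ?d = "\<lambda>x. frechet_derivative \<phi> (at x) b"
    have 1: "(\<lambda>n. l2_inner lebesgue (u n) ?d) \<longlonglongrightarrow> l2_inner lebesgue v ?d"
      by (rule l2_inner_tendsto_left[OF L(1,3) lim(1) test_function_L2[OF test_function_derivative[OF phi]]])
    have 2: "(\<lambda>n. l2_inner lebesgue (G n) (\<lambda>x. \<phi> x *\<^sub>R b)) \<longlonglongrightarrow> l2_inner lebesgue H (\<lambda>x. \<phi> x *\<^sub>R b)"
      by (rule l2_inner_tendsto_left[OF L(2,4) lim(2) L2_scaleR_const[OF test_function_L2[OF phi]]])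
    have "l2_inner lebesgue (u n) ?d = - l2_inner lebesgue (G n) (\<lambda>x. \<phi> x *\<^sub>R b)" for n
      using weak_gradient_identity[OF W phi] by (simp add: l2_inner_def mult.commute)
    hence "(\<lambda>n. - l2_inner lebesgue (G n) (\<lambda>x. \<phi> x *\<^sub>R b)) \<longlonglongrightarrow> l2_inner lebesgue v ?d" using 1 by simp
    with tendsto_minus[OF 2] have "l2_inner lebesgue v ?d = - l2_inner lebesgue H (\<lambda>x. \<phi> x *\<^sub>R b)"
      using LIMSEQ_unique by blast
    thus ?thesis by (simp add: l2_inner_def mult.commute)
  qed
  thus ?thesis using L by (auto simp: has_weak_gradient_def intro: L2_locally_integrable)
qed

section \<open>Difference quotients\<close>

text \<open>Differentiation under the integral. The difference quotients are dominated by the Lipschitz constant of \<open>\<phi>\<close> times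
  \<open>u\<close> on a ball that contains all supports for \<open>\<bar>h\<bar> < 1\<close>, which is why \<open>h\<close> is first confined to \<open>{-1<..<1}\<close>.\<close>

lemma integral_test_translate_derivative:
  assumes u: "locally_integrable (u :: 'a::euclidean_space \<Rightarrow> real)" and phi: "\<phi> \<in> test_functions"
  shows "((\<lambda>s. LINT x|lebesgue. u x * \<phi> (x + s *\<^sub>R v)) has_real_derivative
          (LINT x|lebesgue. u x * frechet_derivative \<phi> (at (x + s *\<^sub>R v)) v)) (at s)"
proof -
  let ?\<psi> = "\<lambda>x. \<phi> (x + s *\<^sub>R v)"
  have psi: "?\<psi> \<in> test_functions" by (rule test_function_translate[OF phi])
  obtain R where R: "\<And>x. norm x > R \<Longrightarrow> ?\<psi> x = 0" using test_function_support[OF psi] by metis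
  obtain C where C: "C > 0" "\<And>x h. \<bar>?\<psi> (x + h) - ?\<psi> x\<bar> \<le> C * norm h" using test_function_lipschitz[OF psi] by metis
  have um: "u \<in> borel_measurable lebesgue" by (rule locally_integrable_measurable[OF u])
  have shift: "\<phi> (x + (s + h) *\<^sub>R v) = ?\<psi> (x + h *\<^sub>R v)" for x h by (simp add: algebra_simps)
  have "((\<lambda>h. ((LINT x|lebesgue. u x * \<phi> (x + (s + h) *\<^sub>R v)) - (LINT x|lebesgue. u x * \<phi> (x + s *\<^sub>R v))) / h)
      \<longlongrightarrow> (LINT x|lebesgue. u x * frechet_derivative \<phi> (at (x + s *\<^sub>R v)) v)) (at 0 within {-1<..<1})"
    unfolding tendsto_at_iff_sequentially comp_def
  proof (intro allI impI)
    fix X :: "nat \<Rightarrow> real" assume X: "\<forall>i. X i \<in> {-1<..<1} - {0}" and X0: "X \<longlonglongrightarrow> 0"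
    have eq: "((LINT x|lebesgue. u x * \<phi> (x + (s + X i) *\<^sub>R v)) - (LINT x|lebesgue. u x * \<phi> (x + s *\<^sub>R v))) / X i
        = (LINT x|lebesgue. u x * ((?\<psi> (x + X i *\<^sub>R v) - ?\<psi> x) / X i))" for i
    proof -
      note i1 = locally_integrable_test_mult[OF u test_function_translate[OF psi, of "X i *\<^sub>R v"]]
        and i2 = locally_integrable_test_mult[OF u psi]
      show ?thesis
        unfolding shift Bochner_Integration.integral_diff[OF i1 i2, symmetric] integral_divide_zero[symmetric]
        by (simp add: right_diff_distrib diff_divide_distrib)
    qed
    show "(\<lambda>i. ((LINT x|lebesgue. u x * \<phi> (x + (s + X i) *\<^sub>R v)) - (LINT x|lebesgue. u x * \<phi> (x + s *\<^sub>R v))) / X i)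
      \<longlonglongrightarrow> (LINT x|lebesgue. u x * frechet_derivative \<phi> (at (x + s *\<^sub>R v)) v)"
      unfolding eq
    proof (rule integral_dominated_convergence)
      show "(\<lambda>x. u x * frechet_derivative \<phi> (at (x + s *\<^sub>R v)) v) \<in> borel_measurable lebesgue"
        using um test_function_measurable[OF test_function_translate[OF test_function_derivative[OF phi]]] 
        by measurable
      show "(\<lambda>x. u x * ((?\<psi> (x + X i *\<^sub>R v) - ?\<psi> x) / X i)) \<in> borel_measurable lebesgue" for i
        using um test_function_measurable[OF psi] test_function_measurable[OF test_function_translate[OF psi, of "X i *\<^sub>R v"]]
        by measurable
      show "integrable lebesgue (\<lambda>x. (C * norm v) * norm (indicator (cball 0 (R + norm v)) x *\<^sub>R u x))"
        by (intro integrable_mult_right integrable_norm locally_integrable_cball u)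
      show "AE x in lebesgue. norm (u x * ((?\<psi> (x + X i *\<^sub>R v) - ?\<psi> x) / X i)) 
          \<le> (C * norm v) * norm (indicator (cball 0 (R + norm v)) x *\<^sub>R u x)" for i
      proof (rule AE_I2)
        fix x
        have Xi: "\<bar>X i\<bar> < 1" "X i \<noteq> 0" using X[rule_format, of i] by auto
        show "norm (u x * ((?\<psi> (x + X i *\<^sub>R v) - ?\<psi> x) / X i)) 
          \<le> (C * norm v) * norm (indicator (cball 0 (R + norm v)) x *\<^sub>R u x)"
        proof (cases "norm x \<le> R + norm v")
          case True
          have "\<bar>?\<psi> (x + X i *\<^sub>R v) - ?\<psi> x\<bar> / \<bar>X i\<bar> \<le> C * norm v"
            using C(2)[of x "X i *\<^sub>R v"] Xi by (simp add: field_simps)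
          hence "\<bar>u x\<bar> * (\<bar>?\<psi> (x + X i *\<^sub>R v) - ?\<psi> x\<bar> / \<bar>X i\<bar>) \<le> \<bar>u x\<bar> * (C * norm v)" 
            by (rule mult_left_mono) simp
          thus ?thesis using True by (simp add: abs_mult abs_divide mult.commute)
        next
          case False
          have "norm (X i *\<^sub>R v) \<le> norm v" using Xi mult_right_mono[of "\<bar>X i\<bar>" 1 "norm v"] by simp
          moreover have "norm (x + X i *\<^sub>R v) \<ge> norm x - norm (X i *\<^sub>R v)" by (metis norm_diff_ineq)
          ultimately have "?\<psi> (x + X i *\<^sub>R v) = 0" using False by (intro R) linarith
          moreover have "norm x > R" using False norm_ge_zero[of v] by linarith
          hence "?\<psi> x = 0" by (rule R)
          ultimately show ?thesis using C(1) by simp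
        qed
      qed
      show "AE x in lebesgue. (\<lambda>i. u x * ((?\<psi> (x + X i *\<^sub>R v) - ?\<psi> x) / X i))
          \<longlonglongrightarrow> u x * frechet_derivative \<phi> (at (x + s *\<^sub>R v)) v"
      proof (intro AE_I2 tendsto_mult tendsto_const)
        fix x
        have "((\<lambda>h. x + h *\<^sub>R v) has_derivative (\<lambda>h. h *\<^sub>R v)) (at (0::real))" 
          by (auto intro!: derivative_eq_intros)
        moreover have "(?\<psi> has_derivative frechet_derivative \<phi> (at (x + s *\<^sub>R v))) (at (x + 0 *\<^sub>R v))"
          using frechet_derivative_translate(1)[OF test_function_smooth[OF phi], of "s *\<^sub>R v" x] by simp
        ultimately have "((\<lambda>h. ?\<psi> (x + h *\<^sub>R v)) has_derivative (\<lambda>h. frechet_derivative \<phi> (at (x + s *\<^sub>R v)) (h *\<^sub>R v))) (at 0)"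
          by (rule has_derivative_compose)
        moreover have "frechet_derivative \<phi> (at (x + s *\<^sub>R v)) (h *\<^sub>R v) = frechet_derivative \<phi> (at (x + s *\<^sub>R v)) v * h" for h
          using linear_cmul[OF has_derivative_linear[OF test_function_has_derivative[OF phi]]] by (simp add: mult.commute)
        ultimately have "((\<lambda>h. ?\<psi> (x + h *\<^sub>R v)) has_real_derivative frechet_derivative \<phi> (at (x + s *\<^sub>R v)) v) (at 0)"
          by (simp add: has_field_derivative_def)
        hence "((\<lambda>h. (?\<psi> (x + h *\<^sub>R v) - ?\<psi> x) / h) \<longlongrightarrow> frechet_derivative \<phi> (at (x + s *\<^sub>R v)) v) (at 0)"
          by (simp add: DERIV_def)
        thus "(\<lambda>i. (?\<psi> (x + X i *\<^sub>R v) - ?\<psi> x) / X i) \<longlonglongrightarrow> frechet_derivative \<phi> (at (x + s *\<^sub>R v)) v"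
          unfolding tendsto_at_iff_sequentially comp_def using X X0 by auto
      qed
    qed
  qed
  hence "((\<lambda>h. ((LINT x|lebesgue. u x * \<phi> (x + (s + h) *\<^sub>R v)) - (LINT x|lebesgue. u x * \<phi> (x + s *\<^sub>R v))) / h)
      \<longlongrightarrow> (LINT x|lebesgue. u x * frechet_derivative \<phi> (at (x + s *\<^sub>R v)) v)) (at 0)"
    by (subst (asm) at_within_open) auto
  thus ?thesis by (simp add: DERIV_def)
qed

lemma integral_translate_test:
  assumes u: "locally_integrable (u :: 'a::euclidean_space \<Rightarrow> real)" and phi: "\<phi> \<in> test_functions"
  shows "(LINT x|lebesgue. u (x + h) * \<phi> x) = (LINT x|lebesgue. u x * \<phi> (x - h))"
    and "integrable lebesgue (\<lambda>x. u (x + h) * \<phi> x)"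
proof -
  have psi: "(\<lambda>x. \<phi> (x - h)) \<in> test_functions" using test_function_translate[OF phi, of "-h"] by simp
  have i: "integrable lebesgue (\<lambda>x. u x * \<phi> (x - h))" by (rule locally_integrable_test_mult[OF u psi])
  show "(LINT x|lebesgue. u (x + h) * \<phi> x) = (LINT x|lebesgue. u x * \<phi> (x - h))"
    using integral_translate[OF borel_measurable_integrable[OF i], of h] by simp
  show "integrable lebesgue (\<lambda>x. u (x + h) * \<phi> x)"
    using integrable_translate[OF i, of h] by simp
qed

lemma translation_pairing_derivative:
  assumes u: "locally_integrable u" "has_weak_gradient u G" and phi: "\<phi> \<in> test_functions"
  shows "((\<lambda>s. LINT x|lebesgue. u x * \<phi> (x - s *\<^sub>R h)) has_real_derivative
          (LINT x|lebesgue. (G x \<bullet> h) * \<phi> (x - s *\<^sub>R h))) (at s)"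
proof -
  have psi: "(\<lambda>x. \<phi> (x + s *\<^sub>R (-h))) \<in> test_functions" by (rule test_function_translate[OF phi])
  have "((\<lambda>s. LINT x|lebesgue. u x * \<phi> (x + s *\<^sub>R (-h))) has_real_derivative
          (LINT x|lebesgue. u x * frechet_derivative \<phi> (at (x + s *\<^sub>R (-h))) (-h))) (at s)"
    by (rule integral_test_translate_derivative[OF u(1) phi])
  also have "(LINT x|lebesgue. u x * frechet_derivative \<phi> (at (x + s *\<^sub>R (-h))) (-h)) = 
      - (LINT x|lebesgue. (G x \<bullet> (-h)) * \<phi> (x + s *\<^sub>R (-h)))"
    using weak_gradient_identity[OF u(2) psi, of "-h"] 
    by (simp only: frechet_derivative_translate(2)[OF test_function_smooth[OF phi]])
  finally show ?thesis by simp
qed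

text \<open>The gradient \<open>G\<close> is carried along explicitly, because it is unique only up to null sets and estimates are made for
  concrete choices of it.\<close>

definition wdiff :: "'a::euclidean_space measure \<Rightarrow> ('a \<Rightarrow> real) \<Rightarrow> ('a \<Rightarrow> 'a) \<Rightarrow> bool" where
  "wdiff M u G \<longleftrightarrow> u \<in> L2 M \<and> G \<in> L2 M \<and> has_weak_gradient u G"

lemma l2_norm_inner_le: "G \<in> L2 M \<Longrightarrow> l2_norm M (\<lambda>x. G x \<bullet> h) \<le> norm h * l2_norm M G"
proof -
  assume G: "G \<in> L2 M"
  have "l2_norm M (\<lambda>x. G x \<bullet> h) \<le> l2_norm M (\<lambda>x. norm h *\<^sub>R G x)"
  proof (rule l2_norm_mono_AE[OF L2_scaleR[OF G]], rule AE_I2)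
    fix x show "norm (G x \<bullet> h) \<le> norm (norm h *\<^sub>R G x)"
      using Cauchy_Schwarz_ineq2[of "G x" h] by (simp add: mult.commute)
  qed
  thus ?thesis by (simp add: l2_norm_scaleR)
qed

text \<open>By duality it suffices to test with \<open>\<phi>\<close>. Moving the translation to \<open>\<phi>\<close>, the mean value theorem for
  \<open>s \<mapsto> \<integral> u * \<phi> (x - s h)\<close> expresses the difference through the gradient at one intermediate \<open>s\<close>.\<close>

theorem translation_difference_le:
  assumes W: "wdiff lebesgue u G"
  shows "l2_norm lebesgue (\<lambda>x. u (x + h) - u x) \<le> norm h * l2_norm lebesgue G"
proof -
  have u: "u \<in> L2 lebesgue" and G: "G \<in> L2 lebesgue" and wg: "has_weak_gradient u G" 
    using W by (auto simp: wdiff_def)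
  have lu: "locally_integrable u" by (rule L2_locally_integrable[OF u])
  show ?thesis
  proof (rule l2_norm_le_of_duality[OF L2_diff[OF L2_translate[OF u] u]])
    fix \<phi> :: "'a \<Rightarrow> real" assume phi: "\<phi> \<in> test_functions"
    let ?P = "\<lambda>s. LINT x|lebesgue. u x * \<phi> (x - s *\<^sub>R h)"
    obtain z :: real where z: "?P 1 - ?P 0 = (1 - 0) * (LINT x|lebesgue. (G x \<bullet> h) * \<phi> (x - z *\<^sub>R h))"
      using MVT2[of 0 1 ?P "\<lambda>s. LINT x|lebesgue. (G x \<bullet> h) * \<phi> (x - s *\<^sub>R h)"]
        translation_pairing_derivative[OF lu wg phi] by force
    have psi: "(\<lambda>x. \<phi> (x - z *\<^sub>R h)) \<in> L2 lebesgue" 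
      using L2_translate[OF test_function_L2[OF phi], of "- (z *\<^sub>R h)"] by simp
    have "l2_inner lebesgue (\<lambda>x. u (x + h) - u x) \<phi> = ?P 1 - ?P 0"
      unfolding l2_inner_def using integral_translate_test[OF lu phi, of h] locally_integrable_test_mult[OF lu phi]
      by (simp add: left_diff_distrib)
    also have "\<dots> = l2_inner lebesgue (\<lambda>x. G x \<bullet> h) (\<lambda>x. \<phi> (x - z *\<^sub>R h))"
      unfolding z by (simp add: l2_inner_def)
    also have "\<dots> \<le> l2_norm lebesgue (\<lambda>x. G x \<bullet> h) * l2_norm lebesgue (\<lambda>x. \<phi> (x - z *\<^sub>R h))"
      using l2_Cauchy_Schwarz[OF L2_inner_const[OF G] psi, of h] by simp
    also have "l2_norm lebesgue (\<lambda>x. \<phi> (x - z *\<^sub>R h)) = l2_norm lebesgue \<phi>"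
      using l2_norm_translate[OF test_function_measurable[OF phi], of "- (z *\<^sub>R h)"] by simp
    also have "l2_norm lebesgue (\<lambda>x. G x \<bullet> h) * l2_norm lebesgue \<phi> \<le> (norm h * l2_norm lebesgue G) * l2_norm lebesgue \<phi>"
      by (intro mult_right_mono l2_norm_inner_le G) simp
    finally show "l2_inner lebesgue (\<lambda>x. u (x + h) - u x) \<phi> \<le> norm h * l2_norm lebesgue G * l2_norm lebesgue \<phi>" .
  qed
qed

lemma seq_inverse_tendsto_at_0: "filterlim (\<lambda>n. 1 / real (Suc n)) (at 0) sequentially"
  unfolding filterlim_at using LIMSEQ_Suc[OF lim_1_over_n] by auto

text \<open>For a test function in place of \<open>\<psi>\<close> this is the derivative of the pairing at \<open>0\<close>. The quotients are bounded
  uniformly by \<open>translation_difference_le\<close>, so density gives all \<open>\<psi>\<close>.\<close>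

lemma difference_quotient_weak_limit:
  assumes W: "wdiff lebesgue u G" and psi: "\<psi> \<in> L2 lebesgue"
  shows "(\<lambda>n. real (Suc n) * l2_inner lebesgue (\<lambda>x. u (x + (1 / real (Suc n)) *\<^sub>R h) - u x) \<psi>) 
    \<longlonglongrightarrow> l2_inner lebesgue (\<lambda>x. G x \<bullet> h) \<psi>"
proof -
  have u: "u \<in> L2 lebesgue" and G: "G \<in> L2 lebesgue" and wg: "has_weak_gradient u G" 
    using W by (auto simp: wdiff_def)
  have lu: "locally_integrable u" by (rule L2_locally_integrable[OF u])
  let ?t = "\<lambda>n. 1 / real (Suc n)"
  let ?D = "\<lambda>n x. u (x + ?t n *\<^sub>R h) - u x"
  have DL: "?D n \<in> L2 lebesgue" for n by (intro L2_diff L2_translate u)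
  let ?Q = "\<lambda>n f. real (Suc n) * l2_inner lebesgue (?D n) f"
  let ?K = "norm h * l2_norm lebesgue G"
  have Qb: "\<bar>?Q n f\<bar> \<le> ?K * l2_norm lebesgue f" if f: "f \<in> L2 lebesgue" for n f
  proof -
    have "\<bar>l2_inner lebesgue (?D n) f\<bar> \<le> l2_norm lebesgue (?D n) * l2_norm lebesgue f"
      by (rule l2_Cauchy_Schwarz[OF DL f])
    also have "\<dots> \<le> (norm (?t n *\<^sub>R h) * l2_norm lebesgue G) * l2_norm lebesgue f"
      by (intro mult_right_mono translation_difference_le[OF W]) simp
    finally have "real (Suc n) * \<bar>l2_inner lebesgue (?D n) f\<bar> \<le> real (Suc n) * ((norm (?t n *\<^sub>R h) * l2_norm lebesgue G) * l2_norm lebesgue f)"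
      by (rule mult_left_mono) simp
    also have "\<dots> = ?K * l2_norm lebesgue f" by (simp del: of_nat_Suc)
    finally show ?thesis by (simp add: abs_mult del: of_nat_Suc)
  qed
  have Gb: "\<bar>l2_inner lebesgue (\<lambda>x. G x \<bullet> h) f\<bar> \<le> ?K * l2_norm lebesgue f" if f: "f \<in> L2 lebesgue" for f
    using l2_Cauchy_Schwarz[OF L2_inner_const[OF G] f, of h] l2_norm_inner_le[OF G, of h] 
    by (meson l2_norm_nonneg mult_right_mono order_trans)
  have test: "(\<lambda>n. ?Q n \<phi>) \<longlonglongrightarrow> l2_inner lebesgue (\<lambda>x. G x \<bullet> h) \<phi>" if phi: "\<phi> \<in> test_functions" for \<phi>
  proof -
    have "((\<lambda>s. ((LINT x|lebesgue. u x * \<phi> (x - s *\<^sub>R h)) - (LINT x|lebesgue. u x * \<phi> x)) / s)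
      \<longlongrightarrow> (LINT x|lebesgue. (G x \<bullet> h) * \<phi> x)) (at 0)"
      using translation_pairing_derivative[OF lu wg phi, of h 0] by (simp add: DERIV_def)
    from filterlim_compose[OF this seq_inverse_tendsto_at_0]
    have "(\<lambda>n. ((LINT x|lebesgue. u x * \<phi> (x - ?t n *\<^sub>R h)) - (LINT x|lebesgue. u x * \<phi> x)) / ?t n)
      \<longlonglongrightarrow> (LINT x|lebesgue. (G x \<bullet> h) * \<phi> x)" .
    moreover have "((LINT x|lebesgue. u x * \<phi> (x - ?t n *\<^sub>R h)) - (LINT x|lebesgue. u x * \<phi> x)) / ?t n = ?Q n \<phi>" for n
    proof -
      have "l2_inner lebesgue (?D n) \<phi> = (LINT x|lebesgue. u x * \<phi> (x - ?t n *\<^sub>R h)) - (LINT x|lebesgue. u x * \<phi> x)"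
        unfolding l2_inner_def using integral_translate_test[OF lu phi, of "?t n *\<^sub>R h"] locally_integrable_test_mult[OF lu phi]
        by (simp add: left_diff_distrib del: of_nat_Suc)
      thus ?thesis by (simp del: of_nat_Suc)
    qed
    ultimately show ?thesis by (simp only: l2_inner_def inner_real_def)
  qed
  obtain \<phi> where t: "\<And>m. \<phi> m \<in> test_functions" and lim: "(\<lambda>m. l2_norm lebesgue (\<lambda>x. \<psi> x - \<phi> m x)) \<longlonglongrightarrow> 0"
    using test_functions_dense_L2[OF psi] by blast
  have K0: "?K \<ge> 0" by simp
  show ?thesis
  proof (rule LIMSEQ_I)
    fix e :: real assume e: "e > 0"
    have "3 * (?K + 1) > 0" by (rule mult_pos_pos[OF _ add_nonneg_pos[OF K0]]) auto
    hence "e / (3 * (?K + 1)) > 0" by (intro divide_pos_pos e)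
    from LIMSEQ_D[OF lim this] obtain m where m: "l2_norm lebesgue (\<lambda>x. \<psi> x - \<phi> m x) < e / (3 * (?K + 1))" by auto
    have dL: "(\<lambda>x. \<psi> x - \<phi> m x) \<in> L2 lebesgue" by (rule L2_diff[OF psi test_function_L2[OF t]])
    have small: "?K * l2_norm lebesgue (\<lambda>x. \<psi> x - \<phi> m x) \<le> e / 3"
    proof -
      have "?K * l2_norm lebesgue (\<lambda>x. \<psi> x - \<phi> m x) \<le> (?K + 1) * (e / (3 * (?K + 1)))"
        using m K0 by (intro mult_mono) auto
      also have "\<dots> = e / 3" using K0 by (simp add: field_simps add_nonneg_eq_0_iff)
      finally show ?thesis .
    qed
    have "e / 3 > 0" using e by simp
    from LIMSEQ_D[OF test[OF t] this] obtain N where 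
      N: "\<And>n. n \<ge> N \<Longrightarrow> \<bar>?Q n (\<phi> m) - l2_inner lebesgue (\<lambda>x. G x \<bullet> h) (\<phi> m)\<bar> < e / 3" by (metis real_norm_def)
    show "\<exists>N. \<forall>n\<ge>N. norm (?Q n \<psi> - l2_inner lebesgue (\<lambda>x. G x \<bullet> h) \<psi>) < e"
    proof (intro exI allI impI)
      fix n assume n: "n \<ge> N"
      have 1: "?Q n \<psi> = ?Q n (\<phi> m) + ?Q n (\<lambda>x. \<psi> x - \<phi> m x)"
        by (simp add: l2_inner_diff_right[OF psi test_function_L2[OF t] DL] right_diff_distrib del: of_nat_Suc)
      have 2: "l2_inner lebesgue (\<lambda>x. G x \<bullet> h) \<psi> = l2_inner lebesgue (\<lambda>x. G x \<bullet> h) (\<phi> m) + l2_inner lebesgue (\<lambda>x. G x \<bullet> h) (\<lambda>x. \<psi> x - \<phi> m x)"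
        using l2_inner_diff_right[OF psi test_function_L2[OF t[of m]] L2_inner_const[OF G], of h] by simp
      show "norm (?Q n \<psi> - l2_inner lebesgue (\<lambda>x. G x \<bullet> h) \<psi>) < e"
        using Qb[OF dL, of n] Gb[OF dL] small N[OF n] unfolding 1 2 real_norm_def by linarith
    qed
  qed
qed

section \<open>Chain rule\<close>

lemma L2_bounded_mult:
  fixes f :: "'a \<Rightarrow> real"
  assumes f: "f \<in> L2 M" and m: "m \<in> borel_measurable M" and B: "\<And>x. \<bar>m x\<bar> \<le> B"
  shows "(\<lambda>x. m x * f x) \<in> L2 M" "l2_norm M (\<lambda>x. m x * f x) \<le> B * l2_norm M f"
proof -
  have B0: "B \<ge> 0" using B[of undefined] by linarith
  have le: "norm (m x * f x) \<le> norm (B * f x)" for x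
    using B[of x] B0 by (simp add: abs_mult mult_right_mono)
  show L: "(\<lambda>x. m x * f x) \<in> L2 M"
  proof (rule L2_bound[OF _ L2_integrable[OF L2_cmult[OF f, of B]]])
    show "(\<lambda>x. m x * f x) \<in> borel_measurable M" using m L2_measurable[OF f] by measurable
    show "AE x in M. (norm (m x * f x))\<^sup>2 \<le> (norm (B * f x))\<^sup>2" using le by (intro AE_I2 power_mono) auto
  qed
  have "l2_norm M (\<lambda>x. m x * f x) \<le> l2_norm M (\<lambda>x. B * f x)"
    by (rule l2_norm_mono_AE[OF L2_cmult[OF f]], rule AE_I2, rule le)
  thus "l2_norm M (\<lambda>x. m x * f x) \<le> B * l2_norm M f" using B0 by (simp add: l2_norm_cmult)
qed

text \<open>Write the derivative of the test function as a limit of difference quotients and shift them to \<open>F (u x)\<close>. Taylor's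
  formula replaces the increment of \<open>F\<close> by \<open>F' (u x)\<close> times the increment of \<open>u\<close>, with an error that is quadratic in the
  increment of \<open>u\<close>; by \<open>translation_difference_le\<close> its integral is of order \<open>h\<^sup>2\<close>, so it disappears after division by \<open>h\<close>.
  Linear growth of \<open>F'\<close> is allowed in order to include the square.\<close>

theorem weak_chain_rule:
  fixes F F' :: "real \<Rightarrow> real"
  assumes W: "wdiff lebesgue u G"
    and Fm: "F \<in> borel_measurable borel" and F'm: "F' \<in> borel_measurable borel"
    and taylor: "\<And>a b. \<bar>F b - F a - F' a * (b - a)\<bar> \<le> L * (b - a)\<^sup>2"
    and lin: "\<And>a. \<bar>F' a\<bar> \<le> K * (1 + \<bar>a\<bar>)"
  shows "has_weak_gradient (\<lambda>x. F (u x)) (\<lambda>x. F' (u x) *\<^sub>R G x)"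
proof -
  have u: "u \<in> L2 lebesgue" and G: "G \<in> L2 lebesgue" and wg: "has_weak_gradient u G" 
    using W by (auto simp: wdiff_def)
  have um[measurable]: "u \<in> borel_measurable lebesgue" and Gm[measurable]: "G \<in> borel_measurable lebesgue"
    using u G by (auto simp: L2_def)
  note Fm[measurable] F'm[measurable]
  have L0: "L \<ge> 0" using taylor[of 1 0] by (simp add: power2_eq_square)
  have K0: "K \<ge> 0" using lin[of 0] by simp
  have lu: "locally_integrable u" and lG: "locally_integrable G" 
    using u G by (auto intro: L2_locally_integrable)
  have FuM: "(\<lambda>x. F (u x)) \<in> borel_measurable lebesgue" by measurable
  have F'uM: "(\<lambda>x. F' (u x)) \<in> borel_measurable lebesgue" by measurable
  have lF: "locally_integrable (\<lambda>x. F (u x))"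
  proof (rule locally_integrableI[OF FuM])
    fix R
    let ?I = "indicator (cball 0 R) :: 'a \<Rightarrow> real"
    have Im: "?I \<in> borel_measurable lebesgue" by (rule L2_measurable[OF indicator_ball_L2])
    have i1: "integrable lebesgue ?I" 
      using emeasure_lebesgue_cball_finite[of "0::'a" R] by (intro integrable_real_indicator) auto
    have i2: "integrable lebesgue (\<lambda>x. ?I x * norm (u x))"
      using L2_integrable_mult[OF indicator_ball_L2 L2_norm_fun[OF u]] .
    show "integrable lebesgue (\<lambda>x. ?I x *\<^sub>R norm (F (u x)))"
    proof (rule Bochner_Integration.integrable_bound)
      show "integrable lebesgue (\<lambda>x. \<bar>F 0\<bar> * ?I x + K * (?I x * norm (u x)) + L * (norm (u x))\<^sup>2)"
        by (intro Bochner_Integration.integrable_add integrable_mult_right i1 i2 L2_integrable u)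
      show "(\<lambda>x. ?I x *\<^sub>R norm (F (u x))) \<in> borel_measurable lebesgue" using Im FuM by measurable
      have le: "?I x * \<bar>F (u x)\<bar> \<le> \<bar>F 0\<bar> * ?I x + K * (?I x * \<bar>u x\<bar>) + L * (u x)\<^sup>2" for x
      proof (cases "x \<in> cball 0 R")
        case True
        have "\<bar>F (u x)\<bar> \<le> \<bar>F 0\<bar> + \<bar>F' 0 * u x\<bar> + L * (u x)\<^sup>2"
          using taylor[of "u x" 0] by simp
        moreover have "\<bar>F' 0 * u x\<bar> \<le> K * \<bar>u x\<bar>" using lin[of 0] by (simp add: abs_mult mult_right_mono)
        ultimately show ?thesis using True by simp
      next
        case False thus ?thesis using L0 by simp
      qed
      show "AE x in lebesgue. norm (?I x *\<^sub>R norm (F (u x))) \<le> norm (\<bar>F 0\<bar> * ?I x + K * (?I x * norm (u x)) + L * (norm (u x))\<^sup>2)"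
      proof (rule AE_I2)
        fix x
        have "norm (?I x *\<^sub>R norm (F (u x))) = ?I x * \<bar>F (u x)\<bar>" by (simp add: abs_mult)
        also have "\<dots> \<le> \<bar>F 0\<bar> * ?I x + K * (?I x * norm (u x)) + L * (norm (u x))\<^sup>2" using le[of x] by simp
        also have "\<dots> \<le> norm (\<bar>F 0\<bar> * ?I x + K * (?I x * norm (u x)) + L * (norm (u x))\<^sup>2)"
          unfolding real_norm_def by (rule abs_ge_self)
        finally show "norm (?I x *\<^sub>R norm (F (u x))) \<le> norm (\<bar>F 0\<bar> * ?I x + K * (?I x * norm (u x)) + L * (norm (u x))\<^sup>2)" .
      qed
    qed
  qed
  have lF': "locally_integrable (\<lambda>x. F' (u x) *\<^sub>R G x)"
  proof (rule locally_integrableI)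
    show "(\<lambda>x. F' (u x) *\<^sub>R G x) \<in> borel_measurable lebesgue" by measurable
    fix R
    let ?I = "indicator (cball 0 R) :: 'a \<Rightarrow> real"
    have Im: "?I \<in> borel_measurable lebesgue" by (rule L2_measurable[OF indicator_ball_L2])
    show "integrable lebesgue (\<lambda>x. ?I x *\<^sub>R norm (F' (u x) *\<^sub>R G x))"
    proof (rule Bochner_Integration.integrable_bound)
      show "integrable lebesgue (\<lambda>x. K * (?I x * norm (G x)) + K * (norm (u x) * norm (G x)))"
        using L2_integrable_mult[OF indicator_ball_L2 L2_norm_fun[OF G]] L2_integrable_norm_mult[OF u G]
        by (intro Bochner_Integration.integrable_add integrable_mult_right) auto
      show "(\<lambda>x. ?I x *\<^sub>R norm (F' (u x) *\<^sub>R G x)) \<in> borel_measurable lebesgue" using Im by measurable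
      have "?I x * (\<bar>F' (u x)\<bar> * norm (G x)) \<le> K * (?I x * norm (G x)) + K * (\<bar>u x\<bar> * norm (G x))" for x
      proof (cases "x \<in> cball 0 R")
        case True
        have "\<bar>F' (u x)\<bar> * norm (G x) \<le> (K * (1 + \<bar>u x\<bar>)) * norm (G x)" by (intro mult_right_mono lin) simp
        thus ?thesis using True by (simp add: algebra_simps)
      next
        case False thus ?thesis using K0 by simp
      qed
      thus "AE x in lebesgue. norm (?I x *\<^sub>R norm (F' (u x) *\<^sub>R G x)) \<le> norm (K * (?I x * norm (G x)) + K * (norm (u x) * norm (G x)))"
        using K0 by (intro AE_I2) (simp add: abs_mult)
    qed
  qed
  have "(LINT x|lebesgue. F (u x) * frechet_derivative \<phi> (at x) b) = - (LINT x|lebesgue. ((F' (u x) *\<^sub>R G x) \<bullet> b) * \<phi> x)"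
    if phi: "\<phi> \<in> test_functions" and b: "b \<in> Basis" for \<phi> b
  proof -
    let ?t = "\<lambda>n. 1 / real (Suc n)"
    let ?D = "\<lambda>n x. u (x + ?t n *\<^sub>R b) - u x"
    obtain R where R: "\<And>x. norm x > R \<Longrightarrow> \<phi> x = 0" using test_function_support[OF phi] by metis
    obtain B where B: "B > 0" "\<And>x. \<bar>\<phi> x\<bar> \<le> B" using test_function_bounded[OF phi] by metis
    have pm[measurable]: "\<phi> \<in> borel_measurable lebesgue" by (rule test_function_measurable[OF phi])
    have DL: "?D n \<in> L2 lebesgue" for n by (intro L2_diff L2_translate u)
    \<comment> \<open>The weight in the pairing with the increments of \<open>u\<close>; it is square integrable because \<open>\<phi>\<close> has bounded support.\<close>
    let ?\<psi> = "\<lambda>x. F' (u x) * \<phi> x"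
    have psi: "?\<psi> \<in> L2 lebesgue"
    proof (rule L2_bound)
      let ?I = "indicator (cball 0 R) :: 'a \<Rightarrow> real"
      show "?\<psi> \<in> borel_measurable lebesgue" by measurable
      show "integrable lebesgue (\<lambda>x. (K * B)\<^sup>2 * (norm (?I x + norm (u x)))\<^sup>2)"
        by (intro integrable_mult_right L2_integrable L2_add indicator_ball_L2 L2_norm_fun u)
      show "AE x in lebesgue. (norm (?\<psi> x))\<^sup>2 \<le> (K * B)\<^sup>2 * (norm (?I x + norm (u x)))\<^sup>2"
      proof (rule AE_I2)
        fix x
        show "(norm (?\<psi> x))\<^sup>2 \<le> (K * B)\<^sup>2 * (norm (?I x + norm (u x)))\<^sup>2"
        proof (cases "x \<in> cball 0 R")
          case True
          have "\<bar>F' (u x)\<bar> * \<bar>\<phi> x\<bar> \<le> (K * (1 + \<bar>u x\<bar>)) * B" using lin B K0 by (intro mult_mono) auto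
          hence "\<bar>?\<psi> x\<bar> \<le> (K * B) * (1 + \<bar>u x\<bar>)" by (simp add: abs_mult algebra_simps)
          hence "\<bar>?\<psi> x\<bar>\<^sup>2 \<le> ((K * B) * (1 + \<bar>u x\<bar>))\<^sup>2" by (rule power_mono) simp
          thus ?thesis using True by (simp add: power_mult_distrib)
        next
          case False thus ?thesis using R[of x] by simp
        qed
      qed
    qed
    \<comment> \<open>\<open>?A\<close> are the quotients for \<open>F (u x)\<close>, \<open>?B\<close> their linearisations. Their limits are the two sides of the claim.\<close>
    let ?A = "\<lambda>n. real (Suc n) * ((LINT x|lebesgue. F (u x) * \<phi> (x - ?t n *\<^sub>R b)) - (LINT x|lebesgue. F (u x) * \<phi> x))"
    let ?B = "\<lambda>n. real (Suc n) * l2_inner lebesgue (?D n) ?\<psi>"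
    have "((\<lambda>s. ((LINT x|lebesgue. F (u x) * \<phi> (x + s *\<^sub>R (-b))) - (LINT x|lebesgue. F (u x) * \<phi> x)) / s)
      \<longlongrightarrow> (LINT x|lebesgue. F (u x) * frechet_derivative \<phi> (at x) (-b))) (at 0)"
      using integral_test_translate_derivative[OF lF phi, of "-b" 0] by (simp add: DERIV_def)
    from filterlim_compose[OF this seq_inverse_tendsto_at_0]
    have "?A \<longlonglongrightarrow> (LINT x|lebesgue. F (u x) * frechet_derivative \<phi> (at x) (-b))"
      by (simp add: mult.commute del: of_nat_Suc)
    also have "(LINT x|lebesgue. F (u x) * frechet_derivative \<phi> (at x) (-b)) = - (LINT x|lebesgue. F (u x) * frechet_derivative \<phi> (at x) b)"
      using linear_neg[OF has_derivative_linear[OF test_function_has_derivative[OF phi]]] by simp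
    finally have A: "?A \<longlonglongrightarrow> - (LINT x|lebesgue. F (u x) * frechet_derivative \<phi> (at x) b)" .
    have Bl: "?B \<longlonglongrightarrow> l2_inner lebesgue (\<lambda>x. G x \<bullet> b) ?\<psi>"
      by (rule difference_quotient_weak_limit[OF W psi])
    have "(\<lambda>n. ?A n - ?B n) \<longlonglongrightarrow> 0"
    proof (rule Lim_null_comparison, rule always_eventually, rule allI)
      fix n
      let ?h = "?t n *\<^sub>R b"
      have hm: "(\<lambda>x. F (u (x + ?h))) \<in> borel_measurable lebesgue" by (rule measurable_translate[OF FuM])
      have i1: "integrable lebesgue (\<lambda>x. F (u (x + ?h)) * \<phi> x)" by (rule integral_translate_test(2)[OF lF phi])
      have i2: "integrable lebesgue (\<lambda>x. F (u x) * \<phi> x)" by (rule locally_integrable_test_mult[OF lF phi])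
      have i3: "integrable lebesgue (\<lambda>x. ?D n x * ?\<psi> x)" by (rule L2_integrable_mult[OF DL psi])
      have "(LINT x|lebesgue. F (u x) * \<phi> (x - ?h)) - (LINT x|lebesgue. F (u x) * \<phi> x) - l2_inner lebesgue (?D n) ?\<psi>
          = (LINT x|lebesgue. F (u (x + ?h)) * \<phi> x - F (u x) * \<phi> x - ?D n x * ?\<psi> x)"
        unfolding l2_inner_def inner_real_def integral_translate_test(1)[OF lF phi, symmetric]
        using i1 i2 i3 by (simp del: of_nat_Suc)
      hence "\<bar>(LINT x|lebesgue. F (u x) * \<phi> (x - ?h)) - (LINT x|lebesgue. F (u x) * \<phi> x) - l2_inner lebesgue (?D n) ?\<psi>\<bar>
          \<le> (LINT x|lebesgue. norm (F (u (x + ?h)) * \<phi> x - F (u x) * \<phi> x - ?D n x * ?\<psi> x))"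
        using integral_norm_bound[of lebesgue "\<lambda>x. F (u (x + ?h)) * \<phi> x - F (u x) * \<phi> x - ?D n x * ?\<psi> x"] by simp
      also have "\<dots> \<le> (LINT x|lebesgue. (L * B) * (norm (?D n x))\<^sup>2)"
      proof (rule integral_mono)
        show "integrable lebesgue (\<lambda>x. norm (F (u (x + ?h)) * \<phi> x - F (u x) * \<phi> x - ?D n x * ?\<psi> x))"
          using i1 i2 i3 by (intro integrable_norm Bochner_Integration.integrable_diff)
        show "integrable lebesgue (\<lambda>x. (L * B) * (norm (?D n x))\<^sup>2)"
          by (intro integrable_mult_right L2_integrable DL)
        fix x
        have "F (u (x + ?h)) * \<phi> x - F (u x) * \<phi> x - ?D n x * ?\<psi> x = (F (u (x + ?h)) - F (u x) - F' (u x) * ?D n x) * \<phi> x"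
          by (simp add: algebra_simps)
        hence "norm (F (u (x + ?h)) * \<phi> x - F (u x) * \<phi> x - ?D n x * ?\<psi> x) = \<bar>F (u (x + ?h)) - F (u x) - F' (u x) * ?D n x\<bar> * \<bar>\<phi> x\<bar>"
          by (simp add: abs_mult)
        also have "\<dots> \<le> (L * (?D n x)\<^sup>2) * B" using taylor B L0 by (intro mult_mono) auto
        finally show "norm (F (u (x + ?h)) * \<phi> x - F (u x) * \<phi> x - ?D n x * ?\<psi> x) \<le> (L * B) * (norm (?D n x))\<^sup>2"
          by (simp add: mult.commute mult.left_commute)
      qed
      also have "\<dots> = (L * B) * (l2_norm lebesgue (?D n))\<^sup>2" by (simp add: l2_norm_sq)
      also have "\<dots> \<le> (L * B) * (norm ?h * l2_norm lebesgue G)\<^sup>2"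
        using L0 B by (intro mult_left_mono power_mono translation_difference_le[OF W]) auto
      finally have "real (Suc n) * \<bar>(LINT x|lebesgue. F (u x) * \<phi> (x - ?h)) - (LINT x|lebesgue. F (u x) * \<phi> x) - l2_inner lebesgue (?D n) ?\<psi>\<bar>
          \<le> real (Suc n) * ((L * B) * (norm ?h * l2_norm lebesgue G)\<^sup>2)" by (rule mult_left_mono) simp
      also have "\<dots> = ((L * B) * (l2_norm lebesgue G)\<^sup>2) * ?t n"
        using b by (simp add: power_mult_distrib power2_eq_square del: of_nat_Suc)
      finally have fin: "real (Suc n) * \<bar>(LINT x|lebesgue. F (u x) * \<phi> (x - ?h)) - (LINT x|lebesgue. F (u x) * \<phi> x) - l2_inner lebesgue (?D n) ?\<psi>\<bar>
          \<le> ((L * B) * (l2_norm lebesgue G)\<^sup>2) * ?t n" .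
      have "?A n - ?B n = real (Suc n) * ((LINT x|lebesgue. F (u x) * \<phi> (x - ?h)) - (LINT x|lebesgue. F (u x) * \<phi> x) - l2_inner lebesgue (?D n) ?\<psi>)"
        by (simp only: right_diff_distrib)
      hence "norm (?A n - ?B n) = real (Suc n) * \<bar>(LINT x|lebesgue. F (u x) * \<phi> (x - ?h)) - (LINT x|lebesgue. F (u x) * \<phi> x) - l2_inner lebesgue (?D n) ?\<psi>\<bar>"
        by (simp only: real_norm_def abs_mult abs_of_nat)
      thus "norm (?A n - ?B n) \<le> ((L * B) * (l2_norm lebesgue G)\<^sup>2) * ?t n" using fin by simp
    next
      show "(\<lambda>n. ((L * B) * (l2_norm lebesgue G)\<^sup>2) * ?t n) \<longlonglongrightarrow> 0"
        using tendsto_mult[OF tendsto_const[of "(L * B) * (l2_norm lebesgue G)\<^sup>2"] LIMSEQ_Suc[OF lim_1_over_n]] by simp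
    qed
    with tendsto_diff[OF A Bl]
    have "- (LINT x|lebesgue. F (u x) * frechet_derivative \<phi> (at x) b) - l2_inner lebesgue (\<lambda>x. G x \<bullet> b) ?\<psi> = 0"
      using LIMSEQ_unique by blast
    moreover have "l2_inner lebesgue (\<lambda>x. G x \<bullet> b) ?\<psi> = (LINT x|lebesgue. ((F' (u x) *\<^sub>R G x) \<bullet> b) * \<phi> x)"
      by (simp add: l2_inner_def algebra_simps)
    ultimately show ?thesis by linarith
  qed
  thus ?thesis using lF lF' by (simp add: has_weak_gradient_def)
qed

lemma weak_gradient_square:
  assumes W: "wdiff lebesgue u G"
  shows "has_weak_gradient (\<lambda>x. (u x)\<^sup>2) (\<lambda>x. (2 * u x) *\<^sub>R G x)"
proof (rule weak_chain_rule[OF W, where F="\<lambda>s. s\<^sup>2" and F'="\<lambda>s. 2 * s" and L=1 and K=2])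
  fix a b :: real
  have "b\<^sup>2 - a\<^sup>2 - 2 * a * (b - a) = (b - a)\<^sup>2" by (simp add: power2_eq_square algebra_simps)
  thus "\<bar>b\<^sup>2 - a\<^sup>2 - 2 * a * (b - a)\<bar> \<le> 1 * (b - a)\<^sup>2" by simp
qed auto

text \<open>A bounded function with bounded second derivative whose derivative is \<open>1\<close> at \<open>0\<close> and decays at infinity.\<close>

definition saturate :: "real \<Rightarrow> real" where "saturate s = s / (1 + s\<^sup>2)"
definition saturate' :: "real \<Rightarrow> real" where "saturate' s = (1 - s\<^sup>2) / (1 + s\<^sup>2)\<^sup>2"

lemma one_plus_sq_pos: "1 + (s::real)\<^sup>2 > 0" 
  by (smt (verit) zero_le_power2)

lemma two_abs_le: "2 * \<bar>s\<bar> \<le> 1 + (s::real)\<^sup>2"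
proof -
  have "0 \<le> (\<bar>s\<bar> - 1)\<^sup>2" by simp
  thus ?thesis by (simp add: power2_diff)
qed

lemma saturate'_bound: "\<bar>saturate' s\<bar> \<le> 1"
proof -
  have "\<bar>1 - s\<^sup>2\<bar> \<le> 1 + s\<^sup>2" by (simp add: abs_le_iff)
  also have "\<dots> \<le> (1 + s\<^sup>2)\<^sup>2" 
    using mult_left_mono[of 1 "1 + s\<^sup>2" "1 + s\<^sup>2"] by (simp add: power2_eq_square)
  finally show ?thesis by (simp add: saturate'_def divide_le_eq one_plus_sq_pos)
qed

lemma saturate_taylor: "\<bar>saturate b - saturate a - saturate' a * (b - a)\<bar> \<le> 2 * (b - a)\<^sup>2"
proof -
  let ?A = "1 + a\<^sup>2" and ?B = "1 + b\<^sup>2"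
  have pos: "?A > 0" "?B > 0" by (rule one_plus_sq_pos)+
  \<comment> \<open>The remainder is computed exactly; the factor \<open>(b - a)\<^sup>2\<close> splits off.\<close>
  have eq: "saturate b - saturate a - saturate' a * (b - a) = - (b - a)\<^sup>2 * (2 * a + b - a\<^sup>2 * b) / (?A\<^sup>2 * ?B)"
    using pos unfolding saturate_def saturate'_def 
    by (simp add: divide_simps) (simp add: power2_eq_square algebra_simps)
  have "\<bar>2 * a + b - a\<^sup>2 * b\<bar> \<le> 2 * \<bar>a\<bar> + \<bar>b\<bar> * ?A"
    by (simp add: abs_le_iff algebra_simps) (smt (verit) mult_minus_left mult_nonneg_nonneg zero_le_power2 mult_left_mono mult.commute abs_ge_self abs_ge_minus_self)
  also have "\<dots> \<le> ?A * ?B + ?A * ?B"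
  proof (rule add_mono)
    have "2 * \<bar>a\<bar> * 1 \<le> ?A * ?B" using two_abs_le[of a] by (intro mult_mono) auto
    thus "2 * \<bar>a\<bar> \<le> ?A * ?B" by simp
    have "\<bar>b\<bar> * ?A \<le> ?B * ?A" using two_abs_le[of b] by (intro mult_right_mono) auto
    thus "\<bar>b\<bar> * ?A \<le> ?A * ?B" by (simp add: mult.commute)
  qed
  also have "\<dots> \<le> 2 * (?A\<^sup>2 * ?B)" 
  proof -
    have "?A * ?B * 1 \<le> ?A * ?B * ?A" using pos by (intro mult_left_mono) auto
    thus ?thesis by (simp add: power2_eq_square mult.commute mult.left_commute)
  qed
  finally have "\<bar>2 * a + b - a\<^sup>2 * b\<bar> / (?A\<^sup>2 * ?B) \<le> 2" using pos by (simp add: divide_le_eq)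
  hence "(b - a)\<^sup>2 * (\<bar>2 * a + b - a\<^sup>2 * b\<bar> / (?A\<^sup>2 * ?B)) \<le> (b - a)\<^sup>2 * 2" by (rule mult_left_mono) simp
  thus ?thesis unfolding eq using pos by (simp add: abs_mult abs_divide)
qed

lemma saturate_measurable [measurable]: "saturate \<in> borel_measurable borel" "saturate' \<in> borel_measurable borel"
  unfolding saturate_def[abs_def] saturate'_def[abs_def] by measurable

text \<open>Apply the chain rule to \<open>saturate (n * s) / n\<close>. These functions tend to \<open>0\<close> uniformly, while their derivatives tend
  boundedly to the indicator of \<open>{0}\<close>. So the gradient restricted to the zero set has vanishing integral against
  every test function.\<close>

theorem weak_gradient_zero_level:
  assumes W: "wdiff lebesgue u G"
  shows "AE x in lebesgue. u x = 0 \<longrightarrow> G x = 0"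
proof -
  have u: "u \<in> L2 lebesgue" and G: "G \<in> L2 lebesgue" and wg: "has_weak_gradient u G" 
    using W by (auto simp: wdiff_def)
  have um[measurable]: "u \<in> borel_measurable lebesgue" and Gm[measurable]: "G \<in> borel_measurable lebesgue"
    using u G by (auto simp: L2_def)
  have lG: "locally_integrable G" and lu: "locally_integrable u" using u G by (auto intro: L2_locally_integrable)
  let ?F = "\<lambda>n s. saturate (real (Suc n) * s) / real (Suc n)"
  let ?F' = "\<lambda>n s. saturate' (real (Suc n) * s)"
  have chain: "has_weak_gradient (\<lambda>x. ?F n (u x)) (\<lambda>x. ?F' n (u x) *\<^sub>R G x)" for n
  proof (rule weak_chain_rule[OF W, where L="2 * real (Suc n)" and K=1])
    show "?F n \<in> borel_measurable borel" "?F' n \<in> borel_measurable borel" by measurable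
    fix a b :: real
    let ?k = "real (Suc n)"
    have "\<bar>saturate (?k * b) - saturate (?k * a) - saturate' (?k * a) * (?k * b - ?k * a)\<bar> \<le> 2 * (?k * b - ?k * a)\<^sup>2"
      by (rule saturate_taylor)
    also have "\<dots> = ?k * (2 * ?k * (b - a)\<^sup>2)" by (simp add: power2_eq_square algebra_simps)
    also have "saturate (?k * b) - saturate (?k * a) - saturate' (?k * a) * (?k * b - ?k * a) = 
        ?k * (?F n b - ?F n a - ?F' n a * (b - a))"
      by (simp add: right_diff_distrib mult.left_commute del: of_nat_Suc)
    finally have "?k * \<bar>?F n b - ?F n a - ?F' n a * (b - a)\<bar> \<le> ?k * (2 * ?k * (b - a)\<^sup>2)"
      by (simp only: abs_mult abs_of_nat)
    thus "\<bar>?F n b - ?F n a - ?F' n a * (b - a)\<bar> \<le> 2 * ?k * (b - a)\<^sup>2"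
      by (rule mult_left_le_imp_le) simp
    show "\<bar>?F' n a\<bar> \<le> 1 * (1 + \<bar>a\<bar>)" using saturate'_bound[of "?k * a"] by simp
  qed
  have Fabs: "\<bar>?F n s\<bar> \<le> 1 / real (Suc n)" for n s
  proof -
    let ?k = "real (Suc n) * s"
    have "\<bar>?k\<bar> \<le> 1 + ?k\<^sup>2" using two_abs_le[of ?k] by linarith
    hence "\<bar>saturate ?k\<bar> \<le> 1" unfolding saturate_def using one_plus_sq_pos[of ?k] 
      by (simp add: divide_le_eq del: of_nat_Suc)
    thus ?thesis by (simp add: divide_right_mono del: of_nat_Suc)
  qed
  have F'lim: "(\<lambda>n. ?F' n s) \<longlonglongrightarrow> (if s = 0 then 1 else 0)" for s
  proof (cases "s = 0")
    case True thus ?thesis by (simp add: saturate'_def)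
  next
    case False
    have le: "\<bar>?F' n s\<bar> \<le> (1 / s\<^sup>2) * (1 / real (Suc n))" for n
    proof -
      let ?k = "real (Suc n) * s"
      have "\<bar>1 - ?k\<^sup>2\<bar> \<le> 1 + ?k\<^sup>2" by (simp add: abs_le_iff del: of_nat_Suc)
      hence "\<bar>?F' n s\<bar> \<le> (1 + ?k\<^sup>2) / (1 + ?k\<^sup>2)\<^sup>2" unfolding saturate'_def
        by (simp add: divide_right_mono del: of_nat_Suc)
      also have "\<dots> = 1 / (1 + ?k\<^sup>2)" using one_plus_sq_pos[of ?k] by (simp add: power2_eq_square del: of_nat_Suc)
      also have "\<dots> \<le> 1 / (s\<^sup>2 * real (Suc n))"
      proof (rule divide_left_mono)
        have "s\<^sup>2 * real (Suc n) * 1 \<le> s\<^sup>2 * real (Suc n) * real (Suc n)" by (rule mult_left_mono) simp_all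
        thus "s\<^sup>2 * real (Suc n) \<le> 1 + ?k\<^sup>2" by (simp add: power2_eq_square algebra_simps del: of_nat_Suc)
        show "0 < (1 + ?k\<^sup>2) * (s\<^sup>2 * real (Suc n))" using False one_plus_sq_pos[of ?k] 
          by (intro mult_pos_pos) auto
      qed simp
      finally show ?thesis by simp
    qed
    have lim0: "(\<lambda>n. (1 / s\<^sup>2) * (1 / real (Suc n))) \<longlonglongrightarrow> 0"
      using tendsto_mult[OF tendsto_const[of "1 / s\<^sup>2"] LIMSEQ_Suc[OF lim_1_over_n]] by simp
    have "(\<lambda>n. ?F' n s) \<longlonglongrightarrow> 0"
      by (rule Lim_null_comparison[OF _ lim0], rule always_eventually, rule allI, unfold real_norm_def, rule le)
    thus ?thesis using False by simp
  qed
  let ?Z = "\<lambda>x. (if u x = 0 then 1 else 0 :: real)"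
  have Zm: "?Z \<in> borel_measurable lebesgue" by measurable
  have "AE x in lebesgue. ?Z x * (G x \<bullet> b) = 0" if b: "b \<in> Basis" for b
  proof (rule fundamental_lemma)
    have "locally_integrable (\<lambda>x. G x \<bullet> b)" by (rule locally_integrable_inner[OF lG])
    have "(\<lambda>x. ?Z x * (G x \<bullet> b)) \<in> L2 lebesgue"
      by (rule L2_bounded_mult(1)[OF L2_inner_const[OF G] Zm, where B=1]) auto
    thus "locally_integrable (\<lambda>x. ?Z x * (G x \<bullet> b))" by (rule L2_locally_integrable)
    fix \<phi> :: "'a \<Rightarrow> real" assume phi: "\<phi> \<in> test_functions"
    have pm[measurable]: "\<phi> \<in> borel_measurable lebesgue" by (rule test_function_measurable[OF phi])
    let ?d = "\<lambda>x. frechet_derivative \<phi> (at x) b"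
    have dt: "?d \<in> test_functions" by (rule test_function_derivative[OF phi])
    have dm[measurable]: "?d \<in> borel_measurable lebesgue" by (rule test_function_measurable[OF dt])
    have Gi: "integrable lebesgue (\<lambda>x. (G x \<bullet> b) * \<phi> x)"
      by (rule locally_integrable_test_mult[OF locally_integrable_inner[OF lG] phi])
    have di: "integrable lebesgue ?d"
    proof -
      have "locally_integrable (\<lambda>x::'a. 1::real)" 
        unfolding locally_integrable_def set_integrable_def
        by (auto intro!: integrable_real_indicator simp: compact_imp_closed emeasure_bounded_finite[OF compact_imp_bounded, unfolded infinity_ennreal_def])
      from locally_integrable_test_mult[OF this dt] show ?thesis by simp
    qed
    have "(\<lambda>n. LINT x|lebesgue. ?F' n (u x) * ((G x \<bullet> b) * \<phi> x)) \<longlonglongrightarrow> (LINT x|lebesgue. ?Z x * ((G x \<bullet> b) * \<phi> x))"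
    proof (rule integral_dominated_convergence[where w="\<lambda>x. norm ((G x \<bullet> b) * \<phi> x)"])
      show "AE x in lebesgue. norm (?F' n (u x) * ((G x \<bullet> b) * \<phi> x)) \<le> norm ((G x \<bullet> b) * \<phi> x)" for n
        using saturate'_bound by (intro AE_I2) (simp add: abs_mult mult_left_le_one_le del: of_nat_Suc)
      show "AE x in lebesgue. (\<lambda>n. ?F' n (u x) * ((G x \<bullet> b) * \<phi> x)) \<longlonglongrightarrow> ?Z x * ((G x \<bullet> b) * \<phi> x)"
        by (intro AE_I2 tendsto_mult F'lim tendsto_const)
      show "integrable lebesgue (\<lambda>x. norm ((G x \<bullet> b) * \<phi> x))" using Gi by (rule integrable_norm)
    qed measurable
    moreover have lim0: "(\<lambda>n. LINT x|lebesgue. ?F n (u x) * ?d x) \<longlonglongrightarrow> integral\<^sup>L lebesgue (\<lambda>x::'a. 0)"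
    proof (rule integral_dominated_convergence[where w="\<lambda>x. norm (?d x)"])
      have le: "\<bar>?F n (u x) * ?d x\<bar> \<le> (1 / real (Suc n)) * \<bar>?d x\<bar>" for n x
        unfolding abs_mult by (intro mult_right_mono Fabs) simp
      have le1: "(1 / real (Suc n)) * \<bar>?d x\<bar> \<le> 1 * \<bar>?d x\<bar>" for n x by (rule mult_right_mono) simp_all
      show "AE x in lebesgue. norm (?F n (u x) * ?d x) \<le> norm (?d x)" for n
        using order_trans[OF le le1] by (intro AE_I2) (simp only: real_norm_def mult_1)
      show "AE x in lebesgue. (\<lambda>n. ?F n (u x) * ?d x) \<longlonglongrightarrow> 0"
      proof (rule AE_I2)
        fix x
        have "(\<lambda>n. (1 / real (Suc n)) * \<bar>?d x\<bar>) \<longlonglongrightarrow> 0"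
          using tendsto_mult[OF LIMSEQ_Suc[OF lim_1_over_n] tendsto_const[of "\<bar>?d x\<bar>"]] by simp
        thus "(\<lambda>n. ?F n (u x) * ?d x) \<longlonglongrightarrow> 0"
          by (rule Lim_null_comparison[rotated], intro always_eventually allI) (unfold real_norm_def, rule le)
      qed
      show "integrable lebesgue (\<lambda>x. norm (?d x))" using di by (rule integrable_norm)
    qed measurable
    moreover have eq: "(LINT x|lebesgue. ?F n (u x) * ?d x) = - (LINT x|lebesgue. ?F' n (u x) * ((G x \<bullet> b) * \<phi> x))" for n
      using weak_gradient_identity[OF chain[of n] phi, of b] by (simp add: mult.assoc del: of_nat_Suc)
    ultimately have "- (LINT x|lebesgue. ?Z x * ((G x \<bullet> b) * \<phi> x)) = integral\<^sup>L lebesgue (\<lambda>x::'a. 0)"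
      by (intro LIMSEQ_unique[OF tendsto_minus lim0[unfolded eq]])
    hence "(LINT x|lebesgue. ?Z x * ((G x \<bullet> b) * \<phi> x)) = 0" by simp
    thus "(LINT x|lebesgue. ?Z x * (G x \<bullet> b) * \<phi> x) = 0" by (simp add: mult.assoc)
  qed
  hence "AE x in lebesgue. \<forall>b\<in>Basis. ?Z x * (G x \<bullet> b) = 0" by (intro AE_finite_allI) auto
  thus ?thesis
  proof eventually_elim
    case (elim x)
    show ?case
    proof
      assume "u x = 0"
      thus "G x = 0" using elim by (intro euclidean_eqI[of "G x" 0]) simp
    qed
  qed
qed

section \<open>Averages over balls\<close>

text \<open>The type argument fixes the dimension.\<close>

definition ball_volume :: "'a::euclidean_space itself \<Rightarrow> real \<Rightarrow> real" where
  "ball_volume _ r = measure lborel (cball (0::'a) r)"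

text \<open>Averages of Borel functions are taken with the Borel measure, so that Fubini's theorem for product measures applies.\<close>

definition average :: "real \<Rightarrow> ('a::euclidean_space \<Rightarrow> 'b::euclidean_space) \<Rightarrow> 'a \<Rightarrow> 'b" where
  "average r f x = (1 / ball_volume TYPE('a) r) *\<^sub>R (LINT y|lborel. indicator (cball 0 r) y *\<^sub>R f (x + y))"

lemma ball_volume_pos: "r > 0 \<Longrightarrow> ball_volume TYPE('a::euclidean_space) r > 0"
  unfolding ball_volume_def using content_cball_pos[of r "0::'a"] by simp

lemma l2_norm_indicator_ball: "(l2_norm lebesgue (indicator (cball (0::'a::euclidean_space) r) :: 'a \<Rightarrow> real))\<^sup>2 = ball_volume TYPE('a) r"
proof -
  have eq: "(\<lambda>x::'a. (norm (indicator (cball 0 r) x :: real))\<^sup>2) = indicator (cball 0 r)"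
    by (auto simp: indicator_def)
  show ?thesis unfolding l2_norm_sq eq ball_volume_def by simp
qed

lemma l2_norm_indicator_ball_sqrt: 
  "l2_norm lebesgue (indicator (cball (0::'a::euclidean_space) r) :: 'a \<Rightarrow> real) = sqrt (ball_volume TYPE('a) r)"
  using l2_norm_indicator_ball[where 'a='a, of r] by (metis l2_norm_nonneg real_sqrt_unique)

lemma borel_measurable_lborel_pair:
  fixes f :: "'a::euclidean_space \<times> 'a \<Rightarrow> 'b::topological_space"
  assumes "f \<in> borel_measurable (borel \<Otimes>\<^sub>M borel)"
  shows "f \<in> borel_measurable (lborel \<Otimes>\<^sub>M lborel)"
  using assms unfolding measurable_cong_sets[OF sets_pair_measure_cong[OF sets_lborel sets_lborel] refl] .

lemma borel_measurable_lborelI: "f \<in> borel_measurable borel \<Longrightarrow> f \<in> borel_measurable lborel"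
  by simp

lemma borel_measurable_shift:
  fixes f :: "'a::euclidean_space \<Rightarrow> 'b::topological_space"
  assumes "f \<in> borel_measurable borel"
  shows "(\<lambda>y. f (x + y)) \<in> borel_measurable borel"
  by (rule measurable_compose[OF _ assms]) measurable

lemma borel_measurable_pair_shift:
  fixes f :: "'a::euclidean_space \<Rightarrow> 'b::topological_space"
  assumes "f \<in> borel_measurable borel"
  shows "(\<lambda>p. f (fst p + snd p)) \<in> borel_measurable (borel \<Otimes>\<^sub>M borel)"
  by (rule measurable_compose[OF _ assms]) measurable

lemma borel_measurable_indicator_cball:
  "(indicator (cball (0::'a::euclidean_space) r) :: 'a \<Rightarrow> real) \<in> borel_measurable borel"
  by (intro borel_measurable_indicator) simp

lemma average_integrable:
  assumes f: "f \<in> L2 lebesgue" "f \<in> borel_measurable borel"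
  shows "integrable lborel (\<lambda>y. indicator (cball 0 r) y *\<^sub>R f (x + y))"
proof -
  have "(\<lambda>y. f (x + y)) \<in> L2 lebesgue" using L2_translate[OF f(1), of x] by (simp add: add.commute)
  hence "integrable lebesgue (\<lambda>y. indicator (cball 0 r) y *\<^sub>R f (x + y))"
    by (intro locally_integrable_cball L2_locally_integrable)
  moreover have "(\<lambda>y. indicator (cball 0 r) y *\<^sub>R f (x + y)) \<in> borel_measurable lborel"
    by (intro borel_measurable_lborelI borel_measurable_scaleR borel_measurable_shift[OF f(2)] borel_measurable_indicator_cball)
  ultimately show ?thesis by (simp add: integrable_completion)
qed

lemma average_measurable:
  assumes f[measurable]: "f \<in> borel_measurable borel"
  shows "average r f \<in> borel_measurable borel"
proof -
  have "(\<lambda>x. LINT y|lborel. indicator (cball 0 r) y *\<^sub>R f (x + y)) \<in> borel_measurable lborel"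
  proof (rule lborel.borel_measurable_lebesgue_integral, rule borel_measurable_lborel_pair)
    note [measurable] = borel_measurable_pair_shift[OF f] borel_measurable_indicator_cball
    show "(\<lambda>(x, y). indicator (cball 0 r) y *\<^sub>R f (x + y)) \<in> borel_measurable (borel \<Otimes>\<^sub>M borel)"
      unfolding case_prod_beta by measurable
  qed
  thus ?thesis unfolding average_def[abs_def] by measurable
qed

text \<open>Jensen's inequality for the square, obtained from the Cauchy-Schwarz inequality with the indicator of the ball.\<close>

lemma average_diff_pointwise:
  fixes f :: "'a::euclidean_space \<Rightarrow> 'b::euclidean_space"
  assumes f: "f \<in> L2 lebesgue" and fb: "f \<in> borel_measurable borel" and r: "r > 0"
  shows "ennreal ((norm (average r f x - f x))\<^sup>2) \<le> 
     (\<integral>\<^sup>+y. ennreal (indicator (cball 0 r) y / ball_volume TYPE('a) r * (norm (f (x + y) - f x))\<^sup>2) \<partial>lborel)"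
proof -
  let ?B = "indicator (cball 0 r) :: 'a \<Rightarrow> real" and ?V = "ball_volume TYPE('a) r"
  note fb[measurable]
  have V: "?V > 0" by (rule ball_volume_pos[OF r])
  have B: "?B \<in> L2 lebesgue" by (rule indicator_ball_L2)
  have iB: "integrable lborel ?B" using emeasure_bounded_finite[of "cball (0::'a) r"] 
    by (intro integrable_real_indicator) auto
  have fx: "(\<lambda>y. f (x + y)) \<in> L2 lebesgue" using L2_translate[OF f, of x] by (simp add: add.commute)
  let ?g = "\<lambda>y. ?B y *\<^sub>R (f (x + y) - f x)"
  have "(\<lambda>y. ?B y *\<^sub>R f (x + y)) \<in> L2 lebesgue"
  proof (rule L2_bound[OF _ L2_integrable[OF fx]])
    show "(\<lambda>y. ?B y *\<^sub>R f (x + y)) \<in> borel_measurable lebesgue" using L2_measurable[OF fx] L2_measurable[OF B] by measurable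
  qed (auto simp: indicator_def)
  from L2_diff[OF this L2_scaleR_const[OF B, of "f x"]] have gL: "?g \<in> L2 lebesgue"
    by (simp add: scaleR_diff_right)
  have "integrable lborel (\<lambda>y. ?B y *\<^sub>R f x)" using iB by (rule integrable_scaleR_left)
  hence "(LINT y|lborel. ?g y) = (LINT y|lborel. ?B y *\<^sub>R f (x + y)) - ?V *\<^sub>R f x"
    using average_integrable[OF f fb] unfolding scaleR_diff_right ball_volume_def by (simp add: iB)
  hence "average r f x - f x = (1 / ?V) *\<^sub>R (LINT y|lborel. ?g y)"
    using V by (simp add: average_def scaleR_diff_right)
  also have "(LINT y|lborel. ?g y) = (LINT y|lebesgue. ?g y)"
    by (intro integral_completion[symmetric] borel_measurable_lborelI borel_measurable_scaleR borel_measurable_diff borel_measurable_const borel_measurable_shift[OF fb] borel_measurable_indicator_cball)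
  finally have "norm (average r f x - f x) = (1 / ?V) * norm (LINT y|lebesgue. ?g y)" using V by simp
  also have "norm (LINT y|lebesgue. ?g y) \<le> (LINT y|lebesgue. norm (?g y))" by (rule integral_norm_bound)
  also have "(LINT y|lebesgue. norm (?g y)) = l2_inner lebesgue ?B (\<lambda>y. norm (?g y))"
    unfolding l2_inner_def by (intro Bochner_Integration.integral_cong) (auto simp: indicator_def)
  also have "\<dots> \<le> sqrt ?V * l2_norm lebesgue (\<lambda>y. norm (?g y))"
    using l2_Cauchy_Schwarz[OF B L2_norm_fun[OF gL]] unfolding l2_norm_indicator_ball_sqrt by linarith
  finally have "norm (average r f x - f x) \<le> (1 / ?V) * (sqrt ?V * l2_norm lebesgue ?g)" 
    unfolding l2_norm_norm using V by (simp add: divide_right_mono mult_left_mono)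
  hence "(norm (average r f x - f x))\<^sup>2 \<le> ((1 / ?V) * (sqrt ?V * l2_norm lebesgue ?g))\<^sup>2" 
    by (rule power_mono) simp
  also have "\<dots> = (1 / ?V) * (l2_norm lebesgue ?g)\<^sup>2" using V by (simp add: power_mult_distrib power_divide) (simp add: power2_eq_square)
  finally have "ennreal ((norm (average r f x - f x))\<^sup>2) \<le> ennreal ((1 / ?V) * (l2_norm lebesgue ?g)\<^sup>2)" by (rule ennreal_leI)
  also have "\<dots> = ennreal (LINT y|lebesgue. (1 / ?V) * (norm (?g y))\<^sup>2)" by (simp add: l2_norm_sq)
  also have "\<dots> = (\<integral>\<^sup>+y. ennreal ((1 / ?V) * (norm (?g y))\<^sup>2) \<partial>lebesgue)"
    using V by (intro nn_integral_eq_integral[symmetric] integrable_mult_right L2_integrable gL) auto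
  also have "\<dots> = (\<integral>\<^sup>+y. ennreal (?B y / ?V * (norm (f (x + y) - f x))\<^sup>2) \<partial>lborel)"
    unfolding nn_integral_completion by (intro nn_integral_cong) (auto simp: indicator_def)
  finally show ?thesis .
qed

text \<open>Exchanging the integrals, the squared distance to the average is at most a mean of squared translation differences.\<close>

theorem average_close:
  fixes f :: "'a::euclidean_space \<Rightarrow> 'b::euclidean_space"
  assumes f: "f \<in> L2 lebesgue" and fb: "f \<in> borel_measurable borel" and r: "r > 0"
    and e: "\<And>h. norm h \<le> r \<Longrightarrow> l2_norm lebesgue (\<lambda>x. f (x + h) - f x) \<le> e"
  shows "(\<lambda>x. average r f x - f x) \<in> L2 lebesgue" "l2_norm lebesgue (\<lambda>x. average r f x - f x) \<le> e"
proof -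
  let ?B = "indicator (cball 0 r) :: 'a \<Rightarrow> real" and ?V = "ball_volume TYPE('a) r"
  note fb[measurable]
  have V: "?V > 0" by (rule ball_volume_pos[OF r])
  have e0: "e \<ge> 0" using e[of 0] r by simp
  have am[measurable]: "average r f \<in> borel_measurable borel" by (rule average_measurable[OF fb])
  have dm: "(\<lambda>x. average r f x - f x) \<in> borel_measurable lebesgue" by (intro measurable_completion) simp
  have "(\<integral>\<^sup>+x. ennreal ((norm (average r f x - f x))\<^sup>2) \<partial>lebesgue) = (\<integral>\<^sup>+x. ennreal ((norm (average r f x - f x))\<^sup>2) \<partial>lborel)"
    by (rule nn_integral_completion)
  also have "\<dots> \<le> (\<integral>\<^sup>+x. \<integral>\<^sup>+y. ennreal (?B y / ?V * (norm (f (x + y) - f x))\<^sup>2) \<partial>lborel \<partial>lborel)"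
    by (intro nn_integral_mono average_diff_pointwise f fb r)
  also have "\<dots> = (\<integral>\<^sup>+y. \<integral>\<^sup>+x. ennreal (?B y / ?V * (norm (f (x + y) - f x))\<^sup>2) \<partial>lborel \<partial>lborel)"
  proof (rule lborel_pair.Fubini'[symmetric], rule borel_measurable_lborel_pair)
    note [measurable] = borel_measurable_pair_shift[OF fb] borel_measurable_indicator_cball
    show "(\<lambda>(x, y). ennreal (?B y / ?V * (norm (f (x + y) - f x))\<^sup>2)) \<in> borel_measurable (borel \<Otimes>\<^sub>M borel)"
      unfolding case_prod_beta by measurable
  qed
  also have "\<dots> \<le> (\<integral>\<^sup>+y. ennreal (e\<^sup>2 / ?V) * indicator (cball (0::'a) r) y \<partial>lborel)"
  proof (rule nn_integral_mono)
    fix y :: 'a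
    show "(\<integral>\<^sup>+x. ennreal (?B y / ?V * (norm (f (x + y) - f x))\<^sup>2) \<partial>lborel) \<le> ennreal (e\<^sup>2 / ?V) * indicator (cball 0 r) y"
    proof (cases "y \<in> cball 0 r")
      case True
      have D: "(\<lambda>x. f (x + y) - f x) \<in> L2 lebesgue" by (intro L2_diff L2_translate f)
      have "(\<integral>\<^sup>+x. ennreal (?B y / ?V * (norm (f (x + y) - f x))\<^sup>2) \<partial>lborel) = 
          (\<integral>\<^sup>+x. ennreal (1 / ?V * (norm (f (x + y) - f x))\<^sup>2) \<partial>lebesgue)"
        using True by (simp add: nn_integral_completion)
      also have "\<dots> = ennreal (LINT x|lebesgue. 1 / ?V * (norm (f (x + y) - f x))\<^sup>2)"
        using V by (intro nn_integral_eq_integral integrable_mult_right L2_integrable D) auto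
      also have "\<dots> = ennreal (1 / ?V * (l2_norm lebesgue (\<lambda>x. f (x + y) - f x))\<^sup>2)" by (simp add: l2_norm_sq)
      also have "\<dots> \<le> ennreal (1 / ?V * e\<^sup>2)"
        using V e[of y] True by (intro ennreal_leI mult_left_mono power_mono) auto
      finally show ?thesis using True by simp
    qed simp
  qed
  also have "\<dots> = ennreal (e\<^sup>2 / ?V) * emeasure lborel (cball (0::'a) r)"
    by (subst nn_integral_cmult_indicator) auto
  also have "emeasure lborel (cball (0::'a) r) = ennreal ?V"
    unfolding ball_volume_def using emeasure_bounded_finite[of "cball (0::'a) r"] 
    by (intro emeasure_eq_ennreal_measure) auto
  also have "ennreal (e\<^sup>2 / ?V) * ennreal ?V = ennreal (e\<^sup>2)" using V by (simp add: ennreal_mult[symmetric])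
  finally have le: "(\<integral>\<^sup>+x. ennreal ((norm (average r f x - f x))\<^sup>2) \<partial>lebesgue) \<le> ennreal (e\<^sup>2)" .
  have int: "integrable lebesgue (\<lambda>x. (norm (average r f x - f x))\<^sup>2)"
    by (rule integrableI_bounded) (use le dm in \<open>auto simp: le_less_trans\<close>)
  show "(\<lambda>x. average r f x - f x) \<in> L2 lebesgue" by (rule L2I[OF dm int])
  have "ennreal ((l2_norm lebesgue (\<lambda>x. average r f x - f x))\<^sup>2) \<le> ennreal (e\<^sup>2)"
    using le int by (simp add: l2_norm_sq nn_integral_eq_integral)
  hence "(l2_norm lebesgue (\<lambda>x. average r f x - f x))\<^sup>2 \<le> e\<^sup>2" by simp
  thus "l2_norm lebesgue (\<lambda>x. average r f x - f x) \<le> e" using e0 by (rule power2_le_imp_le)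
qed

text \<open>A difference of averages is an average of a translation difference, so both estimates are the Cauchy-Schwarz inequality
  with the indicator of the ball.\<close>

lemma average_difference_le:
  fixes u :: "'a::euclidean_space \<Rightarrow> real"
  assumes u: "u \<in> L2 lebesgue" and ub: "u \<in> borel_measurable borel" and r: "r > 0"
  shows "\<bar>average r u x\<bar> \<le> l2_norm lebesgue u / sqrt (ball_volume TYPE('a) r)"
    "\<bar>average r u x - average r u z\<bar> \<le> l2_norm lebesgue (\<lambda>y. u (y + (x - z)) - u y) / sqrt (ball_volume TYPE('a) r)"
proof -
  let ?B = "indicator (cball 0 r) :: 'a \<Rightarrow> real" and ?V = "ball_volume TYPE('a) r"
  note ub[measurable]
  have V: "?V > 0" by (rule ball_volume_pos[OF r])
  have B: "?B \<in> L2 lebesgue" by (rule indicator_ball_L2)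
  have L: "(\<lambda>y. u (x + y)) \<in> L2 lebesgue" for x using L2_translate[OF u, of x] by (simp add: add.commute)
  have eq: "average r u x = (1 / ?V) * l2_inner lebesgue ?B (\<lambda>y. u (x + y))" for x
  proof -
    have "(\<lambda>y. ?B y * u (x + y)) \<in> borel_measurable lborel"
      by (intro borel_measurable_lborelI borel_measurable_times borel_measurable_shift[OF ub] borel_measurable_indicator_cball)
    thus ?thesis unfolding average_def l2_inner_def by (simp add: integral_completion)
  qed
  have key: "\<bar>(1 / ?V) * l2_inner lebesgue ?B f\<bar> \<le> l2_norm lebesgue f / sqrt ?V" if f: "f \<in> L2 lebesgue" for f
  proof -
    have "\<bar>(1 / ?V) * l2_inner lebesgue ?B f\<bar> = (1 / ?V) * \<bar>l2_inner lebesgue ?B f\<bar>" using V by (simp add: abs_mult)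
    also have "\<dots> \<le> (1 / ?V) * (sqrt ?V * l2_norm lebesgue f)"
      using l2_Cauchy_Schwarz[OF B f] V unfolding l2_norm_indicator_ball_sqrt by (intro mult_left_mono) auto
    also have "\<dots> = l2_norm lebesgue f / sqrt ?V" using V by (simp add: field_simps)
    finally show ?thesis .
  qed
  have "l2_norm lebesgue (\<lambda>y. u (x + y)) = l2_norm lebesgue u"
    using l2_norm_translate[OF L2_measurable[OF u], of x] by (simp add: add.commute)
  thus "\<bar>average r u x\<bar> \<le> l2_norm lebesgue u / sqrt ?V" using key[OF L[of x]] eq by simp
  have "average r u x - average r u z = (1 / ?V) * l2_inner lebesgue ?B (\<lambda>y. u (x + y) - u (z + y))"
    unfolding eq by (simp add: l2_inner_diff_right[OF L L B] right_diff_distrib)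
  moreover have "l2_norm lebesgue (\<lambda>y. u (x + y) - u (z + y)) = l2_norm lebesgue (\<lambda>y. u (y + (x - z)) - u y)"
    using l2_norm_translate[OF L2_measurable[OF L2_diff[OF L2_translate[OF u, of "x - z"] u]], of z]
    by (simp add: algebra_simps)
  ultimately show "\<bar>average r u x - average r u z\<bar> \<le> l2_norm lebesgue (\<lambda>y. u (y + (x - z)) - u y) / sqrt ?V"
    using key[OF L2_diff[OF L L], of x z] by simp
qed

text \<open>Fubini's theorem; integrability on the product follows from the bound for the average of \<open>\<bar>u\<bar>\<close>.\<close>

lemma average_pairing:
  fixes u \<psi> :: "'a::euclidean_space \<Rightarrow> real"
  assumes u: "u \<in> L2 lebesgue" and ub: "u \<in> borel_measurable borel" and r: "r > 0" and psi: "\<psi> \<in> test_functions"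
  shows "(LINT x|lebesgue. average r u x * \<psi> x) = 
    (LINT y|lborel. indicator (cball 0 r) y / ball_volume TYPE('a) r * (LINT x|lebesgue. u (x + y) * \<psi> x))"
proof -
  let ?B = "indicator (cball 0 r) :: 'a \<Rightarrow> real" and ?V = "ball_volume TYPE('a) r"
  note ub[measurable]
  have V: "?V > 0" by (rule ball_volume_pos[OF r])
  have pb[measurable]: "\<psi> \<in> borel_measurable borel" by (rule test_function_borel[OF psi])
  have am[measurable]: "average r u \<in> borel_measurable borel" by (rule average_measurable[OF ub])
  let ?f = "\<lambda>x y. ?B y / ?V * u (x + y) * \<psi> x"
  have fm: "case_prod ?f \<in> borel_measurable (lborel \<Otimes>\<^sub>M lborel)"
  proof (rule borel_measurable_lborel_pair)
    note [measurable] = borel_measurable_pair_shift[OF ub] borel_measurable_indicator_cball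
    show "case_prod ?f \<in> borel_measurable (borel \<Otimes>\<^sub>M borel)" unfolding case_prod_beta by measurable
  qed
  have fx: "integrable lborel (\<lambda>y. ?f x y)" for x
  proof -
    have "integrable lborel (\<lambda>y. (\<psi> x / ?V) * (?B y *\<^sub>R u (x + y)))"
      by (intro integrable_mult_right average_integrable u ub)
    thus ?thesis by (simp add: algebra_simps)
  qed
  have nabs: "(\<lambda>x. norm (u x)) \<in> L2 lebesgue" "(\<lambda>x. norm (u x)) \<in> borel_measurable borel"
    using L2_norm_fun[OF u] by auto
  have "(LINT y|lborel. norm (?f x y)) = average r (\<lambda>x. norm (u x)) x * \<bar>\<psi> x\<bar>" for x
  proof -
    have "(\<lambda>y. norm (?f x y)) = (\<lambda>y. (\<bar>\<psi> x\<bar> / ?V) * (?B y *\<^sub>R norm (u (x + y))))"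
      using V by (auto simp: abs_mult)
    thus ?thesis by (simp add: average_def)
  qed
  moreover have "integrable lborel (\<lambda>x. average r (\<lambda>x. norm (u x)) x * \<bar>\<psi> x\<bar>)"
  proof -
    have am'[measurable]: "average r (\<lambda>x. norm (u x)) \<in> borel_measurable borel" by (rule average_measurable[OF nabs(2)])
    obtain R where R: "\<And>x. norm x > R \<Longrightarrow> \<psi> x = 0" using test_function_support[OF psi] by metis
    obtain C where C: "\<And>x. \<bar>\<psi> x\<bar> \<le> C" using test_function_bounded[OF psi] by metis
    let ?K = "l2_norm lebesgue (\<lambda>x. norm (u x)) / sqrt ?V"
    show ?thesis
    proof (rule integrableI_bounded_set[where A="cball 0 R" and B="?K * C"])
      show "AE x in lborel. x \<in> cball 0 R \<longrightarrow> norm (average r (\<lambda>x. norm (u x)) x * \<bar>\<psi> x\<bar>) \<le> ?K * C"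
      proof (intro AE_I2 impI)
        fix x
        have "\<bar>average r (\<lambda>x. norm (u x)) x\<bar> * \<bar>\<psi> x\<bar> \<le> ?K * C"
          using average_difference_le(1)[OF nabs r, of x] C V by (intro mult_mono) auto
        thus "norm (average r (\<lambda>x. norm (u x)) x * \<bar>\<psi> x\<bar>) \<le> ?K * C" by (simp add: abs_mult)
      qed
      show "emeasure lborel (cball (0::'a) R) < \<infinity>" by (rule emeasure_bounded_finite) simp
      show "(\<lambda>x. average r (\<lambda>x. norm (u x)) x * \<bar>\<psi> x\<bar>) \<in> borel_measurable lborel"
        using am' pb by (intro borel_measurable_lborelI borel_measurable_times borel_measurable_abs)
    qed (use R in \<open>auto simp: dist_norm\<close>)
  qed
  ultimately have norm_int: "integrable lborel (\<lambda>x. LINT y|lborel. norm (?f x y))" by simp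
  have pair: "integrable (lborel \<Otimes>\<^sub>M lborel) (case_prod ?f)"
    by (rule lborel_pair.Fubini_integrable[OF fm]) (use norm_int fx in auto)
  have "(LINT x|lebesgue. average r u x * \<psi> x) = (LINT x|lborel. average r u x * \<psi> x)"
    by (rule integral_completion) simp
  also have "\<dots> = (LINT x|lborel. LINT y|lborel. ?f x y)"
  proof (rule Bochner_Integration.integral_cong)
    fix x
    have "(\<lambda>y. ?f x y) = (\<lambda>y. (\<psi> x / ?V) * (?B y *\<^sub>R u (x + y)))" by (auto simp: algebra_simps)
    thus "average r u x * \<psi> x = (LINT y|lborel. ?f x y)" by (simp add: average_def)
  qed simp
  also have "\<dots> = (LINT y|lborel. LINT x|lborel. ?f x y)"
    by (rule lborel_pair.Fubini_integral[OF pair, symmetric])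
  also have "\<dots> = (LINT y|lborel. ?B y / ?V * (LINT x|lebesgue. u (x + y) * \<psi> x))"
  proof (rule Bochner_Integration.integral_cong)
    fix y
    have "(LINT x|lebesgue. u (x + y) * \<psi> x) = (LINT x|lborel. u (x + y) * \<psi> x)"
      by (rule integral_completion) simp
    thus "(LINT x|lborel. ?f x y) = ?B y / ?V * (LINT x|lebesgue. u (x + y) * \<psi> x)" by (simp add: mult.assoc)
  qed simp
  finally show ?thesis .
qed

lemma average_inner:
  fixes G :: "'a::euclidean_space \<Rightarrow> 'b::euclidean_space"
  assumes "G \<in> L2 lebesgue" "G \<in> borel_measurable borel"
  shows "average r G x \<bullet> b = average r (\<lambda>x. G x \<bullet> b) x"
proof -
  have "(LINT y|lborel. indicator (cball 0 r) y *\<^sub>R G (x + y)) \<bullet> b = (LINT y|lborel. (indicator (cball 0 r) y *\<^sub>R G (x + y)) \<bullet> b)"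
    using average_integrable[OF assms, of r x] by (intro integral_inner_left[symmetric]) auto
  thus ?thesis by (simp add: average_def)
qed

lemma average_weak_gradient:
  fixes u :: "'a::euclidean_space \<Rightarrow> real"
  assumes W: "wdiff lebesgue u G" and ub: "u \<in> borel_measurable borel" 
    and Gb: "G \<in> borel_measurable borel" and r: "r > 0" 
    and L: "average r u \<in> L2 lebesgue" "average r G \<in> L2 lebesgue"
  shows "has_weak_gradient (average r u) (average r G)"
proof -
  have u: "u \<in> L2 lebesgue" and G: "G \<in> L2 lebesgue" and wg: "has_weak_gradient u G" 
    using W by (auto simp: wdiff_def)
  have lu: "locally_integrable u" and lG: "locally_integrable G" using u G by (auto intro: L2_locally_integrable)
  have "(LINT x|lebesgue. average r u x * frechet_derivative \<phi> (at x) b) = - (LINT x|lebesgue. (average r G x \<bullet> b) * \<phi> x)"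
    if phi: "\<phi> \<in> test_functions" for \<phi> b
  proof -
    let ?c = "\<lambda>y. indicator (cball 0 r) y / ball_volume TYPE('a) r"
    have shift: "(LINT x|lebesgue. u (x + y) * frechet_derivative \<phi> (at x) b) = - (LINT x|lebesgue. (G (x + y) \<bullet> b) * \<phi> x)" for y
    proof -
      have psi: "(\<lambda>x. \<phi> (x + (-y))) \<in> test_functions" by (rule test_function_translate[OF phi])
      have "(LINT x|lebesgue. u (x + y) * frechet_derivative \<phi> (at x) b) = (LINT x|lebesgue. u x * frechet_derivative \<phi> (at (x - y)) b)"
        by (rule integral_translate_test(1)[OF lu test_function_derivative[OF phi]])
      also have "\<dots> = - (LINT x|lebesgue. (G x \<bullet> b) * \<phi> (x - y))"
        using weak_gradient_identity[OF wg psi, of b] frechet_derivative_translate(2)[OF test_function_smooth[OF phi], of "-y"] by simp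
      also have "(LINT x|lebesgue. (G x \<bullet> b) * \<phi> (x - y)) = (LINT x|lebesgue. (G (x + y) \<bullet> b) * \<phi> x)"
        by (rule integral_translate_test(1)[OF locally_integrable_inner[OF lG] phi, symmetric])
      finally show ?thesis .
    qed
    have "(LINT x|lebesgue. average r u x * frechet_derivative \<phi> (at x) b) = 
        - (LINT y|lborel. ?c y * (LINT x|lebesgue. (G (x + y) \<bullet> b) * \<phi> x))"
      unfolding average_pairing[OF u ub r test_function_derivative[OF phi]] shift by simp
    also have "(LINT y|lborel. ?c y * (LINT x|lebesgue. (G (x + y) \<bullet> b) * \<phi> x)) = (LINT x|lebesgue. average r (\<lambda>x. G x \<bullet> b) x * \<phi> x)"
      using Gb by (intro average_pairing[symmetric] L2_inner_const G r phi) simp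
    finally show ?thesis by (simp add: average_inner[OF G Gb])
  qed
  thus ?thesis using L by (auto simp: has_weak_gradient_def intro: L2_locally_integrable)
qed

text \<open>The average over a small ball is close by continuity of translations, its gradient is the average of the gradient, and
  it is Lipschitz by the gradient bound for translations.\<close>

theorem continuous_approximation:
  fixes u :: "'a::euclidean_space \<Rightarrow> real"
  assumes W: "wdiff lebesgue u G" and e: "e > 0"
  obtains v H where "wdiff lebesgue v H" "continuous_on UNIV v"
    "l2_norm lebesgue (\<lambda>x. v x - u x) \<le> e" "l2_norm lebesgue (\<lambda>x. H x - G x) \<le> e"
proof -
  have u: "u \<in> L2 lebesgue" and G: "G \<in> L2 lebesgue" and wg: "has_weak_gradient u G" 
    using W by (auto simp: wdiff_def)
  obtain u' where u'b: "u' \<in> borel_measurable borel" and uu': "AE x in lebesgue. u x = u' x"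
    using borel_representative[OF L2_measurable[OF u]] by metis
  obtain G' where G'b: "G' \<in> borel_measurable borel" and GG': "AE x in lebesgue. G x = G' x"
    using borel_representative[OF L2_measurable[OF G]] by metis
  have u'm: "u' \<in> borel_measurable lebesgue" and G'm: "G' \<in> borel_measurable lebesgue" 
    using u'b G'b by (auto intro!: measurable_completion)
  have u'L: "u' \<in> L2 lebesgue" by (rule L2_cong_AE[OF u u'm uu'])
  have G'L: "G' \<in> L2 lebesgue" by (rule L2_cong_AE[OF G G'm GG'])
  have W': "wdiff lebesgue u' G'"
    using u'L G'L has_weak_gradient_cong[OF wg uu' GG' u'm G'm] by (simp add: wdiff_def)
  obtain d1 where d1: "d1 > 0" "\<And>h. norm h \<le> d1 \<Longrightarrow> l2_norm lebesgue (\<lambda>x. u' (x + h) - u' x) \<le> e"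
    using translation_continuous[OF u'L e] by metis
  obtain d2 where d2: "d2 > 0" "\<And>h. norm h \<le> d2 \<Longrightarrow> l2_norm lebesgue (\<lambda>x. G' (x + h) - G' x) \<le> e"
    using translation_continuous[OF G'L e] by metis
  define r where "r = min d1 d2"
  have r: "r > 0" using d1 d2 by (simp add: r_def)
  have c1: "(\<lambda>x. average r u' x - u' x) \<in> L2 lebesgue" "l2_norm lebesgue (\<lambda>x. average r u' x - u' x) \<le> e"
    using average_close[OF u'L u'b r, of e] d1(2) by (auto simp: r_def)
  have c2: "(\<lambda>x. average r G' x - G' x) \<in> L2 lebesgue" "l2_norm lebesgue (\<lambda>x. average r G' x - G' x) \<le> e"
    using average_close[OF G'L G'b r, of e] d2(2) by (auto simp: r_def)
  have aL: "average r u' \<in> L2 lebesgue" using L2_add[OF c1(1) u'L] by simp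
  have bL: "average r G' \<in> L2 lebesgue" using L2_add[OF c2(1) G'L] by simp
  have "continuous_on UNIV (average r u')"
  proof (rule continuous_onI)
    fix x :: 'a and \<epsilon> :: real assume eps: "\<epsilon> > 0"
    let ?K = "l2_norm lebesgue G' / sqrt (ball_volume TYPE('a) r)"
    have K0: "?K \<ge> 0" using ball_volume_pos[OF r, where 'a='a] by simp
    have lip: "\<bar>average r u' z - average r u' x\<bar> \<le> ?K * dist z x" for z
    proof -
      have "\<bar>average r u' z - average r u' x\<bar> \<le> l2_norm lebesgue (\<lambda>y. u' (y + (z - x)) - u' y) / sqrt (ball_volume TYPE('a) r)"
        by (rule average_difference_le(2)[OF u'L u'b r])
      also have "\<dots> \<le> (norm (z - x) * l2_norm lebesgue G') / sqrt (ball_volume TYPE('a) r)"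
        using ball_volume_pos[OF r, where 'a='a] by (intro divide_right_mono translation_difference_le[OF W']) auto
      finally show ?thesis by (simp add: dist_norm mult.commute)
    qed
    show "\<exists>d>0. \<forall>z\<in>UNIV. dist z x < d \<longrightarrow> dist (average r u' z) (average r u' x) \<le> \<epsilon>"
    proof (intro exI conjI ballI impI)
      show "\<epsilon> / (?K + 1) > 0" using eps K0 by (intro divide_pos_pos) linarith+
      fix z assume "dist z x < \<epsilon> / (?K + 1)"
      hence "?K * dist z x \<le> (?K + 1) * (\<epsilon> / (?K + 1))" using K0 by (intro mult_mono) auto
      also have "\<dots> = \<epsilon>" using K0 by (simp add: add_nonneg_eq_0_iff)
      finally show "dist (average r u' z) (average r u' x) \<le> \<epsilon>" using lip[of z] by (simp add: dist_real_def)
    qed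
  qed
  moreover have "wdiff lebesgue (average r u') (average r G')"
    using aL bL average_weak_gradient[OF W' u'b G'b r aL bL] by (simp add: wdiff_def)
  moreover have "l2_norm lebesgue (\<lambda>x. average r u' x - u x) = l2_norm lebesgue (\<lambda>x. average r u' x - u' x)"
    using uu' by (intro l2_norm_cong_AE L2_measurable L2_diff aL u u'L) (auto elim!: eventually_mono)
  moreover have "l2_norm lebesgue (\<lambda>x. average r G' x - G x) = l2_norm lebesgue (\<lambda>x. average r G' x - G' x)"
    using GG' by (intro l2_norm_cong_AE L2_measurable L2_diff bL G G'L) (auto elim!: eventually_mono)
  ultimately show ?thesis using c1(2) c2(2) that by simp
qed

section \<open>Sobolev functions for a weighted measure\<close>

text \<open>The common properties of Lebesgue measure and the weighted measure: the same null sets, and domination of Lebesgue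
  measure. The second makes convergence in the weighted norm imply convergence in the unweighted one, where weak
  gradients are defined.\<close>

definition sobolev_measure :: "'a::euclidean_space measure \<Rightarrow> bool" where
  "sobolev_measure M \<longleftrightarrow> sets M = sets lebesgue \<and> (\<forall>P. (AE x in M. P x) \<longleftrightarrow> (AE x in lebesgue. P x)) \<and>
     (\<forall>f\<in>borel_measurable lebesgue. integral\<^sup>N lebesgue f \<le> integral\<^sup>N M f)"

lemma sobolev_measure_lebesgue: "sobolev_measure lebesgue"
  by (simp add: sobolev_measure_def)

lemma sobolev_measurable_eq: "sobolev_measure M \<Longrightarrow> f \<in> borel_measurable M \<longleftrightarrow> f \<in> borel_measurable lebesgue"
  using measurable_cong_sets[of M lebesgue borel borel] by (auto simp: sobolev_measure_def)

lemma sobolev_AE_eq: "sobolev_measure M \<Longrightarrow> (AE x in M. P x) \<longleftrightarrow> (AE x in lebesgue. P x)"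
  by (simp add: sobolev_measure_def)

lemma sobolev_L2:
  fixes f :: "'a::euclidean_space \<Rightarrow> 'b::euclidean_space"
  assumes M: "sobolev_measure M" and f: "f \<in> L2 M"
  shows "f \<in> L2 lebesgue" "l2_norm lebesgue f \<le> l2_norm M f"
proof -
  have fm: "f \<in> borel_measurable lebesgue" using L2_measurable[OF f] sobolev_measurable_eq[OF M] by blast
  have "(\<lambda>x. ennreal ((norm (f x))\<^sup>2)) \<in> borel_measurable lebesgue" using fm by measurable
  hence "(\<integral>\<^sup>+x. ennreal ((norm (f x))\<^sup>2) \<partial>lebesgue) \<le> (\<integral>\<^sup>+x. ennreal ((norm (f x))\<^sup>2) \<partial>M)"
    using M by (simp add: sobolev_measure_def)
  also have "\<dots> = ennreal ((l2_norm M f)\<^sup>2)"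
    unfolding l2_norm_sq by (rule nn_integral_eq_integral) (use L2_integrable[OF f] in auto)
  finally have le: "(\<integral>\<^sup>+x. ennreal ((norm (f x))\<^sup>2) \<partial>lebesgue) \<le> ennreal ((l2_norm M f)\<^sup>2)" .
  have int: "integrable lebesgue (\<lambda>x. (norm (f x))\<^sup>2)"
    by (rule integrableI_bounded) (use le fm in \<open>auto simp: le_less_trans\<close>)
  show "f \<in> L2 lebesgue" by (rule L2I[OF fm int])
  have "ennreal ((l2_norm lebesgue f)\<^sup>2) \<le> ennreal ((l2_norm M f)\<^sup>2)"
    using le int by (simp add: l2_norm_sq nn_integral_eq_integral)
  hence "(l2_norm lebesgue f)\<^sup>2 \<le> (l2_norm M f)\<^sup>2" by simp
  thus "l2_norm lebesgue f \<le> l2_norm M f" by (rule power2_le_imp_le) simp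
qed

lemma L2_Pair:
  assumes "f \<in> L2 M" "g \<in> L2 M" shows "(\<lambda>x. (f x, g x)) \<in> L2 M"
proof (rule L2I)
  show "(\<lambda>x. (f x, g x)) \<in> borel_measurable M"
    using L2_measurable[OF assms(1)] L2_measurable[OF assms(2)] by measurable
  show "integrable M (\<lambda>x. (norm (f x, g x))\<^sup>2)"
    using L2_integrable[OF assms(1)] L2_integrable[OF assms(2)] by (simp add: norm_Pair)
qed

lemma l2_norm_Pair:
  assumes "f \<in> L2 M" "g \<in> L2 M" 
  shows "(l2_norm M (\<lambda>x. (f x, g x)))\<^sup>2 = (l2_norm M f)\<^sup>2 + (l2_norm M g)\<^sup>2"
  unfolding l2_norm_sq using L2_integrable[OF assms(1)] L2_integrable[OF assms(2)] by (simp add: norm_Pair)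

lemma L2_fst_snd:
  assumes "F \<in> L2 M" 
  shows "(\<lambda>x. fst (F x)) \<in> L2 M" "(\<lambda>x. snd (F x)) \<in> L2 M"
    "l2_norm M (\<lambda>x. fst (F x)) \<le> l2_norm M F" "l2_norm M (\<lambda>x. snd (F x)) \<le> l2_norm M F"
proof -
  have Fm[measurable]: "F \<in> borel_measurable M" by (rule L2_measurable[OF assms])
  have 1: "norm (fst (F x)) \<le> norm (F x)" for x using norm_fst_le[of "fst (F x)" "snd (F x)"] by simp
  have 2: "norm (snd (F x)) \<le> norm (F x)" for x using norm_snd_le[of "snd (F x)" "fst (F x)"] by simp
  have m: "(\<lambda>x. fst (F x)) \<in> borel_measurable M" "(\<lambda>x. snd (F x)) \<in> borel_measurable M" 
    using measurable_compose[OF Fm borel_measurable_continuous_onI[OF continuous_on_fst[OF continuous_on_id]]]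
      measurable_compose[OF Fm borel_measurable_continuous_onI[OF continuous_on_snd[OF continuous_on_id]]] by auto
  show "(\<lambda>x. fst (F x)) \<in> L2 M" using 1 
    by (intro L2_bound[OF m(1) L2_integrable[OF assms]] AE_I2 power_mono) auto
  show "(\<lambda>x. snd (F x)) \<in> L2 M" using 2
    by (intro L2_bound[OF m(2) L2_integrable[OF assms]] AE_I2 power_mono) auto
  show "l2_norm M (\<lambda>x. fst (F x)) \<le> l2_norm M F" "l2_norm M (\<lambda>x. snd (F x)) \<le> l2_norm M F"
    using 1 2 by (auto intro!: l2_norm_mono_AE[OF assms])
qed

text \<open>With the pair of value and gradient as one vector-valued function, the Sobolev norm is an \<open>L2\<close> norm, and completeness,
  the triangle inequality and almost everywhere convergent subsequences need no second proof.\<close>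

abbreviation jet :: "('a \<Rightarrow> real) \<Rightarrow> ('a \<Rightarrow> 'a) \<Rightarrow> 'a \<Rightarrow> real \<times> 'a" where
  "jet u G \<equiv> (\<lambda>x. (u x, G x))"

lemma wdiff_L2: "wdiff M u G \<Longrightarrow> u \<in> L2 M" "wdiff M u G \<Longrightarrow> G \<in> L2 M" "wdiff M u G \<Longrightarrow> has_weak_gradient u G"
  by (auto simp: wdiff_def)

lemma wdiff_jet: "wdiff M u G \<Longrightarrow> jet u G \<in> L2 M"
  by (auto intro: L2_Pair wdiff_L2)

lemma H1_iff: "u \<in> H1 M \<longleftrightarrow> (\<exists>G. wdiff M u G)"
  by (auto simp: H1_def wdiff_def)

lemma wdiff_lebesgue: "sobolev_measure M \<Longrightarrow> wdiff M u G \<Longrightarrow> wdiff lebesgue u G"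
  by (auto simp: wdiff_def sobolev_L2)

lemma wdiff_weak_gradient:
  assumes M: "sobolev_measure M" and W: "wdiff M u G"
  shows "wdiff M u (weak_gradient u)" "AE x in M. weak_gradient u x = G x"
proof -
  note h = has_weak_gradient_weak_gradient[OF wdiff_L2(3)[OF W]]
  show ae: "AE x in M. weak_gradient u x = G x" using h(2) sobolev_AE_eq[OF M] by blast
  have "weak_gradient u \<in> borel_measurable M"
    using h(1) by (auto simp: sobolev_measurable_eq[OF M] has_weak_gradient_def intro: locally_integrable_measurable)
  hence "weak_gradient u \<in> L2 M" using ae by (intro L2_cong_AE[OF wdiff_L2(2)[OF W]]) (auto elim!: eventually_mono)
  thus "wdiff M u (weak_gradient u)" using W h(1) by (simp add: wdiff_def)
qed

lemma H1_norm_eq: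
  assumes M: "sobolev_measure M" and W: "wdiff M u G"
  shows "H1_norm M u = l2_norm M (jet u G)"
proof -
  note w = wdiff_weak_gradient[OF M W]
  have "l2_norm M (weak_gradient u) = l2_norm M G"
    using w wdiff_L2(2)[OF W] wdiff_L2(2)[OF w(1)] by (intro l2_norm_cong_AE L2_measurable) auto
  hence "(H1_norm M u)\<^sup>2 = (l2_norm M (jet u G))\<^sup>2"
    unfolding l2_norm_Pair[OF wdiff_L2(1)[OF W] wdiff_L2(2)[OF W]] by (simp add: H1_norm_def l2_norm_sq[symmetric] l2_norm_sq_real[symmetric])
  moreover have "H1_norm M u \<ge> 0" by (simp add: H1_norm_def)
  ultimately show ?thesis by (metis l2_norm_nonneg power2_eq_imp_eq)
qed

lemma wdiff_add: "wdiff M u G \<Longrightarrow> wdiff M v H \<Longrightarrow> wdiff M (\<lambda>x. u x + v x) (\<lambda>x. G x + H x)"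
  by (auto simp: wdiff_def intro: L2_add has_weak_gradient_add)

lemma wdiff_scale: "wdiff M u G \<Longrightarrow> wdiff M (\<lambda>x. c * u x) (\<lambda>x. c *\<^sub>R G x)"
  by (auto simp: wdiff_def intro: L2_cmult L2_scaleR has_weak_gradient_scale)

lemma wdiff_zero: "wdiff M (\<lambda>x. 0) (\<lambda>x. 0)"
  by (auto simp: wdiff_def has_weak_gradient_zero)

lemma wdiff_diff: "wdiff M u G \<Longrightarrow> wdiff M v H \<Longrightarrow> wdiff M (\<lambda>x. u x - v x) (\<lambda>x. G x - H x)"
  using wdiff_add[of M u G "\<lambda>x. -1 * v x" "\<lambda>x. -1 *\<^sub>R H x"] wdiff_scale[of M v H "-1"] by simp

lemma wdiff_complete:
  assumes M: "sobolev_measure M" and W: "\<And>n. wdiff M (u n) (G n)" and cau: "l2_Cauchy M (\<lambda>n. jet (u n) (G n))"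
  obtains v H where "wdiff M v H" "(\<lambda>n. l2_norm M (\<lambda>x. jet (u n) (G n) x - jet v H x)) \<longlonglongrightarrow> 0"
proof -
  have J: "jet (u n) (G n) \<in> L2 M" for n by (rule wdiff_jet[OF W])
  obtain F where F: "F \<in> L2 M" and lim: "(\<lambda>n. l2_norm M (\<lambda>x. jet (u n) (G n) x - F x)) \<longlonglongrightarrow> 0"
    using l2_complete[of "\<lambda>n. jet (u n) (G n)" M, OF J cau] by blast
  let ?v = "\<lambda>x. fst (F x)" and ?H = "\<lambda>x. snd (F x)"
  have D: "(\<lambda>x. jet (u n) (G n) x - F x) \<in> L2 M" for n by (rule L2_diff[OF J F])
  have FL: "?v \<in> L2 M" "?H \<in> L2 M" using L2_fst_snd[OF F] by auto
  have l1: "(\<lambda>n. l2_norm lebesgue (\<lambda>x. u n x - ?v x)) \<longlonglongrightarrow> 0"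
  proof (rule Lim_null_comparison[OF _ lim], rule always_eventually, rule allI)
    fix n
    have "l2_norm lebesgue (\<lambda>x. u n x - ?v x) \<le> l2_norm M (\<lambda>x. u n x - ?v x)"
      by (rule sobolev_L2(2)[OF M L2_diff[OF wdiff_L2(1)[OF W] FL(1)]])
    also have "\<dots> \<le> l2_norm M (\<lambda>x. jet (u n) (G n) x - F x)" using L2_fst_snd(3)[OF D[of n]] by simp
    finally show "norm (l2_norm lebesgue (\<lambda>x. u n x - ?v x)) \<le> l2_norm M (\<lambda>x. jet (u n) (G n) x - F x)" by simp
  qed
  have l2: "(\<lambda>n. l2_norm lebesgue (\<lambda>x. G n x - ?H x)) \<longlonglongrightarrow> 0"
  proof (rule Lim_null_comparison[OF _ lim], rule always_eventually, rule allI)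
    fix n
    have "l2_norm lebesgue (\<lambda>x. G n x - ?H x) \<le> l2_norm M (\<lambda>x. G n x - ?H x)"
      by (rule sobolev_L2(2)[OF M L2_diff[OF wdiff_L2(2)[OF W] FL(2)]])
    also have "\<dots> \<le> l2_norm M (\<lambda>x. jet (u n) (G n) x - F x)" using L2_fst_snd(4)[OF D[of n]] by simp
    finally show "norm (l2_norm lebesgue (\<lambda>x. G n x - ?H x)) \<le> l2_norm M (\<lambda>x. jet (u n) (G n) x - F x)" by simp
  qed
  have "has_weak_gradient ?v ?H"
    by (rule has_weak_gradient_L2_limit[OF wdiff_L2(3)[OF W] sobolev_L2(1)[OF M wdiff_L2(1)[OF W]] 
        sobolev_L2(1)[OF M wdiff_L2(2)[OF W]] sobolev_L2(1)[OF M FL(1)] sobolev_L2(1)[OF M FL(2)] l1 l2])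
  hence "wdiff M ?v ?H" using FL by (simp add: wdiff_def)
  moreover have "(\<lambda>n. l2_norm M (\<lambda>x. jet (u n) (G n) x - jet ?v ?H x)) \<longlonglongrightarrow> 0" using lim by simp
  ultimately show ?thesis by (rule that)
qed

section \<open>Capacity\<close>

text \<open>A smooth substitute for truncation. It is nonnegative and at most \<open>\<bar>s\<bar>\<close>, it is at least \<open>1\<close> where \<open>\<bar>s\<bar> \<ge> 1\<close>, and
  its derivative is bounded by \<open>2\<close>, so it turns any competitor for the capacity into a nonnegative one at the
  cost of a factor \<open>2\<close> in the norm.\<close>

definition excess :: "real \<Rightarrow> real" where "excess s = 2 * s\<^sup>2 / (1 + s\<^sup>2)"
definition excess' :: "real \<Rightarrow> real" where "excess' s = 4 * s / (1 + s\<^sup>2)\<^sup>2"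

lemma excess_nonneg: "0 \<le> excess s"
  unfolding excess_def by (intro divide_nonneg_pos one_plus_sq_pos) simp

lemma excess_ge_1: "1 \<le> \<bar>s\<bar> \<Longrightarrow> 1 \<le> excess s"
proof -
  assume "1 \<le> \<bar>s\<bar>"
  hence "1 \<le> s\<^sup>2" using power_mono[of 1 "\<bar>s\<bar>" 2] by simp
  thus ?thesis using one_plus_sq_pos[of s] by (simp add: excess_def le_divide_eq)
qed

lemma excess_le: "excess s \<le> \<bar>s\<bar>"
proof -
  have "2 * s\<^sup>2 = (2 * \<bar>s\<bar>) * \<bar>s\<bar>" by (simp add: power2_eq_square)
  also have "\<dots> \<le> (1 + s\<^sup>2) * \<bar>s\<bar>" by (intro mult_right_mono two_abs_le) simp
  finally show ?thesis using one_plus_sq_pos[of s] by (simp add: excess_def divide_le_eq mult.commute)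
qed

lemma excess'_bound: "\<bar>excess' s\<bar> \<le> 2"
proof -
  have pos: "1 + s\<^sup>2 > 0" by (rule one_plus_sq_pos)
  have "4 * \<bar>s\<bar> \<le> 2 * (1 + s\<^sup>2)" using two_abs_le[of s] by simp
  also have "\<dots> \<le> 2 * (1 + s\<^sup>2)\<^sup>2" using mult_left_mono[of 1 "1 + s\<^sup>2" "1 + s\<^sup>2"] by (simp add: power2_eq_square)
  finally show ?thesis using pos by (simp add: excess'_def abs_mult divide_le_eq)
qed

lemma excess_taylor: "\<bar>excess b - excess a - excess' a * (b - a)\<bar> \<le> 4 * (b - a)\<^sup>2"
proof -
  let ?A = "1 + a\<^sup>2" and ?B = "1 + b\<^sup>2"
  have pos: "?A > 0" "?B > 0" by (rule one_plus_sq_pos)+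
  have eq: "excess b - excess a - excess' a * (b - a) = (b - a)\<^sup>2 * (2 * (1 - a\<^sup>2 - 2 * a * b)) / (?A\<^sup>2 * ?B)"
    using pos unfolding excess_def excess'_def 
    by (simp add: divide_simps) (simp add: power2_eq_square algebra_simps)
  have "\<bar>1 - a\<^sup>2 - 2 * a * b\<bar> \<le> \<bar>1 - a\<^sup>2\<bar> + \<bar>2 * a * b\<bar>" by (rule abs_triangle_ineq4)
  also have "\<bar>1 - a\<^sup>2\<bar> \<le> ?A" by (simp add: abs_le_iff)
  also have "\<bar>2 * a * b\<bar> \<le> ?A * ?B"
  proof -
    have "\<bar>2 * a * b\<bar> = (2 * \<bar>a\<bar>) * \<bar>b\<bar>" by (simp add: abs_mult)
    also have "\<dots> \<le> ?A * ?B" using two_abs_le[of a] two_abs_le[of b] by (intro mult_mono) auto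
    finally show ?thesis .
  qed
  finally have "\<bar>1 - a\<^sup>2 - 2 * a * b\<bar> \<le> ?A + ?A * ?B" by simp
  also have "\<dots> \<le> 2 * (?A * ?B)" using mult_left_mono[of 1 ?B ?A] pos by simp
  also have "?A * ?B \<le> ?A\<^sup>2 * ?B" using mult_right_mono[of 1 ?A "?A * ?B"] pos by (simp add: power2_eq_square)
  finally have "\<bar>1 - a\<^sup>2 - 2 * a * b\<bar> \<le> 2 * (?A\<^sup>2 * ?B)" by simp
  hence "\<bar>2 * (1 - a\<^sup>2 - 2 * a * b)\<bar> / (?A\<^sup>2 * ?B) \<le> 4" using pos by (simp add: divide_le_eq abs_mult)
  hence "(b - a)\<^sup>2 * (\<bar>2 * (1 - a\<^sup>2 - 2 * a * b)\<bar> / (?A\<^sup>2 * ?B)) \<le> (b - a)\<^sup>2 * 4" by (rule mult_left_mono) simp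
  thus ?thesis unfolding eq using pos by (simp add: abs_mult abs_divide)
qed

lemma wdiff_excess:
  assumes W: "wdiff lebesgue u G"
  shows "wdiff lebesgue (\<lambda>x. excess (u x)) (\<lambda>x. excess' (u x) *\<^sub>R G x)"
    "l2_norm lebesgue (jet (\<lambda>x. excess (u x)) (\<lambda>x. excess' (u x) *\<^sub>R G x)) \<le> 2 * l2_norm lebesgue (jet u G)"
proof -
  have m[measurable]: "excess \<in> borel_measurable borel" "excess' \<in> borel_measurable borel"
    unfolding excess_def[abs_def] excess'_def[abs_def] by measurable
  have um[measurable]: "u \<in> borel_measurable lebesgue" and Gm[measurable]: "G \<in> borel_measurable lebesgue"
    using wdiff_L2[OF W] by (auto simp: L2_def)
  have wg: "has_weak_gradient (\<lambda>x. excess (u x)) (\<lambda>x. excess' (u x) *\<^sub>R G x)"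
    by (rule weak_chain_rule[OF W m, where L=4 and K=2]) 
      (use excess_taylor excess'_bound in \<open>auto intro: order_trans[OF excess'_bound]\<close>)
  have le1: "\<bar>excess (u x)\<bar> \<le> \<bar>u x\<bar>" for x using excess_nonneg excess_le by simp
  have le2: "norm (excess' (u x) *\<^sub>R G x) \<le> 2 * norm (G x)" for x
    using excess'_bound by (simp add: mult_right_mono)
  have n: "norm (jet (\<lambda>x. excess (u x)) (\<lambda>x. excess' (u x) *\<^sub>R G x) x) \<le> norm (2 *\<^sub>R jet u G x)" for x
  proof (rule power2_le_imp_le)
    have "\<bar>excess (u x)\<bar>\<^sup>2 \<le> \<bar>u x\<bar>\<^sup>2" by (intro power_mono le1) simp
    moreover have "(norm (excess' (u x) *\<^sub>R G x))\<^sup>2 \<le> (2 * norm (G x))\<^sup>2" by (intro power_mono le2) simp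
    ultimately show "(norm (jet (\<lambda>x. excess (u x)) (\<lambda>x. excess' (u x) *\<^sub>R G x) x))\<^sup>2 \<le> (norm (2 *\<^sub>R jet u G x))\<^sup>2"
      by (simp add: norm_Pair power_mult_distrib) (smt (verit) zero_le_power2)
  qed simp
  have eL: "(\<lambda>x. excess (u x)) \<in> L2 lebesgue"
  proof (rule L2_bound[OF _ L2_integrable[OF wdiff_L2(1)[OF W]]])
    show "AE x in lebesgue. (norm (excess (u x)))\<^sup>2 \<le> (norm (u x))\<^sup>2" using le1 by (intro AE_I2 power_mono) auto
  qed measurable
  have e'L: "(\<lambda>x. excess' (u x) *\<^sub>R G x) \<in> L2 lebesgue"
  proof (rule L2_bound[OF _ L2_integrable[OF L2_scaleR[OF wdiff_L2(2)[OF W], of 2]]])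
    show "AE x in lebesgue. (norm (excess' (u x) *\<^sub>R G x))\<^sup>2 \<le> (norm (2 *\<^sub>R G x))\<^sup>2" 
      using le2 by (intro AE_I2 power_mono) auto
  qed measurable
  show "wdiff lebesgue (\<lambda>x. excess (u x)) (\<lambda>x. excess' (u x) *\<^sub>R G x)"
    using wg eL e'L by (simp add: wdiff_def)
  have "l2_norm lebesgue (jet (\<lambda>x. excess (u x)) (\<lambda>x. excess' (u x) *\<^sub>R G x)) \<le> l2_norm lebesgue (\<lambda>x. 2 *\<^sub>R jet u G x)"
    by (rule l2_norm_mono_AE[OF L2_scaleR[OF wdiff_jet[OF W]]]) (rule AE_I2, rule n)
  thus "l2_norm lebesgue (jet (\<lambda>x. excess (u x)) (\<lambda>x. excess' (u x) *\<^sub>R G x)) \<le> 2 * l2_norm lebesgue (jet u G)"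
    by (simp only: l2_norm_scaleR)
qed

text \<open>A nonnegative competitor for the capacity of \<open>U\<close>. Nonnegativity is what allows barriers to be added.\<close>

definition barrier :: "'a::euclidean_space set \<Rightarrow> real \<Rightarrow> ('a \<Rightarrow> real) \<Rightarrow> ('a \<Rightarrow> 'a) \<Rightarrow> bool" where
  "barrier U \<delta> p P \<longleftrightarrow> wdiff lebesgue p P \<and> (\<forall>x. 0 \<le> p x) \<and> (AE x in lebesgue. x \<in> U \<longrightarrow> 1 \<le> p x) \<and>
     l2_norm lebesgue (jet p P) \<le> \<delta>"

lemma cap_le_barrier:
  assumes "barrier U \<delta> p P" "open U" "E \<subseteq> U"
  shows "cap E \<le> ennreal (\<delta>\<^sup>2)"
proof -
  have W: "wdiff lebesgue p P" using assms by (simp add: barrier_def)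
  have "cap E \<le> ennreal ((H1_norm lebesgue p)\<^sup>2)"
    unfolding cap_def using assms W by (intro Inf_lower) (auto simp: H1_iff barrier_def)
  also have "\<dots> \<le> ennreal (\<delta>\<^sup>2)"
    unfolding H1_norm_eq[OF sobolev_measure_lebesgue W] using assms by (intro ennreal_leI power_mono) (auto simp: barrier_def)
  finally show ?thesis .
qed

lemma barrier_of_cap:
  assumes "cap E < ennreal (\<epsilon>\<^sup>2)" "\<epsilon> > 0"
  obtains U p P where "open U" "E \<subseteq> U" "barrier U (2 * \<epsilon>) p P"
proof -
  obtain u U where u: "u \<in> H1 lebesgue" "open U" "E \<subseteq> U" "AE x in lebesgue. x \<in> U \<longrightarrow> u x \<ge> 1"
    "ennreal ((H1_norm lebesgue u)\<^sup>2) < ennreal (\<epsilon>\<^sup>2)"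
    using assms(1) unfolding cap_def Inf_less_iff by auto
  obtain G where W: "wdiff lebesgue u G" using u(1) H1_iff by blast
  have "(l2_norm lebesgue (jet u G))\<^sup>2 < \<epsilon>\<^sup>2"
    using u(5) unfolding H1_norm_eq[OF sobolev_measure_lebesgue W] by (simp add: ennreal_less_iff)
  hence "l2_norm lebesgue (jet u G) < \<epsilon>" using assms(2) by (rule power2_less_imp_less[OF _ less_imp_le])
  hence "l2_norm lebesgue (jet (\<lambda>x. excess (u x)) (\<lambda>x. excess' (u x) *\<^sub>R G x)) \<le> 2 * \<epsilon>"
    using wdiff_excess(2)[OF W] by linarith
  moreover have "AE x in lebesgue. x \<in> U \<longrightarrow> 1 \<le> excess (u x)"
    using u(4) by eventually_elim (auto intro: excess_ge_1)
  ultimately have "barrier U (2 * \<epsilon>) (\<lambda>x. excess (u x)) (\<lambda>x. excess' (u x) *\<^sub>R G x)"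
    using wdiff_excess(1)[OF W] excess_nonneg by (simp add: barrier_def)
  thus ?thesis using u that by blast
qed

lemma barrier_add:
  assumes "barrier U \<delta> p P" "barrier V \<epsilon> q Q"
  shows "barrier (U \<union> V) (\<delta> + \<epsilon>) (\<lambda>x. p x + q x) (\<lambda>x. P x + Q x)"
proof -
  have W: "wdiff lebesgue p P" "wdiff lebesgue q Q" using assms by (auto simp: barrier_def)
  have "l2_norm lebesgue (\<lambda>x. jet p P x + jet q Q x) \<le> \<delta> + \<epsilon>"
    using l2_norm_triangle[OF wdiff_jet[OF W(1)] wdiff_jet[OF W(2)]] assms by (auto simp: barrier_def)
  moreover have ae: "AE x in lebesgue. x \<in> U \<longrightarrow> 1 \<le> p x" "AE x in lebesgue. x \<in> V \<longrightarrow> 1 \<le> q x" 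
    and nn: "\<And>x. 0 \<le> p x" "\<And>x. 0 \<le> q x" using assms by (auto simp: barrier_def)
  moreover have "AE x in lebesgue. x \<in> U \<union> V \<longrightarrow> 1 \<le> p x + q x"
    using ae
  proof eventually_elim
    case (elim x)
    thus ?case using nn(1)[of x] nn(2)[of x] by auto
  qed
  ultimately show ?thesis using wdiff_add[OF W] by (simp add: barrier_def)
qed

lemma barrier_mono: "barrier U \<delta> p P \<Longrightarrow> V \<subseteq> U \<Longrightarrow> \<delta> \<le> \<epsilon> \<Longrightarrow> barrier V \<epsilon> p P"
  by (auto simp: barrier_def elim!: eventually_mono)

text \<open>The partial sums of the barriers converge in the Sobolev norm, and almost everywhere along a subsequence, so the limit
  dominates each summand. It is nonnegative only almost everywhere, hence the final \<open>max\<close> with \<open>0\<close>.\<close>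

lemma barrier_countable_Union:
  assumes b: "\<And>n::nat. barrier (U n) (\<delta> n) (p n) (P n)" and s: "summable \<delta>"
  obtains q Q where "barrier (\<Union>n. U n) (suminf \<delta>) q Q"
proof -
  have W: "wdiff lebesgue (p n) (P n)" and nn: "0 \<le> p n x" and ae: "AE x in lebesgue. x \<in> U n \<longrightarrow> 1 \<le> p n x" 
    and le: "l2_norm lebesgue (jet (p n) (P n)) \<le> \<delta> n" for n x using b[of n] by (auto simp: barrier_def)
  have d0: "0 \<le> \<delta> n" for n using le[of n] l2_norm_nonneg[of lebesgue "jet (p n) (P n)"] by linarith
  define S where "S m x = (\<Sum>n<m. p n x)" for m x
  define T where "T m x = (\<Sum>n<m. P n x)" for m x
  have WS: "wdiff lebesgue (S m) (T m)" for m
  proof (induction m)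
    case 0 thus ?case using wdiff_zero by (simp add: S_def[abs_def] T_def[abs_def])
  next
    case (Suc m) from wdiff_add[OF this W[of m]] show ?case by (simp add: S_def[abs_def] T_def[abs_def])
  qed
  have J: "jet (S m) (T m) \<in> L2 lebesgue" for m by (rule wdiff_jet[OF WS])
  have jump: "l2_norm lebesgue (\<lambda>x. jet (S n) (T n) x - jet (S m) (T m) x) \<le> (\<Sum>i=m..<n. \<delta> i)" if "m \<le> n" for m n
    using that
  proof (induction n rule: dec_induct)
    case base show ?case by simp
  next
    case (step n)
    have "(\<lambda>x. jet (S (Suc n)) (T (Suc n)) x - jet (S m) (T m) x) = 
       (\<lambda>x. (jet (S n) (T n) x - jet (S m) (T m) x) + jet (p n) (P n) x)"
      by (auto simp: S_def T_def)
    hence "l2_norm lebesgue (\<lambda>x. jet (S (Suc n)) (T (Suc n)) x - jet (S m) (T m) x) \<le>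
       l2_norm lebesgue (\<lambda>x. jet (S n) (T n) x - jet (S m) (T m) x) + l2_norm lebesgue (jet (p n) (P n))"
      using l2_norm_triangle[OF L2_diff[OF J J] wdiff_jet[OF W], of n m n] by simp
    also have "\<dots> \<le> (\<Sum>i=m..<n. \<delta> i) + \<delta> n" by (intro add_mono step le)
    finally show ?case using step by simp
  qed
  have "l2_Cauchy lebesgue (\<lambda>m. jet (S m) (T m))"
    unfolding l2_Cauchy_def
  proof (intro allI impI)
    fix e :: real assume e: "e > 0"
    obtain N where N: "\<And>m n. m \<ge> N \<Longrightarrow> norm (sum \<delta> {m..<n}) < e" using s e unfolding summable_Cauchy by blast
    show "\<exists>N. \<forall>m\<ge>N. \<forall>n\<ge>N. l2_norm lebesgue (\<lambda>x. jet (S m) (T m) x - jet (S n) (T n) x) < e"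
    proof (intro exI allI impI)
      fix m n assume mn: "N \<le> m" "N \<le> n"
      have sd: "sum \<delta> {m..<n} < e" "sum \<delta> {n..<m} < e" using N[OF mn(1), of n] N[OF mn(2), of m] by auto
      show "l2_norm lebesgue (\<lambda>x. jet (S m) (T m) x - jet (S n) (T n) x) < e"
      proof (cases "m \<le> n")
        case True
        thus ?thesis using jump[OF True] sd l2_norm_minus_commute[of lebesgue "jet (S m) (T m)" "jet (S n) (T n)"] by linarith
      next
        case False
        thus ?thesis using jump[of n m] sd by linarith
      qed
    qed
  qed
  then obtain q Q where Wq: "wdiff lebesgue q Q" 
    and lim: "(\<lambda>n. l2_norm lebesgue (\<lambda>x. jet (S n) (T n) x - jet q Q x)) \<longlonglongrightarrow> 0"
    using wdiff_complete[of lebesgue S T, OF sobolev_measure_lebesgue WS] by blast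
  have norm_q: "l2_norm lebesgue (jet q Q) \<le> suminf \<delta>"
  proof (rule LIMSEQ_le_const2[OF l2_norm_tendsto[OF J wdiff_jet[OF Wq] lim]])
    have "l2_norm lebesgue (jet (S n) (T n)) \<le> suminf \<delta>" for n
    proof -
      have "l2_norm lebesgue (jet (S n) (T n)) \<le> (\<Sum>i=0..<n. \<delta> i)" using jump[of 0 n] by (simp add: S_def T_def zero_prod_def[symmetric])
      also have "\<dots> \<le> suminf \<delta>" using sum_le_suminf[OF s, of "{0..<n}"] d0 by auto
      finally show ?thesis .
    qed
    thus "\<exists>N. \<forall>n\<ge>N. l2_norm lebesgue (jet (S n) (T n)) \<le> suminf \<delta>" by blast
  qed
  obtain r where r: "strict_mono (r::nat\<Rightarrow>nat)" "AE x in lebesgue. (\<lambda>n. jet (S (r n)) (T (r n)) x - jet q Q x) \<longlonglongrightarrow> 0"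
    using l2_AE_subseq[of "\<lambda>n x. jet (S n) (T n) x - jet q Q x" lebesgue, OF L2_diff[OF J wdiff_jet[OF Wq]] lim] by blast
  have ge: "AE x in lebesgue. \<forall>n. p n x \<le> q x"
    using r(2)
  proof eventually_elim
    case (elim x)
    from tendsto_fst[OF this] have "(\<lambda>n. S (r n) x - q x) \<longlonglongrightarrow> 0" by simp
    hence l: "(\<lambda>n. S (r n) x) \<longlonglongrightarrow> q x" by (rule LIM_zero_cancel)
    show ?case
    proof
      fix n
      have "p n x \<le> S (r m) x" if "m \<ge> Suc n" for m
      proof -
        have "n < r m" using that seq_suble[OF r(1), of m] by linarith
        thus ?thesis unfolding S_def using nn by (intro member_le_sum) auto
      qed
      thus "p n x \<le> q x" using LIMSEQ_le_const[OF l] by blast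
    qed
  qed
  have ae_all: "AE x in lebesgue. \<forall>n. x \<in> U n \<longrightarrow> 1 \<le> p n x" unfolding AE_all_countable using ae by blast
  let ?q = "\<lambda>x. max 0 (q x)"
  have qm: "q \<in> borel_measurable lebesgue" using wdiff_L2[OF Wq] by (auto dest: L2_measurable)
  have eqq: "AE x in lebesgue. q x = ?q x"
    using ge
  proof eventually_elim
    case (elim x)
    hence "0 \<le> q x" using nn[of 0 x] order_trans by blast
    thus ?case by simp
  qed
  have q'm: "?q \<in> borel_measurable lebesgue" using qm by measurable
  have "has_weak_gradient ?q Q"
    by (rule has_weak_gradient_cong[OF wdiff_L2(3)[OF Wq] eqq _ q'm]) (use wdiff_L2(2)[OF Wq] in \<open>auto dest: L2_measurable\<close>)
  moreover have "?q \<in> L2 lebesgue" by (rule L2_cong_AE[OF wdiff_L2(1)[OF Wq] q'm eqq])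
  ultimately have W': "wdiff lebesgue ?q Q" using wdiff_L2(2)[OF Wq] by (simp add: wdiff_def)
  have "l2_norm lebesgue (jet ?q Q) = l2_norm lebesgue (jet q Q)"
    using eqq by (intro l2_norm_cong_AE L2_measurable wdiff_jet[OF W'] wdiff_jet[OF Wq]) (auto elim!: eventually_mono)
  moreover have "AE x in lebesgue. x \<in> (\<Union>n. U n) \<longrightarrow> 1 \<le> ?q x"
    using ge ae_all
  proof eventually_elim
    case (elim x)
    show ?case
    proof
      assume "x \<in> (\<Union>n. U n)"
      then obtain n where "1 \<le> p n x" using elim(2) by blast
      also have "p n x \<le> q x" using elim(1) by blast
      finally show "1 \<le> ?q x" by simp
    qed
  qed
  ultimately have "barrier (\<Union>n. U n) (suminf \<delta>) ?q Q"
    using W' norm_q by (simp add: barrier_def)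
  thus ?thesis by (rule that)
qed

lemma cap_mono: "E \<subseteq> F \<Longrightarrow> cap E \<le> cap F"
  unfolding cap_def by (intro Inf_superset_mono) blast

lemma cap_empty [simp]: "cap {} = 0"
proof -
  have "barrier {} 0 (\<lambda>x::'a. 0) (\<lambda>x. 0)" 
    using wdiff_zero[of "lebesgue :: 'a measure"] by (simp add: barrier_def zero_prod_def[symmetric])
  from cap_le_barrier[OF this, of "{}"] show ?thesis by simp
qed

lemma cap_Union_le:
  assumes "\<And>n::nat. cap (E n) < ennreal ((\<delta> n)\<^sup>2)" "\<And>n. \<delta> n > 0" "summable \<delta>"
  shows "cap (\<Union>n. E n) \<le> ennreal ((2 * suminf \<delta>)\<^sup>2)"
proof -
  have "\<exists>U p P. open U \<and> E n \<subseteq> U \<and> barrier U (2 * \<delta> n) p P" for n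
    using barrier_of_cap[OF assms(1,2)] by metis
  then obtain U p P where U: "\<And>n. open (U n)" "\<And>n. E n \<subseteq> U n" "\<And>n. barrier (U n) (2 * \<delta> n) (p n) (P n)" by metis
  have s: "summable (\<lambda>n. 2 * \<delta> n)" by (intro summable_mult assms)
  obtain q Q where "barrier (\<Union>n. U n) (suminf (\<lambda>n. 2 * \<delta> n)) q Q"
    using barrier_countable_Union[OF U(3) s] by blast
  from cap_le_barrier[OF this] have "cap (\<Union>n. E n) \<le> ennreal ((suminf (\<lambda>n. 2 * \<delta> n))\<^sup>2)" using U by (simp add: UN_mono open_UN)
  also have "suminf (\<lambda>n. 2 * \<delta> n) = 2 * suminf \<delta>" by (rule suminf_mult[OF assms(3)])
  finally show ?thesis .
qed

lemma suminf_geometric_half: "summable (\<lambda>n. c * (1/2::real)^n)" "(\<Sum>n. c * (1/2::real)^n) = 2 * c"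
  by (auto simp: suminf_mult suminf_geometric summable_mult summable_geometric)

text \<open>Distribute \<open>e\<close> over the sets by a geometric series.\<close>

lemma cap_zero_Union:
  assumes "\<And>n::nat. cap (E n) = 0" shows "cap (\<Union>n. E n) = 0"
proof -
  have *: "cap (\<Union>n. E n) \<le> ennreal e" if e: "e > 0" for e
  proof -
    have "cap (\<Union>n. E n) \<le> ennreal ((2 * (\<Sum>n. (sqrt e / 4) * (1/2)^n))\<^sup>2)"
      using e by (intro cap_Union_le suminf_geometric_half) (auto simp: assms)
    also have "2 * (\<Sum>n. (sqrt e / 4) * (1/2)^n) = sqrt e" unfolding suminf_geometric_half by simp
    finally show ?thesis using e by simp
  qed
  have "cap (\<Union>n. E n) \<le> 0"
    by (rule ennreal_le_epsilon) (use * in simp)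
  thus ?thesis by simp
qed

lemma cap_zero_Un: "cap A = 0 \<Longrightarrow> cap B = 0 \<Longrightarrow> cap (A \<union> B) = 0"
proof -
  assume "cap A = 0" "cap B = 0"
  hence "cap (\<Union>n::nat. if n = 0 then A else B) = 0" by (intro cap_zero_Union) auto
  moreover have "A \<union> B \<subseteq> (\<Union>n::nat. if n = 0 then A else B)"
    by (force intro: exI[of _ "0::nat"] exI[of _ "1::nat"])
  ultimately show ?thesis using cap_mono by (metis le_zero_eq)
qed

lemma emeasure_le_barrier:
  assumes "barrier U \<delta> p P" "open U"
  shows "emeasure lebesgue U \<le> ennreal (\<delta>\<^sup>2)"
proof -
  have W: "wdiff lebesgue p P" and ae: "AE x in lebesgue. x \<in> U \<longrightarrow> 1 \<le> p x" and le: "l2_norm lebesgue (jet p P) \<le> \<delta>"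
    using assms by (auto simp: barrier_def)
  have Us: "U \<in> sets lebesgue" using assms by simp
  have "emeasure lebesgue U = (\<integral>\<^sup>+x. indicator U x \<partial>lebesgue)" using Us by simp
  also have "\<dots> \<le> (\<integral>\<^sup>+x. ennreal ((norm (p x))\<^sup>2) \<partial>lebesgue)"
  proof (rule nn_integral_mono_AE)
    show "AE x in lebesgue. indicator U x \<le> ennreal ((norm (p x))\<^sup>2)"
      using ae
    proof eventually_elim
      case (elim x)
      show ?case
      proof (cases "x \<in> U")
        case True
        hence "1 \<le> (norm (p x))\<^sup>2" using elim power_mono[of 1 "p x" 2] by simp
        thus ?thesis using True by (simp add: ennreal_1[symmetric] del: ennreal_1)
      qed simp
    qed
  qed
  also have "\<dots> = ennreal ((l2_norm lebesgue p)\<^sup>2)"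
    unfolding l2_norm_sq by (rule nn_integral_eq_integral[OF L2_integrable[OF wdiff_L2(1)[OF W]]]) simp
  also have "\<dots> \<le> ennreal (\<delta>\<^sup>2)"
    using L2_fst_snd(3)[OF wdiff_jet[OF W]] le by (intro ennreal_leI power_mono) auto
  finally show ?thesis .
qed

lemma open_neighbourhood_of_small_cap:
  assumes "cap E < ennreal (\<epsilon>\<^sup>2)" "\<epsilon> > 0"
  obtains U where "open U" "E \<subseteq> U" "emeasure lebesgue U \<le> ennreal ((2 * \<epsilon>)\<^sup>2)"
  using barrier_of_cap[OF assms] emeasure_le_barrier by metis

text \<open>Small capacity forces an open neighbourhood of small measure, by Chebyshev's inequality for its barrier.\<close>

lemma cap_zero_AE:
  assumes "cap E = 0" shows "AE x in lebesgue. x \<notin> E"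
proof -
  have "\<exists>U. open U \<and> E \<subseteq> U \<and> emeasure lebesgue U \<le> ennreal ((2 * (1 / real (Suc n)))\<^sup>2)" for n
  proof -
    have "cap E < ennreal ((1 / real (Suc n))\<^sup>2)" unfolding assms by simp
    from open_neighbourhood_of_small_cap[OF this] show ?thesis by (metis of_nat_0_less_iff zero_less_Suc zero_less_divide_1_iff)
  qed
  then obtain U where U: "\<And>n. open (U n)" "\<And>n. E \<subseteq> U n" "\<And>n. emeasure lebesgue (U n) \<le> ennreal ((2 * (1 / real (Suc n)))\<^sup>2)"
    by metis
  let ?N = "\<Inter>n. U n"
  have Ns: "?N \<in> sets lebesgue" using U by (intro sets.countable_INT'') auto
  have le: "emeasure lebesgue ?N \<le> ennreal ((2 * (1 / real (Suc n)))\<^sup>2)" for n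
  proof -
    have "emeasure lebesgue ?N \<le> emeasure lebesgue (U n)" using U by (intro emeasure_mono) auto
    thus ?thesis using U(3)[of n] by (rule order_trans)
  qed
  have "(\<lambda>n. ennreal ((2 * (1 / real (Suc n)))\<^sup>2)) \<longlonglongrightarrow> ennreal ((2 * 0)\<^sup>2)"
    by (intro tendsto_ennrealI tendsto_power tendsto_mult tendsto_const LIMSEQ_Suc[OF lim_1_over_n])
  hence "emeasure lebesgue ?N \<le> ennreal ((2 * 0)\<^sup>2)"
    by (rule LIMSEQ_le_const) (intro exI allI impI le)
  hence "?N \<in> null_sets lebesgue" using Ns by (auto simp: null_sets_def)
  hence "AE x in lebesgue. x \<notin> ?N" by (rule AE_not_in)
  thus ?thesis by eventually_elim (use U(2) in blast)
qed

section \<open>Quasi-continuous functions and quasi-open sets\<close>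

lemma open_Un_superlevel:
  fixes w :: "'a::euclidean_space \<Rightarrow> real"
  assumes "open V" "continuous_on (- V) w"
  shows "open ({x. x \<notin> V \<and> c < \<bar>w x\<bar>} \<union> V)"
proof -
  have "closed (- V \<inter> w -` {-c..c})"
    using assms by (intro continuous_closed_preimage) auto
  moreover have "- ({x. x \<notin> V \<and> c < \<bar>w x\<bar>} \<union> V) = - V \<inter> w -` {-c..c}"
    by (auto simp: not_less abs_le_iff)
  ultimately show ?thesis by (simp add: open_closed)
qed

text \<open>Chebyshev's inequality for capacity: \<open>excess (w / c)\<close> is a barrier for the set \<open>\<bar>w\<bar> > c\<close>.\<close>

lemma superlevel_barrier:
  assumes b: "barrier V \<delta> p P" and W: "wdiff lebesgue w G" and c: "c > 0"
  obtains q Q where "barrier ({x. x \<notin> V \<and> c < \<bar>w x\<bar>} \<union> V) (2 * (l2_norm lebesgue (jet w G) / c) + \<delta>) q Q"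
proof -
  have Wc: "wdiff lebesgue (\<lambda>x. (1/c) * w x) (\<lambda>x. (1/c) *\<^sub>R G x)" by (rule wdiff_scale[OF W])
  have "l2_norm lebesgue (jet (\<lambda>x. (1/c) * w x) (\<lambda>x. (1/c) *\<^sub>R G x)) = l2_norm lebesgue (jet w G) / c"
    using l2_norm_scaleR[of lebesgue "1/c" "jet w G"] c by simp
  hence "barrier {x. x \<notin> V \<and> c < \<bar>w x\<bar>} (2 * (l2_norm lebesgue (jet w G) / c))
     (\<lambda>x. excess ((1/c) * w x)) (\<lambda>x. excess' ((1/c) * w x) *\<^sub>R ((1/c) *\<^sub>R G x))"
    unfolding barrier_def using wdiff_excess[OF Wc] c excess_nonneg by (auto intro!: excess_ge_1 simp: abs_mult)
  from barrier_add[OF this b] show ?thesis by (rule that)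
qed

lemma quasi_continuousE:
  assumes "quasi_continuous f" "\<delta> > 0"
  obtains V p P where "open V" "barrier V \<delta> p P" "continuous_on (- V) f"
proof -
  have "(\<delta>/2)\<^sup>2 > 0" using assms by simp
  then obtain \<omega> where w: "open \<omega>" "cap \<omega> < ennreal ((\<delta>/2)\<^sup>2)" "continuous_on (- \<omega>) f"
    using assms(1) unfolding quasi_continuous_def by blast
  obtain V p P where V: "open V" "\<omega> \<subseteq> V" "barrier V (2 * (\<delta>/2)) p P"
    using barrier_of_cap[OF w(2)] assms(2) by auto
  have "continuous_on (- V) f" using V(2) by (intro continuous_on_subset[OF w(3)]) auto
  thus ?thesis using V that by simp
qed

lemma quasi_continuousI:
  assumes "\<And>\<delta>. \<delta> > 0 \<Longrightarrow> \<exists>V p P. open V \<and> barrier V \<delta> p P \<and> continuous_on (- V) f"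
  shows "quasi_continuous f"
  unfolding quasi_continuous_def
proof (intro allI impI)
  fix \<epsilon> :: real assume e: "\<epsilon> > 0"
  have "sqrt \<epsilon> / 2 > 0" using e by simp
  then obtain V p P where V: "open V" "barrier V (sqrt \<epsilon> / 2) p P" "continuous_on (- V) f" using assms by blast
  have "cap V \<le> ennreal ((sqrt \<epsilon> / 2)\<^sup>2)" using cap_le_barrier[OF V(2,1)] by blast
  also have "\<dots> < ennreal \<epsilon>" using e by (intro ennreal_lessI) (auto simp: power_divide)
  finally show "\<exists>\<omega>. open \<omega> \<and> cap \<omega> < ennreal \<epsilon> \<and> continuous_on (- \<omega>) f" using V by blast
qed

lemma continuous_imp_quasi_continuous: "continuous_on UNIV f \<Longrightarrow> quasi_continuous f"
  unfolding quasi_continuous_def by (intro allI impI exI[of _ "{}"]) (auto intro: continuous_on_subset)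

text \<open>Finitely many exceptional sets are united, so their barriers are added.\<close>

lemma quasi_continuous_common:
  fixes k :: nat
  assumes "\<And>i. i < k \<Longrightarrow> quasi_continuous (f i)" "\<delta> > 0"
  shows "\<exists>V p P. open V \<and> barrier V \<delta> p P \<and> (\<forall>i<k. continuous_on (- V) (f i))"
  using assms
proof (induction k arbitrary: \<delta>)
  case 0
  have "barrier {} \<delta> (\<lambda>x::'a. 0) (\<lambda>x. 0)" 
    using 0 wdiff_zero[of "lebesgue :: 'a measure"] by (simp add: barrier_def zero_prod_def[symmetric])
  thus ?case by (intro exI[of _ "{}"]) auto
next
  case (Suc k)
  obtain V p P where V: "open V" "barrier V (\<delta>/2) p P" "\<forall>i<k. continuous_on (- V) (f i)" 
    using Suc.IH[of "\<delta>/2"] Suc.prems by (metis half_gt_zero less_SucI)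
  obtain U q Q where U: "open U" "barrier U (\<delta>/2) q Q" "continuous_on (- U) (f k)" 
    using quasi_continuousE[of "f k" "\<delta>/2"] Suc.prems by (metis half_gt_zero lessI)
  have "barrier (V \<union> U) \<delta> (\<lambda>x. p x + q x) (\<lambda>x. P x + Q x)" using barrier_add[OF V(2) U(2)] by simp
  moreover have "continuous_on (- (V \<union> U)) (f i)" if "i < Suc k" for i
  proof (cases "i = k")
    case True
    thus ?thesis using continuous_on_subset[OF U(3), of "- (V \<union> U)"] by simp
  next
    case False
    hence "continuous_on (- V) (f i)" using V(3) that by simp
    thus ?thesis by (rule continuous_on_subset) simp
  qed
  ultimately show ?case using V(1) U(1) by (intro exI[of _ "V \<union> U"]) auto
qed

lemma quasi_continuous_commonE:
  fixes k :: nat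
  assumes "\<And>i. i < k \<Longrightarrow> quasi_continuous (f i)" "\<delta> > 0"
  obtains V p P where "open V" "barrier V \<delta> p P" "\<forall>i<k. continuous_on (- V) (f i)"
proof -
  have "\<exists>V p P. open V \<and> barrier V \<delta> p P \<and> (\<forall>i<k. continuous_on (- V) (f i))"
    using assms by (rule quasi_continuous_common)
  thus ?thesis by (elim exE conjE) (rule that, auto)
qed

lemma quasi_continuous_add:
  assumes "quasi_continuous f" "quasi_continuous g" shows "quasi_continuous (\<lambda>x. f x + g x)"
proof (rule quasi_continuousI)
  fix \<delta> :: real assume "\<delta> > 0"
  have "quasi_continuous ((\<lambda>i. if i = 0 then f else g) i)" if "i < 2" for i :: nat using assms by simp
  from quasi_continuous_commonE[OF this \<open>\<delta> > 0\<close>]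
  obtain V p P where V: "open V" "barrier V \<delta> p P" 
    "\<forall>i<2. continuous_on (- V) (if i = (0::nat) then f else g)" .
  have "continuous_on (- V) f" using V(3)[rule_format, of 0] by simp
  moreover have "continuous_on (- V) g" using V(3)[rule_format, of 1] by simp
  ultimately show "\<exists>V p P. open V \<and> barrier V \<delta> p P \<and> continuous_on (- V) (\<lambda>x. f x + g x)"
    using V(1,2) by (intro exI conjI continuous_on_add)
qed

lemma quasi_continuous_scale:
  fixes f :: "'a::euclidean_space \<Rightarrow> real"
  assumes "quasi_continuous f" shows "quasi_continuous (\<lambda>x. c * f x)"
proof (rule quasi_continuousI)
  fix \<delta> :: real assume "\<delta> > 0"
  from quasi_continuousE[OF assms this] obtain V p P where "open V" "barrier V \<delta> p P" "continuous_on (- V) f" .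
  thus "\<exists>V p P. open V \<and> barrier V \<delta> p P \<and> continuous_on (- V) (\<lambda>x. c * f x)"
    using continuous_on_mult_left by blast
qed

text \<open>Outside a small open set \<open>V\<close> the function \<open>\<Sum> \<bar>f i\<bar>\<close> is continuous, so its positivity set becomes open after
  adding \<open>V\<close>.\<close>

theorem quasi_open_nonzero:
  fixes k :: nat and f :: "nat \<Rightarrow> 'a::euclidean_space \<Rightarrow> real"
  assumes "\<And>i. i < k \<Longrightarrow> quasi_continuous (f i)"
  shows "quasi_open {x. \<exists>i<k. f i x \<noteq> 0}"
  unfolding quasi_open_def
proof (intro allI impI)
  fix \<epsilon> :: real assume e: "\<epsilon> > 0"
  have "sqrt \<epsilon> / 2 > 0" using e by simp
  from quasi_continuous_commonE[OF assms this] obtain V p P where 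
    V: "open V" "barrier V (sqrt \<epsilon> / 2) p P" "\<forall>i<k. continuous_on (- V) (f i)" .
  have "cap V \<le> ennreal ((sqrt \<epsilon> / 2)\<^sup>2)" using cap_le_barrier[OF V(2,1)] by blast
  also have "\<dots> < ennreal \<epsilon>" using e by (intro ennreal_lessI) (auto simp: power_divide)
  finally have c: "cap V < ennreal \<epsilon>" .
  let ?g = "\<lambda>x. \<Sum>i<k. \<bar>f i x\<bar>"
  have "continuous_on (- V) ?g" using V(3) by (intro continuous_intros) auto
  from open_Un_superlevel[OF V(1) this, of 0] have "open ({x. x \<notin> V \<and> 0 < \<bar>?g x\<bar>} \<union> V)" .
  moreover have "0 < \<bar>?g x\<bar> \<longleftrightarrow> (\<exists>i<k. f i x \<noteq> 0)" for x
  proof -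
    have "?g x = 0 \<longleftrightarrow> (\<forall>i\<in>{..<k}. \<bar>f i x\<bar> = 0)" by (rule sum_nonneg_eq_0_iff) auto
    thus ?thesis unfolding zero_less_abs_iff by auto
  qed
  hence "{x. x \<notin> V \<and> 0 < \<bar>?g x\<bar>} \<union> V = {x. \<exists>i<k. f i x \<noteq> 0} \<union> V" by auto
  ultimately have "open ({x. \<exists>i<k. f i x \<noteq> 0} \<union> V)" by simp
  thus "\<exists>\<omega>. open \<omega> \<and> cap \<omega> < ennreal \<epsilon> \<and> open ({x. \<exists>i<k. f i x \<noteq> 0} \<union> \<omega>)" using V(1) c by blast
qed

text \<open>The set differs from a countable intersection of open sets by part of an intersection of zero capacity.\<close>

theorem quasi_open_measurable:
  fixes \<Omega> :: "'a::euclidean_space set"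
  assumes "quasi_open \<Omega>" shows "\<Omega> \<in> sets lebesgue"
proof -
  have "\<exists>\<omega>. open \<omega> \<and> cap \<omega> < ennreal (1 / real (Suc n)) \<and> open (\<Omega> \<union> \<omega>)" for n
    using assms unfolding quasi_open_def by (metis of_nat_0_less_iff zero_less_Suc zero_less_divide_1_iff)
  then obtain \<omega> where w: "\<And>n. open (\<omega> n)" "\<And>n. cap (\<omega> n) < ennreal (1 / real (Suc n))" "\<And>n. open (\<Omega> \<union> \<omega> n)" by metis
  have "cap (\<Inter>n. \<omega> n) \<le> ennreal (1 / real (Suc n))" for n
    using cap_mono[of "\<Inter>n. \<omega> n" "\<omega> n"] w(2)[of n] by (meson INF_lower UNIV_I less_imp_le order_trans)
  moreover have "(\<lambda>n. ennreal (1 / real (Suc n))) \<longlonglongrightarrow> ennreal 0"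
    by (intro tendsto_ennrealI LIMSEQ_Suc[OF lim_1_over_n])
  ultimately have "cap (\<Inter>n. \<omega> n) \<le> ennreal 0" by (intro LIMSEQ_le_const[where X="\<lambda>n. ennreal (1 / real (Suc n))"]) blast+
  hence "AE x in lebesgue. x \<notin> (\<Inter>n. \<omega> n)" by (intro cap_zero_AE) simp
  hence "AE x in lebesgue. x \<in> (\<Inter>n. \<Omega> \<union> \<omega> n) \<longleftrightarrow> x \<in> \<Omega>" by eventually_elim auto
  moreover have "(\<Inter>n. \<Omega> \<union> \<omega> n) \<in> sets lebesgue" using w(3) by (intro sets.countable_INT'') auto
  ultimately show ?thesis by (rule completion.in_sets_AE) simp
qed

lemma quasi_open_empty: "quasi_open {}"
  unfolding quasi_open_def by (intro allI impI exI[of _ "{}"]) auto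

text \<open>An Egorov argument for capacity. Collect in \<open>E n\<close> the exceptional sets of \<open>v n\<close> and \<open>v (Suc n)\<close> and the points where the
  increment exceeds \<open>2 ^ -n\<close>. By the Chebyshev inequality the tails \<open>\<omega> m\<close> of the union have small capacity, and outside
  \<open>\<omega> m\<close> the sequence consists of continuous functions eventually and converges uniformly.\<close>

theorem quasi_continuous_limit:
  fixes v :: "nat \<Rightarrow> 'a::euclidean_space \<Rightarrow> real"
  assumes qc: "\<And>n. quasi_continuous (v n)" and W: "\<And>n. wdiff lebesgue (v n) (G n)"
    and fast: "\<And>n. l2_norm lebesgue (\<lambda>x. jet (v (Suc n)) (G (Suc n)) x - jet (v n) (G n) x) \<le> (1/4)^n"
  obtains w N where "quasi_continuous w" "cap N = 0" "\<And>x. x \<notin> N \<Longrightarrow> (\<lambda>n. v n x) \<longlonglongrightarrow> w x"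
proof -
  have "\<exists>V p P. open V \<and> barrier V ((1/4)^n) p P \<and> continuous_on (- V) (v n)" for n
  proof -
    have "(1/4::real)^n > 0" by simp
    show ?thesis by (rule quasi_continuousE[OF qc \<open>(1/4::real)^n > 0\<close>]) (intro exI conjI, assumption+)
  qed
  then obtain V p P where V: "\<And>n. open (V n)" "\<And>n. barrier (V n) ((1/4)^n) (p n) (P n)" 
    "\<And>n. continuous_on (- V n) (v n)" by metis
  define d where "d n x = v (Suc n) x - v n x" for n x
  define V2 where "V2 n = V n \<union> V (Suc n)" for n
  define E where "E n = {x. x \<notin> V2 n \<and> (1/2)^n < \<bar>d n x\<bar>} \<union> V2 n" for n
  have Eo: "open (E n)" for n
  proof -
    have "continuous_on (- V2 n) (d n)"
      unfolding d_def V2_def using V(3)[of n] V(3)[of "Suc n"] 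
      by (intro continuous_on_diff) (rule continuous_on_subset, assumption, simp)+
    thus ?thesis unfolding E_def using V(1) by (intro open_Un_superlevel) (auto simp: V2_def)
  qed
  \<comment> \<open>The level \<open>2 ^ -n\<close> is between the norm \<open>4 ^ -n\<close> of the increment and \<open>1\<close>, so both the capacities and the increments
    are summable.\<close>
  have Eb: "\<exists>q Q. barrier (E n) (4 * (1/2)^n) q Q" for n
  proof -
    have b2: "barrier (V2 n) ((1/4)^n + (1/4)^(Suc n)) (\<lambda>x. p n x + p (Suc n) x) (\<lambda>x. P n x + P (Suc n) x)"
      unfolding V2_def by (rule barrier_add[OF V(2) V(2)])
    have Wd: "wdiff lebesgue (d n) (\<lambda>x. G (Suc n) x - G n x)" unfolding d_def[abs_def] by (rule wdiff_diff[OF W W])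
    obtain q Q where q: "barrier (E n) (2 * (l2_norm lebesgue (jet (d n) (\<lambda>x. G (Suc n) x - G n x)) / (1/2)^n) + ((1/4)^n + (1/4)^(Suc n))) q Q"
      using superlevel_barrier[OF b2 Wd, of "(1/2)^n"] unfolding E_def by auto
    have "l2_norm lebesgue (jet (d n) (\<lambda>x. G (Suc n) x - G n x)) \<le> (1/4)^n" using fast[of n] by (simp add: d_def)
    hence "l2_norm lebesgue (jet (d n) (\<lambda>x. G (Suc n) x - G n x)) / (1/2)^n \<le> (1/4)^n / (1/2)^n"
      by (rule divide_right_mono) simp
    also have "\<dots> = (1/2)^n" by (simp add: power_divide[symmetric] field_simps)
    finally have 1: "l2_norm lebesgue (jet (d n) (\<lambda>x. G (Suc n) x - G n x)) / (1/2)^n \<le> (1/2)^n" .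
    have 2: "(1/4)^n \<le> ((1/2)^n :: real)" by (rule power_mono) auto
    have 3: "(1/4)^(Suc n) \<le> ((1/4)^n :: real)" by simp
    have "2 * (l2_norm lebesgue (jet (d n) (\<lambda>x. G (Suc n) x - G n x)) / (1/2)^n) + ((1/4)^n + (1/4)^(Suc n)) \<le> 4 * (1/2)^n"
      using 1 2 3 by linarith
    with q show ?thesis using barrier_mono[OF q order_refl] by blast
  qed
  then obtain q Q where q: "\<And>n. barrier (E n) (4 * (1/2)^n) (q n) (Q n)" by metis
  define \<omega> where "\<omega> m = (\<Union>n. E (n + m))" for m
  have wo: "open (\<omega> m)" for m unfolding \<omega>_def using Eo by blast
  have capw: "cap (\<omega> m) \<le> ennreal ((8 * (1/2)^m)\<^sup>2)" for m
  proof -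
    have b: "barrier (E (n + m)) ((4 * (1/2)^m) * (1/2)^n) (q (n + m)) (Q (n + m))" for n
      using q[of "n + m"] by (simp add: power_add mult.commute mult.left_commute)
    obtain qq QQ where "barrier (\<omega> m) (\<Sum>n. (4 * (1/2)^m) * (1/2)^n) qq QQ"
      using barrier_countable_Union[OF b suminf_geometric_half(1)] unfolding \<omega>_def by blast
    from cap_le_barrier[OF this wo order_refl] show ?thesis unfolding suminf_geometric_half by simp
  qed
  have capw0: "(\<lambda>m. ennreal ((8 * (1/2)^m)\<^sup>2)) \<longlonglongrightarrow> ennreal ((8 * 0)\<^sup>2)"
    by (intro tendsto_ennrealI tendsto_power tendsto_mult tendsto_const LIMSEQ_power_zero) simp
  have VE: "V n \<subseteq> \<omega> m" if "m \<le> n" for m n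
  proof -
    have "E (n - m + m) \<subseteq> \<omega> m" unfolding \<omega>_def by blast
    thus ?thesis using that by (auto simp: E_def V2_def)
  qed
  have step: "\<bar>v (Suc n) x - v n x\<bar> \<le> (1/2)^n" if "x \<notin> \<omega> m" "m \<le> n" for x m n
  proof -
    have "x \<notin> E (n - m + m)" using that(1) unfolding \<omega>_def by blast
    thus ?thesis using that(2) by (auto simp: E_def d_def)
  qed
  \<comment> \<open>The subtracted term makes the telescoping estimate inductive.\<close>
  have tele: "\<bar>v (n + j) x - v n x\<bar> \<le> 2 * (1/2)^n - 2 * (1/2)^(n+j)" if "x \<notin> \<omega> m" "m \<le> n" for x m n j
  proof (induction j)
    case (Suc j)
    have "\<bar>v (n + Suc j) x - v n x\<bar> \<le> \<bar>v (Suc (n + j)) x - v (n + j) x\<bar> + \<bar>v (n + j) x - v n x\<bar>" by simp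
    also have "\<dots> \<le> (1/2)^(n+j) + (2 * (1/2)^n - 2 * (1/2)^(n+j))" using step[OF that(1), of "n + j"] that(2) Suc by simp
    finally show ?case by simp
  qed simp
  have tele': "\<bar>v k x - v n x\<bar> \<le> 2 * (1/2)^n" if "x \<notin> \<omega> m" "m \<le> n" "n \<le> k" for x m n k
  proof -
    have "\<bar>v (n + (k - n)) x - v n x\<bar> \<le> 2 * (1/2)^n - 2 * (1/2)^(n+(k-n))" using that by (intro tele)
    moreover have "0 \<le> 2 * (1/2::real)^(n+(k-n))" by simp
    ultimately show ?thesis unfolding le_add_diff_inverse[OF that(3)] by linarith
  qed
  define w where "w x = lim (\<lambda>n. v n x)" for x
  have ul: "uniform_limit (- \<omega> m) v w sequentially" for m
  proof -
    have "uniformly_Cauchy_on (- \<omega> m) v"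
      unfolding uniformly_Cauchy_on_def
    proof (intro allI impI)
      fix e :: real assume e: "e > 0"
      have "(\<lambda>n. 2 * (1/2::real)^n) \<longlonglongrightarrow> 2 * 0" by (intro tendsto_mult tendsto_const LIMSEQ_power_zero) simp
      hence "\<forall>\<^sub>F n in sequentially. 2 * (1/2::real)^n < e / 2" using order_tendstoD(2)[of "\<lambda>n. 2 * (1/2::real)^n" 0 sequentially "e / 2"] e by simp
      then obtain N where N: "\<And>n. n \<ge> N \<Longrightarrow> 2 * (1/2::real)^n < e / 2" by (auto simp: eventually_sequentially)
      show "\<exists>M. \<forall>x\<in>- \<omega> m. \<forall>k\<ge>M. \<forall>n\<ge>M. dist (v k x) (v n x) < e"
      proof (intro exI ballI allI impI)
        fix x k n assume x: "x \<in> - \<omega> m" and k: "k \<ge> max N m" and n: "n \<ge> max N m"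
        have "\<bar>v k x - v (max N m) x\<bar> \<le> 2 * (1/2)^(max N m)" "\<bar>v n x - v (max N m) x\<bar> \<le> 2 * (1/2)^(max N m)"
          using tele'[of x m "max N m"] x k n by auto
        moreover have "2 * (1/2::real)^(max N m) < e / 2" by (rule N) simp
        ultimately show "dist (v k x) (v n x) < e" unfolding dist_real_def by linarith
      qed
    qed
    hence "uniformly_convergent_on (- \<omega> m) v" by (rule Cauchy_uniformly_convergent)
    thus ?thesis unfolding uniformly_convergent_uniform_limit_iff w_def[abs_def] .
  qed
  have "quasi_continuous w"
    unfolding quasi_continuous_def
  proof (intro allI impI)
    fix \<epsilon> :: real assume e: "\<epsilon> > 0"
    have "\<forall>\<^sub>F m in sequentially. ennreal ((8 * (1/2)^m)\<^sup>2) < ennreal \<epsilon>"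
      using capw0 e by (intro order_tendstoD(2)) auto
    then obtain m where m: "ennreal ((8 * (1/2)^m)\<^sup>2) < ennreal \<epsilon>" by (auto simp: eventually_sequentially)
    have "\<forall>\<^sub>F n in sequentially. continuous_on (- \<omega> m) (v n)"
      unfolding eventually_sequentially
    proof (intro exI allI impI)
      fix n assume "m \<le> n"
      show "continuous_on (- \<omega> m) (v n)" using VE[OF \<open>m \<le> n\<close>] by (intro continuous_on_subset[OF V(3)[of n]]) simp
    qed
    hence "continuous_on (- \<omega> m) w" by (rule uniform_limit_theorem[OF _ ul]) simp
    thus "\<exists>\<omega>. open \<omega> \<and> cap \<omega> < ennreal \<epsilon> \<and> continuous_on (- \<omega>) w"
      using wo le_less_trans[OF capw m] by blast
  qed
  moreover have "cap (\<Inter>m. \<omega> m) = 0"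
  proof -
    have "cap (\<Inter>m. \<omega> m) \<le> ennreal ((8 * (1/2)^m)\<^sup>2)" for m
      using cap_mono[of "\<Inter>m. \<omega> m" "\<omega> m"] capw[of m] by (meson INF_lower UNIV_I order_trans)
    hence "cap (\<Inter>m. \<omega> m) \<le> ennreal ((8 * 0)\<^sup>2)" by (intro LIMSEQ_le_const[OF capw0]) blast
    thus ?thesis by simp
  qed
  moreover have "(\<lambda>n. v n x) \<longlonglongrightarrow> w x" if x: "x \<notin> (\<Inter>m. \<omega> m)" for x
  proof -
    obtain m where "x \<in> - \<omega> m" using x by auto
    thus ?thesis using tendsto_uniform_limitI[OF ul] by blast
  qed
  ultimately show ?thesis by (rule that)
qed

text \<open>Continuous Sobolev functions approximate \<open>u\<close> as fast as wanted, and their limit outside a set of zero capacity is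
  quasi-continuous.\<close>

theorem quasi_continuous_representative:
  assumes W: "wdiff lebesgue u G"
  obtains w where "quasi_continuous w" "AE x in lebesgue. w x = u x"
proof -
  \<comment> \<open>The errors \<open>4 ^ -n / 4\<close> of value and gradient add up to at most \<open>4 ^ -n\<close> for consecutive members.\<close>
  let ?approx = "\<lambda>n f. wdiff lebesgue (fst f) (snd f) \<and> continuous_on UNIV (fst f) \<and> 
     l2_norm lebesgue (\<lambda>x. fst f x - u x) \<le> (1/4)^n / 4 \<and> l2_norm lebesgue (\<lambda>x. snd f x - G x) \<le> (1/4)^n / 4"
  have "\<exists>f. ?approx n f" for n :: nat
  proof -
    have "(1/4::real)^n / 4 > 0" by simp
    from continuous_approximation[OF W this] obtain v H where
      "wdiff lebesgue v H" "continuous_on UNIV v" "l2_norm lebesgue (\<lambda>x. v x - u x) \<le> (1/4)^n / 4"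
      "l2_norm lebesgue (\<lambda>x. H x - G x) \<le> (1/4)^n / 4" .
    thus ?thesis by (intro exI[of _ "(v, H)"]) simp
  qed
  hence "\<forall>n. \<exists>f. ?approx n f" by (rule allI)
  from choice[OF this] obtain f where f: "\<forall>n. ?approx n (f n)" ..
  define v where "v n = fst (f n)" for n
  define H where "H n = snd (f n)" for n
  have v: "\<And>n. wdiff lebesgue (v n) (H n)" "\<And>n. continuous_on UNIV (v n)" 
    "\<And>n. l2_norm lebesgue (\<lambda>x. v n x - u x) \<le> (1/4)^n / 4" "\<And>n. l2_norm lebesgue (\<lambda>x. H n x - G x) \<le> (1/4)^n / 4"
    using f unfolding v_def H_def by blast+
  have D: "l2_norm lebesgue (\<lambda>x. jet (v n) (H n) x - jet u G x) \<le> (1/4)^n / 2" for n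
  proof (rule power2_le_imp_le)
    have "(l2_norm lebesgue (\<lambda>x. v n x - u x))\<^sup>2 \<le> ((1/4)^n / 4)\<^sup>2" "(l2_norm lebesgue (\<lambda>x. H n x - G x))\<^sup>2 \<le> ((1/4)^n / 4)\<^sup>2"
      by (rule power_mono[OF v(3) l2_norm_nonneg], rule power_mono[OF v(4) l2_norm_nonneg])
    moreover have "(l2_norm lebesgue (\<lambda>x. jet (v n) (H n) x - jet u G x))\<^sup>2 = 
      (l2_norm lebesgue (\<lambda>x. v n x - u x))\<^sup>2 + (l2_norm lebesgue (\<lambda>x. H n x - G x))\<^sup>2"
      using l2_norm_Pair[OF wdiff_L2(1)[OF wdiff_diff[OF v(1) W]] wdiff_L2(2)[OF wdiff_diff[OF v(1) W]]] by simp
    ultimately have "(l2_norm lebesgue (\<lambda>x. jet (v n) (H n) x - jet u G x))\<^sup>2 \<le> ((1/4)^n / 4)\<^sup>2 + ((1/4)^n / 4)\<^sup>2" by linarith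
    also have "\<dots> \<le> ((1/4)^n / 2)\<^sup>2"
    proof -
      have "(y / 4)\<^sup>2 + (y / 4)\<^sup>2 \<le> (y / 2)\<^sup>2" for y :: real by (simp add: power_divide)
      thus ?thesis .
    qed
    finally show "(l2_norm lebesgue (\<lambda>x. jet (v n) (H n) x - jet u G x))\<^sup>2 \<le> ((1/4)^n / 2)\<^sup>2" .
  qed simp
  have fast: "l2_norm lebesgue (\<lambda>x. jet (v (Suc n)) (H (Suc n)) x - jet (v n) (H n) x) \<le> (1/4)^n" for n
  proof -
    have "l2_norm lebesgue (\<lambda>x. jet (v (Suc n)) (H (Suc n)) x - jet (v n) (H n) x) \<le> 
       l2_norm lebesgue (\<lambda>x. jet (v (Suc n)) (H (Suc n)) x - jet u G x) + l2_norm lebesgue (\<lambda>x. jet u G x - jet (v n) (H n) x)"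
      by (intro l2_norm_triangle_diff wdiff_jet[OF v(1)] wdiff_jet[OF W])
    also have "\<dots> \<le> (1/4)^(Suc n) / 2 + (1/4)^n / 2"
      using D[of "Suc n"] D[of n] l2_norm_minus_commute[of lebesgue "jet u G" "jet (v n) (H n)"] by linarith
    also have "\<dots> \<le> (1/4)^n" by simp
    finally show ?thesis .
  qed
  obtain w N where w: "quasi_continuous w" "cap N = 0" "\<And>x. x \<notin> N \<Longrightarrow> (\<lambda>n. v n x) \<longlonglongrightarrow> w x"
    using quasi_continuous_limit[of v H, OF continuous_imp_quasi_continuous[OF v(2)] v(1) fast] by blast
  have vl: "(\<lambda>n. l2_norm lebesgue (\<lambda>x. v n x - u x)) \<longlonglongrightarrow> 0"
  proof (rule Lim_null_comparison)
    show "\<forall>\<^sub>F n in sequentially. norm (l2_norm lebesgue (\<lambda>x. v n x - u x)) \<le> (1/4)^n / 4" using v(3) by simp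
    have "(\<lambda>n. (1/4)^n / 4) \<longlonglongrightarrow> 0 / (4::real)" by (intro tendsto_divide tendsto_const LIMSEQ_power_zero) auto
    thus "(\<lambda>n. (1/4)^n / 4) \<longlonglongrightarrow> (0::real)" by simp
  qed
  obtain r where r: "strict_mono (r::nat\<Rightarrow>nat)" "AE x in lebesgue. (\<lambda>n. v (r n) x - u x) \<longlonglongrightarrow> 0"
    using l2_AE_subseq[of "\<lambda>n x. v n x - u x" lebesgue, OF wdiff_L2(1)[OF wdiff_diff[OF v(1) W]] vl] by blast
  have "AE x in lebesgue. w x = u x"
    using r(2) cap_zero_AE[OF w(2)]
  proof eventually_elim
    case (elim x)
    have "(\<lambda>n. v (r n) x) \<longlonglongrightarrow> u x" using elim(1) by (rule LIM_zero_cancel)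
    moreover have "(\<lambda>n. v (r n) x) \<longlonglongrightarrow> w x" using LIMSEQ_subseq_LIMSEQ[OF w(3)[OF elim(2)] r(1)] by (simp add: comp_def)
    ultimately show ?case using LIMSEQ_unique by blast
  qed
  thus ?thesis using w(1) that by blast
qed

section \<open>Second moments for the Gaussian weight\<close>

abbreviation gweight :: "'a::euclidean_space \<Rightarrow> real" where "gweight x \<equiv> exp ((norm x)\<^sup>2 / 2)"

lemma gweight_measurable: "gweight \<in> borel_measurable (lebesgue :: 'a::euclidean_space measure)"
  by (intro measurable_completion) measurable

lemma mN_eq: "mN = density lebesgue (\<lambda>x. ennreal (gweight x))"
  by (simp add: mN_def)

text \<open>The weight is finite and at least \<open>1\<close>.\<close>

lemma sobolev_measure_mN: "sobolev_measure (mN :: 'a::euclidean_space measure)"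
proof -
  have m: "(\<lambda>x::'a. ennreal (gweight x)) \<in> borel_measurable lebesgue" using gweight_measurable by measurable
  have "(AE x in mN. P x) \<longleftrightarrow> (AE x in lebesgue. P x)" for P :: "'a \<Rightarrow> bool"
    unfolding mN_eq AE_density[OF m] by simp
  moreover have "integral\<^sup>N lebesgue f \<le> integral\<^sup>N mN f" if f: "f \<in> borel_measurable lebesgue" for f :: "'a \<Rightarrow> ennreal"
  proof -
    have "1 * f x \<le> ennreal (gweight x) * f x" for x
      by (rule mult_right_mono) (simp_all add: ennreal_1[symmetric] del: ennreal_1)
    hence "integral\<^sup>N lebesgue f \<le> (\<integral>\<^sup>+x. ennreal (gweight x) * f x \<partial>lebesgue)"
      by (intro nn_integral_mono) simp
    also have "\<dots> = integral\<^sup>N mN f" unfolding mN_eq by (rule nn_integral_density[OF m f, symmetric])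
    finally show ?thesis .
  qed
  ultimately show ?thesis unfolding sobolev_measure_def by (simp add: mN_def)
qed

lemma integral_mN:
  fixes f :: "'a::euclidean_space \<Rightarrow> real"
  assumes "f \<in> borel_measurable lebesgue"
  shows "(LINT x|mN. f x) = (LINT x|lebesgue. gweight x * f x)" "integrable mN f \<longleftrightarrow> integrable lebesgue (\<lambda>x. gweight x * f x)"
  unfolding mN_eq using integral_density[OF assms gweight_measurable] integrable_density[OF assms gweight_measurable] by auto

text \<open>The weight, cut off smoothly at radius \<open>R\<close>. The limit as \<open>R\<close> grows is the weight times \<open>bump 1 = exp (-1)\<close>.\<close>

definition cutoff :: "real \<Rightarrow> 'a::euclidean_space \<Rightarrow> real" where
  "cutoff R x = bump (1 - (norm x)\<^sup>2 / R\<^sup>2) * gweight x"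

lemma smooth_norm_sq: "smooth (\<lambda>x. (norm x)\<^sup>2 * c)"
proof -
  have "(\<lambda>x::'a. (norm x)\<^sup>2 * c) = (\<lambda>x. (\<Sum>b\<in>Basis. (x \<bullet> b) * (x \<bullet> b)) * c)"
    by (simp add: power2_norm_eq_inner euclidean_inner[symmetric])
  moreover have "smooth (\<lambda>x::'a. (\<Sum>b\<in>Basis. (x \<bullet> b) * (x \<bullet> b)) * c)"
    by (intro smooth_mult smooth_sum smooth_inner smooth_const)
  ultimately show ?thesis by simp
qed

lemma cutoff_test:
  assumes R: "R > 0" shows "(cutoff R :: 'a::euclidean_space \<Rightarrow> real) \<in> test_functions"
proof (rule test_functionI_ball)
  have "smooth (\<lambda>x::'a. bump (1 - (norm x)\<^sup>2 * (1 / R\<^sup>2)) * exp ((norm x)\<^sup>2 * (1/2)))"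
    by (intro smooth_mult smooth_bump smooth_diff smooth_const smooth_exp smooth_norm_sq)
  thus "smooth (cutoff R :: 'a \<Rightarrow> real)" by (simp add: cutoff_def[abs_def])
  fix x :: 'a assume "norm x > R"
  hence "(norm x)\<^sup>2 \<ge> R\<^sup>2" using R by (intro power_mono) auto
  hence "1 - (norm x)\<^sup>2 / R\<^sup>2 \<le> 0" using R by (simp add: field_simps)
  thus "cutoff R x = 0" by (simp add: cutoff_def bump_eq)
qed

lemma cutoff_derivative:
  fixes x v :: "'a::euclidean_space"
  shows "frechet_derivative (cutoff R) (at x) v = 
    (x \<bullet> v) * (cutoff R x - (2 / R\<^sup>2) * bump_deriv 1 (1 - (norm x)\<^sup>2 / R\<^sup>2) * gweight x)"
proof -
  have n: "((\<lambda>x::'a. (norm x)\<^sup>2) has_derivative (\<lambda>v. 2 * (x \<bullet> v))) (at x)"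
    unfolding power2_norm_eq_inner by (auto intro!: derivative_eq_intros simp: inner_commute)
  have p: "((\<lambda>x::'a. 1 - (norm x)\<^sup>2 / R\<^sup>2) has_derivative (\<lambda>v. - (2 * (x \<bullet> v)) / R\<^sup>2)) (at x)"
    using has_derivative_diff[OF has_derivative_const[of 1] bounded_linear.has_derivative[OF bounded_linear_divide n, of "R\<^sup>2"]] 
    by simp
  have b: "((\<lambda>x::'a. bump (1 - (norm x)\<^sup>2 / R\<^sup>2)) has_derivative 
      (\<lambda>v. bump_deriv 1 (1 - (norm x)\<^sup>2 / R\<^sup>2) * (- (2 * (x \<bullet> v)) / R\<^sup>2))) (at x)"
    using has_derivative_compose[OF p bump_deriv_has_derivative[of 0, unfolded has_field_derivative_def]] by simp
  have q: "((\<lambda>x::'a. gweight x) has_derivative (\<lambda>v. gweight x * (x \<bullet> v))) (at x)"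
    by (auto intro!: derivative_eq_intros n)
  have "(cutoff R has_derivative (\<lambda>v. bump (1 - (norm x)\<^sup>2 / R\<^sup>2) * (gweight x * (x \<bullet> v)) + 
      (bump_deriv 1 (1 - (norm x)\<^sup>2 / R\<^sup>2) * (- (2 * (x \<bullet> v)) / R\<^sup>2)) * gweight x)) (at x)"
    unfolding cutoff_def[abs_def] by (rule has_derivative_mult[OF b q])
  from frechet_derivative_eqI[OF this, of v] show ?thesis
    by (simp add: cutoff_def algebra_simps diff_divide_distrib)
qed

lemma bump_deriv_1_bounds: "0 \<le> bump_deriv 1 t" "bump_deriv 1 t \<le> 2"
proof -
  have eq: "bump_deriv 1 t = (if t > 0 then (1/t)\<^sup>2 / exp (1/t) else 0)"
    by (simp add: bump_deriv_def power2_eq_square One_nat_def)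
  show "0 \<le> bump_deriv 1 t" unfolding eq by simp
  have "(1/t)\<^sup>2 \<le> 2 * exp (1/t)" if "t > 0"
  proof -
    have "0 \<le> 1/t" using that by simp
    from exp_lower_Taylor_quadratic[OF this] have "1 + 1/t + (1/t)\<^sup>2 / 2 \<le> exp (1/t)" .
    thus ?thesis using that by (smt (verit) divide_nonneg_nonneg field_sum_of_halves)
  qed
  thus "bump_deriv 1 t \<le> 2" unfolding eq by (simp add: divide_le_eq)
qed

text \<open>The last bound controls the derivative of the cut-off: it is supported where \<open>norm x \<le> R\<close>, and there
  \<open>norm x ^ 2 / R\<^sup>2 \<le> 1\<close>. The bound is the same for all \<open>R\<close>.\<close>

lemma cutoff_bounds:
  assumes "R > 0"
  shows "0 \<le> cutoff R x" "cutoff R x \<le> gweight x"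
    "(2 / R\<^sup>2) * bump_deriv 1 (1 - (norm x)\<^sup>2 / R\<^sup>2) * (norm x)\<^sup>2 \<le> 4"
proof -
  show "0 \<le> cutoff R x" by (simp add: cutoff_def bump_nonneg)
  show "cutoff R x \<le> gweight x" using bump_le_1 bump_nonneg by (simp add: cutoff_def mult_left_le_one_le)
  show "(2 / R\<^sup>2) * bump_deriv 1 (1 - (norm x)\<^sup>2 / R\<^sup>2) * (norm x)\<^sup>2 \<le> 4"
  proof (cases "1 - (norm x)\<^sup>2 / R\<^sup>2 > 0")
    case True
    have "2 * ((norm x)\<^sup>2 / R\<^sup>2) * bump_deriv 1 (1 - (norm x)\<^sup>2 / R\<^sup>2) \<le> 2 * 1 * 2"
      using True bump_deriv_1_bounds by (intro mult_mono) auto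
    thus ?thesis by (simp add: algebra_simps)
  next
    case False thus ?thesis by (simp add: bump_deriv_def)
  qed
qed

text \<open>Integration by parts of \<open>u\<^sup>2\<close> against the vector field \<open>cutoff R x\<close> times \<open>x\<close>, one component at a time. Its divergence is \<open>D\<close>,
  and the factor \<open>norm x ^ 2 * cutoff R x\<close> comes from the derivative of the weight.\<close>

lemma cutoff_integral_identity:
  fixes u :: "'a::euclidean_space \<Rightarrow> real"
  assumes W: "wdiff lebesgue u G" and R: "R > 0"
  defines "D \<equiv> (\<lambda>x. real DIM('a) * cutoff R x + (norm x)\<^sup>2 * (cutoff R x - (2 / R\<^sup>2) * bump_deriv 1 (1 - (norm x)\<^sup>2 / R\<^sup>2) * gweight x))"
  shows "integrable lebesgue (\<lambda>x. (u x)\<^sup>2 * D x)" "integrable lebesgue (\<lambda>x. 2 * u x * (G x \<bullet> x) * cutoff R x)"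
    "(LINT x|lebesgue. (u x)\<^sup>2 * D x) = - (LINT x|lebesgue. 2 * u x * (G x \<bullet> x) * cutoff R x)"
proof -
  note wg = weak_gradient_square[OF W]
  have li: "locally_integrable (\<lambda>x. (u x)\<^sup>2)" "locally_integrable (\<lambda>x. (2 * u x) *\<^sub>R G x)"
    using wg by (auto simp: has_weak_gradient_def)
  let ?\<psi> = "\<lambda>b x::'a. (x \<bullet> b) * cutoff R x"
  have psi: "?\<psi> b \<in> test_functions" for b by (rule test_function_mult[OF cutoff_test[OF R] smooth_inner])
  let ?E = "\<lambda>x. cutoff R x - (2 / R\<^sup>2) * bump_deriv 1 (1 - (norm x)\<^sup>2 / R\<^sup>2) * gweight x"
  have dpsi: "frechet_derivative (?\<psi> b) (at x) b = (x \<bullet> b)\<^sup>2 * ?E x + cutoff R x" if b: "b \<in> Basis" for b x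
  proof -
    have "((\<lambda>x. x \<bullet> b) has_derivative (\<lambda>v. v \<bullet> b)) (at x)" by (auto intro!: derivative_eq_intros)
    from has_derivative_mult[OF this smooth_has_derivative[OF test_function_smooth[OF cutoff_test[OF R]]]]
    have "frechet_derivative (?\<psi> b) (at x) b = (x \<bullet> b) * frechet_derivative (cutoff R) (at x) b + (b \<bullet> b) * cutoff R x"
      by (rule frechet_derivative_eqI)
    thus ?thesis using b unfolding cutoff_derivative by (simp add: power2_eq_square)
  qed
  have sumD: "(\<Sum>b\<in>Basis. frechet_derivative (?\<psi> b) (at x) b) = D x" for x
  proof -
    have "(\<Sum>b\<in>Basis. frechet_derivative (?\<psi> b) (at x) b) = (\<Sum>b\<in>Basis. (x \<bullet> b)\<^sup>2 * ?E x + cutoff R x)"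
      by (intro sum.cong dpsi refl)
    also have "\<dots> = (\<Sum>b\<in>Basis. (x \<bullet> b)\<^sup>2) * ?E x + real DIM('a) * cutoff R x"
      by (simp only: sum.distrib sum_distrib_right sum_constant of_nat_id)
    also have "(\<Sum>b\<in>Basis. (x \<bullet> b)\<^sup>2) = (norm x)\<^sup>2"
      unfolding power2_norm_eq_inner euclidean_inner[of x x] by (simp only: power2_eq_square)
    finally show ?thesis by (simp add: D_def)
  qed
  have i1: "integrable lebesgue (\<lambda>x. (u x)\<^sup>2 * frechet_derivative (?\<psi> b) (at x) b)" for b
    by (rule locally_integrable_test_mult[OF li(1) test_function_derivative[OF psi]])
  have i2: "integrable lebesgue (\<lambda>x. ((2 * u x) *\<^sub>R G x \<bullet> b) * ?\<psi> b x)" for b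
    by (rule locally_integrable_test_mult[OF locally_integrable_inner[OF li(2)] psi])
  have e1: "(\<lambda>x. (u x)\<^sup>2 * D x) = (\<lambda>x. \<Sum>b\<in>Basis. (u x)\<^sup>2 * frechet_derivative (?\<psi> b) (at x) b)"
    unfolding sumD[symmetric] by (simp only: sum_distrib_left)
  have e2: "(\<lambda>x. 2 * u x * (G x \<bullet> x) * cutoff R x) = (\<lambda>x. \<Sum>b\<in>Basis. ((2 * u x) *\<^sub>R G x \<bullet> b) * ?\<psi> b x)"
  proof (rule ext)
    fix x
    show "2 * u x * (G x \<bullet> x) * cutoff R x = (\<Sum>b\<in>Basis. ((2 * u x) *\<^sub>R G x \<bullet> b) * ?\<psi> b x)"
      unfolding euclidean_inner[of "G x" x] sum_distrib_left sum_distrib_right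
      by (intro sum.cong) (simp_all add: algebra_simps)
  qed
  show "integrable lebesgue (\<lambda>x. (u x)\<^sup>2 * D x)" unfolding e1 by (intro Bochner_Integration.integrable_sum i1)
  show "integrable lebesgue (\<lambda>x. 2 * u x * (G x \<bullet> x) * cutoff R x)" unfolding e2 by (intro Bochner_Integration.integrable_sum i2)
  have "(LINT x|lebesgue. (u x)\<^sup>2 * D x) = (\<Sum>b\<in>Basis. LINT x|lebesgue. (u x)\<^sup>2 * frechet_derivative (?\<psi> b) (at x) b)"
    unfolding e1 by (intro Bochner_Integration.integral_sum i1)
  also have "\<dots> = (\<Sum>b\<in>Basis. - (LINT x|lebesgue. ((2 * u x) *\<^sub>R G x \<bullet> b) * ?\<psi> b x))"
    by (intro sum.cong refl weak_gradient_identity[OF wg psi])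
  also have "\<dots> = - (\<Sum>b\<in>Basis. LINT x|lebesgue. ((2 * u x) *\<^sub>R G x \<bullet> b) * ?\<psi> b x)" by (rule sum_negf)
  also have "(\<Sum>b\<in>Basis. LINT x|lebesgue. ((2 * u x) *\<^sub>R G x \<bullet> b) * ?\<psi> b x) = (LINT x|lebesgue. 2 * u x * (G x \<bullet> x) * cutoff R x)"
    unfolding e2 by (intro Bochner_Integration.integral_sum[symmetric] i2)
  finally show "(LINT x|lebesgue. (u x)\<^sup>2 * D x) = - (LINT x|lebesgue. 2 * u x * (G x \<bullet> x) * cutoff R x)" .
qed

text \<open>In the identity, half of the second moment absorbs the gradient term by Young's inequality, the dimension term has a
  good sign, and the derivative of the cut-off costs at most \<open>4 u\<^sup>2\<close> times the weight.\<close>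

lemma cutoff_second_moment:
  fixes u :: "'a::euclidean_space \<Rightarrow> real"
  assumes W: "wdiff mN u G" and R: "R > 0"
  shows "integrable lebesgue (\<lambda>x. (u x)\<^sup>2 * ((norm x)\<^sup>2 * cutoff R x))"
    "(LINT x|lebesgue. (u x)\<^sup>2 * ((norm x)\<^sup>2 * cutoff R x)) \<le> (3 * l2_norm mN (jet u G))\<^sup>2"
proof -
  have Wl: "wdiff lebesgue u G" by (rule wdiff_lebesgue[OF sobolev_measure_mN W])
  have um: "u \<in> borel_measurable lebesgue" and Gm: "G \<in> borel_measurable lebesgue"
    using wdiff_L2[OF Wl] by (auto dest: L2_measurable)
  have li: "locally_integrable (\<lambda>x. (u x)\<^sup>2)" using weak_gradient_square[OF Wl] by (auto simp: has_weak_gradient_def)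
  let ?n = "\<lambda>x::'a. (norm x)\<^sup>2"
  let ?S = "\<lambda>x. (u x)\<^sup>2 * (?n x * cutoff R x)"
  have "(\<lambda>x::'a. (?n x * 1) * cutoff R x) \<in> test_functions"
    by (rule test_function_mult[OF cutoff_test[OF R] smooth_norm_sq])
  from locally_integrable_test_mult[OF li this] show iS: "integrable lebesgue ?S" by simp
  let ?D = "\<lambda>x. real DIM('a) * cutoff R x + ?n x * (cutoff R x - (2 / R\<^sup>2) * bump_deriv 1 (1 - ?n x / R\<^sup>2) * gweight x)"
  note id = cutoff_integral_identity[OF Wl R]
  have iu: "integrable lebesgue (\<lambda>x. gweight x * (norm (u x))\<^sup>2)"
    and nu: "(l2_norm mN u)\<^sup>2 = (LINT x|lebesgue. gweight x * (norm (u x))\<^sup>2)"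
    using L2_integrable[OF wdiff_L2(1)[OF W]] integral_mN[of "\<lambda>x. (norm (u x))\<^sup>2"] um 
    unfolding l2_norm_sq by auto
  have iG: "integrable lebesgue (\<lambda>x. gweight x * (norm (G x))\<^sup>2)"
    and nG: "(l2_norm mN G)\<^sup>2 = (LINT x|lebesgue. gweight x * (norm (G x))\<^sup>2)"
    using L2_integrable[OF wdiff_L2(2)[OF W]] integral_mN[of "\<lambda>x. (norm (G x))\<^sup>2"] Gm
    unfolding l2_norm_sq by auto
  \<comment> \<open>The pointwise form of the estimate, before integration.\<close>
  have pw: "(1/2) * ?S x - 4 * (gweight x * (norm (u x))\<^sup>2) - 2 * (gweight x * (norm (G x))\<^sup>2) \<le> 
     (u x)\<^sup>2 * ?D x + 2 * u x * (G x \<bullet> x) * cutoff R x" for x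
  proof -
    let ?c = "cutoff R x" and ?w = "gweight x"
    have c0: "0 \<le> ?c" and cw: "?c \<le> ?w" using cutoff_bounds[OF R] by auto
    have h1: "(2 / R\<^sup>2) * bump_deriv 1 (1 - ?n x / R\<^sup>2) * ?n x * (?w * (u x)\<^sup>2) \<le> 4 * (?w * (u x)\<^sup>2)"
      by (intro mult_right_mono cutoff_bounds(3) R) simp
    have h2: "(u x)\<^sup>2 * ?D x = real DIM('a) * ((u x)\<^sup>2 * ?c) + ?S x - (2 / R\<^sup>2) * bump_deriv 1 (1 - ?n x / R\<^sup>2) * ?n x * (?w * (u x)\<^sup>2)"
      by (simp add: algebra_simps)
    have h3: "0 \<le> real DIM('a) * ((u x)\<^sup>2 * ?c)" using c0 by simp
    have gen: "X = A + S - T \<Longrightarrow> T \<le> Q \<Longrightarrow> 0 \<le> A \<Longrightarrow> S - Q \<le> X" for X A S T Q :: real by linarith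
    have 1: "?S x - 4 * (?w * (u x)\<^sup>2) \<le> (u x)\<^sup>2 * ?D x" by (rule gen[OF h2 h1 h3])
    have "\<bar>2 * u x * (G x \<bullet> x)\<bar> \<le> 2 * \<bar>u x\<bar> * (norm (G x) * norm x)"
      using Cauchy_Schwarz_ineq2[of "G x" x] by (simp add: abs_mult mult_left_mono)
    also have "\<dots> = 2 * (\<bar>u x\<bar> * norm x) * norm (G x)" by simp
    also have "\<dots> \<le> (1/2) * (\<bar>u x\<bar> * norm x)\<^sup>2 + 2 * (norm (G x))\<^sup>2"
    proof -
      have "0 \<le> (\<bar>u x\<bar> * norm x - 2 * norm (G x))\<^sup>2" by simp
      thus ?thesis by (simp add: power2_diff power_mult_distrib)
    qed
    finally have "\<bar>2 * u x * (G x \<bullet> x)\<bar> * ?c \<le> ((1/2) * (\<bar>u x\<bar> * norm x)\<^sup>2 + 2 * (norm (G x))\<^sup>2) * ?c"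
      using c0 by (rule mult_right_mono)
    also have "\<dots> = (1/2) * ?S x + 2 * ((norm (G x))\<^sup>2 * ?c)" by (simp add: algebra_simps power_mult_distrib)
    also have "\<dots> \<le> (1/2) * ?S x + 2 * ((norm (G x))\<^sup>2 * ?w)" using cw by (intro add_left_mono mult_left_mono) auto
    finally have "\<bar>2 * u x * (G x \<bullet> x)\<bar> * ?c \<le> (1/2) * ?S x + 2 * (?w * (norm (G x))\<^sup>2)" by (simp add: mult.commute)
    moreover have "- (\<bar>2 * u x * (G x \<bullet> x)\<bar> * ?c) \<le> 2 * u x * (G x \<bullet> x) * ?c"
      using mult_right_mono[of "- \<bar>2 * u x * (G x \<bullet> x)\<bar>" "2 * u x * (G x \<bullet> x)" ?c] c0 by simp
    ultimately show ?thesis using 1 by simp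
  qed
  have "(1/2) * (LINT x|lebesgue. ?S x) - 4 * (l2_norm mN u)\<^sup>2 - 2 * (l2_norm mN G)\<^sup>2 = 
      (LINT x|lebesgue. (1/2) * ?S x - 4 * (gweight x * (norm (u x))\<^sup>2) - 2 * (gweight x * (norm (G x))\<^sup>2))"
    unfolding nu nG using iS iu iG by simp
  also have "\<dots> \<le> (LINT x|lebesgue. (u x)\<^sup>2 * ?D x + 2 * u x * (G x \<bullet> x) * cutoff R x)"
    using iS iu iG id(1,2) by (intro integral_mono pw Bochner_Integration.integrable_add Bochner_Integration.integrable_diff integrable_mult_right)
  also have "\<dots> = 0" using id by simp
  finally have "(LINT x|lebesgue. ?S x) \<le> 8 * (l2_norm mN u)\<^sup>2 + 4 * (l2_norm mN G)\<^sup>2" by simp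
  \<comment> \<open>The constants \<open>8\<close> and \<open>4\<close> are enlarged to a perfect square.\<close>
  also have "\<dots> \<le> 9 * ((l2_norm mN u)\<^sup>2 + (l2_norm mN G)\<^sup>2)" by simp
  also have "\<dots> = (3 * l2_norm mN (jet u G))\<^sup>2"
    unfolding power_mult_distrib l2_norm_Pair[OF wdiff_L2(1)[OF W] wdiff_L2(2)[OF W]] by simp
  finally show "(LINT x|lebesgue. ?S x) \<le> (3 * l2_norm mN (jet u G))\<^sup>2" .
qed

text \<open>Let \<open>R\<close> grow in the previous estimate, with Fatou's lemma for the functions weighted by the square root of the cut-off.
  The factor \<open>exp (1/2)\<close> compensates for \<open>bump 1 = exp (-1)\<close>.\<close>

theorem second_moment_bound:
  fixes u :: "'a::euclidean_space \<Rightarrow> real"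
  assumes W: "wdiff mN u G"
  shows "(\<lambda>x. norm x * u x) \<in> L2 mN" "l2_norm mN (\<lambda>x. norm x * u x) \<le> 3 * exp (1/2) * l2_norm mN (jet u G)"
proof -
  have Wl: "wdiff lebesgue u G" by (rule wdiff_lebesgue[OF sobolev_measure_mN W])
  have um[measurable]: "u \<in> borel_measurable lebesgue" using wdiff_L2[OF Wl] by (auto dest: L2_measurable)
  have nm[measurable]: "(\<lambda>x::'a. norm x) \<in> borel_measurable lebesgue" by (intro measurable_completion) measurable
  let ?R = "\<lambda>k. real (Suc k)"
  let ?\<beta> = "\<lambda>k x::'a. bump (1 - (norm x)\<^sup>2 / (?R k)\<^sup>2)"
  let ?h = "\<lambda>k x. sqrt (?\<beta> k x) * (norm x * u x)"
  have bump_cont: "continuous_on UNIV bump"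
    by (rule DERIV_continuous_on) (rule has_field_derivative_at_within[OF bump_deriv_has_derivative])
  have bm[measurable]: "bump \<in> borel_measurable borel" by (rule borel_measurable_continuous_onI[OF bump_cont])
  have \<beta>m: "?\<beta> k \<in> borel_measurable lebesgue" for k by measurable
  have hm: "?h k \<in> borel_measurable lebesgue" for k by measurable
  have sq: "(norm (?h k x))\<^sup>2 = ?\<beta> k x * (norm x)\<^sup>2 * (u x)\<^sup>2" for k x
    using bump_nonneg by (simp add: power_mult_distrib)
  have eq: "gweight x * (norm (?h k x))\<^sup>2 = (u x)\<^sup>2 * ((norm x)\<^sup>2 * cutoff (?R k) x)" for k x
    unfolding sq cutoff_def by simp
  have sqm: "(\<lambda>x. (norm (?h k x))\<^sup>2) \<in> borel_measurable lebesgue" for k using hm by measurable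
  have hL: "?h k \<in> L2 mN" for k
  proof (rule L2I)
    show "?h k \<in> borel_measurable mN" using hm sobolev_measurable_eq[OF sobolev_measure_mN] by blast
    show "integrable mN (\<lambda>x. (norm (?h k x))\<^sup>2)"
      unfolding integral_mN(2)[OF sqm] eq using W by (intro cutoff_second_moment(1)[OF W]) simp
  qed
  have hn: "l2_norm mN (?h k) \<le> 3 * l2_norm mN (jet u G)" for k
  proof (rule power2_le_imp_le)
    show "(l2_norm mN (?h k))\<^sup>2 \<le> (3 * l2_norm mN (jet u G))\<^sup>2"
      unfolding l2_norm_sq[of mN "?h k"] integral_mN(1)[OF sqm] eq using W by (intro cutoff_second_moment(2)) auto
  qed simp
  let ?g = "\<lambda>x. exp (-(1/2)) * (norm x * u x)"
  have lim: "(\<lambda>k. ?h k x) \<longlonglongrightarrow> ?g x" for x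
  proof -
    have "(\<lambda>k. 1 - (norm x)\<^sup>2 * (1 / ?R k)\<^sup>2) \<longlonglongrightarrow> 1 - (norm x)\<^sup>2 * 0\<^sup>2"
      by (intro tendsto_intros LIMSEQ_Suc[OF lim_1_over_n])
    hence "(\<lambda>k. 1 - (norm x)\<^sup>2 / (?R k)\<^sup>2) \<longlonglongrightarrow> 1" by (simp add: power_divide del: of_nat_Suc)
    hence "(\<lambda>k. ?\<beta> k x) \<longlonglongrightarrow> bump 1"
      by (rule continuous_on_tendsto_compose[OF bump_cont]) auto
    hence "(\<lambda>k. ?h k x) \<longlonglongrightarrow> sqrt (bump 1) * (norm x * u x)" by (intro tendsto_intros)
    moreover have "sqrt (bump 1) = exp (-(1/2))"
      by (rule real_sqrt_unique) (simp_all add: bump_eq power2_eq_square exp_add[symmetric])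
    ultimately show ?thesis by simp
  qed
  have "?g \<in> borel_measurable lebesgue" by measurable
  hence gm: "?g \<in> borel_measurable mN" using sobolev_measurable_eq[OF sobolev_measure_mN] by blast
  have F: "?g \<in> L2 mN" "l2_norm mN ?g \<le> 3 * l2_norm mN (jet u G)"
    using l2_Fatou[of ?h mN "3 * l2_norm mN (jet u G)" ?g, OF hL hn _ gm] lim by auto
  have un: "exp (1/2) * ?g x = norm x * u x" for x
    by (simp add: mult.assoc[symmetric] exp_add[symmetric])
  show "(\<lambda>x. norm x * u x) \<in> L2 mN" using L2_cmult[OF F(1), of "exp (1/2)"] unfolding un .
  have "l2_norm mN (\<lambda>x. exp (1/2) * ?g x) = exp (1/2) * l2_norm mN ?g" by (subst l2_norm_cmult) simp
  hence "l2_norm mN (\<lambda>x. norm x * u x) = exp (1/2) * l2_norm mN ?g" unfolding un .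
  also have "\<dots> \<le> exp (1/2) * (3 * l2_norm mN (jet u G))" by (intro mult_left_mono F(2)) simp
  finally show "l2_norm mN (\<lambda>x. norm x * u x) \<le> 3 * exp (1/2) * l2_norm mN (jet u G)" by simp
qed

section \<open>Compact embedding\<close>

lemma l2_bounded_convergence:
  fixes f :: "nat \<Rightarrow> 'a::euclidean_space \<Rightarrow> real"
  assumes f: "\<And>n. f n \<in> borel_measurable lebesgue" and b: "\<And>n x. \<bar>f n x\<bar> \<le> K" and lim: "\<And>x. (\<lambda>n. f n x) \<longlonglongrightarrow> g x"
  shows "l2_Cauchy lebesgue (\<lambda>n x. indicator (cball 0 R) x * f n x)"
proof -
  let ?I = "indicator (cball 0 R) :: 'a \<Rightarrow> real"
  have Im: "?I \<in> borel_measurable lebesgue" by (rule L2_measurable[OF indicator_ball_L2])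
  have gm: "g \<in> borel_measurable lebesgue" by (rule borel_measurable_LIMSEQ_metric[OF f lim])
  have gb: "\<bar>g x\<bar> \<le> K" for x
    by (rule LIMSEQ_le_const2[OF tendsto_rabs[OF lim]]) (use b in blast)
  have comm: "(\<lambda>x. ?I x * h x) = (\<lambda>x. h x * ?I x)" for h :: "'a \<Rightarrow> real" by (simp add: mult.commute)
  have L: "(\<lambda>x. ?I x * f n x) \<in> L2 lebesgue" for n
    unfolding comm by (rule L2_bounded_mult(1)[OF indicator_ball_L2 f b])
  have gL: "(\<lambda>x. ?I x * g x) \<in> L2 lebesgue"
    unfolding comm by (rule L2_bounded_mult(1)[OF indicator_ball_L2 gm gb])
  have "(\<lambda>n. LINT x|lebesgue. (norm (?I x * f n x - ?I x * g x))\<^sup>2) \<longlonglongrightarrow> integral\<^sup>L lebesgue (\<lambda>x::'a. 0::real)"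
  proof (rule integral_dominated_convergence[where w="\<lambda>x. (norm ((2 * K) * ?I x))\<^sup>2"])
    show "integrable lebesgue (\<lambda>x. (norm ((2 * K) * ?I x))\<^sup>2)" by (intro L2_integrable L2_cmult indicator_ball_L2)
    show "(\<lambda>x. (norm (?I x * f n x - ?I x * g x))\<^sup>2) \<in> borel_measurable lebesgue" for n
      using f[of n] gm Im by measurable
    show "AE x in lebesgue. norm ((norm (?I x * f n x - ?I x * g x))\<^sup>2) \<le> (norm ((2 * K) * ?I x))\<^sup>2" for n
    proof (rule AE_I2)
      fix x
      have "\<bar>f n x - g x\<bar> \<le> 2 * K" using b[of n x] gb[of x] by linarith
      hence "\<bar>f n x - g x\<bar> \<le> \<bar>2 * K\<bar>" by linarith
      hence "\<bar>f n x - g x\<bar>\<^sup>2 \<le> \<bar>2 * K\<bar>\<^sup>2" by (rule power_mono) simp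
      thus "norm ((norm (?I x * f n x - ?I x * g x))\<^sup>2) \<le> (norm ((2 * K) * ?I x))\<^sup>2"
        by (cases "x \<in> cball 0 R") simp_all
    qed
    show "AE x in lebesgue. (\<lambda>n. (norm (?I x * f n x - ?I x * g x))\<^sup>2) \<longlonglongrightarrow> 0"
    proof (rule AE_I2)
      fix x
      have "(\<lambda>n. (norm (?I x * f n x - ?I x * g x))\<^sup>2) \<longlonglongrightarrow> (norm (?I x * g x - ?I x * g x))\<^sup>2"
        by (intro tendsto_intros lim)
      thus "(\<lambda>n. (norm (?I x * f n x - ?I x * g x))\<^sup>2) \<longlonglongrightarrow> 0" by simp
    qed
  qed simp
  hence "(\<lambda>n. (l2_norm lebesgue (\<lambda>x. ?I x * f n x - ?I x * g x))\<^sup>2) \<longlonglongrightarrow> 0" by (simp only: l2_norm_sq Bochner_Integration.integral_zero)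
  hence "(\<lambda>n. sqrt ((l2_norm lebesgue (\<lambda>x. ?I x * f n x - ?I x * g x))\<^sup>2)) \<longlonglongrightarrow> sqrt 0" by (rule tendsto_real_sqrt)
  hence "(\<lambda>n. l2_norm lebesgue (\<lambda>x. ?I x * f n x - ?I x * g x)) \<longlonglongrightarrow> 0" by simp
  thus ?thesis by (rule l2_Cauchy_of_converges[of "\<lambda>n x. ?I x * f n x", OF L gL])
qed

text \<open>The pointwise part of the Arzela-Ascoli argument.\<close>

lemma convergent_of_dense_equicontinuous:
  fixes f :: "nat \<Rightarrow> 'a::metric_space \<Rightarrow> real"
  assumes lip: "\<And>n x y. \<bar>f n x - f n y\<bar> \<le> K * dist x y"
    and dense: "\<And>X. open X \<Longrightarrow> X \<noteq> {} \<Longrightarrow> \<exists>d\<in>D. d \<in> X"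
    and conv: "\<And>d. d \<in> D \<Longrightarrow> convergent (\<lambda>n. f n d)"
  shows "convergent (\<lambda>n. f n x)"
proof -
  have "Cauchy (\<lambda>n. f n x)"
  proof (rule CauchyI)
    fix e :: real assume e: "e > 0"
    define \<delta> where "\<delta> = e / (3 * (\<bar>K\<bar> + 1))"
    have \<delta>: "\<delta> > 0" using e by (simp add: \<delta>_def)
    obtain d where d: "d \<in> D" "dist x d < \<delta>" using dense[of "ball x \<delta>"] \<delta> by auto
    have small: "\<bar>f n x - f n d\<bar> \<le> e / 3" for n
    proof -
      have "\<bar>f n x - f n d\<bar> \<le> K * dist x d" by (rule lip)
      also have "\<dots> \<le> (\<bar>K\<bar> + 1) * \<delta>" using d(2) by (intro mult_mono) auto
      also have "\<dots> = e / 3" by (simp add: \<delta>_def field_simps)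
      finally show ?thesis .
    qed
    have "Cauchy (\<lambda>n. f n d)" using conv[OF d(1)] by (rule convergent_Cauchy)
    then obtain N where N: "\<And>m n. m \<ge> N \<Longrightarrow> n \<ge> N \<Longrightarrow> norm (f m d - f n d) < e / 3"
      using CauchyD[of "\<lambda>n. f n d" "e / 3"] e by auto
    show "\<exists>M. \<forall>m\<ge>M. \<forall>n\<ge>M. norm (f m x - f n x) < e"
    proof (intro exI allI impI)
      fix m n assume "N \<le> m" "N \<le> n"
      thus "norm (f m x - f n x) < e" using N[of m n] small[of m] small[of n] unfolding real_norm_def by linarith
    qed
  qed
  thus ?thesis by (rule Cauchy_convergent)
qed

text \<open>Inside the ball the weight is bounded; outside, \<open>norm x / R \<ge> 1\<close>. The exponent is \<open>R\<^sup>2 / 4\<close> because norms are square roots.\<close>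

lemma l2_norm_mN_ball_tail:
  fixes f :: "'a::euclidean_space \<Rightarrow> real"
  assumes f: "f \<in> L2 mN" and R: "R > 0" and mom: "(\<lambda>x. norm x * f x) \<in> L2 mN"
  shows "l2_norm mN f \<le> exp (R\<^sup>2 / 4) * l2_norm lebesgue (\<lambda>x. indicator (cball 0 R) x * f x) + l2_norm mN (\<lambda>x. norm x * f x) / R"
proof -
  let ?I = "indicator (cball 0 R) :: 'a \<Rightarrow> real"
  have Im: "?I \<in> borel_measurable lebesgue" by (rule L2_measurable[OF indicator_ball_L2])
  have ImN: "?I \<in> borel_measurable mN" using Im sobolev_measurable_eq[OF sobolev_measure_mN] by blast
  have If: "(\<lambda>x. ?I x * f x) \<in> L2 mN"
    by (rule L2_bounded_mult(1)[OF f ImN, where B=1]) (auto simp: indicator_def)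
  have f1: "(\<lambda>x. f x - ?I x * f x) \<in> L2 mN" by (rule L2_diff[OF f If])
  have Ifl: "(\<lambda>x. ?I x * f x) \<in> L2 lebesgue" by (rule sobolev_L2(1)[OF sobolev_measure_mN If])
  have sqm: "(\<lambda>x. (norm (?I x * f x))\<^sup>2) \<in> borel_measurable lebesgue"
    using L2_measurable[OF Ifl] by measurable
  have 1: "l2_norm mN (\<lambda>x. ?I x * f x) \<le> exp (R\<^sup>2 / 4) * l2_norm lebesgue (\<lambda>x. ?I x * f x)"
  proof (rule power2_le_imp_le)
    have "(l2_norm mN (\<lambda>x. ?I x * f x))\<^sup>2 = (LINT x|lebesgue. gweight x * (norm (?I x * f x))\<^sup>2)"
      unfolding l2_norm_sq by (rule integral_mN(1)[OF sqm])
    also have "\<dots> \<le> (LINT x|lebesgue. exp (R\<^sup>2 / 2) * (norm (?I x * f x))\<^sup>2)"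
    proof (rule integral_mono)
      show "integrable lebesgue (\<lambda>x. gweight x * (norm (?I x * f x))\<^sup>2)"
        using L2_integrable[OF If] integral_mN(2)[OF sqm] by blast
      show "integrable lebesgue (\<lambda>x. exp (R\<^sup>2 / 2) * (norm (?I x * f x))\<^sup>2)"
        by (intro integrable_mult_right L2_integrable Ifl)
      fix x
      show "gweight x * (norm (?I x * f x))\<^sup>2 \<le> exp (R\<^sup>2 / 2) * (norm (?I x * f x))\<^sup>2"
      proof (cases "x \<in> cball 0 R")
        case True
        hence "(norm x)\<^sup>2 \<le> R\<^sup>2" by (intro power_mono) auto
        thus ?thesis by (intro mult_right_mono) auto
      qed simp
    qed
    also have "\<dots> = exp (R\<^sup>2 / 2) * (l2_norm lebesgue (\<lambda>x. ?I x * f x))\<^sup>2" unfolding l2_norm_sq by simp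
    also have "\<dots> = (exp (R\<^sup>2 / 4) * l2_norm lebesgue (\<lambda>x. ?I x * f x))\<^sup>2"
    proof -
      have "exp (R\<^sup>2 / 2) = (exp (R\<^sup>2 / 4))\<^sup>2" by (simp add: power2_eq_square exp_add[symmetric])
      thus ?thesis by (simp add: power_mult_distrib)
    qed
    finally show "(l2_norm mN (\<lambda>x. ?I x * f x))\<^sup>2 \<le> (exp (R\<^sup>2 / 4) * l2_norm lebesgue (\<lambda>x. ?I x * f x))\<^sup>2" .
  qed simp
  have 2: "l2_norm mN (\<lambda>x. f x - ?I x * f x) \<le> l2_norm mN (\<lambda>x. norm x * f x) / R"
  proof -
    have "l2_norm mN (\<lambda>x. f x - ?I x * f x) \<le> l2_norm mN (\<lambda>x. (1/R) * (norm x * f x))"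
    proof (rule l2_norm_mono_AE[OF L2_cmult[OF mom]], rule AE_I2)
      fix x
      show "norm (f x - ?I x * f x) \<le> norm ((1/R) * (norm x * f x))"
      proof (cases "x \<in> cball 0 R")
        case False
        hence "1 \<le> norm x / R" using R by simp
        hence "1 * \<bar>f x\<bar> \<le> (norm x / R) * \<bar>f x\<bar>" by (rule mult_right_mono) simp
        thus ?thesis using False R by (simp add: abs_mult)
      qed simp
    qed
    thus ?thesis using R unfolding l2_norm_cmult by simp
  qed
  have "l2_norm mN f \<le> l2_norm mN (\<lambda>x. ?I x * f x) + l2_norm mN (\<lambda>x. f x - ?I x * f x)"
    by (rule l2_norm_triangle_sub[OF f If])
  thus ?thesis using 1 2 by linarith
qed

text \<open>The tail outside a large ball is small by the second moments. Inside, \<open>u m - u n\<close> is compared with the approximations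
  \<open>A j m\<close> and \<open>A j n\<close>. The radius is chosen first, then \<open>j\<close>, then the indices.\<close>

lemma l2_Cauchy_of_local_averages:
  fixes u :: "nat \<Rightarrow> 'a::euclidean_space \<Rightarrow> real"
  assumes W: "\<And>n. wdiff mN (u n) (G n)" and C: "\<And>n. l2_norm mN (jet (u n) (G n)) \<le> C"
    and A: "\<And>j n. A j n \<in> L2 lebesgue" "\<And>j n. l2_norm lebesgue (\<lambda>x. A j n x - u n x) \<le> C / real (Suc j)"
    and cau: "\<And>j R. l2_Cauchy lebesgue (\<lambda>n x. indicator (cball 0 R) x * A j n x)"
  shows "l2_Cauchy mN u"
  unfolding l2_Cauchy_def
proof (intro allI impI)
  fix e :: real assume e: "e > 0"
  have C0: "C \<ge> 0" using C[of 0] l2_norm_nonneg[of mN "jet (u 0) (G 0)"] by linarith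
  \<comment> \<open>The second moment bound for a difference \<open>u m - u n\<close>, whose Sobolev norm is at most \<open>2 * C\<close>.\<close>
  define K where "K = 6 * exp (1/2) * C"
  have K0: "K \<ge> 0" using C0 by (simp add: K_def)
  define R where "R = 3 * K / e + 1"
  have R: "R > 0" using K0 e by (simp add: R_def add_nonneg_pos)
  have KR: "K / R < e / 3"
  proof -
    have "3 * K < R * e" using e by (simp add: R_def field_simps)
    thus ?thesis using R by (simp add: field_simps)
  qed
  define M where "M = exp (R\<^sup>2 / 4)"
  have M: "M > 0" by (simp add: M_def)
  have "(\<lambda>j. (2 * M * C) * (1 / real (Suc j))) \<longlonglongrightarrow> (2 * M * C) * 0"
    by (intro tendsto_mult tendsto_const LIMSEQ_Suc[OF lim_1_over_n])
  hence "\<forall>\<^sub>F j in sequentially. (2 * M * C) * (1 / real (Suc j)) < e / 3"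
    using order_tendstoD(2)[of "\<lambda>j. (2 * M * C) * (1 / real (Suc j))" 0 sequentially "e / 3"] e by simp
  then obtain j where j: "(2 * M * C) * (1 / real (Suc j)) < e / 3" by (auto simp: eventually_sequentially)
  have "e / (3 * M) > 0" using e M by simp
  then obtain N where N: "\<And>m n. m \<ge> N \<Longrightarrow> n \<ge> N \<Longrightarrow> 
      l2_norm lebesgue (\<lambda>x. indicator (cball 0 R) x * A j m x - indicator (cball 0 R) x * A j n x) < e / (3 * M)"
    using cau[where j=j and R=R] unfolding l2_Cauchy_def by meson
  show "\<exists>N. \<forall>m\<ge>N. \<forall>n\<ge>N. l2_norm mN (\<lambda>x. u m x - u n x) < e"
  proof (intro exI allI impI)
    fix m n assume mn: "m \<ge> N" "n \<ge> N"
    let ?I = "indicator (cball 0 R) :: 'a \<Rightarrow> real"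
    let ?D = "\<lambda>x. u m x - u n x"
    have Im: "?I \<in> borel_measurable lebesgue" by (rule L2_measurable[OF indicator_ball_L2])
    have I1: "\<bar>?I x\<bar> \<le> 1" for x by (simp add: indicator_def)
    have WD: "wdiff mN ?D (\<lambda>x. G m x - G n x)" by (rule wdiff_diff[OF W W])
    have "l2_norm mN (jet ?D (\<lambda>x. G m x - G n x)) \<le> 2 * C"
    proof -
      have "l2_norm mN (\<lambda>x. jet (u m) (G m) x - jet (u n) (G n) x) \<le> l2_norm mN (\<lambda>x. jet (u m) (G m) x - 0) + l2_norm mN (\<lambda>x. 0 - jet (u n) (G n) x)"
        by (intro l2_norm_triangle_diff wdiff_jet[OF W] L2_zero)
      also have "\<dots> \<le> C + C" using C[of m] C[of n] l2_norm_minus[of mN "jet (u n) (G n)"] by simp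
      finally show ?thesis by simp
    qed
    hence "l2_norm mN (\<lambda>x. norm x * ?D x) \<le> 3 * exp (1/2) * (2 * C)"
      by (intro order_trans[OF second_moment_bound(2)[OF WD]] mult_left_mono) auto
    hence tail: "l2_norm mN (\<lambda>x. norm x * ?D x) / R \<le> K / R" using R by (intro divide_right_mono) (auto simp: K_def)
    have uL: "u n \<in> L2 lebesgue" for n by (rule sobolev_L2(1)[OF sobolev_measure_mN wdiff_L2(1)[OF W]])
    have IL: "(\<lambda>x. ?I x * f x) \<in> L2 lebesgue" if "f \<in> L2 lebesgue" for f by (rule L2_bounded_mult(1)[OF that Im I1])
    have d1: "l2_norm lebesgue (\<lambda>x. ?I x * (A j n x - u n x)) \<le> C / real (Suc j)" for n
      using L2_bounded_mult(2)[OF L2_diff[OF A(1) uL] Im I1, of j n n] A(2)[of j n] by simp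
    have "l2_norm lebesgue (\<lambda>x. ?I x * u m x - ?I x * u n x) \<le> 
        l2_norm lebesgue (\<lambda>x. ?I x * u m x - ?I x * A j m x) + l2_norm lebesgue (\<lambda>x. ?I x * A j m x - ?I x * u n x)"
      by (intro l2_norm_triangle_diff IL uL A)
    also have "l2_norm lebesgue (\<lambda>x. ?I x * A j m x - ?I x * u n x) \<le>
        l2_norm lebesgue (\<lambda>x. ?I x * A j m x - ?I x * A j n x) + l2_norm lebesgue (\<lambda>x. ?I x * A j n x - ?I x * u n x)"
      by (intro l2_norm_triangle_diff IL uL A)
    also have "l2_norm lebesgue (\<lambda>x. ?I x * u m x - ?I x * A j m x) = l2_norm lebesgue (\<lambda>x. ?I x * (A j m x - u m x))"
      unfolding right_diff_distrib by (rule l2_norm_minus_commute)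
    also have "l2_norm lebesgue (\<lambda>x. ?I x * A j n x - ?I x * u n x) = l2_norm lebesgue (\<lambda>x. ?I x * (A j n x - u n x))"
      by (simp only: right_diff_distrib)
    finally have "l2_norm lebesgue (\<lambda>x. ?I x * u m x - ?I x * u n x) \<le> 2 * (C / real (Suc j)) + e / (3 * M)"
      using d1[of m] d1[of n] N[OF mn] by linarith
    hence "M * l2_norm lebesgue (\<lambda>x. ?I x * ?D x) \<le> M * (2 * (C / real (Suc j)) + e / (3 * M))"
      using M unfolding right_diff_distrib by (intro mult_left_mono) auto
    also have "\<dots> = (2 * M * C) * (1 / real (Suc j)) + e / 3" using M by (simp add: distrib_left)
    finally have "M * l2_norm lebesgue (\<lambda>x. ?I x * ?D x) < 2 * (e / 3)" using j by linarith
    moreover have "l2_norm mN ?D \<le> M * l2_norm lebesgue (\<lambda>x. ?I x * ?D x) + l2_norm mN (\<lambda>x. norm x * ?D x) / R"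
      unfolding M_def by (rule l2_norm_mN_ball_tail[OF wdiff_L2(1)[OF WD] R second_moment_bound(1)[OF WD]])
    ultimately show "l2_norm mN ?D < e" using tail KR by linarith
  qed
qed

text \<open>For each radius \<open>1 / Suc j\<close> the averages are uniformly bounded and equi-Lipschitz. A diagonal subsequence converges
  for all radii at the points of a countable dense set, hence everywhere, and by dominated convergence in \<open>L2\<close> on balls.\<close>

lemma compact_embedding_borel:
  fixes u :: "nat \<Rightarrow> 'a::euclidean_space \<Rightarrow> real"
  assumes W: "\<And>n. wdiff mN (u n) (G n)" and C: "\<And>n. l2_norm mN (jet (u n) (G n)) \<le> C"
    and ub: "\<And>n. u n \<in> borel_measurable borel"
  obtains k :: "nat \<Rightarrow> nat" where "strict_mono k" "l2_Cauchy mN (\<lambda>n. u (k n))"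
proof -
  have C0: "C \<ge> 0" using C[of 0] l2_norm_nonneg[of mN "jet (u 0) (G 0)"] by linarith
  have Wl: "wdiff lebesgue (u n) (G n)" for n by (rule wdiff_lebesgue[OF sobolev_measure_mN W])
  have jl: "l2_norm lebesgue (jet (u n) (G n)) \<le> C" for n
    using sobolev_L2(2)[OF sobolev_measure_mN wdiff_jet[OF W], of n] C[of n] by linarith
  have un: "l2_norm lebesgue (u n) \<le> C" and Gn: "l2_norm lebesgue (G n) \<le> C" for n
    using L2_fst_snd(3,4)[OF wdiff_jet[OF Wl], of n] jl[of n] by auto
  have uL: "u n \<in> L2 lebesgue" for n by (rule wdiff_L2(1)[OF Wl])
  define r where "r j = 1 / real (Suc j)" for j
  have r: "r j > 0" for j by (simp add: r_def)
  define V where "V j = sqrt (ball_volume TYPE('a) (r j))" for j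
  have V: "V j > 0" for j using ball_volume_pos[OF r] by (simp add: V_def)
  define A where "A j n = average (r j) (u n)" for j n
  have tr: "l2_norm lebesgue (\<lambda>y. u n (y + h) - u n y) \<le> norm h * C" for n h
  proof -
    have "l2_norm lebesgue (\<lambda>y. u n (y + h) - u n y) \<le> norm h * l2_norm lebesgue (G n)" by (rule translation_difference_le[OF Wl])
    also have "\<dots> \<le> norm h * C" by (intro mult_left_mono Gn) simp
    finally show ?thesis .
  qed
  have Ab: "\<bar>A j n x\<bar> \<le> C / V j" for j n x
  proof -
    have "\<bar>A j n x\<bar> \<le> l2_norm lebesgue (u n) / V j" unfolding A_def V_def by (rule average_difference_le(1)[OF uL ub r])
    also have "\<dots> \<le> C / V j" using V[of j] by (intro divide_right_mono un) simp
    finally show ?thesis .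
  qed
  have Alip: "\<bar>A j n x - A j n y\<bar> \<le> (C / V j) * dist x y" for j n x y
  proof -
    have "\<bar>A j n x - A j n y\<bar> \<le> l2_norm lebesgue (\<lambda>z. u n (z + (x - y)) - u n z) / V j" 
      unfolding A_def V_def by (rule average_difference_le(2)[OF uL ub r])
    also have "\<dots> \<le> (norm (x - y) * C) / V j" using V[of j] by (intro divide_right_mono tr) simp
    finally show ?thesis by (simp add: dist_norm mult.commute)
  qed
  have Ac: "(\<lambda>x. A j n x - u n x) \<in> L2 lebesgue" "l2_norm lebesgue (\<lambda>x. A j n x - u n x) \<le> C / real (Suc j)" for j n
  proof -
    have "l2_norm lebesgue (\<lambda>x. u n (x + h) - u n x) \<le> C / real (Suc j)" if "norm h \<le> r j" for h
    proof -
      have "norm h * C \<le> r j * C" using that C0 by (rule mult_right_mono)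
      thus ?thesis using tr[of n h] by (simp add: r_def)
    qed
    from average_close[OF uL ub r this] 
    show "(\<lambda>x. A j n x - u n x) \<in> L2 lebesgue" "l2_norm lebesgue (\<lambda>x. A j n x - u n x) \<le> C / real (Suc j)"
      unfolding A_def by auto
  qed
  have AL: "A j n \<in> L2 lebesgue" for j n using L2_add[OF Ac(1) uL, of j n n] by simp
  obtain D :: "'a set" where D: "countable D" "\<And>X. open X \<Longrightarrow> X \<noteq> {} \<Longrightarrow> \<exists>d\<in>D. d \<in> X"
    using countable_dense_exists by blast
  \<comment> \<open>The factor \<open>V\<close> normalises the bounds \<open>C / V j\<close>, which depend on the radius, to a common one.\<close>
  let ?F = "\<lambda>n p. A (fst p) n (snd p) * V (fst p)"
  have Fb: "norm (?F n p) \<le> C" if "p \<in> (UNIV :: nat set) \<times> D" for n p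
  proof -
    have "\<bar>A (fst p) n (snd p)\<bar> * V (fst p) \<le> (C / V (fst p)) * V (fst p)"
      using V[of "fst p"] by (intro mult_right_mono Ab) simp
    thus ?thesis using V[of "fst p"] by (simp add: abs_mult)
  qed
  have "countable ((UNIV :: nat set) \<times> D)" using D(1) by simp
  then obtain k where k: "strict_mono (k :: nat \<Rightarrow> nat)"
    and kl: "\<forall>p \<in> UNIV \<times> D. \<exists>l. (\<lambda>n. ?F (k n) p) \<longlonglongrightarrow> l"
    by (rule function_convergent_subsequence[of "UNIV \<times> D" ?F C, OF _ Fb]) (assumption, meson ballI)
  have conv: "convergent (\<lambda>n. A j (k n) x)" for j x
  proof (rule convergent_of_dense_equicontinuous[of "\<lambda>n. A j (k n)", OF Alip D(2)])
    fix d assume "d \<in> D"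
    then obtain l where "(\<lambda>n. A j (k n) d * V j) \<longlonglongrightarrow> l" using bspec[OF kl, of "(j, d)"] by auto
    hence "(\<lambda>n. A j (k n) d * V j / V j) \<longlonglongrightarrow> l / V j" using V[of j] by (intro tendsto_divide tendsto_const) auto
    thus "convergent (\<lambda>n. A j (k n) d)" using V[of j] by (auto simp: convergent_def)
  qed
  have "l2_Cauchy mN (\<lambda>n. u (k n))"
  proof (rule l2_Cauchy_of_local_averages[where A="\<lambda>j n. A j (k n)" and C=C, OF W C AL Ac(2)])
    fix j R
    show "l2_Cauchy lebesgue (\<lambda>n x. indicator (cball 0 R) x * A j (k n) x)"
      by (rule l2_bounded_convergence[where K="C / V j" and g="\<lambda>x. lim (\<lambda>n. A j (k n) x)"])
        (use AL Ab conv in \<open>auto simp: convergent_LIMSEQ_iff[symmetric] intro: L2_measurable\<close>)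
  qed
  with k show ?thesis by (rule that)
qed

text \<open>The estimates for averages concern Borel functions, so each function is first replaced by a Borel representative.\<close>

theorem compact_embedding:
  fixes u :: "nat \<Rightarrow> 'a::euclidean_space \<Rightarrow> real"
  assumes W: "\<And>n. wdiff mN (u n) (G n)" and C: "\<And>n. l2_norm mN (jet (u n) (G n)) \<le> C"
  obtains k :: "nat \<Rightarrow> nat" where "strict_mono k" "l2_Cauchy mN (\<lambda>n. u (k n))"
proof -
  have Wl: "wdiff lebesgue (u n) (G n)" for n by (rule wdiff_lebesgue[OF sobolev_measure_mN W])
  have "\<forall>n. \<exists>v. v \<in> borel_measurable borel \<and> (AE x in lebesgue. u n x = v x)"
  proof
    fix n
    obtain v where "v \<in> borel_measurable borel" "AE x in lebesgue. u n x = v x"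
      by (rule borel_representative[OF L2_measurable[OF wdiff_L2(1)[OF Wl[of n]]]])
    thus "\<exists>v. v \<in> borel_measurable borel \<and> (AE x in lebesgue. u n x = v x)" by blast
  qed
  from choice[OF this] obtain v where v: "\<forall>n. v n \<in> borel_measurable borel \<and> (AE x in lebesgue. u n x = v n x)" ..
  have vb: "v n \<in> borel_measurable borel" and uv: "AE x in lebesgue. u n x = v n x" for n using v by auto
  have vm: "v n \<in> borel_measurable lebesgue" for n by (intro measurable_completion borel_measurable_lborelI vb)
  have vmN: "v n \<in> borel_measurable mN" for n using vm sobolev_measurable_eq[OF sobolev_measure_mN] by blast
  have uvN: "AE x in mN. u n x = v n x" for n using uv sobolev_AE_eq[OF sobolev_measure_mN] by blast
  have Wv: "wdiff mN (v n) (G n)" for n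
    unfolding wdiff_def
  proof (intro conjI)
    show "v n \<in> L2 mN" by (rule L2_cong_AE[OF wdiff_L2(1)[OF W] vmN uvN])
    show "G n \<in> L2 mN" by (rule wdiff_L2(2)[OF W])
    show "has_weak_gradient (v n) (G n)"
      by (rule has_weak_gradient_cong[OF wdiff_L2(3)[OF W] uv _ vm]) (auto intro: L2_measurable wdiff_L2(2)[OF Wl])
  qed
  have Cv: "l2_norm mN (jet (v n) (G n)) \<le> C" for n
  proof -
    have "l2_norm mN (jet (v n) (G n)) = l2_norm mN (jet (u n) (G n))"
      using uvN[of n] by (intro l2_norm_cong_AE L2_measurable wdiff_jet[OF Wv] wdiff_jet[OF W]) (auto elim!: eventually_mono)
    thus ?thesis using C[of n] by simp
  qed
  obtain k where k: "strict_mono (k :: nat \<Rightarrow> nat)" "l2_Cauchy mN (\<lambda>n. v (k n))"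
    by (rule compact_embedding_borel[of v G C, OF Wv Cv vb])
  have "l2_norm mN (\<lambda>x. u m x - u n x) = l2_norm mN (\<lambda>x. v m x - v n x)" for m n
  proof (rule l2_norm_cong_AE)
    show "AE x in mN. u m x - u n x = v m x - v n x"
      using uvN[of m] uvN[of n] by eventually_elim simp
  qed (intro L2_measurable L2_diff wdiff_L2(1)[OF W] wdiff_L2(1)[OF Wv])+
  hence "l2_Cauchy mN (\<lambda>n. u (k n))" using k(2) by (simp add: l2_Cauchy_def)
  with k(1) show ?thesis by (rule that)
qed

section \<open>Weak closedness of Sobolev subspaces\<close>

definition sobolev_closed_subspace :: "('a::euclidean_space \<Rightarrow> real) set \<Rightarrow> bool" where
  "sobolev_closed_subspace S \<longleftrightarrow> S \<subseteq> H1 mN \<and> (\<lambda>x. 0) \<in> S \<and>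
     (\<forall>u\<in>S. \<forall>v\<in>S. (\<lambda>x. u x + v x) \<in> S) \<and> (\<forall>u\<in>S. \<forall>c. (\<lambda>x. c * u x) \<in> S) \<and>
     (\<forall>u G w H. (\<forall>n::nat. u n \<in> S \<and> wdiff mN (u n) (G n)) \<longrightarrow> wdiff mN w H \<longrightarrow>
        (\<lambda>n. l2_norm mN (\<lambda>x. jet (u n) (G n) x - jet w H x)) \<longlonglongrightarrow> 0 \<longrightarrow> w \<in> S)"

lemma sobolev_closed_subspaceD:
  assumes "sobolev_closed_subspace S"
  shows "u \<in> S \<Longrightarrow> u \<in> H1 mN" "(\<lambda>x. 0) \<in> S" 
    "u \<in> S \<Longrightarrow> v \<in> S \<Longrightarrow> (\<lambda>x. u x + v x) \<in> S" "u \<in> S \<Longrightarrow> (\<lambda>x. c * u x) \<in> S"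
  using assms unfolding sobolev_closed_subspace_def by blast+

lemma sobolev_closed_subspace_H1: "sobolev_closed_subspace (H1 mN)"
  unfolding sobolev_closed_subspace_def
proof (intro conjI ballI allI impI)
  show "(\<lambda>x. 0) \<in> H1 mN" unfolding H1_iff by (rule exI[of _ "\<lambda>x. 0"]) (rule wdiff_zero)
  show "(\<lambda>x. c * u x) \<in> H1 mN" if "u \<in> H1 mN" for u :: "'a \<Rightarrow> real" and c
  proof -
    obtain G where "wdiff mN u G" using \<open>u \<in> H1 mN\<close> unfolding H1_iff ..
    from wdiff_scale[OF this] show ?thesis unfolding H1_iff by blast
  qed
  show "(\<lambda>x. u x + v x) \<in> H1 mN" if "u \<in> H1 mN" "v \<in> H1 mN" for u v :: "'a \<Rightarrow> real"
  proof -
    obtain G where G: "wdiff mN u G" using \<open>u \<in> H1 mN\<close> unfolding H1_iff ..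
    obtain H where "wdiff mN v H" using \<open>v \<in> H1 mN\<close> unfolding H1_iff ..
    from wdiff_add[OF G this] show ?thesis unfolding H1_iff by blast
  qed
  show "w \<in> H1 mN" if "wdiff mN w H" for w :: "'a \<Rightarrow> real" and H
    unfolding H1_iff by (rule exI[of _ H]) (rule \<open>wdiff mN w H\<close>)
qed simp

text \<open>Lower semicontinuity of the energy without weak topology. Among the elements of \<open>S\<close> within \<open>1 / Suc n\<close> of \<open>w\<close> in
  \<open>L2\<close>, choose one with almost minimal gradient norm. These sets are convex and decreasing in \<open>n\<close>, so the gradients
  form a Cauchy sequence; the limit is the gradient of \<open>w\<close>, and \<open>w\<close> is a limit in the Sobolev norm.\<close>

theorem weak_closure:
  fixes u :: "nat \<Rightarrow> 'a::euclidean_space \<Rightarrow> real"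
  assumes S: "sobolev_closed_subspace S" and uS: "\<And>n. u n \<in> S" and W: "\<And>n. wdiff mN (u n) (G n)" 
    and C: "\<And>n. l2_norm mN (G n) \<le> C" and w: "w \<in> L2 mN" 
    and lim: "(\<lambda>n. l2_norm mN (\<lambda>x. u n x - w x)) \<longlonglongrightarrow> 0"
  obtains H where "wdiff mN w H" "l2_norm mN H \<le> C" "w \<in> S"
proof -
  have C0: "C \<ge> 0" using C[of 0] l2_norm_nonneg[of mN "G 0"] by linarith
  define X where "X n = {f. fst f \<in> S \<and> wdiff mN (fst f) (snd f) \<and> l2_norm mN (\<lambda>x. fst f x - w x) \<le> 1 / real (Suc n)}" for n
  let ?E = "\<lambda>f. (l2_norm mN (snd f))\<^sup>2"
  define d where "d n = (INF f\<in>X n. ?E f)" for n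
  have bdd: "bdd_below (?E ` X n)" for n by (rule bdd_belowI[of _ 0]) auto
  have ex: "\<exists>m. (u m, G m) \<in> X n" for n
  proof -
    have "\<forall>\<^sub>F m in sequentially. l2_norm mN (\<lambda>x. u m x - w x) < 1 / real (Suc n)"
      using order_tendstoD(2)[OF lim, of "1 / real (Suc n)"] by simp
    then obtain m where "l2_norm mN (\<lambda>x. u m x - w x) < 1 / real (Suc n)" by (auto simp: eventually_sequentially)
    thus ?thesis using uS W by (auto simp: X_def intro: less_imp_le)
  qed
  have ne: "X n \<noteq> {}" for n using ex[of n] by blast
  have low: "d n \<le> ?E f" if "f \<in> X n" for f n unfolding d_def by (rule cINF_lower[OF bdd that])
  have dC: "d n \<le> C\<^sup>2" for n
  proof -
    obtain m where "(u m, G m) \<in> X n" using ex by blast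
    from low[OF this] have "d n \<le> (l2_norm mN (G m))\<^sup>2" by simp
    also have "\<dots> \<le> C\<^sup>2" by (intro power_mono C) simp
    finally show ?thesis .
  qed
  have Xmono: "X m \<subseteq> X n" if "n \<le> m" for m n
  proof -
    have "1 / real (Suc m) \<le> 1 / real (Suc n)" using that by (intro divide_left_mono) auto
    thus ?thesis by (auto simp: X_def)
  qed
  have "incseq d"
    unfolding d_def by (rule incseq_SucI) (intro cINF_superset_mono ne bdd Xmono, simp_all)
  then obtain Dl where Dl: "d \<longlonglongrightarrow> Dl" using incseq_convergent dC by blast
  have DC: "Dl \<le> C\<^sup>2" by (rule LIMSEQ_le_const2[OF Dl]) (use dC in blast)
  have "\<forall>n. \<exists>f. f \<in> X n \<and> ?E f < d n + 1 / real (Suc n)"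
  proof
    fix n
    have "d n < d n + 1 / real (Suc n)" by simp
    thus "\<exists>f. f \<in> X n \<and> ?E f < d n + 1 / real (Suc n)"
      using cINF_less_iff[OF ne bdd, of n "d n + 1 / real (Suc n)"] unfolding d_def by blast
  qed
  from choice[OF this] obtain f where f: "\<forall>n. f n \<in> X n \<and> ?E (f n) < d n + 1 / real (Suc n)" ..
  define v where "v n = fst (f n)" for n
  define F where "F n = snd (f n)" for n
  have vS: "v n \<in> S" and Wv: "wdiff mN (v n) (F n)" and vw: "l2_norm mN (\<lambda>x. v n x - w x) \<le> 1 / real (Suc n)"
    and Fn: "(l2_norm mN (F n))\<^sup>2 < d n + 1 / real (Suc n)" for n
    using f by (auto simp: X_def v_def F_def)
  have vL: "v n \<in> L2 mN" and FL: "F n \<in> L2 mN" for n by (auto intro: wdiff_L2[OF Wv])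
  have sl: "(\<lambda>n. 1 / real (Suc n)) \<longlonglongrightarrow> 0" by (rule LIMSEQ_Suc[OF lim_1_over_n])
  have vlim: "(\<lambda>n. l2_norm mN (\<lambda>x. v n x - w x)) \<longlonglongrightarrow> 0"
    by (rule Lim_null_comparison[OF _ sl], rule always_eventually, rule allI) (simp add: vw del: of_nat_Suc)
  have cF: "l2_Cauchy mN F"
  proof (rule l2_minimizing_Cauchy[OF FL less_imp_le[OF Fn] _ Dl sl])
    fix m n :: nat assume nm: "n \<le> m"
    have "((\<lambda>x. (1/2) * (v n x + v m x)), (\<lambda>x. (1/2) *\<^sub>R (F n x + F m x))) \<in> X n"
    proof -
      have "(\<lambda>x. (1/2) * (v n x + v m x)) \<in> S" by (intro sobolev_closed_subspaceD(3,4)[OF S] vS)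
      moreover have "wdiff mN (\<lambda>x. (1/2) * (v n x + v m x)) (\<lambda>x. (1/2) *\<^sub>R (F n x + F m x))"
        by (intro wdiff_scale wdiff_add Wv)
      moreover have "l2_norm mN (\<lambda>x. (1/2) * (v n x + v m x) - w x) \<le> 1 / real (Suc n)"
      proof -
        have eq: "(\<lambda>x. (1/2) * (v n x + v m x) - w x) = (\<lambda>x. (1/2) *\<^sub>R ((v n x - w x) + (v m x - w x)))"
          by (auto simp: field_simps)
        have "l2_norm mN (\<lambda>x. (v n x - w x) + (v m x - w x)) \<le> l2_norm mN (\<lambda>x. v n x - w x) + l2_norm mN (\<lambda>x. v m x - w x)"
          by (intro l2_norm_triangle L2_diff vL w)
        also have "\<dots> \<le> 1 / real (Suc n) + 1 / real (Suc n)"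
        proof (rule add_mono[OF vw])
          have "1 / real (Suc m) \<le> 1 / real (Suc n)" using nm by (intro divide_left_mono) auto
          thus "l2_norm mN (\<lambda>x. v m x - w x) \<le> 1 / real (Suc n)" using vw[of m] by linarith
        qed
        finally show ?thesis unfolding eq l2_norm_scaleR by simp
      qed
      ultimately show ?thesis by (simp add: X_def)
    qed
    from low[OF this] show "d n \<le> (l2_norm mN (\<lambda>x. (1/2) *\<^sub>R (F n x + F m x)))\<^sup>2" by simp
  qed
  obtain H where H: "H \<in> L2 mN" and Flim: "(\<lambda>n. l2_norm mN (\<lambda>x. F n x - H x)) \<longlonglongrightarrow> 0"
    using l2_complete[of F mN, OF FL cF] by blast
  note sob = sobolev_L2[OF sobolev_measure_mN]
  have "has_weak_gradient w H"
  proof (rule has_weak_gradient_L2_limit[OF wdiff_L2(3)[OF Wv] sob(1)[OF vL] sob(1)[OF FL] sob(1)[OF w] sob(1)[OF H]])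
    show "(\<lambda>n. l2_norm lebesgue (\<lambda>x. v n x - w x)) \<longlonglongrightarrow> 0"
      by (rule Lim_null_comparison[OF _ vlim], rule always_eventually, rule allI) (simp add: sob(2)[OF L2_diff[OF vL w]])
    show "(\<lambda>n. l2_norm lebesgue (\<lambda>x. F n x - H x)) \<longlonglongrightarrow> 0"
      by (rule Lim_null_comparison[OF _ Flim], rule always_eventually, rule allI) (simp add: sob(2)[OF L2_diff[OF FL H]])
  qed
  hence WH: "wdiff mN w H" using w H by (simp add: wdiff_def)
  have HC: "l2_norm mN H \<le> C"
  proof (rule power2_le_imp_le[OF _ C0])
    have "(l2_norm mN H)\<^sup>2 \<le> Dl"
    proof (rule LIMSEQ_le)
      show "(\<lambda>n. (l2_norm mN (F n))\<^sup>2) \<longlonglongrightarrow> (l2_norm mN H)\<^sup>2" by (intro tendsto_power l2_norm_tendsto[OF FL H Flim])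
      show "(\<lambda>n. d n + 1 / real (Suc n)) \<longlonglongrightarrow> Dl" using tendsto_add[OF Dl sl] by simp
      show "\<exists>N. \<forall>n\<ge>N. (l2_norm mN (F n))\<^sup>2 \<le> d n + 1 / real (Suc n)" using less_imp_le[OF Fn] by blast
    qed
    thus "(l2_norm mN H)\<^sup>2 \<le> C\<^sup>2" using DC by linarith
  qed
  have jl: "(\<lambda>n. l2_norm mN (\<lambda>x. jet (v n) (F n) x - jet w H x)) \<longlonglongrightarrow> 0"
  proof -
    have "(l2_norm mN (\<lambda>x. jet (v n) (F n) x - jet w H x))\<^sup>2 = (l2_norm mN (\<lambda>x. v n x - w x))\<^sup>2 + (l2_norm mN (\<lambda>x. F n x - H x))\<^sup>2" for n
      using l2_norm_Pair[OF L2_diff[OF vL[of n] w] L2_diff[OF FL[of n] H]] by simp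
    moreover have "(\<lambda>n. (l2_norm mN (\<lambda>x. v n x - w x))\<^sup>2 + (l2_norm mN (\<lambda>x. F n x - H x))\<^sup>2) \<longlonglongrightarrow> 0\<^sup>2 + 0\<^sup>2"
      by (intro tendsto_add tendsto_power vlim Flim)
    ultimately have "(\<lambda>n. (l2_norm mN (\<lambda>x. jet (v n) (F n) x - jet w H x))\<^sup>2) \<longlonglongrightarrow> 0" by simp
    from tendsto_real_sqrt[OF this] show ?thesis by simp
  qed
  have "\<And>u G w H. (\<forall>n::nat. u n \<in> S \<and> wdiff mN (u n) (G n)) \<Longrightarrow> wdiff mN w H \<Longrightarrow>
        (\<lambda>n. l2_norm mN (\<lambda>x. jet (u n) (G n) x - jet w H x)) \<longlonglongrightarrow> 0 \<Longrightarrow> w \<in> S"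
    using S unfolding sobolev_closed_subspace_def by (elim conjE) simp
  from this[of v F w H] have "w \<in> S" using vS Wv WH jl by simp
  thus ?thesis using that[OF WH HC] by blast
qed

section \<open>The spaces with zero boundary values\<close>

lemma H10_iff: "u \<in> H10 \<Omega> \<longleftrightarrow> (\<exists>G. wdiff mN u G) \<and> (\<exists>v. quasi_continuous v \<and> (AE x in lebesgue. v x = u x) \<and> 
    cap {x. x \<notin> \<Omega> \<and> v x \<noteq> 0} = 0)"
  by (simp add: H10_def H1_iff quasi_everywhere_def)

lemma H10_AE_zero:
  assumes "u \<in> H10 \<Omega>" shows "AE x in lebesgue. x \<notin> \<Omega> \<longrightarrow> u x = 0"
proof -
  obtain v where v: "AE x in lebesgue. v x = u x" "cap {x. x \<notin> \<Omega> \<and> v x \<noteq> 0} = 0"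
    using assms unfolding H10_iff by blast
  show ?thesis using v(1) cap_zero_AE[OF v(2)] by eventually_elim auto
qed

lemma H10_zero: "(\<lambda>x. 0) \<in> H10 \<Omega>"
  unfolding H10_iff
  by (intro conjI exI[of _ "\<lambda>x. 0"] wdiff_zero continuous_imp_quasi_continuous) auto

lemma H10_add:
  assumes "u \<in> H10 \<Omega>" "w \<in> H10 \<Omega>" shows "(\<lambda>x. u x + w x) \<in> H10 \<Omega>"
proof -
  obtain G v where G: "wdiff mN u G" and v: "quasi_continuous v" "AE x in lebesgue. v x = u x" "cap {x. x \<notin> \<Omega> \<and> v x \<noteq> 0} = 0"
    using assms(1) unfolding H10_iff by blast
  obtain H z where H: "wdiff mN w H" and z: "quasi_continuous z" "AE x in lebesgue. z x = w x" "cap {x. x \<notin> \<Omega> \<and> z x \<noteq> 0} = 0"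
    using assms(2) unfolding H10_iff by blast
  have "cap {x. x \<notin> \<Omega> \<and> v x + z x \<noteq> 0} \<le> cap ({x. x \<notin> \<Omega> \<and> v x \<noteq> 0} \<union> {x. x \<notin> \<Omega> \<and> z x \<noteq> 0})"
    by (intro cap_mono) auto
  also have "\<dots> = 0" by (rule cap_zero_Un[OF v(3) z(3)])
  finally have c: "cap {x. x \<notin> \<Omega> \<and> v x + z x \<noteq> 0} = 0" by simp
  have ae: "AE x in lebesgue. v x + z x = u x + w x" using v(2) z(2) by eventually_elim simp
  show ?thesis unfolding H10_iff
    by (intro conjI exI[of _ "\<lambda>x. G x + H x"] exI[of _ "\<lambda>x. v x + z x"] wdiff_add G H quasi_continuous_add v z ae c)
qed

lemma H10_scale:
  assumes "u \<in> H10 \<Omega>" shows "(\<lambda>x. c * u x) \<in> H10 \<Omega>"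
proof -
  obtain G v where G: "wdiff mN u G" and v: "quasi_continuous v" "AE x in lebesgue. v x = u x" "cap {x. x \<notin> \<Omega> \<and> v x \<noteq> 0} = 0"
    using assms(1) unfolding H10_iff by blast
  have "cap {x. x \<notin> \<Omega> \<and> c * v x \<noteq> 0} \<le> cap {x. x \<notin> \<Omega> \<and> v x \<noteq> 0}" by (intro cap_mono) auto
  hence c: "cap {x. x \<notin> \<Omega> \<and> c * v x \<noteq> 0} = 0" using v(3) by simp
  have ae: "AE x in lebesgue. c * v x = c * u x" using v(2) by eventually_elim simp
  show ?thesis unfolding H10_iff
    by (intro conjI exI[of _ "\<lambda>x. c *\<^sub>R G x"] exI[of _ "\<lambda>x. c * v x"] wdiff_scale G quasi_continuous_scale v ae c)
qed

text \<open>Pass to a fast subsequence of the quasi-continuous representatives. It converges outside a set of zero capacity to a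
  quasi-continuous function, which represents \<open>w\<close> and vanishes outside \<open>\<Omega>\<close> except on a countable union of sets of zero
  capacity.\<close>

lemma H10_limit:
  fixes u :: "nat \<Rightarrow> 'a::euclidean_space \<Rightarrow> real"
  assumes u: "\<And>n. u n \<in> H10 \<Omega>" and W: "\<And>n. wdiff mN (u n) (G n)" and Ww: "wdiff mN w H"
    and lim: "(\<lambda>n. l2_norm mN (\<lambda>x. jet (u n) (G n) x - jet w H x)) \<longlonglongrightarrow> 0"
  shows "w \<in> H10 \<Omega>"
proof -
  note sob = sobolev_L2[OF sobolev_measure_mN]
  have J: "jet (u n) (G n) \<in> L2 mN" for n by (rule wdiff_jet[OF W])
  have Jw: "jet w H \<in> L2 mN" by (rule wdiff_jet[OF Ww])
  have "l2_Cauchy mN (\<lambda>n. jet (u n) (G n))" by (rule l2_Cauchy_of_converges[of "\<lambda>n. jet (u n) (G n)", OF J Jw lim])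
  then obtain r :: "nat \<Rightarrow> nat" where r: "strict_mono r" and 
    rf: "\<And>k n. n \<ge> r k \<Longrightarrow> l2_norm mN (\<lambda>x. jet (u n) (G n) x - jet (u (r k)) (G (r k)) x) \<le> (1/4)^k"
    by (rule l2_Cauchy_fast_subseq) blast
  have "\<forall>k. \<exists>v. quasi_continuous v \<and> (AE x in lebesgue. v x = u (r k) x) \<and> cap {x. x \<notin> \<Omega> \<and> v x \<noteq> 0} = 0"
    using u unfolding H10_iff by blast
  from choice[OF this] obtain v where v: "\<forall>k. quasi_continuous (v k) \<and> (AE x in lebesgue. v k x = u (r k) x) \<and> cap {x. x \<notin> \<Omega> \<and> v k x \<noteq> 0} = 0" ..
  have vq: "quasi_continuous (v k)" and vae: "AE x in lebesgue. v k x = u (r k) x" and vc: "cap {x. x \<notin> \<Omega> \<and> v k x \<noteq> 0} = 0" for k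
    using v by auto
  have uae: "AE x in lebesgue. u (r k) x = v k x" for k using vae[of k] by eventually_elim simp
  have Wl: "wdiff lebesgue (u n) (G n)" for n by (rule wdiff_lebesgue[OF sobolev_measure_mN W])
  have vm: "v k \<in> borel_measurable lebesgue" for k
    by (rule borel_measurable_AE[OF L2_measurable[OF wdiff_L2(1)[OF Wl]] uae])
  have Wv: "wdiff lebesgue (v k) (G (r k))" for k
    unfolding wdiff_def
  proof (intro conjI)
    show "v k \<in> L2 lebesgue" by (rule L2_cong_AE[OF wdiff_L2(1)[OF Wl] vm uae])
    show "G (r k) \<in> L2 lebesgue" by (rule wdiff_L2(2)[OF Wl])
    show "has_weak_gradient (v k) (G (r k))"
      by (rule has_weak_gradient_cong[OF wdiff_L2(3)[OF Wl] uae _ vm]) (auto intro: L2_measurable wdiff_L2(2)[OF Wl])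
  qed
  have fast: "l2_norm lebesgue (\<lambda>x. jet (v (Suc k)) (G (r (Suc k))) x - jet (v k) (G (r k)) x) \<le> (1/4)^k" for k
  proof -
    have "l2_norm lebesgue (\<lambda>x. jet (v (Suc k)) (G (r (Suc k))) x - jet (v k) (G (r k)) x) = 
        l2_norm lebesgue (\<lambda>x. jet (u (r (Suc k))) (G (r (Suc k))) x - jet (u (r k)) (G (r k)) x)"
    proof (intro l2_norm_cong_AE L2_measurable[OF L2_diff[OF wdiff_jet[OF Wv] wdiff_jet[OF Wv]]] 
          L2_measurable[OF L2_diff[OF wdiff_jet[OF Wl] wdiff_jet[OF Wl]]])
      show "AE x in lebesgue. jet (v (Suc k)) (G (r (Suc k))) x - jet (v k) (G (r k)) x = 
          jet (u (r (Suc k))) (G (r (Suc k))) x - jet (u (r k)) (G (r k)) x"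
        using vae[of k] vae[of "Suc k"] by eventually_elim simp
    qed
    also have "\<dots> \<le> l2_norm mN (\<lambda>x. jet (u (r (Suc k))) (G (r (Suc k))) x - jet (u (r k)) (G (r k)) x)"
      by (rule sob(2)[OF L2_diff[OF J J]])
    also have "\<dots> \<le> (1/4)^k" by (rule rf) (simp add: strict_mono_less_eq[OF r])
    finally show ?thesis .
  qed
  obtain z N where z: "quasi_continuous z" "cap N = 0" "\<And>x. x \<notin> N \<Longrightarrow> (\<lambda>n. v n x) \<longlonglongrightarrow> z x"
    by (rule quasi_continuous_limit[of v "\<lambda>k. G (r k)", OF vq Wv fast]) blast
  have jl: "(\<lambda>k. l2_norm mN (\<lambda>x. jet (u (r k)) (G (r k)) x - jet w H x)) \<longlonglongrightarrow> 0"
    using LIMSEQ_subseq_LIMSEQ[OF lim r] by (simp add: comp_def)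
  obtain s where s: "strict_mono (s::nat\<Rightarrow>nat)" "AE x in mN. (\<lambda>n. jet (u (r (s n))) (G (r (s n))) x - jet w H x) \<longlonglongrightarrow> 0"
    using l2_AE_subseq[of "\<lambda>k x. jet (u (r k)) (G (r k)) x - jet w H x" mN, OF L2_diff[OF J Jw] jl] by blast
  have s': "AE x in lebesgue. (\<lambda>n. jet (u (r (s n))) (G (r (s n))) x - jet w H x) \<longlonglongrightarrow> 0"
    using s(2) sobolev_AE_eq[OF sobolev_measure_mN] by blast
  have all: "AE x in lebesgue. \<forall>k. v k x = u (r k) x" unfolding AE_all_countable using vae by blast
  have "AE x in lebesgue. z x = w x"
    using s' all cap_zero_AE[OF z(2)]
  proof eventually_elim
    case (elim x)
    from tendsto_fst[OF elim(1)] have "(\<lambda>n. u (r (s n)) x - w x) \<longlonglongrightarrow> 0" by simp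
    hence "(\<lambda>n. v (s n) x) \<longlonglongrightarrow> w x" using elim(2) by (simp add: LIM_zero_cancel)
    moreover have "(\<lambda>n. v (s n) x) \<longlonglongrightarrow> z x" using LIMSEQ_subseq_LIMSEQ[OF z(3)[OF elim(3)] s(1)] by (simp add: comp_def)
    ultimately show ?case using LIMSEQ_unique by blast
  qed
  moreover have "cap {x. x \<notin> \<Omega> \<and> z x \<noteq> 0} = 0"
  proof -
    have "{x. x \<notin> \<Omega> \<and> z x \<noteq> 0} \<subseteq> N \<union> (\<Union>k. {x. x \<notin> \<Omega> \<and> v k x \<noteq> 0})"
    proof
      fix x assume x: "x \<in> {x. x \<notin> \<Omega> \<and> z x \<noteq> 0}"
      show "x \<in> N \<union> (\<Union>k. {x. x \<notin> \<Omega> \<and> v k x \<noteq> 0})"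
      proof (rule ccontr)
        assume "x \<notin> N \<union> (\<Union>k. {x. x \<notin> \<Omega> \<and> v k x \<noteq> 0})"
        hence "x \<notin> N" "\<And>k. v k x = 0" using x by auto
        from z(3)[OF this(1)] this(2) have "z x = 0" by (simp add: LIMSEQ_const_iff)
        thus False using x by simp
      qed
    qed
    hence "cap {x. x \<notin> \<Omega> \<and> z x \<noteq> 0} \<le> cap (N \<union> (\<Union>k. {x. x \<notin> \<Omega> \<and> v k x \<noteq> 0}))" by (rule cap_mono)
    also have "\<dots> = 0" by (intro cap_zero_Un cap_zero_Union z vc)
    finally show ?thesis by simp
  qed
  ultimately show ?thesis unfolding H10_iff using Ww z(1) by blast
qed

theorem sobolev_closed_subspace_H10: "sobolev_closed_subspace (H10 \<Omega>)"
  unfolding sobolev_closed_subspace_def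
proof (intro conjI ballI allI impI)
  show "H10 \<Omega> \<subseteq> H1 mN" by (auto simp: H10_def)
  show "w \<in> H10 \<Omega>" if "\<forall>n. u n \<in> H10 \<Omega> \<and> wdiff mN (u n) (G n)" "wdiff mN w H" 
    "(\<lambda>n. l2_norm mN (\<lambda>x. jet (u n) (G n) x - jet w H x)) \<longlonglongrightarrow> 0" for u :: "nat \<Rightarrow> 'a \<Rightarrow> real" and G w H
    by (rule H10_limit[of u \<Omega> G w H]) (use \<open>\<forall>n. u n \<in> H10 \<Omega> \<and> wdiff mN (u n) (G n)\<close> \<open>wdiff mN w H\<close> 
       \<open>(\<lambda>n. l2_norm mN (\<lambda>x. jet (u n) (G n) x - jet w H x)) \<longlonglongrightarrow> 0\<close> in auto)
qed (auto intro: H10_zero H10_add H10_scale)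

section \<open>The energy form and its eigenvalues\<close>

definition energy :: "('a::euclidean_space \<Rightarrow> real) \<Rightarrow> ('a \<Rightarrow> real) \<Rightarrow> real" where
  "energy u v = l2_inner mN (weak_gradient u) (weak_gradient v)"

lemma H1_mN_wdiff: "u \<in> H1 mN \<Longrightarrow> wdiff mN u (weak_gradient u)"
  unfolding H1_iff using wdiff_weak_gradient(1)[OF sobolev_measure_mN] by blast

lemma energy_diag: "energy u u = (l2_norm mN (weak_gradient u))\<^sup>2"
  by (simp add: energy_def l2_norm_sq_inner)

lemma energy_eq:
  assumes "wdiff mN u G" "wdiff mN v H" shows "energy u v = l2_inner mN G H"
  unfolding energy_def
  by (rule l2_inner_cong_AE) (use wdiff_weak_gradient[OF sobolev_measure_mN assms(1)] 
      wdiff_weak_gradient[OF sobolev_measure_mN assms(2)] assms in \<open>auto intro: L2_measurable wdiff_L2\<close>)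

text \<open>Compactness is the compact embedding followed by \<open>weak_closure\<close>, which also is the semicontinuity of the energy.\<close>

theorem energy_forms_closed_subspace:
  assumes S: "sobolev_closed_subspace S"
  shows "energy_forms S energy (l2_inner mN)"
proof
  note D = sobolev_closed_subspaceD[OF S]
  have W: "wdiff mN u (weak_gradient u)" if "u \<in> S" for u using H1_mN_wdiff[OF D(1)[OF that]] .
  have L: "u \<in> L2 mN" if "u \<in> S" for u by (rule wdiff_L2(1)[OF W[OF that]])
  have GL: "weak_gradient u \<in> L2 mN" if "u \<in> S" for u by (rule wdiff_L2(2)[OF W[OF that]])
  show "(\<lambda>x. 0) \<in> S" by (rule D(2))
  show "(\<lambda>x. u x + v x) \<in> S" if "u \<in> S" "v \<in> S" for u v using that by (rule D(3))
  show "(\<lambda>x. c * u x) \<in> S" if "u \<in> S" for u c using that by (rule D(4))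
  show "energy (\<lambda>x. u x + v x) w = energy u w + energy v w" if "u \<in> S" "v \<in> S" "w \<in> S" for u v w
    unfolding energy_eq[OF wdiff_add[OF W[OF that(1)] W[OF that(2)]] W[OF that(3)]] 
    unfolding energy_def by (rule l2_inner_add_left) (use GL that in auto)
  show "energy (\<lambda>x. c * u x) w = c * energy u w" if "u \<in> S" "w \<in> S" for u w c
    unfolding energy_eq[OF wdiff_scale[OF W[OF that(1)]] W[OF that(2)]] unfolding energy_def by (rule l2_inner_scaleR_left)
  show "energy u v = energy v u" for u v :: "'a \<Rightarrow> real" unfolding energy_def by (rule l2_inner_commute)
  show "0 \<le> energy u u" for u :: "'a \<Rightarrow> real" by (simp add: energy_diag)
  show "l2_inner mN (\<lambda>x. u x + v x) w = l2_inner mN u w + l2_inner mN v w" if "u \<in> S" "v \<in> S" "w \<in> S" for u v w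
    using that by (intro l2_inner_add_left L)
  show "l2_inner mN (\<lambda>x. c * u x) w = c * l2_inner mN u w" for u w :: "'a \<Rightarrow> real" and c
    using l2_inner_scaleR_left[of mN c u w] by simp
  show "l2_inner mN u v = l2_inner mN v u" for u v :: "'a \<Rightarrow> real" by (rule l2_inner_commute)
  show "0 \<le> l2_inner mN u u" for u :: "'a \<Rightarrow> real" by (simp add: l2_norm_sq_inner[symmetric])
  fix vs :: "nat \<Rightarrow> 'a \<Rightarrow> real" and C
  assume vS: "\<And>n. vs n \<in> S" and aC: "\<And>n. energy (vs n) (vs n) \<le> C"
  have C0: "C \<ge> 0" using aC[of 0] by (simp add: energy_diag) (smt (verit) zero_le_power2)
  have GC: "l2_norm mN (weak_gradient (vs n)) \<le> sqrt C" for n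
    using aC[of n] by (simp add: energy_diag real_le_rsqrt)
  {
    fix w assume w: "w \<in> S" and lim: "(\<lambda>n. l2_inner mN (\<lambda>x. vs n x - w x) (\<lambda>x. vs n x - w x)) \<longlonglongrightarrow> 0"
    have "(\<lambda>n. sqrt ((l2_norm mN (\<lambda>x. vs n x - w x))\<^sup>2)) \<longlonglongrightarrow> sqrt 0"
      using lim by (intro tendsto_real_sqrt) (simp add: l2_norm_sq_inner)
    hence lim': "(\<lambda>n. l2_norm mN (\<lambda>x. vs n x - w x)) \<longlonglongrightarrow> 0" by simp
    obtain H where H: "wdiff mN w H" "l2_norm mN H \<le> sqrt C"
      by (rule weak_closure[OF S vS W[OF vS] GC L[OF w] lim'])
    have "energy w w = (l2_norm mN H)\<^sup>2" unfolding energy_eq[OF H(1) H(1)] by (rule l2_norm_sq_inner[symmetric])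
    also have "\<dots> \<le> (sqrt C)\<^sup>2" by (intro power_mono H) simp
    finally show "energy w w \<le> C" using C0 by simp
  }
  assume bC: "\<And>n. l2_inner mN (vs n) (vs n) \<le> 1"
  have JC: "l2_norm mN (jet (vs n) (weak_gradient (vs n))) \<le> sqrt (1 + C)" for n
  proof (rule real_le_rsqrt)
    show "(l2_norm mN (jet (vs n) (weak_gradient (vs n))))\<^sup>2 \<le> 1 + C"
      unfolding l2_norm_Pair[OF L[OF vS] GL[OF vS]] using aC[of n] bC[of n]
      by (simp add: energy_diag l2_norm_sq_inner[of mN "vs n"])
  qed
  obtain k :: "nat \<Rightarrow> nat" where k: "strict_mono k" "l2_Cauchy mN (\<lambda>n. vs (k n))"
    by (rule compact_embedding[of vs "\<lambda>n. weak_gradient (vs n)", OF W[OF vS] JC])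
  obtain w where w: "w \<in> L2 mN" "(\<lambda>n. l2_norm mN (\<lambda>x. vs (k n) x - w x)) \<longlonglongrightarrow> 0"
    by (rule l2_complete[of "\<lambda>n. vs (k n)", OF L[OF vS] k(2)])
  have "w \<in> S" by (rule weak_closure[of S "\<lambda>n. vs (k n)" "\<lambda>n. weak_gradient (vs (k n))", OF S vS W[OF vS] GC w])
  moreover have "(\<lambda>n. l2_inner mN (\<lambda>x. vs (k n) x - w x) (\<lambda>x. vs (k n) x - w x)) \<longlonglongrightarrow> 0"
    using tendsto_power[OF w(2), of 2] by (simp add: l2_norm_sq_inner)
  ultimately show "\<exists>r w. strict_mono r \<and> w \<in> S \<and> (\<lambda>n. l2_inner mN (\<lambda>x. vs (r n) x - w x) (\<lambda>x. vs (r n) x - w x)) \<longlonglongrightarrow> 0"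
    using k(1) by blast
qed

interpretation H10: energy_forms "H10 \<Omega>" energy "l2_inner mN" for \<Omega> :: "'a::euclidean_space set"
  by (rule energy_forms_closed_subspace[OF sobolev_closed_subspace_H10])

lemma H10_wdiff: "u \<in> H10 \<Omega> \<Longrightarrow> wdiff mN u (weak_gradient u)"
  by (rule H1_mN_wdiff) (simp add: H10_def)

lemma set_integral_eq_of_AE_zero:
  fixes f :: "'a::euclidean_space \<Rightarrow> real"
  assumes f: "f \<in> borel_measurable mN" and Om: "\<Omega> \<in> sets lebesgue" and z: "AE x in lebesgue. x \<notin> \<Omega> \<longrightarrow> f x = 0"
  shows "(LINT x:\<Omega>|mN. f x) = (LINT x|mN. f x)"
  unfolding set_lebesgue_integral_def
proof (rule integral_cong_AE)
  have "\<Omega> \<in> sets mN" using Om by (simp add: mN_def)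
  thus "(\<lambda>x. indicator \<Omega> x *\<^sub>R f x) \<in> borel_measurable mN" using f by measurable
  have "AE x in mN. x \<notin> \<Omega> \<longrightarrow> f x = 0" using z sobolev_AE_eq[OF sobolev_measure_mN] by blast
  thus "AE x in mN. indicator \<Omega> x *\<^sub>R f x = f x" by eventually_elim (auto simp: indicator_def)
qed (rule f)

text \<open>The integrals over \<open>\<Omega>\<close> extend to the whole space, since the functions vanish almost everywhere outside \<open>\<Omega>\<close> and
  their gradients do so on the zero sets of the functions.\<close>

lemma eigenspace_eq:
  assumes Om: "quasi_open \<Omega>"
  shows "u \<in> eigenspace \<Omega> \<mu> \<longleftrightarrow> H10.eigenvector \<Omega> \<mu> u"
proof -
  have Oms: "\<Omega> \<in> sets lebesgue" by (rule quasi_open_measurable[OF Om])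
  have "(LINT x:\<Omega>|mN. weak_gradient u x \<bullet> weak_gradient \<phi> x) = energy u \<phi>"
    and "(LINT x:\<Omega>|mN. u x * \<phi> x) = l2_inner mN u \<phi>" if u: "u \<in> H10 \<Omega>" and phi: "\<phi> \<in> H10 \<Omega>" for \<phi>
  proof -
    note Wu = H10_wdiff[OF u] and Wp = H10_wdiff[OF phi]
    have z: "AE x in lebesgue. x \<notin> \<Omega> \<longrightarrow> u x = 0" by (rule H10_AE_zero[OF u])
    have g: "AE x in lebesgue. x \<notin> \<Omega> \<longrightarrow> weak_gradient u x = 0"
      using z weak_gradient_zero_level[OF wdiff_lebesgue[OF sobolev_measure_mN Wu]] by eventually_elim auto
    have 1: "(\<lambda>x. weak_gradient u x \<bullet> weak_gradient \<phi> x) \<in> borel_measurable mN"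
      by (rule borel_measurable_inner) (auto intro: L2_measurable wdiff_L2(2)[OF Wu] wdiff_L2(2)[OF Wp])
    have 2: "(\<lambda>x. u x * \<phi> x) \<in> borel_measurable mN"
      by (rule borel_measurable_times) (auto intro: L2_measurable wdiff_L2(1)[OF Wu] wdiff_L2(1)[OF Wp])
    show "(LINT x:\<Omega>|mN. weak_gradient u x \<bullet> weak_gradient \<phi> x) = energy u \<phi>"
      unfolding energy_def l2_inner_def
      by (rule set_integral_eq_of_AE_zero[OF 1 Oms]) (use g in \<open>auto elim!: eventually_mono\<close>)
    show "(LINT x:\<Omega>|mN. u x * \<phi> x) = l2_inner mN u \<phi>"
      unfolding l2_inner_def inner_real_def
      by (rule set_integral_eq_of_AE_zero[OF 2 Oms]) (use z in \<open>auto elim!: eventually_mono\<close>)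
  qed
  thus ?thesis unfolding eigenspace_def H10.eigenvector_def by auto
qed

lemma l2_inner_self_eq_0_iff:
  fixes u :: "'a::euclidean_space \<Rightarrow> real"
  assumes u: "u \<in> L2 mN" shows "l2_inner mN u u = 0 \<longleftrightarrow> (AE x in lebesgue. u x = 0)"
proof -
  have "l2_inner mN u u = (LINT x|mN. (norm (u x))\<^sup>2)" by (simp add: l2_norm_sq_inner[symmetric] l2_norm_sq)
  also have "\<dots> = 0 \<longleftrightarrow> (AE x in mN. (norm (u x))\<^sup>2 = 0)"
    by (rule integral_nonneg_eq_0_iff_AE[OF L2_integrable[OF u]]) simp
  finally show ?thesis using sobolev_AE_eq[OF sobolev_measure_mN] by simp
qed

lemma multiplicity_eq:
  assumes Om: "quasi_open \<Omega>" shows "multiplicity \<Omega> \<mu> = energy_forms.multiplicity_of (H10 \<Omega>) energy (l2_inner mN) \<mu>"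
proof -
  have "(\<forall>i<n. u i \<in> eigenspace \<Omega> \<mu>) \<and> independent_modulo_null n u \<longleftrightarrow> 
      (\<forall>i<n. H10.eigenvector \<Omega> \<mu> (u i)) \<and> H10.independent n u" for n u
  proof (cases "\<forall>i<n. H10.eigenvector \<Omega> \<mu> (u i)")
    case True
    have "lincomb n c u \<in> L2 mN" for c
    proof -
      have "lincomb n c u \<in> H10 \<Omega>" using True by (intro H10.lincomb_mem) (auto simp: H10.eigenvector_def)
      thus ?thesis by (intro wdiff_L2(1)[OF H10_wdiff])
    qed
    hence "independent_modulo_null n u \<longleftrightarrow> H10.independent n u"
      unfolding independent_modulo_null_def H10.independent_def by (simp add: l2_inner_self_eq_0_iff) (simp add: lincomb_def)
    thus ?thesis using True by (simp add: eigenspace_eq[OF Om])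
  next
    case False
    thus ?thesis by (auto simp: eigenspace_eq[OF Om])
  qed
  thus ?thesis unfolding multiplicity_def H10.multiplicity_of_def by simp
qed

theorem enat_le_eigenvalue_count:
  assumes Om: "quasi_open \<Omega>"
  shows "enat k \<le> eigenvalue_count \<Omega> t \<longleftrightarrow> (\<exists>e \<mu>. H10.eigensystem \<Omega> k e \<mu> \<and> (\<forall>i<k. \<mu> i \<le> t))"
  unfolding eigenvalue_count_def multiplicity_eq[OF Om] by (rule H10.enat_le_eigenvalue_count_iff)

section \<open>Existence of an optimal domain\<close>

lemma common_Cauchy_subsequence:
  fixes e :: "nat \<Rightarrow> nat \<Rightarrow> 'a::euclidean_space \<Rightarrow> real" and k :: nat
  assumes "\<And>n i. i < k \<Longrightarrow> wdiff mN (e n i) (G n i)" "\<And>n i. i < k \<Longrightarrow> l2_norm mN (jet (e n i) (G n i)) \<le> C"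
  shows "\<exists>r. strict_mono (r :: nat \<Rightarrow> nat) \<and> (\<forall>i<k. l2_Cauchy mN (\<lambda>n. e (r n) i))"
  using assms
proof (induction k)
  case 0 thus ?case using strict_mono_id by blast
next
  case (Suc k)
  then obtain r where r: "strict_mono (r :: nat \<Rightarrow> nat)" "\<forall>i<k. l2_Cauchy mN (\<lambda>n. e (r n) i)" by auto
  obtain s :: "nat \<Rightarrow> nat" where s: "strict_mono s" "l2_Cauchy mN (\<lambda>n. e (r (s n)) k)"
    by (rule compact_embedding[of "\<lambda>n. e (r n) k" "\<lambda>n. G (r n) k" C]) (use Suc.prems in auto)
  have "l2_Cauchy mN (\<lambda>n. e (r (s n)) i)" if "i < k" for i
    using r(2)[rule_format, OF that] unfolding l2_Cauchy_def by (meson order_trans seq_suble[OF s(1)])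
  hence "\<forall>i<Suc k. l2_Cauchy mN (\<lambda>n. e ((r \<circ> s) n) i)" using s(2) by (auto simp: less_Suc_eq)
  moreover have "strict_mono (r \<circ> s)" using r(1) s(1) by (rule strict_mono_o)
  ultimately show ?case by blast
qed

lemma lincomb_converges:
  fixes e :: "nat \<Rightarrow> nat \<Rightarrow> 'a \<Rightarrow> real"
  assumes "\<And>n i. i < k \<Longrightarrow> e n i \<in> L2 M" "\<And>i. i < k \<Longrightarrow> f i \<in> L2 M"
    and "\<And>i. i < k \<Longrightarrow> (\<lambda>n. l2_norm M (\<lambda>x. e n i x - f i x)) \<longlonglongrightarrow> 0"
  shows "(\<lambda>n. l2_norm M (\<lambda>x. lincomb k c (e n) x - lincomb k c f x)) \<longlonglongrightarrow> 0"
proof (rule Lim_null_comparison, rule always_eventually, rule allI)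
  fix n
  have "(\<lambda>x. lincomb k c (e n) x - lincomb k c f x) = (\<lambda>x. \<Sum>i<k. c i * (e n i x - f i x))"
    by (simp add: lincomb_def sum_subtractf[symmetric] right_diff_distrib)
  hence "l2_norm M (\<lambda>x. lincomb k c (e n) x - lincomb k c f x) \<le> (\<Sum>i<k. l2_norm M (\<lambda>x. c i * (e n i x - f i x)))"
    using l2_norm_sum_le[of "{..<k}" "\<lambda>i x. c i * (e n i x - f i x)" M] assms(1,2) by (simp add: L2_cmult L2_diff)
  thus "norm (l2_norm M (\<lambda>x. lincomb k c (e n) x - lincomb k c f x)) \<le> (\<Sum>i<k. \<bar>c i\<bar> * l2_norm M (\<lambda>x. e n i x - f i x))"
    by (simp add: l2_norm_cmult)
next
  have "(\<lambda>n. \<Sum>i<k. \<bar>c i\<bar> * l2_norm M (\<lambda>x. e n i x - f i x)) \<longlonglongrightarrow> (\<Sum>i<k. \<bar>c i\<bar> * 0)"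
    using assms(3) by (intro tendsto_sum tendsto_mult tendsto_const) auto
  thus "(\<lambda>n. \<Sum>i<k. \<bar>c i\<bar> * l2_norm M (\<lambda>x. e n i x - f i x)) \<longlonglongrightarrow> 0" by simp
qed

text \<open>Along a subsequence \<open>e n i\<close> converges to \<open>f i\<close> almost everywhere for all \<open>i < k\<close> at once. Where \<open>f i \<noteq> 0\<close>, eventually
  \<open>e n i \<noteq> 0\<close>, so the point lies in \<open>\<Omega> n\<close>; Fatou's lemma for the indicators gives the bound.\<close>

lemma measure_nonzero_limit_le:
  fixes e :: "nat \<Rightarrow> nat \<Rightarrow> 'a::euclidean_space \<Rightarrow> real" and k :: nat
  assumes eL: "\<And>n i. i < k \<Longrightarrow> e n i \<in> L2 mN" and fL: "\<And>i. i < k \<Longrightarrow> f i \<in> L2 mN"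
    and lim: "\<And>i. i < k \<Longrightarrow> (\<lambda>n. l2_norm mN (\<lambda>x. e n i x - f i x)) \<longlonglongrightarrow> 0"
    and Om: "\<And>n. \<Omega> n \<in> sets lebesgue" "\<And>n. emeasure mN (\<Omega> n) \<le> C"
    and z: "\<And>n i. i < k \<Longrightarrow> AE x in lebesgue. x \<notin> \<Omega> n \<longrightarrow> e n i x = 0"
    and A: "A \<in> sets lebesgue" and Af: "AE x in lebesgue. x \<in> A \<longrightarrow> (\<exists>i<k. f i x \<noteq> 0)"
  shows "emeasure mN A \<le> C"
proof -
  let ?h = "\<lambda>n x. \<Sum>i<k. \<bar>e n i x - f i x\<bar>"
  have dL: "(\<lambda>x. \<bar>e n i x - f i x\<bar>) \<in> L2 mN" if "i < k" for n i
    using L2_norm_fun[OF L2_diff[OF eL[OF that] fL[OF that]], of n] by simp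
  have hL: "?h n \<in> L2 mN" for n using dL by (intro L2_sum) auto
  have "(\<lambda>n. l2_norm mN (?h n)) \<longlonglongrightarrow> 0"
  proof (rule Lim_null_comparison, rule always_eventually, rule allI)
    fix n
    have "l2_norm mN (?h n) \<le> (\<Sum>i<k. l2_norm mN (\<lambda>x. \<bar>e n i x - f i x\<bar>))" using dL by (intro l2_norm_sum_le) auto
    also have "\<dots> = (\<Sum>i<k. l2_norm mN (\<lambda>x. e n i x - f i x))" by (simp add: l2_norm_def)
    finally show "norm (l2_norm mN (?h n)) \<le> (\<Sum>i<k. l2_norm mN (\<lambda>x. e n i x - f i x))" by simp
  next
    have "(\<lambda>n. \<Sum>i<k. l2_norm mN (\<lambda>x. e n i x - f i x)) \<longlonglongrightarrow> (\<Sum>i<k. 0)" using lim by (intro tendsto_sum) auto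
    thus "(\<lambda>n. \<Sum>i<k. l2_norm mN (\<lambda>x. e n i x - f i x)) \<longlonglongrightarrow> 0" by simp
  qed
  from l2_AE_subseq[of ?h mN, OF hL this] obtain s where s: "strict_mono (s::nat\<Rightarrow>nat)" "AE x in mN. (\<lambda>n. ?h (s n) x) \<longlonglongrightarrow> 0" by blast
  have mNs: "sets mN = sets (lebesgue :: 'a measure)" by (simp add: mN_def)
  have z': "AE x in mN. \<forall>n. \<forall>i\<in>{..<k}. x \<notin> \<Omega> n \<longrightarrow> e n i x = 0"
    unfolding AE_all_countable sobolev_AE_eq[OF sobolev_measure_mN] using z by (intro allI AE_finite_allI) auto
  have Af': "AE x in mN. x \<in> A \<longrightarrow> (\<exists>i<k. f i x \<noteq> 0)" using Af sobolev_AE_eq[OF sobolev_measure_mN] by blast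
  have "emeasure mN A = (\<integral>\<^sup>+x. indicator A x \<partial>mN)" using A mNs by simp
  also have "\<dots> \<le> (\<integral>\<^sup>+x. liminf (\<lambda>n. indicator (\<Omega> (s n)) x) \<partial>mN)"
  proof (rule nn_integral_mono_AE)
    show "AE x in mN. indicator A x \<le> liminf (\<lambda>n. indicator (\<Omega> (s n)) x :: ennreal)"
      using s(2) z' Af'
    proof eventually_elim
      case (elim x)
      show ?case
      proof (cases "x \<in> A")
        case True
        then obtain i where i: "i < k" "f i x \<noteq> 0" using elim(3) by blast
        have "\<forall>\<^sub>F n in sequentially. ?h (s n) x < \<bar>f i x\<bar>" using elim(1) i(2) by (intro order_tendstoD(2)) auto
        hence "\<forall>\<^sub>F n in sequentially. (1::ennreal) \<le> indicator (\<Omega> (s n)) x"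
        proof eventually_elim
          case (elim n)
          have "\<bar>e (s n) i x - f i x\<bar> \<le> ?h (s n) x" using i(1) by (intro member_le_sum) auto
          hence "e (s n) i x \<noteq> 0" using elim by auto
          hence "x \<in> \<Omega> (s n)" using \<open>\<forall>n. \<forall>i\<in>{..<k}. x \<notin> \<Omega> n \<longrightarrow> e n i x = 0\<close> i(1) by blast
          thus ?case by simp
        qed
        hence "1 \<le> liminf (\<lambda>n. indicator (\<Omega> (s n)) x :: ennreal)" by (rule Liminf_bounded)
        thus ?thesis using True by simp
      qed simp
    qed
  qed
  also have "\<dots> \<le> liminf (\<lambda>n. \<integral>\<^sup>+x. indicator (\<Omega> (s n)) x \<partial>mN)"
    using Om(1) mNs by (intro nn_integral_liminf) simp
  also have "\<dots> = liminf (\<lambda>n. emeasure mN (\<Omega> (s n)))" using Om(1) mNs by simp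
  also have "\<dots> \<le> liminf (\<lambda>n. C)" using Om(2) by (intro Liminf_mono always_eventually) auto
  also have "\<dots> = C" by (simp add: Liminf_const)
  finally show ?thesis .
qed

text \<open>The limit of a sequence of domains with bounded eigenvalues is the set where a limit of eigenfunctions is
  nonzero. All linear combinations are followed at the same time, so that the limits stay independent and the
  bound for the quotients holds on their whole span.\<close>

theorem limit_domain:
  fixes \<Omega> :: "nat \<Rightarrow> 'a::euclidean_space set" and k :: nat
  assumes Om: "\<And>n. quasi_open (\<Omega> n)" "\<And>n. emeasure mN (\<Omega> n) \<le> C" 
    and es: "\<And>n. H10.eigensystem (\<Omega> n) k (e n) (\<mu> n)" and mu: "\<And>n i. i < k \<Longrightarrow> \<mu> n i \<le> t n"
    and t: "t \<longlonglongrightarrow> L"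
  obtains \<Omega>' :: "'a set" where "quasi_open \<Omega>'" "emeasure mN \<Omega>' \<le> C" "enat k \<le> eigenvalue_count \<Omega>' L"
proof -
  have eS: "e n i \<in> H10 (\<Omega> n)" if "i < k" for n i by (rule H10.eigensystem_mem[OF es that])
  have We: "wdiff mN (e n i) (weak_gradient (e n i))" if "i < k" for n i by (rule H10_wdiff[OF eS[OF that]])
  have eL: "e n i \<in> L2 mN" if "i < k" for n i by (rule wdiff_L2(1)[OF We[OF that]])
  have on: "H10.orthonormal k (e n)" for n using es[of n] by (simp add: H10.eigensystem_def)
  have comb_norm: "(l2_norm mN (lincomb k c (e n)))\<^sup>2 = (\<Sum>i<k. (c i)\<^sup>2)" for c n
    unfolding l2_norm_sq_inner by (rule H10.orthonormal_lincomb(2)[OF on eS])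
  have comb_energy: "(l2_norm mN (weak_gradient (lincomb k c (e n))))\<^sup>2 \<le> t n * (\<Sum>i<k. (c i)\<^sup>2)" for c n
    unfolding energy_diag[symmetric] by (rule H10.eigensystem_energy[OF es mu])
  have comb_mem: "lincomb k c (e n) \<in> H10 (\<Omega> n)" for c n by (rule H10.lincomb_mem[OF eS])
  obtain T where T: "\<And>n. \<bar>t n\<bar> \<le> T" using convergent_imp_Bseq[OF convergentI[OF t]] unfolding Bseq_def by auto
  have jb: "l2_norm mN (jet (e n i) (weak_gradient (e n i))) \<le> sqrt (1 + T)" if i: "i < k" for n i
  proof (rule real_le_rsqrt)
    \<comment> \<open>The single function \<open>e n i\<close> as a linear combination.\<close>
    let ?c = "\<lambda>j. if j = i then 1 else (0::real)"
    have eq: "lincomb k ?c (e n) = e n i" using i by (simp add: lincomb_def if_distrib[of "\<lambda>a. a * _"] sum.delta cong: if_cong)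
    have s1: "(\<Sum>j<k. (?c j)\<^sup>2) = 1" using i by (simp add: if_distrib[of "\<lambda>a. a\<^sup>2"] sum.delta cong: if_cong)
    have "(l2_norm mN (e n i))\<^sup>2 = 1" using comb_norm[of ?c n] unfolding eq s1 .
    moreover have "(l2_norm mN (weak_gradient (e n i)))\<^sup>2 \<le> t n" using comb_energy[of ?c n] unfolding eq s1 by simp
    ultimately show "(l2_norm mN (jet (e n i) (weak_gradient (e n i))))\<^sup>2 \<le> 1 + T"
      unfolding l2_norm_Pair[OF wdiff_L2(1)[OF We[OF i]] wdiff_L2(2)[OF We[OF i]]] using T[of n] by linarith
  qed
  obtain r where r: "strict_mono (r :: nat \<Rightarrow> nat)" and rc: "\<forall>i<k. l2_Cauchy mN (\<lambda>n. e (r n) i)"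
    using common_Cauchy_subsequence[of k e "\<lambda>n i. weak_gradient (e n i)", OF We jb] by blast
  have "\<forall>i. \<exists>f. i < k \<longrightarrow> f \<in> L2 mN \<and> (\<lambda>n. l2_norm mN (\<lambda>x. e (r n) i x - f x)) \<longlonglongrightarrow> 0"
  proof
    fix i
    show "\<exists>f. i < k \<longrightarrow> f \<in> L2 mN \<and> (\<lambda>n. l2_norm mN (\<lambda>x. e (r n) i x - f x)) \<longlonglongrightarrow> 0"
    proof (cases "i < k")
      case True
      obtain f where "f \<in> L2 mN" "(\<lambda>n. l2_norm mN (\<lambda>x. e (r n) i x - f x)) \<longlonglongrightarrow> 0"
        by (rule l2_complete[of "\<lambda>n. e (r n) i" mN, OF eL[OF True]]) (use rc True in auto)
      thus ?thesis by blast
    qed simp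
  qed
  from choice[OF this] obtain f where f: "\<forall>i. i < k \<longrightarrow> f i \<in> L2 mN \<and> (\<lambda>n. l2_norm mN (\<lambda>x. e (r n) i x - f i x)) \<longlonglongrightarrow> 0" ..
  have fL: "f i \<in> L2 mN" and fl: "(\<lambda>n. l2_norm mN (\<lambda>x. e (r n) i x - f i x)) \<longlonglongrightarrow> 0" if "i < k" for i using f that by auto
  have cl: "(\<lambda>n. l2_norm mN (\<lambda>x. lincomb k c (e (r n)) x - lincomb k c f x)) \<longlonglongrightarrow> 0" for c
    by (rule lincomb_converges[of k "\<lambda>n. e (r n)", OF eL fL fl])
  have cL: "lincomb k c (e n) \<in> L2 mN" for c n by (rule wdiff_L2(1)[OF H10_wdiff[OF comb_mem]])
  have cfL: "lincomb k c f \<in> L2 mN" for c unfolding lincomb_def using fL by (intro L2_sum L2_cmult) auto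
  have fnorm: "(l2_norm mN (lincomb k c f))\<^sup>2 = (\<Sum>i<k. (c i)\<^sup>2)" for c
  proof -
    have "(\<lambda>n. (l2_norm mN (lincomb k c (e (r n))))\<^sup>2) \<longlonglongrightarrow> (l2_norm mN (lincomb k c f))\<^sup>2"
      by (intro tendsto_power l2_norm_tendsto[OF cL cfL cl])
    thus ?thesis unfolding comb_norm by (simp add: LIMSEQ_const_iff)
  qed
  have fenergy: "lincomb k c f \<in> H1 mN \<and> energy (lincomb k c f) (lincomb k c f) \<le> L * (\<Sum>i<k. (c i)\<^sup>2)" for c
  proof -
    let ?s = "\<Sum>i<k. (c i)\<^sup>2"
    have s0: "?s \<ge> 0" by (intro sum_nonneg) simp
    have ts: "(\<lambda>n. t (r n) * ?s) \<longlonglongrightarrow> L * ?s"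
      using LIMSEQ_subseq_LIMSEQ[OF t r] by (intro tendsto_mult tendsto_const) (simp add: comp_def)
    \<comment> \<open>The bounds \<open>t (r n)\<close> exceed \<open>L\<close> by less than any given amount only from some index on, and \<open>weak_closure\<close> asks for a uniform
      bound; so an \<open>\<epsilon>\<close> is spent and removed at the end.\<close>
    have eps: "lincomb k c f \<in> H1 mN \<and> energy (lincomb k c f) (lincomb k c f) \<le> L * ?s + \<epsilon>" if e: "\<epsilon> > 0" for \<epsilon>
    proof -
      have "\<forall>\<^sub>F n in sequentially. t (r n) * ?s < L * ?s + \<epsilon>" using ts e by (intro order_tendstoD(2)) auto
      then obtain N where N: "\<And>n. n \<ge> N \<Longrightarrow> t (r n) * ?s < L * ?s + \<epsilon>" by (auto simp: eventually_sequentially)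
      let ?u = "\<lambda>n. lincomb k c (e (r (n + N)))"
      have le: "(l2_norm mN (weak_gradient (?u n)))\<^sup>2 \<le> L * ?s + \<epsilon>" for n
        using comb_energy[of c "r (n + N)"] N[of "n + N"] by simp
      have p0: "0 \<le> L * ?s + \<epsilon>" using le[of 0] by (rule order_trans[OF zero_le_power2])
      have lim: "(\<lambda>n. l2_norm mN (\<lambda>x. ?u n x - lincomb k c f x)) \<longlonglongrightarrow> 0"
        using LIMSEQ_ignore_initial_segment[OF cl[of c], of N] .
      have uH: "?u n \<in> H1 mN" for n using comb_mem[of c "r (n + N)"] by (simp add: H10_def)
      obtain H where H: "wdiff mN (lincomb k c f) H" "l2_norm mN H \<le> sqrt (L * ?s + \<epsilon>)" "lincomb k c f \<in> H1 mN"
        by (rule weak_closure[of "H1 mN" ?u "\<lambda>n. weak_gradient (?u n)", OF sobolev_closed_subspace_H1 uH H10_wdiff[OF comb_mem] 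
            real_le_rsqrt[OF le] cfL lim])
      have "energy (lincomb k c f) (lincomb k c f) = (l2_norm mN H)\<^sup>2"
        unfolding energy_eq[OF H(1) H(1)] by (rule l2_norm_sq_inner[symmetric])
      also have "\<dots> \<le> (sqrt (L * ?s + \<epsilon>))\<^sup>2" by (intro power_mono H) simp
      finally show ?thesis using p0 H(3) by simp
    qed
    have "energy (lincomb k c f) (lincomb k c f) \<le> L * ?s" by (rule field_le_epsilon) (use eps in blast)
    thus ?thesis using eps[of 1] by simp
  qed
  have fH: "f i \<in> H1 mN" if i: "i < k" for i
  proof -
    let ?c = "\<lambda>j. if j = i then 1 else (0::real)"
    have "lincomb k ?c f = f i" using i by (simp add: lincomb_def if_distrib[of "\<lambda>a. a * _"] sum.delta cong: if_cong)
    thus ?thesis using fenergy[of ?c] by simp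
  qed
  have "\<forall>i. \<exists>v. i < k \<longrightarrow> quasi_continuous v \<and> (AE x in lebesgue. v x = f i x)"
  proof
    fix i
    show "\<exists>v. i < k \<longrightarrow> quasi_continuous v \<and> (AE x in lebesgue. v x = f i x)"
    proof (cases "i < k")
      case True
      obtain v where "quasi_continuous v" "AE x in lebesgue. v x = f i x"
        by (rule quasi_continuous_representative[OF wdiff_lebesgue[OF sobolev_measure_mN H1_mN_wdiff[OF fH[OF True]]]])
      thus ?thesis by blast
    qed simp
  qed
  from choice[OF this] obtain v where v: "\<forall>i. i < k \<longrightarrow> quasi_continuous (v i) \<and> (AE x in lebesgue. v i x = f i x)" ..
  have vq: "quasi_continuous (v i)" and vf: "AE x in lebesgue. v i x = f i x" if "i < k" for i using v that by auto
  define \<Omega>' where "\<Omega>' = {x. \<exists>i<k. v i x \<noteq> 0}"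
  have qo: "quasi_open \<Omega>'" unfolding \<Omega>'_def by (rule quasi_open_nonzero[OF vq])
  have Af: "AE x in lebesgue. x \<in> \<Omega>' \<longrightarrow> (\<exists>i<k. f i x \<noteq> 0)"
  proof -
    have "AE x in lebesgue. \<forall>i\<in>{..<k}. v i x = f i x" using vf by (intro AE_finite_allI) auto
    thus ?thesis by eventually_elim (auto simp: \<Omega>'_def)
  qed
  have meas: "emeasure mN \<Omega>' \<le> C"
    by (rule measure_nonzero_limit_le[of k "\<lambda>n. e (r n)" f "\<lambda>n. \<Omega> (r n)", OF eL fL fl quasi_open_measurable[OF Om(1)] Om(2) 
        H10_AE_zero[OF eS] quasi_open_measurable[OF qo] Af])
  have fS: "f i \<in> H10 \<Omega>'" if i: "i < k" for i
  proof -
    have "{x. x \<notin> \<Omega>' \<and> v i x \<noteq> 0} = {}" using i by (auto simp: \<Omega>'_def)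
    hence "cap {x. x \<notin> \<Omega>' \<and> v i x \<noteq> 0} = 0" by (simp only: cap_empty)
    thus ?thesis unfolding H10_iff using H1_mN_wdiff[OF fH[OF i]] vq[OF i] vf[OF i] by blast
  qed
  have ind: "H10.independent k f"
    unfolding H10.independent_def l2_norm_sq_inner[symmetric] fnorm
  proof (intro allI impI)
    fix c :: "nat \<Rightarrow> real" and i assume "(\<Sum>i<k. (c i)\<^sup>2) = 0" "i < k"
    thus "c i = 0" by (simp add: sum_nonneg_eq_0_iff)
  qed
  have "energy (lincomb k c f) (lincomb k c f) \<le> L * l2_inner mN (lincomb k c f) (lincomb k c f)" for c
    unfolding l2_norm_sq_inner[symmetric] fnorm using fenergy by blast
  from H10.eigensystem_of_small_energy[OF fS ind this]
  have "enat k \<le> eigenvalue_count \<Omega>' L" unfolding enat_le_eigenvalue_count[OF qo] .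
  thus ?thesis using that[OF qo meas] by blast
qed

text \<open>If no admissible domain has \<open>k\<close> eigenvalues, all values are infinite and the empty set is optimal. Otherwise the levels
  \<open>t\<close> below which an admissible domain has \<open>k\<close> eigenvalues are bounded below by \<open>0\<close>, and their infimum is attained by a limit domain.\<close>

theorem optimal_quasi_open_set:
  fixes c :: real and k :: nat
  assumes k: "k \<ge> 1"
  shows "\<exists>\<Omega>' :: 'a::euclidean_space set.
           quasi_open \<Omega>' \<and> emeasure mN \<Omega>' \<le> ennreal c \<and>
           (\<forall>\<Omega> :: 'a set. quasi_open \<Omega> \<and> emeasure mN \<Omega> \<le> ennreal c \<longrightarrow> eigenvalue k \<Omega>' \<le> eigenvalue k \<Omega>)"
proof -
  let ?ok = "\<lambda>\<Omega> :: 'a set. quasi_open \<Omega> \<and> emeasure mN \<Omega> \<le> ennreal c"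
  define T where "T = {t. \<exists>\<Omega>. ?ok \<Omega> \<and> enat k \<le> eigenvalue_count \<Omega> t}"
  show ?thesis
  proof (cases "T = {}")
    case True
    have "eigenvalue k \<Omega> = \<infinity>" if "?ok \<Omega>" for \<Omega> :: "'a set"
    proof -
      have none: "\<not> enat k \<le> eigenvalue_count \<Omega> t" for t using True that unfolding T_def by blast
      show ?thesis unfolding eigenvalue_def using none by (simp add: top_ereal_def)
    qed
    hence "eigenvalue k {} \<le> eigenvalue k \<Omega>" if "?ok \<Omega>" for \<Omega> :: "'a set" using that by simp
    moreover have "?ok {}" by (simp add: quasi_open_empty)
    ultimately show ?thesis by blast
  next
    case False
    have nonneg: "0 \<le> t" if tT: "t \<in> T" for t
    proof -
      obtain \<Omega> :: "'a set" where "quasi_open \<Omega>" "enat k \<le> eigenvalue_count \<Omega> t" using tT unfolding T_def by blast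
      then obtain e \<mu> where es: "H10.eigensystem \<Omega> k e \<mu>" and mu: "\<forall>i<k. \<mu> i \<le> t"
        using enat_le_eigenvalue_count by blast
      \<comment> \<open>The first eigenfunction, which exists because \<open>k \<ge> 1\<close>; its energy is nonnegative and at most \<open>t\<close>.\<close>
      let ?w = "lincomb k (\<lambda>i. if i = 0 then 1 else 0) e"
      have "0 \<le> energy ?w ?w" by (simp add: energy_diag)
      also have "\<dots> \<le> t * (\<Sum>i<k. (if i = 0 then 1 else 0)\<^sup>2)" by (rule H10.eigensystem_energy[OF es]) (use mu in blast)
      also have "(\<Sum>i<k. (if i = 0 then 1 else 0)\<^sup>2) = (1::real)" using k by (simp add: if_distrib[of "\<lambda>a. a\<^sup>2"] sum.delta cong: if_cong)
      finally show ?thesis by simp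
    qed
    define L where "L = Inf T"
    have bdd: "bdd_below T" using nonneg by (rule bdd_belowI)
    have "\<forall>n. \<exists>t. t \<in> T \<and> t < L + 1 / real (Suc n)"
      using cInf_lessD[OF False] unfolding L_def by (metis less_add_same_cancel1 of_nat_0_less_iff zero_less_Suc zero_less_divide_1_iff)
    from choice[OF this] obtain t where t: "\<forall>n. t n \<in> T \<and> t n < L + 1 / real (Suc n)" ..
    have tL: "t \<longlonglongrightarrow> L"
    proof (rule tendsto_sandwich)
      show "\<forall>\<^sub>F n in sequentially. L \<le> t n" unfolding L_def by (intro always_eventually allI cInf_lower[OF _ bdd]) (use t in blast)
      show "\<forall>\<^sub>F n in sequentially. t n \<le> L + 1 / real (Suc n)" using t by (intro always_eventually allI less_imp_le) blast
      show "(\<lambda>n. L + 1 / real (Suc n)) \<longlonglongrightarrow> L" using tendsto_add[OF tendsto_const LIMSEQ_Suc[OF lim_1_over_n], of L] by simp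
    qed simp
    have "\<forall>n. \<exists>\<Omega>. ?ok \<Omega> \<and> enat k \<le> eigenvalue_count \<Omega> (t n)" using t unfolding T_def by blast
    from choice[OF this] obtain \<Omega> where Om: "\<forall>n. ?ok (\<Omega> n) \<and> enat k \<le> eigenvalue_count (\<Omega> n) (t n)" ..
    have "\<forall>n. \<exists>p. H10.eigensystem (\<Omega> n) k (fst p) (snd p) \<and> (\<forall>i<k. snd p i \<le> t n)"
    proof
      fix n
      obtain e \<mu> where "H10.eigensystem (\<Omega> n) k e \<mu>" "\<forall>i<k. \<mu> i \<le> t n" using Om enat_le_eigenvalue_count by blast
      thus "\<exists>p. H10.eigensystem (\<Omega> n) k (fst p) (snd p) \<and> (\<forall>i<k. snd p i \<le> t n)" by (intro exI[of _ "(e, \<mu>)"]) simp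
    qed
    from choice[OF this] obtain p where p: "\<forall>n. H10.eigensystem (\<Omega> n) k (fst (p n)) (snd (p n)) \<and> (\<forall>i<k. snd (p n) i \<le> t n)" ..
    obtain \<Omega>' :: "'a set" where O': "quasi_open \<Omega>'" "emeasure mN \<Omega>' \<le> ennreal c" "enat k \<le> eigenvalue_count \<Omega>' L"
      by (rule limit_domain[of \<Omega> "ennreal c" k "\<lambda>n. fst (p n)" "\<lambda>n. snd (p n)" t L]) (use Om p tL in auto)
    have up: "eigenvalue k \<Omega>' \<le> ereal L" unfolding eigenvalue_def using O'(3) by (intro Inf_lower) blast
    have "eigenvalue k \<Omega>' \<le> eigenvalue k \<Theta>" if ok: "?ok \<Theta>" for \<Theta> :: "'a set"
    proof -
      have "ereal L \<le> eigenvalue k \<Theta>"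
        unfolding eigenvalue_def
      proof (rule Inf_greatest)
        fix y assume "y \<in> {ereal t |t. enat k \<le> eigenvalue_count \<Theta> t}"
        then obtain t where t: "y = ereal t" "enat k \<le> eigenvalue_count \<Theta> t" by blast
        hence "t \<in> T" using ok unfolding T_def by blast
        hence "L \<le> t" unfolding L_def using bdd by (intro cInf_lower)
        thus "ereal L \<le> y" using t(1) by simp
      qed
      thus ?thesis using up by (rule order_trans[rotated])
    qed
    thus ?thesis using O' by blast
  qed
qed

theorem theorem1p1:
  fixes c :: real and k :: nat
  assumes "CARD('n::finite) \<ge> 2" and "k \<ge> 1" and "c > 0"
  shows "\<exists>\<Omega>' :: (real ^ 'n) set.
           quasi_open \<Omega>' \<and> emeasure mN \<Omega>' \<le> ennreal c \<and>
           (\<forall>\<Omega> :: (real ^ 'n) set.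
              quasi_open \<Omega> \<and> emeasure mN \<Omega> \<le> ennreal c \<longrightarrow> eigenvalue k \<Omega>' \<le> eigenvalue k \<Omega>)"
  using optimal_quasi_open_set[OF assms(2)] by blast

end
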